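(* Let $d\ge 3$ and $q\ge 2$, let $L(s,F)$ be an $L$-function of degree $d$ satisfying the framework described in the context, let $0\le\beta<1$, and let $\mathcal{F}_q$ be a subset (possibly the complete set, possibly depending on $F$) of the set of all primitive Dirichlet characters modulo $q$. Assume: (A1) $|\lambda_F(n)|\le \tau_d(n)$ for all integers $n\ge 1$. (A2) For some fixed (but arbitrary) $\varepsilon>0$, $\sum_{X\le n\le X+Y}|\lambda_F(n)|^2\ll_F Y$ holds for all large $X\geq 2$ and all $X^{1-\varepsilon}\le Y\le X$. (A3) For any $2\le P_1\le P_2\le X$, $\displaystyle\sum_{n\le X,\ (n,\prod_{P_1\le p\le P_2}p)=1}|\lambda_F(n)|^2\ll_F X\frac{\log P_1}{\log P_2}$. (A4) There is a small constant $c_F>0$ depending only on $F$ such that, for any $T$ with $\log^{100}q\ll T\ll q^{o(1)}$, $$\prod_{\chi\in\mathcal{F}_q}L(\sigma+it,F\times\chi)\ne 0\quad\text{for } \sigma>1-\frac{c_F}{\log^{\beta}(qT)},\ |t|\le T.$$ Then, for any $\eta<1-\beta$, $$\sum_{\chi\in\mathcal{F}_q}\Big|L\big(\tfrac12,F\times\chi\big)\Big|^2\ll_F\frac{q^{d/2}}{\log^{\eta}q}.$$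
   Context: Framework. $L(s,F)=\sum_{n\ge1}\lambda_F(n)n^{-s}=\prod_p\prod_{j=1}^d(1-\alpha_{j,F}(p)p^{-s})^{-1}$ is a Dirichlet series with Euler product of degree $d$, both absolutely convergent for $\Re(s)>1$; $\lambda_F$ is multiplicative with $\lambda_F(p^r)=\sum_{r_1,\dots,r_d\ge0,\ r_1+\cdots+r_d=r}\prod_{j=1}^d\alpha_{j,F}(p)^{r_j}$. For $q\ge2$ and a primitive Dirichlet character $\chi$ modulo $q$, $$L(s,F\times\chi)=\sum_{n\ge1}\frac{\lambda_F(n)\chi(n)}{n^s}=\prod_p\prod_{j=1}^d\Big(1-\frac{\alpha_{j,F}(p)\chi(p)}{p^s}\Big)^{-1},$$ both absolutely convergent for $\Re(s)>1$. Put $L_\infty(s,F\times\chi)=N^{s/2}\prod_{j=1}^d\Gamma_{\mathbb R}(s+\mu_j)$ with $\Gamma_{\mathbb R}(s)=\pi^{-s/2}\Gamma(s/2)$, where the conductor $N$ (a positive integer) depends only on $F$ and $q$, and the $\mu_j\in\mathbb C$ depend only on $F$ and $\chi(-1)$ and satisfy $\Re(\mu_j)\ge-1+\theta_F$ for some fixed $\theta_F$ with $\frac1{2d}<\theta_F<\frac12$. Let $\Lambda(s,F\times\chi)=L(s,F\times\chi)L_\infty(s,F\times\chi)$. It is assumed that: (1) $\Lambda(s,F\times\chi)$ extends to an entire function of order 1; (2) $\Lambda(s,F\times\chi)=\kappa\,\Lambda(1-s,\tilde F\times\overline\chi)$ for some $\kappa=\kappa_{F,\chi}$ with $|\kappa|=1$,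 where $\tilde F$ is the dual form with $\lambda_{\tilde F}(n)=\overline{\lambda_F(n)}$ (its completed $L$-function is formed in the same way, with the same $N$ and with parameters $\overline{\mu_j}$); (3) with the analytic conductor $C(s,F\times\chi)=N\prod_{j=1}^d(|s+\mu_j+3|)$ and $C(F\times\chi)=C(\frac12,F\times\chi)$, one has $C(F\times\chi)\ll_F N\ll_F q^d$ for large $q$. Notation. $\tau_d$ is the $d$-fold divisor function, $p$ denotes a prime, $\log^a x=(\log x)^a$. The condition $\log^{100}q\ll T\ll q^{o(1)}$ refers to functions $T=T(q)$ with $T\gg\log^{100}q$ and $\log T\leq o(\log q)$ as $q\to\infty$. $F$ (and $d,\beta,\eta$) are fixed, all constants in the hypotheses are uniform in $q$ and $\chi$, and the implied constant in the conclusion depends on $F$ and the fixed parameters but not on $q$. *)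

theory Defs
  imports
    "HOL-Complex_Analysis.Complex_Analysis"
    "HOL-Computational_Algebra.Primes"
    "HOL-Library.FuncSet"
    "HOL-Library.Landau_Symbols"
begin

text \<open>Dirichlet characters are functions on the integers, so that the parity is \<open>chi (-1)\<close>.\<close>

definition dirichlet_character :: "nat \<Rightarrow> (int \<Rightarrow> complex) \<Rightarrow> bool" where
  "dirichlet_character q chi \<longleftrightarrow>
     (\<forall>m n. chi (m * n) = chi m * chi n) \<and>
     (\<forall>n. chi (n + int q) = chi n) \<and>
     (\<forall>n. chi n \<noteq> 0 \<longleftrightarrow> coprime n (int q))"

definition primitive_characters :: "nat \<Rightarrow> (int \<Rightarrow> complex) set" where
  "primitive_characters q =
     {chi. dirichlet_character q chi \<and>
         \<not> (\<exists>m \<psi>. m dvd q \<and> m < q \<and> dirichlet_character m \<psi> \<and>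
              (\<forall>n. coprime n (int q) \<longrightarrow> chi n = \<psi> n))}"

definition tau :: "nat \<Rightarrow> nat \<Rightarrow> nat" where
  "tau d n = card {f \<in> {..<d} \<rightarrow>\<^sub>E UNIV. (\<Prod>j<d. f j) = n}"

definition dirichlet_series :: "(nat \<Rightarrow> complex) \<Rightarrow> complex \<Rightarrow> complex" where
  "dirichlet_series f s = (\<Sum>\<^sub>\<infinity>n\<in>{1..}. f n / of_nat n powr s)"

definition euler_factor ::
  "nat \<Rightarrow> (nat \<Rightarrow> nat \<Rightarrow> complex) \<Rightarrow> nat \<Rightarrow> complex \<Rightarrow> complex" where
  "euler_factor d \<alpha> p s = (\<Prod>j<d. inverse (1 - \<alpha> j p / of_nat p powr s))"

text \<open>The third clause rules out factors that would be the junk value \<open>inverse 0\<close>; the product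
  over primes is a product over all natural numbers with the value 1 at non-primes.\<close>

definition has_euler_product ::
  "nat \<Rightarrow> (nat \<Rightarrow> nat \<Rightarrow> complex) \<Rightarrow> (nat \<Rightarrow> complex) \<Rightarrow> bool" where
  "has_euler_product d \<alpha> f \<longleftrightarrow>
     (\<forall>s. Re s > 1 \<longrightarrow>
        (\<lambda>n. norm (f n / of_nat n powr s)) summable_on {1..} \<and>
        abs_convergent_prod (\<lambda>n. if prime n then euler_factor d \<alpha> n s else 1) \<and>
        (\<forall>p j. prime p \<and> j < d \<longrightarrow> 1 - \<alpha> j p / of_nat p powr s \<noteq> 0) \<and>
        (\<lambda>n. if prime n then euler_factor d \<alpha> n s else 1) has_prod (dirichlet_series f s))"

definition is_entire_continuation ::
  "(complex \<Rightarrow> complex) \<Rightarrow> (complex \<Rightarrow> complex) \<Rightarrow> bool" where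
  "is_entire_continuation g f \<longleftrightarrow>
     f holomorphic_on UNIV \<and> (\<forall>s. Re s > 1 \<longrightarrow> f s = g s)"

text \<open>By the identity theorem there is at most one entire continuation; when there is none,
  the value of the following function is meaningless.\<close>

definition entire_continuation :: "(complex \<Rightarrow> complex) \<Rightarrow> complex \<Rightarrow> complex" where
  "entire_continuation g = (THE f. is_entire_continuation g f)"

definition entire_order :: "(complex \<Rightarrow> complex) \<Rightarrow> ereal" where
  "entire_order f =
     Inf (ereal ` {\<rho>. \<rho> \<ge> 0 \<and>
       (\<lambda>s. norm (f s)) \<in> O[at_infinity](\<lambda>s. exp (norm s powr \<rho>))})"

definition Gamma_R :: "complex \<Rightarrow> complex" where
  "Gamma_R s = of_real pi powr (- s / 2) * Gamma (s / 2)"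

definition L_infinity :: "nat \<Rightarrow> nat \<Rightarrow> (nat \<Rightarrow> complex) \<Rightarrow> complex \<Rightarrow> complex" where
  "L_infinity d N \<mu> s = of_nat N powr (s / 2) * (\<Prod>j<d. Gamma_R (s + \<mu> j))"

definition completed_series ::
  "nat \<Rightarrow> nat \<Rightarrow> (nat \<Rightarrow> complex) \<Rightarrow> (nat \<Rightarrow> complex) \<Rightarrow> complex \<Rightarrow> complex" where
  "completed_series d N \<mu> f s = dirichlet_series f s * L_infinity d N \<mu> s"

definition completed_L ::
  "nat \<Rightarrow> nat \<Rightarrow> (nat \<Rightarrow> complex) \<Rightarrow> (nat \<Rightarrow> complex) \<Rightarrow> complex \<Rightarrow> complex" where
  "completed_L d N \<mu> f = entire_continuation (completed_series d N \<mu> f)"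

definition analytic_conductor :: "nat \<Rightarrow> nat \<Rightarrow> (nat \<Rightarrow> complex) \<Rightarrow> complex \<Rightarrow> real" where
  "analytic_conductor d N \<mu> s = real N * (\<Prod>j<d. norm (s + \<mu> j + 3))"

definition twist :: "(nat \<Rightarrow> complex) \<Rightarrow> (int \<Rightarrow> complex) \<Rightarrow> nat \<Rightarrow> complex" where
  "twist lamF chi n = lamF n * chi (int n)"

text \<open>If the completed series has an entire continuation and no Gamma factor has a pole in
  \<open>Re s > 1\<close>, then the Dirichlet series has an entire continuation as well, because \<open>1/Gamma\<close>
  is entire.\<close>

definition L_twist :: "(nat \<Rightarrow> complex) \<Rightarrow> (int \<Rightarrow> complex) \<Rightarrow> complex \<Rightarrow> complex" where
  "L_twist lamF chi = entire_continuation (dirichlet_series (twist lamF chi))"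

text \<open>\<open>\<alpha> j p\<close> is the \<open>j\<close>-th local root at the prime \<open>p\<close> (\<open>j < d\<close>), \<open>N q\<close> the conductor of all
  twists by primitive characters modulo \<open>q\<close>, and \<open>\<mu> (chi (-1)) j\<close> the \<open>j\<close>-th Gamma parameter of
  the twist by \<open>chi\<close>.\<close>

locale L_function_framework =
  fixes d :: nat
    and lamF :: "nat \<Rightarrow> complex"
    and \<alpha> :: "nat \<Rightarrow> nat \<Rightarrow> complex"
    and N :: "nat \<Rightarrow> nat"
    and \<mu> :: "complex \<Rightarrow> nat \<Rightarrow> complex"
    and \<theta> :: real
  assumes multiplicative: "\<And>m n. coprime m n \<Longrightarrow> lamF (m * n) = lamF m * lamF n"
    and prime_power: "\<And>p r. prime p \<Longrightarrow>
      lamF (p ^ r) = (\<Sum>e \<in> {e \<in> {..<d} \<rightarrow>\<^sub>E UNIV. (\<Sum>j<d. e j) = r}. \<Prod>j<d. \<alpha> j p ^ e j)"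
    and euler_product: "has_euler_product d \<alpha> lamF"
    and euler_product_twist: "\<And>q chi. q \<ge> 2 \<Longrightarrow> chi \<in> primitive_characters q \<Longrightarrow>
      has_euler_product d (\<lambda>j p. \<alpha> j p * chi (int p)) (twist lamF chi)"
    and theta_gt: "1 / (2 * real d) < \<theta>"
    and theta_less: "\<theta> < 1 / 2"
    and conductor_pos: "\<And>q chi. q \<ge> 2 \<Longrightarrow> chi \<in> primitive_characters q \<Longrightarrow> N q > 0"
    and Re_mu: "\<And>q chi j. q \<ge> 2 \<Longrightarrow> chi \<in> primitive_characters q \<Longrightarrow> j < d \<Longrightarrow>
      Re (\<mu> (chi (-1)) j) \<ge> -1 + \<theta>"
    and entire: "\<And>q chi. q \<ge> 2 \<Longrightarrow> chi \<in> primitive_characters q \<Longrightarrow>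
      \<exists>f. is_entire_continuation (completed_series d (N q) (\<mu> (chi (-1))) (twist lamF chi)) f"
    and order_1: "\<And>q chi. q \<ge> 2 \<Longrightarrow> chi \<in> primitive_characters q \<Longrightarrow>
      entire_order (completed_L d (N q) (\<mu> (chi (-1))) (twist lamF chi)) = 1"
    and functional_equation: "\<And>q chi. q \<ge> 2 \<Longrightarrow> chi \<in> primitive_characters q \<Longrightarrow>
      \<exists>\<kappa>. norm \<kappa> = 1 \<and>
        (\<forall>s. completed_L d (N q) (\<mu> (chi (-1))) (twist lamF chi) s =
             \<kappa> * completed_L d (N q) (\<lambda>j. cnj (\<mu> (chi (-1)) j))
                   (twist (\<lambda>n. cnj (lamF n)) (\<lambda>n. cnj (chi n))) (1 - s))"
    and conductor_bound: "\<exists>K q0. \<forall>q \<ge> max 2 q0. \<forall>chi \<in> primitive_characters q.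
      analytic_conductor d (N q) (\<mu> (chi (-1))) (1 / 2) \<le> K * real (N q) \<and>
      real (N q) \<le> K * real q ^ d"

text \<open>The condition \<open>log^100 q << T << q^{o(1)}\<close> on a function \<open>T = T(q)\<close>.\<close>

definition admissible_height :: "(nat \<Rightarrow> real) \<Rightarrow> bool" where
  "admissible_height T \<longleftrightarrow>
     (\<exists>c>0. \<forall>\<^sub>F q in sequentially. c * ln (real q) ^ 100 \<le> T q) \<and>
     (\<lambda>q. ln (T q)) \<in> o(\<lambda>q. ln (real q))"

text \<open>Admissibility restricts \<open>T\<close> only for large \<open>q\<close>, so non-vanishing is only required for
  \<open>q \<ge> q0 T\<close>, where the threshold \<open>q0 T\<close> may depend on the function \<open>T\<close> in any way.\<close>

definition zero_free_region ::
  "(nat \<Rightarrow> complex) \<Rightarrow> real \<Rightarrow> real \<Rightarrow> ((nat \<Rightarrow> real) \<Rightarrow> nat) \<Rightarrow>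
     (nat \<Rightarrow> (int \<Rightarrow> complex) set) \<Rightarrow> bool" where
  "zero_free_region lamF c \<beta> q0 Fam \<longleftrightarrow>
     (\<forall>T. admissible_height T \<longrightarrow>
       (\<forall>q \<ge> max 2 (q0 T). \<forall>\<sigma> t.
          \<sigma> > 1 - c / ln (real q * T q) powr \<beta> \<and> \<bar>t\<bar> \<le> T q \<longrightarrow>
            (\<Prod>chi\<in>Fam q. L_twist lamF chi (Complex \<sigma> t)) \<noteq> 0))"

end

theory Submission
  imports
    Defs
    "HOL-Number_Theory.Number_Theory"
    "HOL-Real_Asymp.Real_Asymp"
    "HOL-Probability.Probability"
begin

text \<open>The central value \<open>L(1/2, F \<times> \<chi>)\<close> is, up to a bounded factor, dominated by a sum of
  \<open>\<lambda>(n) \<chi>(n) / \<surd>n\<close> smoothly cut off near \<open>n = \<surd>N \<lesssim> q\<^sup>d\<^sup>/\<^sup>2\<close>.  Since \<open>d \<ge> 3\<close>, this is longer than \<open>q\<close>, so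
  that the large sieve alone gives \<open>q\<^sup>d\<^sup>/\<^sup>2\<close> and only a power of \<open>log q\<close> has to be saved.  Put
  \<open>a = \<beta> + \<epsilon>\<close> and \<open>b = 1 - \<epsilon>\<close>.  By (A3) the \<open>n\<close> without prime factor in
  \<open>[exp (log\<^sup>a q), exp (log\<^sup>b q)]\<close> carry only the proportion \<open>log\<^sup>a\<^sup>-\<^sup>b q\<close> of the mean square of \<open>\<lambda>\<close>, which is the
  saving claimed.  The other \<open>n\<close> have a factorisation \<open>n = p m\<close>; there the Mellin
  transform of the cut-off separates the sum over \<open>p\<close> from the sum over \<open>m\<close>, the former is smaller than any fixed
  power of \<open>1 / log q\<close> by the zero-free region (A4), and the latter is treated by the large sieve.

  Overcounting of factorisations \<open>n = p m\<close> is avoided by interpolation: with \<open>f\<^sub>x(n)\<close> the product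
  of \<open>1 - x v(p)\<close> over the primes \<open>p\<close> exactly dividing \<open>n\<close>, the sum over all \<open>n\<close> has weight \<open>f\<^sub>0 = 1\<close>, the weight
  \<open>f\<^sub>1\<close> sieves, and the derivative in \<open>x\<close> is a bilinear sum over \<open>p\<close> and \<open>m\<close>.\<close>

section \<open>Dirichlet characters and the large sieve\<close>

text \<open>The main term gains only a power of \<open>log q\<close>, so it cannot afford a factor
  for the number of dyadic blocks, which is of order \<open>log q\<close>. The weight is therefore
  bounded on two vertical lines, and the long blocks then form geometric series on either side of
  the cut-off. The other terms can afford such factors: the prime sums are bounded by
  \<open>1 / log^5 q\<close> times \<open>1 + \<bar>y\<bar>\<close> at height \<open>y\<close>, and
  blocks shorter than \<open>q\<close>, where the large sieve is lossy, stay below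
  \<open>q^(d/4)\<close> by \<open>q^(5/32)\<close> up to \<open>q^o(1)\<close>, a gap that exists
  because \<open>d \<ge> 3\<close>. In the bilinear sum the variables are still tied together by the
  conditions that \<open>p\<close> does not divide \<open>m\<close> and that \<open>p * m\<close> is
  below the truncation point. Both are dropped by adding the excluded pairs, whose contribution is
  small for separate reasons; then \<open>p\<close> and \<open>m\<close> run independently. The two
  parities of \<open>chi\<close> are treated apart because the Gamma parameters depend on
  \<open>chi (-1)\<close> only, so that constants chosen for one parity are uniform in
  \<open>q\<close>.\<close>

lemma character_add_mult:
  assumes "dirichlet_character q chi"
  shows "chi (n + k * int q) = chi n"
proof -
  have nat: "chi (n + int k * int q) = chi n" for n k
  proof (induction k)
    case (Suc k)
    have "chi (n + int (Suc k) * int q) = chi ((n + int k * int q) + int q)"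
      by (simp add: algebra_simps)
    also have "\<dots> = chi n"
      using assms Suc by (simp add: dirichlet_character_def)
    finally show ?case .
  qed simp
  show ?thesis
  proof (cases "k \<ge> 0")
    case True
    then show ?thesis using nat[of n "nat k"] by simp
  next
    case False
    then show ?thesis using nat[of "n + k * int q" "nat (-k)"] by (simp add: algebra_simps)
  qed
qed

lemma character_cong:
  assumes "dirichlet_character q chi" "[m = n] (mod int q)"
  shows "chi m = chi n"
proof -
  obtain k where "n = m + int q * k"
    using assms(2) by (auto simp: cong_iff_lin)
  then show ?thesis
    using character_add_mult[OF assms(1), of m k] by (simp add: mult.commute)
qed

lemma character_mult:
  "dirichlet_character q chi \<Longrightarrow> chi (m * n) = chi m * chi n"
  by (simp add: dirichlet_character_def)

lemma character_eq_0_iff: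
  "dirichlet_character q chi \<Longrightarrow> chi n = 0 \<longleftrightarrow> \<not> coprime n (int q)"
  by (auto simp: dirichlet_character_def)

lemma character_1:
  assumes "dirichlet_character q chi"
  shows "chi 1 = 1"
proof -
  have "chi 1 = chi 1 * chi 1"
    using character_mult[OF assms, of 1 1] by simp
  moreover have "chi 1 \<noteq> 0"
    using character_eq_0_iff[OF assms, of 1] by simp
  ultimately show ?thesis by simp
qed

lemma character_power:
  assumes "dirichlet_character q chi"
  shows "chi (n ^ k) = chi n ^ k"
  by (induction k) (simp_all add: character_1[OF assms] character_mult[OF assms])

lemma character_root_of_unity:
  assumes "dirichlet_character q chi" "q \<ge> 1" "coprime n (int q)"
  shows "chi n ^ totient q = 1"
proof -
  define a where "a = nat (n mod int q)"
  have a: "[int a = n] (mod int q)"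
    using assms(2) by (simp add: a_def)
  have "coprime (int a) (int q)"
    using assms(3) a by (meson cong_imp_coprime cong_sym)
  then have "coprime a q" by simp
  then have "[a ^ totient q = 1] (mod q)" by (rule euler_theorem)
  then have "[int a ^ totient q = 1] (mod int q)"
    by (metis cong_int_iff of_nat_1 of_nat_power)
  then have "chi (int a ^ totient q) = chi 1"
    by (rule character_cong[OF assms(1)])
  moreover have "chi (int a) = chi n"
    using character_cong[OF assms(1) a] .
  ultimately show ?thesis
    by (simp add: character_power[OF assms(1)] character_1[OF assms(1)])
qed

lemma norm_character:
  assumes "dirichlet_character q chi" "q \<ge> 1" "coprime n (int q)"
  shows "norm (chi n) = 1"
proof -
  have "norm (chi n) ^ totient q = 1"
    using character_root_of_unity[OF assms] by (metis norm_one norm_power)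
  moreover have "totient q > 0"
    using assms(2) by simp
  ultimately show ?thesis
    by (metis norm_ge_zero power_eq_iff_eq_base power_one zero_le_one)
qed

lemma norm_character_le:
  assumes "dirichlet_character q chi" "q \<ge> 1"
  shows "norm (chi n) \<le> 1"
  using norm_character[OF assms, of n] character_eq_0_iff[OF assms(1), of n] by fastforce

text \<open>A character is determined by its values on the residues below \<open>q\<close>, each of
  which is 0 or a root of unity of order dividing \<open>totient q\<close>.\<close>

lemma finite_characters:
  assumes "q \<ge> 1"
  shows "finite {chi. dirichlet_character q chi}"
proof -
  define r where "r = (\<lambda>chi::int \<Rightarrow> complex. restrict (\<lambda>b. chi (int b)) {..<q})"
  define Z where "Z = insert (0::complex) {z. z ^ totient q = 1}"
  have "finite Z"
    unfolding Z_def using finite_roots_unity[of "totient q"] assms by (simp add: Suc_le_eq)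
  then have "finite ({..<q} \<rightarrow>\<^sub>E Z)"
    by (intro finite_PiE) auto
  moreover have "r ` {chi. dirichlet_character q chi} \<subseteq> {..<q} \<rightarrow>\<^sub>E Z"
    using character_root_of_unity[OF _ assms] character_eq_0_iff
    by (fastforce simp: r_def Z_def)
  moreover have "inj_on r {chi. dirichlet_character q chi}"
  proof (rule inj_onI, clarify)
    fix chi \<psi> assume *: "dirichlet_character q chi" "dirichlet_character q \<psi>" "r chi = r \<psi>"
    show "chi = \<psi>"
    proof
      fix n
      define b where "b = nat (n mod int q)"
      have b: "[n = int b] (mod int q)" "b < q"
        using assms by (auto simp: b_def nat_less_iff)
      have "r chi b = r \<psi> b" using * by simp
      then have "chi (int b) = \<psi> (int b)"
        using b(2) by (simp add: r_def)
      then show "chi n = \<psi> n"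
        using character_cong[OF *(1) b(1)] character_cong[OF *(2) b(1)] by simp
    qed
  qed
  ultimately show ?thesis
    by (meson finite_imageD finite_subset)
qed

lemma finite_primitive_characters: "q \<ge> 1 \<Longrightarrow> finite (primitive_characters q)"
  by (rule finite_subset[OF _ finite_characters]) (auto simp: primitive_characters_def)

lemma primitive_imp_character: "chi \<in> primitive_characters q \<Longrightarrow> dirichlet_character q chi"
  by (simp add: primitive_characters_def)

lemma bij_betw_mult_mod:
  assumes "q \<ge> 1" "coprime n (int q)"
  shows "bij_betw (\<lambda>b. nat ((n * int b) mod int q)) {..<q} {..<q}"
proof -
  have inj: "inj_on (\<lambda>b. nat ((n * int b) mod int q)) {..<q}"
  proof (rule inj_onI)
    fix a b assume ab: "a \<in> {..<q}" "b \<in> {..<q}"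
      "nat ((n * int a) mod int q) = nat ((n * int b) mod int q)"
    then have "[n * int a = n * int b] (mod int q)"
      using assms(1) by (simp add: cong_def nat_eq_iff)
    then have "[int a = int b] (mod int q)"
      using assms(2) by (simp add: cong_mult_lcancel)
    then show "a = b"
      using ab by (simp add: cong_int_iff cong_less_modulus_unique_nat)
  qed
  moreover have "(\<lambda>b. nat ((n * int b) mod int q)) ` {..<q} \<subseteq> {..<q}"
    using assms(1) by (auto simp: nat_less_iff)
  ultimately show ?thesis
    by (simp add: bij_betw_def endo_inj_surj)
qed

text \<open>Multiplication by \<open>n\<close> permutes the residues and multiplies the sum by
  \<open>chi n * cnj (\<psi> n)\<close>. For \<open>n\<close> with
  \<open>chi n \<noteq> \<psi> n\<close> this factor is not 1; such an \<open>n\<close> is coprime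
  to \<open>q\<close>, since otherwise both values vanish.\<close>

lemma character_orthogonality:
  assumes chi: "dirichlet_character q chi" and psi: "dirichlet_character q \<psi>"
    and q: "q \<ge> 1" and ne: "chi \<noteq> \<psi>"
  shows "(\<Sum>b<q. chi (int b) * cnj (\<psi> (int b))) = 0"
proof -
  define S where "S = (\<Sum>b<q. chi (int b) * cnj (\<psi> (int b)))"
  obtain n where n: "chi n \<noteq> \<psi> n" using ne by auto
  have cop: "coprime n (int q)"
    using n character_eq_0_iff[OF chi] character_eq_0_iff[OF psi] by metis
  have "S = (\<Sum>b<q. chi (int (nat ((n * int b) mod int q))) * cnj (\<psi> (int (nat ((n * int b) mod int q)))))"
    unfolding S_def by (rule sum.reindex_bij_betw[OF bij_betw_mult_mod[OF q cop], symmetric])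
  also have "\<dots> = (\<Sum>b<q. chi n * cnj (\<psi> n) * (chi (int b) * cnj (\<psi> (int b))))"
  proof (rule sum.cong[OF refl])
    fix b
    have *: "[int (nat ((n * int b) mod int q)) = n * int b] (mod int q)"
      using q by simp
    show "chi (int (nat ((n * int b) mod int q))) * cnj (\<psi> (int (nat ((n * int b) mod int q)))) =
        chi n * cnj (\<psi> n) * (chi (int b) * cnj (\<psi> (int b)))"
      unfolding character_cong[OF chi *] character_cong[OF psi *]
        character_mult[OF chi] character_mult[OF psi] by simp
  qed
  also have "\<dots> = chi n * cnj (\<psi> n) * S"
    by (simp add: S_def sum_distrib_left)
  finally have S: "S = chi n * cnj (\<psi> n) * S" .
  show ?thesis
  proof (rule ccontr)
    assume "(\<Sum>b<q. chi (int b) * cnj (\<psi> (int b))) \<noteq> 0"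
    then have "chi n * cnj (\<psi> n) = 1" using S by (simp add: S_def)
    moreover have "\<psi> n * cnj (\<psi> n) = 1"
      using norm_character[OF psi q cop] by (simp add: complex_norm_square[symmetric])
    ultimately show False using n
      by (metis mult_cancel_right mult_zero_right zero_neq_one)
  qed
qed

text \<open>Duality: \<open>D\<close> is the pairing of \<open>c\<close> with the combination
  \<open>g\<close> of the \<open>e x\<close> whose coefficients are the conjugated inner products.
  Orthogonality leaves only the diagonal in the square norm of \<open>g\<close>, which is at most
  \<open>w * D\<close>, and Cauchy-Schwarz bounds \<open>D^2\<close> by \<open>w * D\<close> times
  the square norm of \<open>c\<close>.\<close>

lemma Bessel_inequality:
  fixes e :: "'a \<Rightarrow> 'b \<Rightarrow> complex"
  assumes "finite X" "finite B" "w \<ge> 0"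
    and orth: "\<And>x y. x \<in> X \<Longrightarrow> y \<in> X \<Longrightarrow> x \<noteq> y \<Longrightarrow> (\<Sum>b\<in>B. e x b * cnj (e y b)) = 0"
    and nrm: "\<And>x. x \<in> X \<Longrightarrow> (\<Sum>b\<in>B. (norm (e x b))\<^sup>2) \<le> w"
  shows "(\<Sum>x\<in>X. (norm (\<Sum>b\<in>B. c b * e x b))\<^sup>2) \<le> w * (\<Sum>b\<in>B. (norm (c b))\<^sup>2)"
proof -
  define a where "a x = (\<Sum>b\<in>B. c b * e x b)" for x
  define g where "g b = (\<Sum>x\<in>X. cnj (a x) * e x b)" for b
  define D where "D = (\<Sum>x\<in>X. (norm (a x))\<^sup>2)"
  have D0: "D \<ge> 0" by (simp add: D_def sum_nonneg)
  have "complex_of_real D = (\<Sum>x\<in>X. cnj (a x) * a x)"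
    unfolding D_def of_real_sum
    by (intro sum.cong refl) (simp add: complex_norm_square mult.commute del: of_real_power)
  also have "\<dots> = (\<Sum>x\<in>X. \<Sum>b\<in>B. cnj (a x) * (c b * e x b))"
    by (simp add: a_def sum_distrib_left)
  also have "\<dots> = (\<Sum>b\<in>B. \<Sum>x\<in>X. cnj (a x) * (c b * e x b))"
    by (rule sum.swap)
  also have "\<dots> = (\<Sum>b\<in>B. c b * g b)"
    by (simp add: g_def sum_distrib_left mult_ac)
  finally have D1: "complex_of_real D = (\<Sum>b\<in>B. c b * g b)" .
  have "complex_of_real (\<Sum>b\<in>B. (norm (g b))\<^sup>2) = (\<Sum>b\<in>B. g b * cnj (g b))"
    unfolding of_real_sum
    by (intro sum.cong refl) (simp add: complex_norm_square del: of_real_power)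
  also have "\<dots> = (\<Sum>b\<in>B. \<Sum>x\<in>X. \<Sum>y\<in>X. cnj (a x) * a y * (e x b * cnj (e y b)))"
    by (simp add: g_def sum_product sum_distrib_left mult_ac)
  also have "\<dots> = (\<Sum>x\<in>X. \<Sum>y\<in>X. \<Sum>b\<in>B. cnj (a x) * a y * (e x b * cnj (e y b)))"
    by (subst sum.swap, rule sum.cong[OF refl], rule sum.swap)
  also have "\<dots> = (\<Sum>x\<in>X. \<Sum>y\<in>X. if y = x then of_real ((norm (a x))\<^sup>2 * (\<Sum>b\<in>B. (norm (e x b))\<^sup>2)) else 0)"
  proof (intro sum.cong refl)
    fix x y assume xy: "x \<in> X" "y \<in> X"
    have "(\<Sum>b\<in>B. cnj (a x) * a y * (e x b * cnj (e y b))) = cnj (a x) * a y * (\<Sum>b\<in>B. e x b * cnj (e y b))"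
      by (simp add: sum_distrib_left)
    moreover have "(\<Sum>b\<in>B. e x b * cnj (e x b)) = of_real (\<Sum>b\<in>B. (norm (e x b))\<^sup>2)"
      unfolding of_real_sum
      by (intro sum.cong refl) (simp add: complex_norm_square del: of_real_power)
    moreover have "cnj (a x) * a x = of_real ((norm (a x))\<^sup>2)"
      by (simp add: complex_norm_square mult.commute del: of_real_power)
    ultimately show "(\<Sum>b\<in>B. cnj (a x) * a y * (e x b * cnj (e y b))) =
        (if y = x then of_real ((norm (a x))\<^sup>2 * (\<Sum>b\<in>B. (norm (e x b))\<^sup>2)) else 0)"
      using orth[OF xy] by auto
  qed
  also have "\<dots> = (\<Sum>x\<in>X. of_real ((norm (a x))\<^sup>2 * (\<Sum>b\<in>B. (norm (e x b))\<^sup>2)))"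
    using assms(1) by simp
  finally have "(\<Sum>b\<in>B. (norm (g b))\<^sup>2) = (\<Sum>x\<in>X. (norm (a x))\<^sup>2 * (\<Sum>b\<in>B. (norm (e x b))\<^sup>2))"
    by (simp only: of_real_sum[symmetric] of_real_eq_iff)
  also have "\<dots> \<le> (\<Sum>x\<in>X. (norm (a x))\<^sup>2 * w)"
    by (intro sum_mono mult_left_mono nrm) auto
  finally have g2: "(\<Sum>b\<in>B. (norm (g b))\<^sup>2) \<le> w * D"
    by (simp add: D_def sum_distrib_left mult.commute)
  have "D = norm (complex_of_real D)" using D0 by simp
  also have "\<dots> \<le> (\<Sum>b\<in>B. norm (c b * g b))" unfolding D1 by (rule norm_sum)
  finally have "D \<le> (\<Sum>b\<in>B. norm (c b) * norm (g b))" by (simp add: norm_mult)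
  then have "D\<^sup>2 \<le> (\<Sum>b\<in>B. norm (c b) * norm (g b))\<^sup>2"
    using D0 by (simp add: power_mono)
  also have "\<dots> \<le> (\<Sum>b\<in>B. (norm (c b))\<^sup>2) * (\<Sum>b\<in>B. (norm (g b))\<^sup>2)"
    by (rule Cauchy_Schwarz_ineq_sum)
  also have "\<dots> \<le> (\<Sum>b\<in>B. (norm (c b))\<^sup>2) * (w * D)"
    by (intro mult_left_mono g2 sum_nonneg) auto
  finally have "D * D \<le> (w * (\<Sum>b\<in>B. (norm (c b))\<^sup>2)) * D"
    by (simp add: power2_eq_square mult_ac)
  then have "D \<le> w * (\<Sum>b\<in>B. (norm (c b))\<^sup>2)"
  proof (cases "D = 0")
    case True
    then show ?thesis using assms(3) by (simp add: sum_nonneg)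
  next
    case False
    then show ?thesis using D0 \<open>D * D \<le> _\<close> by (simp add: mult_le_cancel_right)
  qed
  then show ?thesis by (simp add: D_def a_def)
qed

lemma card_residue_class_le:
  assumes "q \<ge> 1"
  shows "card {n. n < M \<and> n mod q = b} \<le> M div q + (1::nat)"
proof -
  have "card {n. n < M \<and> n mod q = b} \<le> card {..M div q}"
  proof (rule card_inj_on_le)
    show "inj_on (\<lambda>n. n div q) {n. n < M \<and> n mod q = b}"
      by (rule inj_onI) (metis (mono_tags, lifting) mem_Collect_eq mult_div_mod_eq)
  qed (auto intro: div_le_mono)
  then show ?thesis by simp
qed

text \<open>For a single modulus the sum depends only on the sums \<open>c b\<close> over residue
  classes, to which Bessel's inequality applies. Cauchy-Schwarz inside a class of at most
  \<open>M / q + 1\<close> elements gives the constant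
  \<open>q * (M / q + 1) = q + M\<close>.\<close>

lemma large_sieve:
  assumes X: "finite X" "\<And>chi. chi \<in> X \<Longrightarrow> dirichlet_character q chi" and q: "q \<ge> 1"
  shows "(\<Sum>chi\<in>X. (norm (\<Sum>n<M. a n * chi (int n)))\<^sup>2)
       \<le> (real q + real M) * (\<Sum>n<M. (norm (a n))\<^sup>2)"
proof -
  define c where "c b = (\<Sum>n | n < M \<and> n mod q = b. a n)" for b
  have eq: "(\<Sum>n<M. a n * chi (int n)) = (\<Sum>b<q. c b * chi (int b))" if "chi \<in> X" for chi
  proof -
    have "(\<Sum>n<M. a n * chi (int n)) = (\<Sum>b<q. \<Sum>n | n \<in> {..<M} \<and> n mod q = b. a n * chi (int n))"
      by (rule sum.group[symmetric]) (use q in auto)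
    also have "\<dots> = (\<Sum>b<q. c b * chi (int b))"
      unfolding c_def sum_distrib_right
    proof (intro sum.cong refl)
      fix b n assume "n \<in> {n. n < M \<and> n mod q = b}"
      then have "[n = b] (mod q)" by (auto simp: cong_def)
      then have "[int n = int b] (mod int q)" by (simp only: cong_int_iff)
      from character_cong[OF X(2)[OF that] this]
      show "a n * chi (int n) = a n * chi (int b)" by simp
    qed auto
    finally show ?thesis .
  qed
  have c: "(norm (c b))\<^sup>2 \<le> (real M / real q + 1) * (\<Sum>n | n < M \<and> n mod q = b. (norm (a n))\<^sup>2)" for b
  proof -
    have "(norm (c b))\<^sup>2 \<le> (\<Sum>n | n < M \<and> n mod q = b. 1 * norm (a n))\<^sup>2"
      unfolding c_def by (intro power_mono order_trans[OF norm_sum]) auto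
    also have "\<dots> \<le> (\<Sum>n | n < M \<and> n mod q = b. 1\<^sup>2) * (\<Sum>n | n < M \<and> n mod q = b. (norm (a n))\<^sup>2)"
      by (rule Cauchy_Schwarz_ineq_sum)
    also have "\<dots> \<le> (real M / real q + 1) * (\<Sum>n | n < M \<and> n mod q = b. (norm (a n))\<^sup>2)"
    proof (intro mult_right_mono sum_nonneg)
      have "real (card {n. n < M \<and> n mod q = b}) \<le> real (M div q + 1)"
        using card_residue_class_le[OF q, of M b] by linarith
      also have "\<dots> \<le> real M / real q + 1"
        using of_nat_div_le_of_nat[of M q, where ?'a = real] by simp
      finally show "(\<Sum>n | n < M \<and> n mod q = b. 1\<^sup>2) \<le> real M / real q + 1" by simp
    qed auto
    finally show ?thesis .
  qed
  have "(\<Sum>chi\<in>X. (norm (\<Sum>n<M. a n * chi (int n)))\<^sup>2) = (\<Sum>chi\<in>X. (norm (\<Sum>b<q. c b * chi (int b)))\<^sup>2)"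
    by (intro sum.cong refl) (simp add: eq)
  also have "\<dots> \<le> real q * (\<Sum>b<q. (norm (c b))\<^sup>2)"
  proof (rule Bessel_inequality)
    fix x assume "x \<in> X"
    then have "(\<Sum>b<q. (norm (x (int b)))\<^sup>2) \<le> (\<Sum>b<q. 1)"
      by (intro sum_mono power_le_one norm_character_le[OF X(2) q]) auto
    then show "(\<Sum>b<q. (norm (x (int b)))\<^sup>2) \<le> real q" by simp
  qed (use X q character_orthogonality in auto)
  also have "\<dots> \<le> real q * (\<Sum>b<q. (real M / real q + 1) * (\<Sum>n | n < M \<and> n mod q = b. (norm (a n))\<^sup>2))"
    by (intro mult_left_mono sum_mono c) auto
  also have "\<dots> = (real q + real M) * (\<Sum>b<q. \<Sum>n | n \<in> {..<M} \<and> n mod q = b. (norm (a n))\<^sup>2)"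
    by (subst sum_distrib_left[symmetric]) (use q in \<open>simp add: field_simps\<close>)
  also have "(\<Sum>b<q. \<Sum>n | n \<in> {..<M} \<and> n mod q = b. (norm (a n))\<^sup>2) = (\<Sum>n<M. (norm (a n))\<^sup>2)"
    by (rule sum.group) (use q in auto)
  finally show ?thesis .
qed

section \<open>Contour shifts and the Borel--Caratheodory inequality\<close>

lemma integrable_inverse_1_plus_square_lborel:
  "integrable lborel (\<lambda>x::real. inverse (1 + x\<^sup>2))"
  using integrable_inverse_1_plus_square by (simp add: set_integrable_def)

lemma integrable_lborel_inverse_square_bound:
  fixes f :: "real \<Rightarrow> complex"
  assumes cont: "continuous_on UNIV f"
    and bound: "\<And>y. \<bar>y\<bar> \<ge> 1 \<Longrightarrow> norm (f y) \<le> B / (1 + y\<^sup>2)"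
  shows "integrable lborel f"
proof -
  have "compact (f ` {-1..1})"
    by (intro compact_continuous_image continuous_on_subset[OF cont]) auto
  then obtain K where K: "\<And>y. y \<in> {-1..1} \<Longrightarrow> norm (f y) \<le> K"
    by (meson bounded_iff compact_imp_bounded imageI)
  have K0: "K \<ge> 0" using K[of 0] norm_ge_zero[of "f 0"] by (simp del: norm_ge_zero) 
  have B0: "B \<ge> 0" using bound[of 1] norm_ge_zero[of "f 1"] by (simp del: norm_ge_zero add: field_simps)
  \<comment> \<open>\<open>K\<close> bounds \<open>f\<close> on \<open>[-1, 1]\<close>, where
    \<open>1 + y^2 \<le> 2\<close>; hence the factor 2.\<close>
  have "integrable lborel (\<lambda>y. (2 * K + B) * inverse (1 + y\<^sup>2))"
    using integrable_inverse_1_plus_square_lborel by simp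
  then show ?thesis
  proof (rule Bochner_Integration.integrable_bound)
    show "f \<in> borel_measurable lborel"
      using cont borel_measurable_continuous_onI by auto
    show "AE y in lborel. norm (f y) \<le> norm ((2 * K + B) * inverse (1 + y\<^sup>2))"
    proof (rule AE_I2)
      fix y :: real
      have pos: "1 + y\<^sup>2 > 0" by (simp add: add_pos_nonneg)
      have "norm (f y) \<le> (2 * K + B) / (1 + y\<^sup>2)"
      proof (cases "\<bar>y\<bar> \<ge> 1")
        case True
        then have "norm (f y) \<le> B / (1 + y\<^sup>2)" by (rule bound)
        also have "\<dots> \<le> (2 * K + B) / (1 + y\<^sup>2)"
          using K0 pos by (intro divide_right_mono) auto
        finally show ?thesis .
      next
        case False
        then have "y \<in> {-1..1}" by (auto simp: abs_if split: if_splits)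
        then have "norm (f y) \<le> K" by (rule K)
        moreover have "y\<^sup>2 \<le> 1" using False by (simp add: abs_square_le_1)
        then have "K * (1 + y\<^sup>2) \<le> K * 2" using K0 by (intro mult_left_mono) auto
        then have "K \<le> (2 * K + B) / (1 + y\<^sup>2)" using pos B0 by (simp add: pos_le_divide_eq)
        ultimately show ?thesis by linarith
      qed
      also have "\<dots> \<le> norm ((2 * K + B) * inverse (1 + y\<^sup>2))"
        by (simp add: divide_inverse)
      finally show "norm (f y) \<le> norm ((2 * K + B) * inverse (1 + y\<^sup>2))" .
    qed
  qed
qed

text \<open>Contour integrals along segments are gauge integrals over intervals, while vertical
  lines are treated with Lebesgue integrals; dominated convergence connects the two.\<close>

lemma integral_symmetric_interval_tendsto:
  fixes f :: "real \<Rightarrow> complex"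
  assumes "integrable lborel f"
  shows "(\<lambda>n. integral {- real n..real n} f) \<longlonglongrightarrow> (LBINT y. f y)"
proof -
  have "(\<lambda>n. LBINT y. indicator {- real n..real n} y *\<^sub>R f y) \<longlonglongrightarrow> (LBINT y. f y)"
  proof (rule integral_dominated_convergence[where w = "\<lambda>y. norm (f y)"])
    show "AE y in lborel. (\<lambda>n. indicator {- real n..real n} y *\<^sub>R f y) \<longlonglongrightarrow> f y"
    proof (rule AE_I2)
      fix y :: real
      obtain m where m: "\<bar>y\<bar> \<le> real m" using real_arch_simple by blast
      have "eventually (\<lambda>n. indicator {- real n..real n} y *\<^sub>R f y = f y) sequentially"
        using eventually_ge_at_top[of m] by eventually_elim (use m in \<open>auto simp: indicator_def\<close>)
      then show "(\<lambda>n. indicator {- real n..real n} y *\<^sub>R f y) \<longlonglongrightarrow> f y"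
        by (rule tendsto_eventually)
    qed
  qed (use assms in \<open>auto simp: indicator_def\<close>)
  moreover have "(LBINT y. indicator {- real n..real n} y *\<^sub>R f y) = integral {- real n..real n} f" for n
  proof -
    have "set_integrable lborel {- real n..real n} f"
      unfolding set_integrable_def using assms by (intro integrable_mult_indicator) auto
    from set_borel_integral_eq_integral(2)[OF this] show ?thesis
      by (simp add: set_lebesgue_integral_def)
  qed
  ultimately show ?thesis by simp
qed

text \<open>The vertical sides become real integrals because they survive in the limit. The
  horizontal sides stay contour integrals, as they are only estimated, and their integrability is
  recorded for that purpose.\<close>

lemma Cauchy_integral_formula_rectangle:
  assumes f: "f holomorphic_on cbox p r" and z: "z \<in> box p r"
  shows "\<i> * (integral {Im p..Im r} (\<lambda>y. f (Complex (Re r) y) / (Complex (Re r) y - z))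
             - integral {Im p..Im r} (\<lambda>y. f (Complex (Re p) y) / (Complex (Re p) y - z)))
       + (contour_integral (linepath p (Complex (Re r) (Im p))) (\<lambda>w. f w / (w - z))
          + contour_integral (linepath r (Complex (Re p) (Im r))) (\<lambda>w. f w / (w - z)))
       = 2 * pi * \<i> * f z" (is "?lhs = ?rhs")
    and "(\<lambda>w. f w / (w - z)) contour_integrable_on linepath p (Complex (Re r) (Im p))"
    and "(\<lambda>w. f w / (w - z)) contour_integrable_on linepath r (Complex (Re p) (Im r))"
proof -
  define p2 where "p2 = Complex (Re r) (Im p)"
  define p4 where "p4 = Complex (Re p) (Im r)"
  define g where "g = (\<lambda>w. f w / (w - z))"
  have less: "Re p < Re r" "Im p < Im r"
    using z by (auto simp: in_box_complex_iff)
  have "((\<lambda>w. f w / (w - z)) has_contour_integral (2 * pi * \<i> * winding_number (rectpath p r) z * f z)) (rectpath p r)"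
  proof (rule Cauchy_integral_formula_convex_simple)
    show "path_image (rectpath p r) \<subseteq> cbox p r - {z}"
      using less z path_image_rectpath_cbox_minus_box[of p r] by auto
  qed (use f z in \<open>auto simp: interior_cbox\<close>)
  then have *: "(g has_contour_integral (2 * pi * \<i> * f z)) (rectpath p r)"
    using winding_number_rectpath[OF z] by (simp add: g_def)
  have rp: "rectpath p r = linepath p p2 +++ linepath p2 r +++ linepath r p4 +++ linepath p4 p"
    by (simp add: rectpath_def p2_def p4_def Let_def)
  have gint: "g contour_integrable_on (linepath p p2 +++ linepath p2 r +++ linepath r p4 +++ linepath p4 p)"
    using * rp by (metis has_contour_integral_integrable)
  have i1: "g contour_integrable_on linepath p p2" and
     "g contour_integrable_on (linepath p2 r +++ linepath r p4 +++ linepath p4 p)"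
    using gint by simp_all
  then have i2: "g contour_integrable_on linepath p2 r" and
     i34: "g contour_integrable_on (linepath r p4 +++ linepath p4 p)"
    by simp_all
  then have i3: "g contour_integrable_on linepath r p4" and i4: "g contour_integrable_on linepath p4 p"
    by simp_all
  have "2 * pi * \<i> * f z = contour_integral (rectpath p r) g"
    using * by (simp add: contour_integral_unique)
  also have "\<dots> = contour_integral (linepath p p2) g + (contour_integral (linepath p2 r) g
      + (contour_integral (linepath r p4) g + contour_integral (linepath p4 p) g))"
    unfolding rp using i1 i2 i3 i4 by (simp add: contour_integral_join)
  also have "contour_integral (linepath p2 r) g = \<i> * integral {Im p..Im r} (\<lambda>y. g (Complex (Re r) y))"
    by (rule contour_integral_linepath_same_Re) (use less in \<open>auto simp: p2_def\<close>)
  also have "contour_integral (linepath p4 p) g = - contour_integral (linepath p p4) g"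
    using contour_integral_reversepath[of "linepath p p4" g] by simp
  also have "contour_integral (linepath p p4) g = \<i> * integral {Im p..Im r} (\<lambda>y. g (Complex (Re p) y))"
    by (rule contour_integral_linepath_same_Re) (use less in \<open>auto simp: p4_def\<close>)
  finally show "?lhs = ?rhs"
    by (simp add: g_def p2_def p4_def algebra_simps)
  show "(\<lambda>w. f w / (w - z)) contour_integrable_on linepath p (Complex (Re r) (Im p))"
    using i1 by (simp add: g_def p2_def)
  show "(\<lambda>w. f w / (w - z)) contour_integrable_on linepath r (Complex (Re p) (Im r))"
    using i3 by (simp add: g_def p4_def)
qed

text \<open>Cauchy's formula on rectangles of height \<open>2 * n\<close>; the horizontal sides,
  collected in \<open>H n\<close>, are \<open>O(1 / n^2)\<close>. The bound is asked for only when
  \<open>\<bar>Im z\<bar> \<ge> 1\<close>, since \<open>f z / z\<close> may have a pole at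
  0.\<close>

lemma vertical_line_shift_pole:
  fixes f :: "complex \<Rightarrow> complex"
  assumes ab: "a < 0" "0 < b"
    and f: "f holomorphic_on {z. a \<le> Re z \<and> Re z \<le> b}"
    and bound: "\<And>z. a \<le> Re z \<Longrightarrow> Re z \<le> b \<Longrightarrow> \<bar>Im z\<bar> \<ge> 1 \<Longrightarrow> norm (f z / z) \<le> B / (1 + (Im z)\<^sup>2)"
  shows "integrable lborel (\<lambda>y. f (Complex a y) / Complex a y)"
    and "integrable lborel (\<lambda>y. f (Complex b y) / Complex b y)"
    and "(LBINT y. f (Complex b y) / Complex b y) - (LBINT y. f (Complex a y) / Complex a y) = 2 * pi * f 0"
proof -
  have cont: "continuous_on {z. a \<le> Re z \<and> Re z \<le> b} f"
    by (rule holomorphic_on_imp_continuous_on[OF f])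
  have line: "integrable lborel (\<lambda>y. f (Complex c y) / Complex c y)" if c: "c = a \<or> c = b" for c
  proof (rule integrable_lborel_inverse_square_bound)
    show "continuous_on UNIV (\<lambda>y. f (Complex c y) / Complex c y)"
      using c ab
      by (intro continuous_intros continuous_on_compose2[OF cont]) (auto simp: complex_eq_iff)
    show "norm (f (Complex c y) / Complex c y) \<le> B / (1 + y\<^sup>2)" if "\<bar>y\<bar> \<ge> 1" for y
      using bound[of "Complex c y"] c ab that by auto
  qed
  show ia: "integrable lborel (\<lambda>y. f (Complex a y) / Complex a y)"
    and ib: "integrable lborel (\<lambda>y. f (Complex b y) / Complex b y)"
    using line by auto
  define H where "H n = (let p = Complex a (- real n); r = Complex b (real n) in
      contour_integral (linepath p (Complex (Re r) (Im p))) (\<lambda>w. f w / (w - 0))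
          + contour_integral (linepath r (Complex (Re p) (Im r))) (\<lambda>w. f w / (w - 0)))" for n
  have B0: "B \<ge> 0"
  proof -
    have "0 \<le> norm (f (Complex a 1) / Complex a 1)" by simp
    also have "\<dots> \<le> B / (1 + 1\<^sup>2)" using bound[of "Complex a 1"] ab by auto
    finally show ?thesis by simp
  qed
  have eq: "\<i> * (integral {-real n..real n} (\<lambda>y. f (Complex b y) / Complex b y)
             - integral {-real n..real n} (\<lambda>y. f (Complex a y) / Complex a y)) + H n = 2 * pi * \<i> * f 0"
    and Hn: "norm (H n) \<le> 2 * (B / (1 + (real n)\<^sup>2) * (b - a))" if n: "n \<ge> 1" for n
  proof -
    define p where "p = Complex a (- real n)"
    define r where "r = Complex b (real n)"
    have hol: "f holomorphic_on cbox p r"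
      by (rule holomorphic_on_subset[OF f]) (auto simp: in_cbox_complex_iff p_def r_def)
    have z: "0 \<in> box p r" using n ab by (auto simp: in_box_complex_iff p_def r_def)
    note C = Cauchy_integral_formula_rectangle[OF hol z]
    show "\<i> * (integral {-real n..real n} (\<lambda>y. f (Complex b y) / Complex b y)
             - integral {-real n..real n} (\<lambda>y. f (Complex a y) / Complex a y)) + H n = 2 * pi * \<i> * f 0"
      using C(1) by (simp add: p_def r_def H_def Let_def)
    have seg: "norm (f w / (w - 0)) \<le> B / (1 + (real n)\<^sup>2)"
      if "w \<in> closed_segment p (Complex (Re r) (Im p)) \<or> w \<in> closed_segment r (Complex (Re p) (Im r))" for w
    proof -
      have "Re w \<in> {a..b} \<and> \<bar>Im w\<bar> = real n"
        using that ab closed_segment_same_Im[of p "Complex (Re r) (Im p)"] 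
            closed_segment_same_Im[of r "Complex (Re p) (Im r)"]
        by (auto simp: p_def r_def closed_segment_eq_real_ivl split: if_splits)
      moreover from this have "(Im w)\<^sup>2 = (real n)\<^sup>2" by (metis power2_abs)
      ultimately show ?thesis using bound[of w] n by auto
    qed
    have "norm (contour_integral (linepath p (Complex (Re r) (Im p))) (\<lambda>w. f w / (w - 0)))
        \<le> B / (1 + (real n)\<^sup>2) * norm (Complex (Re r) (Im p) - p)"
      by (rule contour_integral_bound_linepath[OF C(2)]) (use B0 seg in auto)
    moreover have "norm (contour_integral (linepath r (Complex (Re p) (Im r))) (\<lambda>w. f w / (w - 0)))
        \<le> B / (1 + (real n)\<^sup>2) * norm (Complex (Re p) (Im r) - r)"
      by (rule contour_integral_bound_linepath[OF C(3)]) (use B0 seg in auto)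
    moreover have "norm (Complex (Re r) (Im p) - p) = b - a" "norm (Complex (Re p) (Im r) - r) = b - a"
      using ab by (simp_all add: p_def r_def cmod_def)
    ultimately show "norm (H n) \<le> 2 * (B / (1 + (real n)\<^sup>2) * (b - a))"
      unfolding H_def Let_def p_def[symmetric] r_def[symmetric]
      by (intro order_trans[OF norm_triangle_ineq]) simp
  qed
  have H0: "H \<longlonglongrightarrow> 0"
  proof (rule Lim_null_comparison)
    show "eventually (\<lambda>n. norm (H n) \<le> 2 * (B / (1 + (real n)\<^sup>2) * (b - a))) sequentially"
      using eventually_ge_at_top[of 1] by eventually_elim (rule Hn)
    show "(\<lambda>n. 2 * (B / (1 + (real n)\<^sup>2) * (b - a))) \<longlonglongrightarrow> 0"
      by real_asymp
  qed
  have "(\<lambda>n. \<i> * (integral {-real n..real n} (\<lambda>y. f (Complex b y) / Complex b y)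
             - integral {-real n..real n} (\<lambda>y. f (Complex a y) / Complex a y)) + H n)
      \<longlonglongrightarrow> \<i> * ((LBINT y. f (Complex b y) / Complex b y) - (LBINT y. f (Complex a y) / Complex a y)) + 0"
    by (intro tendsto_intros integral_symmetric_interval_tendsto ia ib H0)
  moreover have "eventually (\<lambda>n. \<i> * (integral {-real n..real n} (\<lambda>y. f (Complex b y) / Complex b y)
             - integral {-real n..real n} (\<lambda>y. f (Complex a y) / Complex a y)) + H n
      = 2 * pi * \<i> * f 0) sequentially"
    using eventually_ge_at_top[of 1] by eventually_elim (rule eq)
  then have "(\<lambda>n. \<i> * (integral {-real n..real n} (\<lambda>y. f (Complex b y) / Complex b y)
             - integral {-real n..real n} (\<lambda>y. f (Complex a y) / Complex a y)) + H n)
      \<longlonglongrightarrow> 2 * pi * \<i> * f 0"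
    by (rule tendsto_eventually)
  ultimately have "\<i> * ((LBINT y. f (Complex b y) / Complex b y) - (LBINT y. f (Complex a y) / Complex a y)) + 0
      = 2 * pi * \<i> * f 0"
    by (rule LIMSEQ_unique)
  then have "\<i> * ((LBINT y. f (Complex b y) / Complex b y) - (LBINT y. f (Complex a y) / Complex a y))
      = \<i> * (2 * pi * f 0)" by (simp add: mult_ac)
  then show "(LBINT y. f (Complex b y) / Complex b y) - (LBINT y. f (Complex a y) / Complex a y) = 2 * pi * f 0"
    by (simp only: mult_cancel_left) simp
qed

text \<open>Centring the strip at \<open>m\<close> and multiplying by \<open>z\<close> reduces this
  to the version with a pole: the residue is the value of \<open>z * f (z + m)\<close> at 0, which
  is 0.\<close>

lemma vertical_line_shift:
  fixes f :: "complex \<Rightarrow> complex"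
  assumes ab: "a < b"
    and f: "f holomorphic_on {z. a \<le> Re z \<and> Re z \<le> b}"
    and bound: "\<And>z. a \<le> Re z \<Longrightarrow> Re z \<le> b \<Longrightarrow> \<bar>Im z\<bar> \<ge> 1 \<Longrightarrow> norm (f z) \<le> B / (1 + (Im z)\<^sup>2)"
  shows "integrable lborel (\<lambda>y. f (Complex a y))"
    and "integrable lborel (\<lambda>y. f (Complex b y))"
    and "(LBINT y. f (Complex b y)) = (LBINT y. f (Complex a y))"
proof -
  define m where "m = (a + b) / 2"
  define g where "g = (\<lambda>z. z * f (z + of_real m))"
  have 1: "a - m < 0" "0 < b - m" using ab by (auto simp: m_def field_simps)
  have 2: "g holomorphic_on {z. a - m \<le> Re z \<and> Re z \<le> b - m}"
    unfolding g_def
    by (intro holomorphic_intros holomorphic_on_compose_gen[OF _ f, unfolded o_def]) (auto simp: algebra_simps)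
  have 3: "norm (g z / z) \<le> B / (1 + (Im z)\<^sup>2)" if "a - m \<le> Re z" "Re z \<le> b - m" "\<bar>Im z\<bar> \<ge> 1" for z
    using bound[of "z + of_real m"] that by (auto simp: g_def)
  have eq: "g (Complex (c - m) y) / Complex (c - m) y = f (Complex c y)" if "c \<noteq> m" for c y
  proof -
    have "Complex (c - m) y + of_real m = Complex c y" "Complex (c - m) y \<noteq> 0"
      using that by (auto simp: complex_eq_iff)
    then show ?thesis by (simp add: g_def)
  qed
  have ne: "a \<noteq> m" "b \<noteq> m" using 1 by auto
  note S = vertical_line_shift_pole[OF 1 2 3, unfolded eq[OF ne(1)] eq[OF ne(2)]]
  show "integrable lborel (\<lambda>y. f (Complex a y))" "integrable lborel (\<lambda>y. f (Complex b y))"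
    using S(1,2) by auto
  show "(LBINT y. f (Complex b y)) = (LBINT y. f (Complex a y))"
    using S(3) by (simp add: g_def)
qed

text \<open>As the line moves away the integrand tends to 0 pointwise, and as long as the abscissa
  has modulus at least 1 it is dominated by a multiple of \<open>1 / (1 + y^2)\<close>.\<close>

lemma integral_vertical_line_tendsto_0:
  fixes f :: "complex \<Rightarrow> complex" and c :: "nat \<Rightarrow> real"
  assumes c: "\<And>n. \<bar>c n\<bar> \<ge> 1" "filterlim (\<lambda>n. \<bar>c n\<bar>) at_top sequentially"
    and int: "\<And>n. integrable lborel (\<lambda>y. f (Complex (c n) y))"
    and bound: "\<And>n y. norm (f (Complex (c n) y)) \<le> K / (norm (Complex (c n) y))\<^sup>2"
  shows "(\<lambda>n. LBINT y. f (Complex (c n) y)) \<longlonglongrightarrow> 0"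
proof -
  have "(\<lambda>n. LBINT y. f (Complex (c n) y)) \<longlonglongrightarrow> (LBINT (y::real). (0::complex))"
  proof (rule integral_dominated_convergence[where M = lborel and s = "\<lambda>n y. f (Complex (c n) y)"
        and f = "\<lambda>_. 0" and w = "\<lambda>y. \<bar>K\<bar> * inverse (1 + y\<^sup>2)"])
    show "integrable lborel (\<lambda>y. \<bar>K\<bar> * inverse (1 + y\<^sup>2))"
      using integrable_inverse_1_plus_square_lborel by simp
    show "AE y in lborel. (\<lambda>n. f (Complex (c n) y)) \<longlonglongrightarrow> 0"
    proof (rule AE_I2, rule Lim_null_comparison)
      fix y
      show "eventually (\<lambda>n. norm (f (Complex (c n) y)) \<le> \<bar>K\<bar> / \<bar>c n\<bar>) sequentially"
      proof (rule always_eventually, rule allI)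
        fix n
        have "\<bar>c n\<bar> * 1 \<le> \<bar>c n\<bar> * \<bar>c n\<bar>" using c(1)[of n] by (intro mult_left_mono) auto
        then have "\<bar>c n\<bar> \<le> (c n)\<^sup>2" by (simp add: power2_eq_square)
        then have "\<bar>c n\<bar> \<le> (norm (Complex (c n) y))\<^sup>2"
          unfolding cmod_power2 complex.sel using zero_le_power2[of y] by linarith
        then have "K / (norm (Complex (c n) y))\<^sup>2 \<le> \<bar>K\<bar> / \<bar>c n\<bar>"
          using c(1)[of n] by (intro frac_le) auto
        then show "norm (f (Complex (c n) y)) \<le> \<bar>K\<bar> / \<bar>c n\<bar>"
          using bound[of n y] by linarith
      qed
      show "(\<lambda>n. \<bar>K\<bar> / \<bar>c n\<bar>) \<longlonglongrightarrow> 0"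
        by (rule real_tendsto_divide_at_top[OF tendsto_const c(2)])
    qed
    show "AE y in lborel. norm (f (Complex (c n) y)) \<le> \<bar>K\<bar> * inverse (1 + y\<^sup>2)" for n
    proof (rule AE_I2)
      fix y
      have "1 \<le> \<bar>c n\<bar>\<^sup>2" using c(1)[of n] by (simp only: one_le_power)
      then have "K / (norm (Complex (c n) y))\<^sup>2 \<le> \<bar>K\<bar> / (1 + y\<^sup>2)"
        by (intro frac_le) (auto simp: cmod_power2 add_pos_nonneg)
      then show "norm (f (Complex (c n) y)) \<le> \<bar>K\<bar> * inverse (1 + y\<^sup>2)"
        using bound[of n y] by (simp add: divide_inverse)
    qed
  qed (use int in auto)
  then show ?thesis by simp
qed

section \<open>The triangle function and its Mellin inversion\<close>

definition expm1_quot :: "real \<Rightarrow> complex \<Rightarrow> complex" where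
  "expm1_quot u w = (if w = 0 then of_real u else (exp (of_real u * w) - 1) / w)"

lemma holomorphic_expm1_quot: "expm1_quot u holomorphic_on A"
proof -
  have "expm1_quot u holomorphic_on UNIV"
  proof (rule no_isolated_singularity'[where K = "{0}"])
    show "expm1_quot u holomorphic_on UNIV - {0}"
      by (rule holomorphic_transform[where f = "\<lambda>w. (exp (of_real u * w) - 1) / w"])
         (auto intro!: holomorphic_intros simp: expm1_quot_def)
    show "(expm1_quot u \<longlongrightarrow> expm1_quot u z) (at z within UNIV)" if "z \<in> {0}" for z
    proof -
      have "((\<lambda>w. exp (of_real u * w)) has_field_derivative of_real u) (at (0::complex))"
        by (auto intro!: derivative_eq_intros)
      then have "((\<lambda>w. (exp (of_real u * w) - 1) / w) \<longlongrightarrow> of_real u) (at (0::complex))"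
        by (simp add: has_field_derivative_iff)
      moreover have "eventually (\<lambda>w. (exp (of_real u * w) - 1) / w = expm1_quot u w) (at 0)"
        by (auto simp: expm1_quot_def eventually_at intro!: exI[of _ 1])
      ultimately have "(expm1_quot u \<longlongrightarrow> of_real u) (at 0)"
        by (rule Lim_transform_eventually)
      then show ?thesis using that by (simp add: expm1_quot_def)
    qed
  qed auto
  then show ?thesis by (rule holomorphic_on_subset) auto
qed

lemma inverse_norm_square_le:
  fixes z :: complex
  assumes "\<bar>Im z\<bar> \<ge> 1"
  shows "1 / (norm z)\<^sup>2 \<le> 2 / (1 + (Im z)\<^sup>2)"
proof -
  have "1 \<le> \<bar>Im z\<bar>\<^sup>2" using assms by (simp only: one_le_power)
  then have *: "1 \<le> (Im z)\<^sup>2" "0 \<le> (Re z)\<^sup>2" by simp_all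
  have "1 + (Im z)\<^sup>2 \<le> 2 * (norm z)\<^sup>2" unfolding cmod_power2 using * by argo
  moreover have "0 < (norm z)\<^sup>2" unfolding cmod_power2 using * by linarith
  ultimately show ?thesis by (simp add: field_simps add_pos_nonneg)
qed

text \<open>For \<open>u \<le> 0\<close> the exponential is bounded in the right half-plane, so the
  line can be pushed infinitely far to the right without meeting the pole.\<close>

lemma exp_div_square_integral_nonpos:
  assumes k: "\<kappa> > 0" and u: "u \<le> 0"
  shows "integrable lborel (\<lambda>y. exp (of_real u * Complex \<kappa> y) / (Complex \<kappa> y)\<^sup>2)"
    and "(LBINT y. exp (of_real u * Complex \<kappa> y) / (Complex \<kappa> y)\<^sup>2) = 0"
proof -
  define f :: "complex \<Rightarrow> complex" where "f = (\<lambda>w. exp (of_real u * w) / w\<^sup>2)"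
  have bd: "norm (f z) \<le> 1 / (norm z)\<^sup>2" if "Re z > 0" for z
    using that u by (auto simp: f_def norm_divide norm_power mult_nonpos_nonneg intro!: divide_right_mono)
  have sh: "integrable lborel (\<lambda>y. f (Complex \<kappa> y)) \<and> integrable lborel (\<lambda>y. f (Complex C y))
     \<and> (LBINT y. f (Complex C y)) = (LBINT y. f (Complex \<kappa> y))" if C: "\<kappa> < C" for C
  proof -
    have "f holomorphic_on {z. \<kappa> \<le> Re z \<and> Re z \<le> C}"
      unfolding f_def using k by (intro holomorphic_intros) auto
    moreover have "norm (f z) \<le> 2 / (1 + (Im z)\<^sup>2)" if "\<kappa> \<le> Re z" "Re z \<le> C" "\<bar>Im z\<bar> \<ge> 1" for z
      using bd[of z] inverse_norm_square_le[OF that(3)] that k by linarith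
    ultimately show ?thesis using vertical_line_shift[OF C, of f 2] by blast
  qed
  show "integrable lborel (\<lambda>y. exp (of_real u * Complex \<kappa> y) / (Complex \<kappa> y)\<^sup>2)"
    using sh[of "\<kappa> + 1"] by (simp add: f_def)
  define c where "c n = \<kappa> + 1 + real n" for n
  have "(\<lambda>n. LBINT y. f (Complex (c n) y)) \<longlonglongrightarrow> 0"
  proof (rule integral_vertical_line_tendsto_0)
    show "filterlim (\<lambda>n. \<bar>c n\<bar>) at_top sequentially" unfolding c_def by real_asymp
    show "norm (f (Complex (c n) y)) \<le> 1 / (norm (Complex (c n) y))\<^sup>2" for n y
      using bd[of "Complex (c n) y"] k by (simp add: c_def)
  qed (use k sh in \<open>auto simp: c_def\<close>)
  moreover have "(LBINT y. f (Complex (c n) y)) = (LBINT y. f (Complex \<kappa> y))" for n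
    using sh[of "c n"] by (auto simp: c_def)
  ultimately have "(\<lambda>n::nat. LBINT y. f (Complex \<kappa> y)) \<longlonglongrightarrow> 0" by simp
  then have "(LBINT y. f (Complex \<kappa> y)) = 0" by (simp add: LIMSEQ_const_iff)
  then show "(LBINT y. exp (of_real u * Complex \<kappa> y) / (Complex \<kappa> y)\<^sup>2) = 0"
    by (simp add: f_def)
qed

text \<open>For \<open>u > 0\<close> the line has to go to the left and crosses a double pole at 0.
  Splitting off \<open>1 / w^2\<close>, whose integral is the case \<open>u = 0\<close>, leaves a
  simple pole with residue \<open>u\<close>.\<close>

lemma exp_div_square_integral:
  assumes k: "\<kappa> > 0"
  shows "integrable lborel (\<lambda>y. exp (of_real u * Complex \<kappa> y) / (Complex \<kappa> y)\<^sup>2)" (is ?A)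
    and "(LBINT y. exp (of_real u * Complex \<kappa> y) / (Complex \<kappa> y)\<^sup>2) = of_real (2 * pi * max u 0)" (is ?B)
proof -
  have "?A \<and> ?B"
  proof (cases "u \<le> 0")
    case True
    then show ?thesis using exp_div_square_integral_nonpos[OF k True] by auto
  next
    case False
    then have u: "u > 0" by simp
    define f where "f = expm1_quot u"
    define e :: "complex \<Rightarrow> complex" where "e = (\<lambda>w. (exp (of_real u * w) - 1) / w\<^sup>2)"
    have fe: "f w / w = e w" if "w \<noteq> 0" for w
      using that by (simp add: f_def expm1_quot_def e_def power2_eq_square)
    have bd: "norm (e z) \<le> (exp (u * r) + 1) / (norm z)\<^sup>2" if "Re z \<le> r" for z r
    proof -
      have "norm (exp (of_real u * z) - 1) \<le> norm (exp (of_real u * z)) + norm (1::complex)"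
        by (rule norm_triangle_ineq4)
      also have "\<dots> \<le> exp (u * r) + 1" using that u by simp
      finally show ?thesis by (simp add: e_def norm_divide norm_power divide_right_mono)
    qed
    have sh: "integrable lborel (\<lambda>y. e (Complex \<kappa> y)) \<and> integrable lborel (\<lambda>y. e (Complex C y))
     \<and> (LBINT y. e (Complex \<kappa> y)) - (LBINT y. e (Complex C y)) = 2 * pi * u" if C: "C < 0" for C
    proof -
      have 1: "norm (f z / z) \<le> ((exp (u * \<kappa>) + 1) * 2) / (1 + (Im z)\<^sup>2)"
        if "C \<le> Re z" "Re z \<le> \<kappa>" "\<bar>Im z\<bar> \<ge> 1" for z
      proof -
        have "z \<noteq> 0" using that by auto
        have "(exp (u * \<kappa>) + 1) * (1 / (norm z)\<^sup>2) \<le> (exp (u * \<kappa>) + 1) * (2 / (1 + (Im z)\<^sup>2))"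
          by (intro mult_left_mono inverse_norm_square_le that) (simp add: add_nonneg_nonneg)
        then show ?thesis using bd[OF that(2)]
          unfolding fe[OF \<open>z \<noteq> 0\<close>] times_divide_eq_right mult_1_right by linarith
      qed
      have 2: "f holomorphic_on {z. C \<le> Re z \<and> Re z \<le> \<kappa>}"
        unfolding f_def by (rule holomorphic_expm1_quot)
      have ne: "Complex C y \<noteq> 0" "Complex \<kappa> y \<noteq> 0" for y
        using C k by (auto simp: complex_eq_iff)
      show ?thesis
        using vertical_line_shift_pole[OF C k 2 1, unfolded fe[OF ne(1)] fe[OF ne(2)]]
        by (simp add: f_def expm1_quot_def)
    qed
    define c where "c n = - 1 - real n" for n
    have "(\<lambda>n. LBINT y. e (Complex (c n) y)) \<longlonglongrightarrow> 0"
    proof (rule integral_vertical_line_tendsto_0)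
      show "filterlim (\<lambda>n. \<bar>c n\<bar>) at_top sequentially" unfolding c_def by real_asymp
      show "norm (e (Complex (c n) y)) \<le> (exp (u * 0) + 1) / (norm (Complex (c n) y))\<^sup>2" for n y
        by (rule bd) (simp add: c_def)
    qed (use sh in \<open>auto simp: c_def\<close>)
    moreover have "(LBINT y. e (Complex (c n) y)) = (LBINT y. e (Complex \<kappa> y)) - 2 * pi * u" for n
      using sh[of "c n"] by (auto simp: c_def algebra_simps)
    ultimately have "(\<lambda>n::nat. (LBINT y. e (Complex \<kappa> y)) - 2 * pi * u) \<longlonglongrightarrow> 0" by simp
    then have E: "(LBINT y. e (Complex \<kappa> y)) = 2 * pi * u" by (simp add: LIMSEQ_const_iff)
    have Ei: "integrable lborel (\<lambda>y. e (Complex \<kappa> y))" using sh[of "-1"] by simp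
    note Z = exp_div_square_integral_nonpos[OF k, of 0, simplified]
    have eq: "exp (of_real u * w) / w\<^sup>2 = e w + 1 / w\<^sup>2" for w
      by (simp add: e_def diff_divide_distrib)
    have ?A unfolding eq using Ei Z(1) by (rule Bochner_Integration.integrable_add)
    moreover have ?B unfolding eq
      by (subst Bochner_Integration.integral_add[OF Ei Z(1)]) (use E Z(2) u in simp)
    ultimately show ?thesis by blast
  qed
  then show ?A ?B by auto
qed

text \<open>The triangle function is a compromise: its transform decays like an inverse square, so
  that Mellin inversion converges absolutely, and its integer translates form a partition of
  unity.\<close>

definition hat :: "real \<Rightarrow> real" where "hat u = max 0 (1 - \<bar>u\<bar>)"

text \<open>The two-sided Laplace transform of \<open>hat\<close>, factored so that it is visibly
  entire.\<close>

definition hat_transform :: "complex \<Rightarrow> complex" where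
  "hat_transform w = expm1_quot 1 w * expm1_quot (-1) w * (-1)"

lemma hat_transform_eq: "w \<noteq> 0 \<Longrightarrow> hat_transform w = (exp w - 2 + exp (-w)) / w\<^sup>2"
  by (simp add: hat_transform_def expm1_quot_def field_simps power2_eq_square exp_minus)

text \<open>\<open>hat u\<close> is the second difference
  \<open>max (u + 1) 0 - 2 * max u 0 + max (u - 1) 0\<close>, and the numerator
  \<open>exp w - 2 + exp (- w)\<close> of the transform shifts \<open>u\<close> by 1, 0 and -1 with
  the same coefficients.\<close>

lemma hat_inversion:
  assumes k: "\<kappa> > 0"
  shows "integrable lborel (\<lambda>y. exp (of_real u * Complex \<kappa> y) * hat_transform (Complex \<kappa> y))"
    and "(LBINT y. exp (of_real u * Complex \<kappa> y) * hat_transform (Complex \<kappa> y)) = of_real (2 * pi * hat u)"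
proof -
  define E where "E v y = exp (of_real v * Complex \<kappa> y) / (Complex \<kappa> y)\<^sup>2" for v y
  have eq: "exp (of_real u * Complex \<kappa> y) * hat_transform (Complex \<kappa> y) = E (u + 1) y - 2 * E u y + E (u - 1) y" for y
  proof -
    define w where "w = Complex \<kappa> y"
    have "w \<noteq> 0" using k by (auto simp: w_def complex_eq_iff)
    have "exp (of_real (u + 1) * w) = exp (of_real u * w) * exp w"
      "exp (of_real (u - 1) * w) = exp (of_real u * w) * exp (- w)"
      by (simp_all add: exp_add[symmetric] ring_distribs)
    then show ?thesis
      unfolding E_def w_def[symmetric] hat_transform_eq[OF \<open>w \<noteq> 0\<close>]
      by (simp add: algebra_simps add_divide_distrib diff_divide_distrib)
  qed
  note I = exp_div_square_integral[OF k, folded E_def]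
  show "integrable lborel (\<lambda>y. exp (of_real u * Complex \<kappa> y) * hat_transform (Complex \<kappa> y))"
    unfolding eq using I(1) by simp
  have "(LBINT y. exp (of_real u * Complex \<kappa> y) * hat_transform (Complex \<kappa> y))
      = (LBINT y. E (u+1) y) - 2 * (LBINT y. E u y) + (LBINT y. E (u-1) y)"
    unfolding eq using I(1) by simp
  also have "\<dots> = of_real (2 * pi * hat u)"
  proof -
    have "max (u + 1) 0 - 2 * max u 0 + max (u - 1) 0 = hat u"
      by (simp add: hat_def max_def abs_if)
    note h = this
    have "2 * pi * hat u = 2 * pi * max (u + 1) 0 - 2 * (2 * pi * max u 0) + 2 * pi * max (u - 1) 0"
      unfolding h[symmetric] by (simp only: ring_distribs mult_ac)
    then show ?thesis unfolding I(2) by simp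
  qed
  finally show "(LBINT y. exp (of_real u * Complex \<kappa> y) * hat_transform (Complex \<kappa> y)) = of_real (2 * pi * hat u)" .
qed

text \<open>The map \<open>z / (2 * A - z)\<close> sends the half-plane \<open>Re z < A\<close> into
  the unit disc and fixes 0, so the Schwarz lemma applies after rescaling the disc.\<close>

lemma Borel_Caratheodory:
  assumes f: "f holomorphic_on ball z0 R" and f0: "f z0 = 0"
    and A: "\<And>z. z \<in> ball z0 R \<Longrightarrow> Re (f z) < A"
    and r: "dist z0 z \<le> r" "0 \<le> r" "r < R"
  shows "norm (f z) \<le> 2 * A * r / (R - r)"
proof -
  have R: "R > 0" using r by simp
  have A0: "A > 0" using A[of z0] f0 R by simp
  define g where "g w = f (z0 + of_real R * w)" for w
  define h where "h w = g w / (2 * of_real A - g w)" for w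
  have in_ball: "z0 + of_real R * w \<in> ball z0 R" if "w \<in> ball 0 1" for w
    using that R by (simp add: dist_norm norm_mult)
  have g: "g holomorphic_on ball 0 1"
    unfolding g_def using in_ball
    by (intro holomorphic_on_compose_gen[OF _ f, unfolded o_def] holomorphic_intros) auto
  have Reg: "Re (g w) < A" if "w \<in> ball 0 1" for w
    using A[OF in_ball[OF that]] by (simp add: g_def)
  have nz: "2 * of_real A - g w \<noteq> 0" if "w \<in> ball 0 1" for w
    using Reg[OF that] A0 by (auto simp: complex_eq_iff)
  have lt: "norm (g w) < norm (2 * of_real A - g w)" if "w \<in> ball 0 1" for w
  proof -
    have "A * Re (g w) < A * A" using Reg[OF that] A0 by simp
    then have "(norm (g w))\<^sup>2 < (norm (2 * of_real A - g w))\<^sup>2"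
      unfolding cmod_power2 by (simp add: power2_eq_square algebra_simps)
    then show ?thesis by (rule power2_less_imp_less) simp
  qed
  have h: "h holomorphic_on ball 0 1"
    unfolding h_def using nz by (intro holomorphic_intros g) auto
  define w where "w = (z - z0) / of_real R"
  have nw: "norm w \<le> r / R"
    using r R by (simp add: w_def norm_divide dist_norm norm_minus_commute divide_right_mono)
  also have "\<dots> < 1" using r R by simp
  finally have w1: "norm w < 1" .
  have "norm (h w) \<le> norm w"
  proof (rule Schwarz_Lemma(1)[OF h])
    show "h 0 = 0" by (simp add: h_def g_def f0)
    show "norm (h z) < 1" if "norm z < 1" for z
      using lt[of z] that nz[of z] by (simp add: h_def norm_divide)
  qed (rule w1)
  then have hw: "norm (h w) \<le> r / R" using nw by simp
  have gw: "g w = f z" using R by (simp add: g_def w_def)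
  have "norm (g w) = norm (h w) * norm (2 * of_real A - g w)"
    using nz[of w] w1 by (simp add: h_def norm_divide)
  also have "\<dots> \<le> r / R * norm (2 * of_real A - g w)"
    by (intro mult_right_mono hw) auto
  also have "\<dots> \<le> r / R * (2 * A + norm (g w))"
    using r R A0 norm_triangle_ineq4[of "2 * of_real A" "g w"] by (intro mult_left_mono) auto
  finally have "R * norm (g w) \<le> r * (2 * A + norm (g w))"
    using R by (simp add: field_simps)
  then have "(R - r) * norm (f z) \<le> 2 * A * r"
    by (simp add: gw algebra_simps)
  then show ?thesis using r by (simp add: field_simps)
qed

section \<open>Bounds for Gamma and its reciprocal in vertical strips\<close>

lemma norm_Gamma_le_Gamma_Re:
  assumes "Re z > 0"
  shows "norm (Gamma z) \<le> Gamma (Re z)"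
proof -
  let ?f = "\<lambda>t. complex_of_real t powr (z - 1) / of_real (exp t)"
  let ?g = "\<lambda>t. t powr (Re z - 1) / exp t"
  have f: "(?f has_integral Gamma z) {0..}" by (rule Gamma_integral_complex[OF assms])
  have g: "(?g has_integral Gamma (Re z)) {0..}" by (rule Gamma_integral_real[OF assms])
  have "norm (integral {0..} ?f) \<le> integral {0..} ?g"
  proof (rule integral_norm_bound_integral)
    show "?f integrable_on {0..}" "?g integrable_on {0..}" using f g by blast+
    show "norm (?f t) \<le> ?g t" if "t \<in> {0..}" for t
      using that by (simp add: norm_divide norm_powr_real_powr)
  qed
  then show ?thesis using f g by (simp add: integral_unique)
qed

lemma norm_sin_le_exp: "norm (sin z) \<le> exp \<bar>Im z\<bar>" for z :: complex
proof -
  have "norm (exp (\<i> * z) - exp (- (\<i> * z))) \<le> norm (exp (\<i> * z)) + norm (exp (- (\<i> * z)))"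
    by (rule norm_triangle_ineq4)
  also have "\<dots> \<le> exp \<bar>Im z\<bar> + exp \<bar>Im z\<bar>" by (intro add_mono) (simp_all add: norm_exp_eq_Re)
  finally show ?thesis by (simp add: sin_exp_eq norm_divide norm_mult)
qed

text \<open>By reflection \<open>rGamma z = sin (pi * z) * Gamma (1 - z) / pi\<close>, where
  \<open>1 - z\<close> stays in the right half-plane because \<open>B < 1\<close>. A bound
  exponential in \<open>Im z\<close> is enough in place of Stirling's formula, since it enters only
  through the logarithm of the L-function.\<close>

lemma rGamma_bound_left_strip:
  assumes "B < 1"
  shows "\<exists>C. \<forall>z. A \<le> Re z \<and> Re z \<le> B \<longrightarrow> norm (rGamma z) \<le> C * exp (pi * \<bar>Im z\<bar>)"
proof -
  have "compact (Gamma ` {1 - B..1 - A :: real})"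
    using assms by (intro compact_continuous_image continuous_intros) (auto elim!: nonpos_Ints_cases)
  then obtain K where K: "\<And>x. x \<in> {1 - B..1 - A} \<Longrightarrow> norm (Gamma x :: real) \<le> K"
    by (meson bounded_iff compact_imp_bounded imageI)
  show ?thesis
  proof (intro exI[of _ "K / pi"] allI impI)
    fix z assume z: "A \<le> Re z \<and> Re z \<le> B"
    have pos: "Re (1 - z) > 0" using z assms by simp
    have nz: "1 - z \<notin> \<int>\<^sub>\<le>\<^sub>0"
    proof
      assume "1 - z \<in> \<int>\<^sub>\<le>\<^sub>0"
      then obtain n where "1 - z = of_int n" "n \<le> 0" by (auto elim!: nonpos_Ints_cases)
      then have "Re (1 - z) = Re (of_int n)" by (simp only:)
      then have "Re (1 - z) = of_int n" by simp
      then show False using pos \<open>n \<le> 0\<close> by simp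
    qed
    have "rGamma z = rGamma z * (rGamma (1 - z) * Gamma (1 - z))"
      using rGamma_inverse_Gamma[of "1 - z"] Gamma_eq_zero_iff[of "1 - z"] nz by simp
    also have "\<dots> = sin (of_real pi * z) / of_real pi * Gamma (1 - z)"
      by (simp add: rGamma_reflection_complex[symmetric] mult.assoc)
    finally have eq: "rGamma z = sin (of_real pi * z) / of_real pi * Gamma (1 - z)" .
    have "norm (Gamma (1 - z)) \<le> Gamma (1 - Re z)"
      using norm_Gamma_le_Gamma_Re[OF pos] by simp
    also have "\<dots> \<le> K" using K[of "1 - Re z"] z by auto
    finally have G: "norm (Gamma (1 - z)) \<le> K" .
    have "norm (sin (of_real pi * z)) \<le> exp (pi * \<bar>Im z\<bar>)"
      using norm_sin_le_exp[of "of_real pi * z"] by (simp add: abs_mult)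
    then have "norm (sin (of_real pi * z)) * norm (Gamma (1 - z)) \<le> exp (pi * \<bar>Im z\<bar>) * K"
      by (intro mult_mono G) auto
    then show "norm (rGamma z) \<le> K / pi * exp (pi * \<bar>Im z\<bar>)"
      unfolding eq by (simp add: norm_mult norm_divide divide_right_mono mult.commute)
  qed
qed

text \<open>Induction on the right end of the strip:
  \<open>rGamma (z - 1) = (z - 1) * rGamma z\<close>, and \<open>z - 1\<close> has modulus at least
  1 when \<open>\<bar>Im z\<bar> \<ge> 1\<close>. The base case ends at
  \<open>B - 1 / 2 < 1\<close>, where reflection applies.\<close>

lemma rGamma_bound_strip_away:
  "\<exists>C. \<forall>z. A \<le> Re z \<and> Re z \<le> B - 1 / 2 + real k \<and> \<bar>Im z\<bar> \<ge> 1 \<longrightarrow> norm (rGamma z) \<le> C * exp (pi * \<bar>Im z\<bar>)"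
  if "B \<le> 1"
proof (induction k arbitrary: A)
  case 0
  then show ?case using rGamma_bound_left_strip[of "B - 1/2" A] that by auto
next
  case (Suc k)
  obtain C where C: "\<And>z. A - 1 \<le> Re z \<Longrightarrow> Re z \<le> B - 1 / 2 + real k \<Longrightarrow> \<bar>Im z\<bar> \<ge> 1 \<Longrightarrow>
      norm (rGamma z) \<le> C * exp (pi * \<bar>Im z\<bar>)"
    using Suc[of "A - 1"] by blast
  show ?case
  proof (intro exI[of _ C] allI impI)
    fix z assume z: "A \<le> Re z \<and> Re z \<le> B - 1 / 2 + real (Suc k) \<and> \<bar>Im z\<bar> \<ge> 1"
    have "1 \<le> norm (z - 1)" using abs_Im_le_cmod[of "z - 1"] z by simp
    then have "norm (rGamma z) * 1 \<le> norm (rGamma z) * norm (z - 1)"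
      by (intro mult_left_mono) auto
    also have "\<dots> = norm (rGamma (z - 1))"
      using rGamma_plus1[of "z - 1"] by (metis diff_add_cancel mult.commute norm_mult)
    also have "\<dots> \<le> C * exp (pi * \<bar>Im z\<bar>)" using C[of "z - 1"] z by simp
    finally show "norm (rGamma z) \<le> C * exp (pi * \<bar>Im z\<bar>)" by simp
  qed
qed

lemma rGamma_bound_strip:
  "\<exists>C. \<forall>z. A \<le> Re z \<and> Re z \<le> B \<longrightarrow> norm (rGamma z) \<le> C * exp (pi * \<bar>Im z\<bar>)"
proof -
  obtain k where k: "B \<le> 1 - 1 / 2 + real k"
    using real_arch_simple[of "B"] by (smt (verit) field_sum_of_halves)
  obtain C where C: "\<And>z. A \<le> Re z \<Longrightarrow> Re z \<le> 1 - 1 / 2 + real k \<Longrightarrow> \<bar>Im z\<bar> \<ge> 1 \<Longrightarrow>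
      norm (rGamma z) \<le> C * exp (pi * \<bar>Im z\<bar>)"
    using rGamma_bound_strip_away[of 1 A k] by fastforce
  have "compact (rGamma ` cbox (Complex A (-1)) (Complex B 1))"
    by (intro compact_continuous_image continuous_intros) auto
  then obtain K where K: "\<And>z. z \<in> cbox (Complex A (-1)) (Complex B 1) \<Longrightarrow> norm (rGamma z) \<le> K"
    by (meson bounded_iff compact_imp_bounded imageI)
  show ?thesis
  proof (intro exI[of _ "max C K"] allI impI)
    fix z assume z: "A \<le> Re z \<and> Re z \<le> B"
    show "norm (rGamma z) \<le> max C K * exp (pi * \<bar>Im z\<bar>)"
    proof (cases "\<bar>Im z\<bar> \<ge> 1")
      case True
      then have "norm (rGamma z) \<le> C * exp (pi * \<bar>Im z\<bar>)" using z k by (intro C) auto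
      also have "\<dots> \<le> max C K * exp (pi * \<bar>Im z\<bar>)" by (intro mult_right_mono) auto
      finally show ?thesis .
    next
      case False
      then have "z \<in> cbox (Complex A (-1)) (Complex B 1)"
        using z by (auto simp: in_cbox_complex_iff)
      then have le: "norm (rGamma z) \<le> K" by (rule K)
      then have "0 \<le> K" using norm_ge_zero order_trans by blast
      then have "K * 1 \<le> max C K * exp (pi * \<bar>Im z\<bar>)"
        by (intro mult_mono) auto
      then show ?thesis using le by simp
    qed
  qed
qed

text \<open>Multiplying by \<open>exp ((s - s0)\<^sup>2)\<close> makes the function tend to 0 at both ends of the
  strip, so that the maximum principle applies to a long rectangle.\<close>

lemma strip_maximum_modulus:
  assumes F: "F holomorphic_on UNIV" and ab: "a < b"
    and growth: "(\<lambda>s. norm (F s)) \<in> O[at_infinity](\<lambda>s. exp (norm s powr (3 / 2)))"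
    and M: "M > 0" "\<And>s. Re s = a \<or> Re s = b \<Longrightarrow> norm (F s) \<le> M"
    and s0: "a \<le> Re s0" "Re s0 \<le> b"
  shows "norm (F s0) \<le> M * exp ((b - a)\<^sup>2)"
proof -
  obtain K where K: "K > 0" "eventually (\<lambda>s. norm (F s) \<le> K * exp (norm s powr (3 / 2))) at_infinity"
    using growth by (auto elim!: landau_o.bigE)
  then obtain r where r: "\<And>s. norm s \<ge> r \<Longrightarrow> norm (F s) \<le> K * exp (norm s powr (3 / 2))"
    by (auto simp: eventually_at_infinity)
  define D where "D = \<bar>a\<bar> + \<bar>b\<bar> + \<bar>Im s0\<bar>"
  \<comment> \<open>Any growth exponent below 2 loses against the factor \<open>exp (- R^2)\<close>
    on the horizontal sides.\<close>
  have "((\<lambda>R. K * exp ((D + R) powr (3 / 2) + (b - a)\<^sup>2 - R\<^sup>2)) \<longlongrightarrow> 0) at_top"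
    using K(1) by real_asymp
  then have "eventually (\<lambda>R. K * exp ((D + R) powr (3 / 2) + (b - a)\<^sup>2 - R\<^sup>2) < M) at_top"
    using M(1) by (rule order_tendstoD)
  then have "eventually (\<lambda>R. K * exp ((D + R) powr (3 / 2) + (b - a)\<^sup>2 - R\<^sup>2) < M \<and> R \<ge> r + D \<and> R > 0) at_top"
    using eventually_ge_at_top[of "r + D"] eventually_gt_at_top[of "0::real"] by eventually_elim auto
  then obtain R where R: "K * exp ((D + R) powr (3 / 2) + (b - a)\<^sup>2 - R\<^sup>2) < M" "R \<ge> r + D" "R > 0"
    by (metis (mono_tags, lifting) eventually_at_top_linorder order_refl)
  define h where "h s = F s * exp ((s - s0)\<^sup>2)" for s
  define p where "p = Complex a (Im s0 - R)"
  define q where "q = Complex b (Im s0 + R)"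
  have Re_sq: "Re ((s - s0)\<^sup>2) = (Re s - Re s0)\<^sup>2 - (Im s - Im s0)\<^sup>2" for s
    by (simp add: power2_eq_square)
  have h: "norm (h s) = norm (F s) * exp ((Re s - Re s0)\<^sup>2 - (Im s - Im s0)\<^sup>2)" for s
    by (simp only: h_def norm_mult norm_exp_eq_Re Re_sq)
  have sq: "(Re s - Re s0)\<^sup>2 \<le> (b - a)\<^sup>2" if "a \<le> Re s" "Re s \<le> b" for s
  proof -
    have "\<bar>Re s - Re s0\<bar> \<le> \<bar>b - a\<bar>" using that s0 by auto
    then show ?thesis by (simp add: abs_le_square_iff)
  qed
  have hol: "h holomorphic_on UNIV"
    unfolding h_def by (intro holomorphic_intros F)
  have "norm (h s0) \<le> M * exp ((b - a)\<^sup>2)"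
  proof (rule maximum_modulus_frontier[where f = h and \<xi> = s0 and S = "cbox p q"])
    show "h holomorphic_on interior (cbox p q)" "continuous_on (closure (cbox p q)) h"
      using hol holomorphic_on_imp_continuous_on[OF hol]
      by (auto intro: holomorphic_on_subset continuous_on_subset)
    show "s0 \<in> cbox p q" using s0 R by (auto simp: in_cbox_complex_iff p_def q_def)
    fix s assume "s \<in> frontier (cbox p q)"
    then have s: "a \<le> Re s" "Re s \<le> b" "\<bar>Im s - Im s0\<bar> \<le> R"
      and s': "Re s = a \<or> Re s = b \<or> \<bar>Im s - Im s0\<bar> = R"
      by (auto simp: frontier_cbox in_cbox_complex_iff in_box_complex_iff p_def q_def abs_if split: if_splits)
    show "norm (h s) \<le> M * exp ((b - a)\<^sup>2)"
    proof (cases "Re s = a \<or> Re s = b")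
      case True
      have "exp ((Re s - Re s0)\<^sup>2 - (Im s - Im s0)\<^sup>2) \<le> exp ((b - a)\<^sup>2)"
        unfolding exp_le_cancel_iff using sq[OF s(1,2)] zero_le_power2[of "Im s - Im s0"] by linarith
      then show ?thesis unfolding h using M True by (intro mult_mono) auto
    next
      case False
      then have Im: "\<bar>Im s - Im s0\<bar> = R" using s' by simp
      then have Im2: "(Im s - Im s0)\<^sup>2 = R\<^sup>2" by (metis power2_abs)
      have "\<bar>Re s\<bar> \<le> \<bar>a\<bar> + \<bar>b\<bar>" using s(1,2) by linarith
      moreover have "\<bar>Im s\<bar> \<le> \<bar>Im s0\<bar> + R" using Im by linarith
      ultimately have nD: "norm s \<le> D + R" using cmod_le[of s] unfolding D_def by linarith
      have "\<bar>Im s\<bar> \<ge> R - \<bar>Im s0\<bar>" using Im by linarith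
      then have "norm s \<ge> r"
        using abs_Im_le_cmod[of s] R(2) abs_ge_zero[of a] abs_ge_zero[of b] unfolding D_def by linarith
      then have "norm (F s) \<le> K * exp (norm s powr (3 / 2))" by (rule r)
      also have "\<dots> \<le> K * exp ((D + R) powr (3 / 2))"
        using nD K by (intro mult_left_mono iffD2[OF exp_le_cancel_iff] powr_mono2) auto
      finally have "norm (F s) \<le> K * exp ((D + R) powr (3 / 2))" .
      then have "norm (h s) \<le> K * exp ((D + R) powr (3 / 2)) * exp ((b - a)\<^sup>2 - R\<^sup>2)"
        unfolding h Im2 using sq[OF s(1,2)] K by (intro mult_mono) auto
      also have "\<dots> = K * exp ((D + R) powr (3 / 2) + (b - a)\<^sup>2 - R\<^sup>2)"
        by (simp add: exp_add[symmetric] algebra_simps)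
      also have "\<dots> \<le> M * 1" using R by simp
      also have "\<dots> \<le> M * exp ((b - a)\<^sup>2)" using M by (intro mult_left_mono) auto
      finally show ?thesis .
    qed
  qed auto
  then show ?thesis by (simp add: h_def)
qed

lemma holomorphic_suminf_M_test:
  fixes u :: "nat \<Rightarrow> complex \<Rightarrow> complex"
  assumes "open S" "\<And>n. u n holomorphic_on S"
    and "\<And>n s. s \<in> S \<Longrightarrow> norm (u n s) \<le> M n" "summable M"
  shows "(\<lambda>s. \<Sum>n. u n s) holomorphic_on S"
proof (rule holomorphic_uniform_sequence[OF assms(1)])
  show "(\<lambda>s. \<Sum>i<n. u i s) holomorphic_on S" for n
    by (intro holomorphic_intros assms)
  have ul: "uniform_limit S (\<lambda>n s. \<Sum>i<n. u i s) (\<lambda>s. \<Sum>i. u i s) sequentially"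
    by (rule Weierstrass_m_test[OF assms(3,4)])
  show "\<exists>d>0. cball x d \<subseteq> S \<and> uniform_limit (cball x d) (\<lambda>n s. \<Sum>i<n. u i s) (\<lambda>s. \<Sum>i. u i s) sequentially"
    if "x \<in> S" for x
    using open_contains_cball[of S] assms(1) that ul uniform_limit_on_subset by blast
qed

text \<open>The potential \<open>G\<close> telescopes: it grows by at least \<open>min y (1 / y)\<close> from \<open>y\<close> to \<open>r * y\<close>.\<close>

lemma sum_min_geometric_le:
  fixes x r :: real
  assumes x: "x > 0" and r: "r > 1"
  shows "(\<Sum>i<n. min (x * r ^ i) (1 / (x * r ^ i))) \<le> 2 / (r - 1) + 2"
proof -
  define D where "D = 1 / (r - 1)"
  have D: "D > 0" "D * (r - 1) = 1" using r by (auto simp: D_def)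
  \<comment> \<open>\<open>D\<close> is chosen such that a step from \<open>y\<close> to
    \<open>r * y\<close> on one side of 1 adds exactly \<open>y\<close> or \<open>1 / y\<close> to
    the potential; \<open>E\<close> makes the one step across 1 add at least 1.\<close>
  define E where "E = D * r + D + 1"
  define G where "G y = (if y \<le> 1 then D * y else E - D * r / y)" for y
  have step: "min y (1 / y) \<le> G (r * y) - G y" if y: "y > 0" for y
  proof -
    consider "r * y \<le> 1" | "y > 1" | "y \<le> 1" "r * y > 1" by linarith
    then show ?thesis
    proof cases
      case 1
      have "y < r * y" using r y by simp
      then have "G (r * y) - G y = (D * (r - 1)) * y" using 1 by (simp add: G_def algebra_simps)
      then show ?thesis using D by simp
    next
      case 2
      have "y < r * y" using r y by simp
      then have "\<not> r * y \<le> 1" using 2 by linarith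
      then have "G (r * y) - G y = D * (r - 1) * (1 / y)" using 2 r by (simp add: G_def field_simps)
      then show ?thesis using D by simp
    next
      case 3
      then have "1 / y < r" using y by (simp add: field_simps)
      then have "D * (1 / y) \<le> D * r" "D * y \<le> D * 1" using D 3 mult_left_mono[of "1 / y" r D] mult_left_mono[of y 1 D] by auto
      moreover have "G (r * y) - G y = E - D * (1 / y) - D * y" using 3 r y by (simp add: G_def)
      moreover have "min y (1 / y) \<le> 1" using 3 by auto
      ultimately show ?thesis unfolding E_def by linarith
    qed
  qed
  have "(\<Sum>i<n. min (x * r ^ i) (1 / (x * r ^ i))) \<le> (\<Sum>i<n. G (x * r ^ Suc i) - G (x * r ^ i))"
    by (intro sum_mono) (use step[of "x * r ^ _"] x r in \<open>simp add: mult_ac\<close>)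
  also have "\<dots> = G (x * r ^ n) - G (x * r ^ 0)"
    by (rule sum_lessThan_telescope)
  also have "\<dots> \<le> E"
  proof -
    have "0 \<le> G x"
    proof (cases "x \<le> 1")
      case False
      moreover have "0 \<le> D * r" using D r by simp
      ultimately have "D * r * 1 \<le> D * r * x" by (intro mult_left_mono) auto
      then have "D * r / x \<le> D * r" using x by (simp add: pos_divide_le_eq)
      then show ?thesis using False D by (simp add: G_def E_def)
    qed (use D x in \<open>simp add: G_def\<close>)
    moreover have "G y \<le> E" if "y > 0" for y
    proof (cases "y \<le> 1")
      case True
      then have "D * y \<le> D * 1" using D by (intro mult_left_mono) auto
      moreover have "0 \<le> D * r" using D r by simp
      moreover have "G y = D * y" using True by (simp add: G_def)
      ultimately show ?thesis unfolding E_def by linarith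
    next
      case False
      then show ?thesis using D r that by (simp add: G_def)
    qed
    moreover have "0 < x * r ^ n" using x r by simp
    ultimately have "G (x * r ^ n) \<le> E" "0 \<le> G (x * r ^ 0)" by (blast, simp)
    then show ?thesis by linarith
  qed
  also have "E = 2 / (r - 1) + 2"
  proof -
    have "D * r = D + 1" using D(2) by (simp add: algebra_simps)
    then have "E = 2 * D + 2" by (simp add: E_def)
    then show ?thesis by (simp add: D_def)
  qed
  finally show ?thesis .
qed

section \<open>The completed L-function\<close>

lemma entire_continuation_unique:
  assumes "is_entire_continuation g f1" "is_entire_continuation g f2"
  shows "f1 = f2"
proof
  fix z
  show "f1 z = f2 z"
  proof (rule analytic_continuation_open[where s = "{s. Re s > 1}" and s' = UNIV and f = f1 and g = f2])
    have "(2::complex) \<in> {s. Re s > 1}" by simp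
    then show "{s. Re s > 1} \<noteq> {}" by blast
  qed (use assms in \<open>auto simp: is_entire_continuation_def open_halfspace_Re_gt\<close>)
qed

lemma entire_continuation_eq:
  assumes "is_entire_continuation g f"
  shows "entire_continuation g = f"
  unfolding entire_continuation_def
  using assms entire_continuation_unique by (intro the_equality) auto

lemma is_entire_continuation_entire_continuation:
  "\<exists>f. is_entire_continuation g f \<Longrightarrow> is_entire_continuation g (entire_continuation g)"
  using entire_continuation_eq by fastforce

lemma norm_of_nat_powr: "norm (of_nat n powr s :: complex) = real n powr Re s"
  by (cases "n = 0") (simp_all add: norm_powr_real_powr)

lemma cnj_of_nat_powr: "cnj (of_nat n powr s) = of_nat n powr cnj s"
  by (subst cnj_powr) auto

lemma dirichlet_series_cnj:
  "dirichlet_series (\<lambda>n. cnj (f n)) s = cnj (dirichlet_series f (cnj s))"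
  by (simp add: dirichlet_series_def infsum_cnj[symmetric] cnj_of_nat_powr del: infsum_cnj)

lemma Gamma_R_cnj: "Gamma_R (cnj s) = cnj (Gamma_R s)"
  by (simp add: Gamma_R_def cnj_powr cnj_Gamma)

lemma L_infinity_cnj: "L_infinity d N (\<lambda>j. cnj (\<mu> j)) s = cnj (L_infinity d N \<mu> (cnj s))"
  by (simp add: L_infinity_def cnj_of_nat_powr Gamma_R_cnj[symmetric])

lemma holomorphic_cnj_cnj:
  assumes "f holomorphic_on UNIV"
  shows "(\<lambda>s. cnj (f (cnj s))) holomorphic_on UNIV"
proof -
  have "((cnj \<circ> f \<circ> cnj) has_field_derivative cnj (deriv f (cnj z))) (at z)" for z
    by (intro has_field_derivative_cnj_cnj holomorphic_derivI[OF assms]) auto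
  then show ?thesis by (auto simp: holomorphic_on_def field_differentiable_def o_def intro: has_field_derivative_at_within)
qed

text \<open>Conjugating the continuation at \<open>cnj s\<close> continues the dual series, so
  uniqueness identifies the dual completed function. The functional equation thereby becomes a
  relation between values of one function.\<close>

lemma completed_L_cnj:
  assumes "\<exists>g. is_entire_continuation (completed_series d N \<mu> f) g"
  shows "completed_L d N (\<lambda>j. cnj (\<mu> j)) (\<lambda>n. cnj (f n)) s = cnj (completed_L d N \<mu> f (cnj s))"
proof -
  note * = is_entire_continuation_entire_continuation[OF assms, folded completed_L_def]
  have "is_entire_continuation (completed_series d N (\<lambda>j. cnj (\<mu> j)) (\<lambda>n. cnj (f n)))
      (\<lambda>s. cnj (completed_L d N \<mu> f (cnj s)))"
    unfolding is_entire_continuation_def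
  proof safe
    show "(\<lambda>s. cnj (completed_L d N \<mu> f (cnj s))) holomorphic_on UNIV"
      using * by (intro holomorphic_cnj_cnj) (simp add: is_entire_continuation_def)
    fix s :: complex assume "Re s > 1"
    then have "completed_L d N \<mu> f (cnj s) = completed_series d N \<mu> f (cnj s)"
      using * by (simp add: is_entire_continuation_def)
    then show "cnj (completed_L d N \<mu> f (cnj s)) =
        completed_series d N (\<lambda>j. cnj (\<mu> j)) (\<lambda>n. cnj (f n)) s"
      by (simp add: completed_series_def dirichlet_series_cnj L_infinity_cnj)
  qed
  then show ?thesis
    unfolding completed_L_def by (metis entire_continuation_eq)
qed

text \<open>The order is an infimum that need not be attained, so order 1 gives only the exponents
  above 1; \<open>3 / 2\<close> still lies below 2, the limit for
  \<open>strip_maximum_modulus\<close>.\<close>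

lemma exp_growth_order_1:
  assumes "entire_order f = 1"
  shows "(\<lambda>s. norm (f s)) \<in> O[at_infinity](\<lambda>s. exp (norm s powr (3 / 2)))"
proof -
  have "Inf (ereal ` {\<rho>. \<rho> \<ge> 0 \<and>
       (\<lambda>s. norm (f s)) \<in> O[at_infinity](\<lambda>s. exp (norm s powr \<rho>))}) < ereal (3/2)"
    using assms by (simp add: entire_order_def one_ereal_def)
  then obtain \<rho> where \<rho>: "\<rho> < 3/2" "(\<lambda>s. norm (f s)) \<in> O[at_infinity](\<lambda>s. exp (norm s powr \<rho>))"
    by (auto simp: Inf_less_iff)
  have "(\<lambda>s::complex. exp (norm s powr \<rho>)) \<in> O[at_infinity](\<lambda>s. exp (norm s powr (3 / 2)))"
  proof (rule bigoI[where c = 1])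
    have "norm (exp (norm s powr \<rho>)) \<le> 1 * norm (exp (norm s powr (3 / 2)))" if "norm s \<ge> 1" for s :: complex
      using that \<rho>(1) by (simp add: powr_mono)
    then show "eventually (\<lambda>s::complex. norm (exp (norm s powr \<rho>)) \<le> 1 * norm (exp (norm s powr (3 / 2)))) at_infinity"
      by (auto simp: eventually_at_infinity intro: exI[of _ 1])
  qed
  with \<rho>(2) show ?thesis by (rule landau_o.big_trans)
qed

text \<open>The Gaussian absorbs everything at once:
  \<open>(1 + y^2)^2 \<le> exp (4 * \<bar>y\<bar>)\<close> accounts for the 4 in
  \<open>k + 4\<close>, and completing the square gives the constant.\<close>

lemma exp_linear_minus_square_le: "exp (k * \<bar>y\<bar> - y\<^sup>2) \<le> exp ((k + 4)\<^sup>2 / 4) / (1 + y\<^sup>2)\<^sup>2" for y k :: real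
proof -
  have "1 + \<bar>y\<bar> \<le> exp \<bar>y\<bar>" by (rule exp_ge_add_one_self)
  then have "(1 + \<bar>y\<bar>)\<^sup>2 \<le> (exp \<bar>y\<bar>)\<^sup>2" by (intro power_mono) auto
  moreover have "1 + y\<^sup>2 \<le> (1 + \<bar>y\<bar>)\<^sup>2" by (simp add: power2_eq_square algebra_simps)
  ultimately have "1 + y\<^sup>2 \<le> (exp \<bar>y\<bar>)\<^sup>2" by linarith
  also have "\<dots> = exp (2 * \<bar>y\<bar>)" by (simp only: exp_double)
  finally have "1 + y\<^sup>2 \<le> exp (2 * \<bar>y\<bar>)" .
  then have "(1 + y\<^sup>2)\<^sup>2 \<le> (exp (2 * \<bar>y\<bar>))\<^sup>2" by (intro power_mono) auto
  also have "\<dots> = exp (4 * \<bar>y\<bar>)" by (simp add: power2_eq_square exp_add[symmetric])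
  finally have "exp (k * \<bar>y\<bar> - y\<^sup>2) * (1 + y\<^sup>2)\<^sup>2 \<le> exp (k * \<bar>y\<bar> - y\<^sup>2) * exp (4 * \<bar>y\<bar>)"
    by (intro mult_left_mono) auto
  also have "\<dots> = exp ((k + 4) * \<bar>y\<bar> - y\<^sup>2)" by (simp add: exp_add[symmetric] algebra_simps)
  also have "\<dots> \<le> exp ((k + 4)\<^sup>2 / 4)"
  proof -
    have "0 \<le> (\<bar>y\<bar> - (k + 4) / 2)\<^sup>2" by simp
    also have "\<dots> = y\<^sup>2 - (k + 4) * \<bar>y\<bar> + (k + 4)\<^sup>2 / 4"
      by (simp add: power2_diff power_divide)
    finally show ?thesis by simp
  qed
  finally have "exp (k * \<bar>y\<bar> - y\<^sup>2) * (1 + y\<^sup>2)\<^sup>2 \<le> exp ((k + 4)\<^sup>2 / 4)" .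
  moreover have "(1 + y\<^sup>2)\<^sup>2 > 0" by (intro zero_less_power add_pos_nonneg) auto
  ultimately show ?thesis by (subst pos_le_divide_eq)
qed

lemma norm_exp_square: "norm (exp (w\<^sup>2)) = exp ((Re w)\<^sup>2 - (Im w)\<^sup>2)" for w :: complex
  by (simp add: norm_exp_eq_Re power2_eq_square)

lemma Gamma_bound_interval:
  assumes "0 < a"
  shows "\<exists>K\<ge>0. \<forall>z. a \<le> Re z \<and> Re z \<le> b \<longrightarrow> norm (Gamma z) \<le> K"
proof -
  have "compact (Gamma ` {a..b})"
    using assms by (intro compact_continuous_image continuous_intros) (auto elim!: nonpos_Ints_cases)
  then obtain K where K: "\<And>x. x \<in> {a..b} \<Longrightarrow> norm (Gamma x :: real) \<le> K"
    by (meson bounded_iff compact_imp_bounded imageI)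
  show ?thesis
  proof (intro exI[of _ "\<bar>K\<bar>"] conjI allI impI)
    fix z assume z: "a \<le> Re z \<and> Re z \<le> b"
    have "norm (Gamma z) \<le> Gamma (Re z)" using z assms by (intro norm_Gamma_le_Gamma_Re) auto
    also have "\<dots> \<le> \<bar>K\<bar>" using K[of "Re z"] z by auto
    finally show "norm (Gamma z) \<le> \<bar>K\<bar>" .
  qed simp
qed

context L_function_framework
begin

definition Lam :: "nat \<Rightarrow> (int \<Rightarrow> complex) \<Rightarrow> complex \<Rightarrow> complex" where
  "Lam q chi = completed_L d (N q) (\<mu> (chi (-1))) (twist lamF chi)"

text \<open>The reciprocal of the product of the \<open>Gamma_R\<close> factors, written with
  \<open>rGamma\<close> so that it is entire.\<close>

definition inv_gam :: "complex \<Rightarrow> complex \<Rightarrow> complex" where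
  "inv_gam e s = (\<Prod>j<d. of_real pi powr ((s + \<mu> e j) / 2) * rGamma ((s + \<mu> e j) / 2))"

lemma Lam_continuation:
  assumes "q \<ge> 2" "chi \<in> primitive_characters q"
  shows "is_entire_continuation (completed_series d (N q) (\<mu> (chi (-1))) (twist lamF chi)) (Lam q chi)"
  unfolding Lam_def completed_L_def
  by (rule is_entire_continuation_entire_continuation[OF entire[OF assms]])

lemma holomorphic_Lam:
  assumes "q \<ge> 2" "chi \<in> primitive_characters q"
  shows "Lam q chi holomorphic_on A"
  using Lam_continuation[OF assms] holomorphic_on_subset by (auto simp: is_entire_continuation_def)

lemma Lam_eq:
  assumes "q \<ge> 2" "chi \<in> primitive_characters q" "Re s > 1"
  shows "Lam q chi s = dirichlet_series (twist lamF chi) s * L_infinity d (N q) (\<mu> (chi (-1))) s"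
  using Lam_continuation[OF assms(1,2)] assms(3) by (simp add: is_entire_continuation_def completed_series_def)

lemma Lam_functional_equation:
  assumes "q \<ge> 2" "chi \<in> primitive_characters q"
  obtains \<kappa> where "norm \<kappa> = 1" "\<And>s. Lam q chi s = \<kappa> * cnj (Lam q chi (1 - cnj s))"
proof -
  obtain \<kappa> where \<kappa>: "norm \<kappa> = 1" "\<And>s. Lam q chi s = \<kappa> * completed_L d (N q) (\<lambda>j. cnj (\<mu> (chi (-1)) j))
                   (twist (\<lambda>n. cnj (lamF n)) (\<lambda>n. cnj (chi n))) (1 - s)"
    using functional_equation[OF assms] by (auto simp: Lam_def)
  have "twist (\<lambda>n. cnj (lamF n)) (\<lambda>n. cnj (chi n)) = (\<lambda>n. cnj (twist lamF chi n))"
    by (auto simp: twist_def)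
  then have "Lam q chi s = \<kappa> * cnj (Lam q chi (1 - cnj s))" for s
    using \<kappa>(2)[of s] completed_L_cnj[OF entire[OF assms]] by (simp add: Lam_def)
  with \<kappa>(1) that show ?thesis by blast
qed

lemma norm_Lam_reflect:
  assumes "q \<ge> 2" "chi \<in> primitive_characters q"
  shows "norm (Lam q chi s) = norm (Lam q chi (1 - cnj s))"
proof -
  obtain \<kappa> where "norm \<kappa> = 1" "\<And>s. Lam q chi s = \<kappa> * cnj (Lam q chi (1 - cnj s))"
    by (rule Lam_functional_equation[OF assms]) blast
  then show ?thesis by (metis complex_mod_cnj mult_1 norm_mult)
qed

lemma summable_lamF:
  assumes "\<sigma> > 1"
  shows "summable (\<lambda>n. norm (lamF n) / real n powr \<sigma>)"
proof -
  have "(\<lambda>n. norm (lamF n / of_nat n powr of_real \<sigma>)) summable_on {1..}"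
    using euler_product assms unfolding has_euler_product_def by (metis Re_complex_of_real)
  then have "(\<lambda>n. norm (lamF n) / real n powr \<sigma>) summable_on {1..}"
    by (simp add: norm_divide norm_of_nat_powr)
  then have "(\<lambda>n. norm (lamF n) / real n powr \<sigma>) summable_on UNIV"
    by (rule summable_on_cong_neutral[THEN iffD1, rotated -1]) (auto simp: not_le)
  then show ?thesis by (rule summable_on_imp_summable)
qed

lemma norm_twist_le:
  assumes "q \<ge> 2" "chi \<in> primitive_characters q"
  shows "norm (twist lamF chi n) \<le> norm (lamF n)"
  using norm_character_le[OF primitive_imp_character[OF assms(2)], of "int n"] assms(1)
  by (simp add: twist_def norm_mult mult_left_le)

lemma norm_twist_term_le:
  assumes "q \<ge> 2" "chi \<in> primitive_characters q"
  shows "norm (twist lamF chi n / of_nat n powr s) \<le> norm (lamF n) / real n powr Re s"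
  unfolding norm_divide norm_of_nat_powr by (intro divide_right_mono norm_twist_le[OF assms] powr_ge_zero)

lemma summable_twist:
  assumes "q \<ge> 2" "chi \<in> primitive_characters q" "Re s > 1"
  shows "summable (\<lambda>n. norm (twist lamF chi n / of_nat n powr s))"
proof (rule summable_comparison_test'[OF summable_lamF[OF assms(3)]])
  show "norm (norm (twist lamF chi n / of_nat n powr s)) \<le> norm (lamF n) / real n powr Re s" for n
    unfolding real_norm_def abs_norm_cancel by (rule norm_twist_term_le[OF assms(1,2)])
qed

lemma dirichlet_series_twist_eq:
  assumes "q \<ge> 2" "chi \<in> primitive_characters q" "Re s > 1"
  shows "dirichlet_series (twist lamF chi) s = (\<Sum>n. twist lamF chi n / of_nat n powr s)"
proof -
  let ?f = "\<lambda>n. twist lamF chi n / of_nat n powr s"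
  have "?f sums (\<Sum>n. ?f n)"
    by (rule summable_sums[OF summable_norm_cancel[OF summable_twist[OF assms]]])
  then have "(?f has_sum (\<Sum>n. ?f n)) UNIV"
    by (rule norm_summable_imp_has_sum[OF summable_twist[OF assms]])
  then have "(?f has_sum (\<Sum>n. ?f n)) {1..}"
    by (rule has_sum_cong_neutral[THEN iffD1, rotated -1]) (auto simp: not_le)
  then show ?thesis by (simp add: dirichlet_series_def infsumI)
qed

lemma norm_dirichlet_series_twist_le:
  assumes "q \<ge> 2" "chi \<in> primitive_characters q" "Re s > 1"
  shows "norm (dirichlet_series (twist lamF chi) s) \<le> (\<Sum>n. norm (lamF n) / real n powr Re s)"
  unfolding dirichlet_series_twist_eq[OF assms]
proof (rule norm_suminf_le)
  show "norm (twist lamF chi n / of_nat n powr s) \<le> norm (lamF n) / real n powr Re s" for n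
    by (rule norm_twist_term_le[OF assms(1,2)])
qed (rule summable_lamF[OF assms(3)])

lemma norm_Gamma_R_le:
  assumes "Re s > 0"
  shows "norm (Gamma_R s) \<le> pi powr (- Re s / 2) * Gamma (Re s / 2)"
proof -
  have "norm (of_real pi powr (- s / 2)) = pi powr (- Re s / 2)"
    by (subst norm_powr_real_powr) auto
  moreover have "norm (Gamma (s / 2)) \<le> Gamma (Re (s / 2))"
    using assms by (intro norm_Gamma_le_Gamma_Re) simp
  ultimately show ?thesis
    unfolding Gamma_R_def norm_mult by (simp add: mult_left_mono)
qed

lemma theta_pos: "\<theta> > 0"
proof -
  have "0 \<le> 1 / (2 * real d)" by simp
  then show ?thesis using theta_gt by linarith
qed

lemma N_pos: "q \<ge> 2 \<Longrightarrow> chi \<in> primitive_characters q \<Longrightarrow> real (N q) \<ge> 1"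
  using conductor_pos[of q chi] by simp

text \<open>On this line the Dirichlet series converges absolutely and all Gamma arguments have
  positive real part; \<open>N^2\<close> is the modulus of \<open>N powr (s / 2)\<close>. Fixing the
  parity \<open>e\<close> fixes the parameters \<open>\<mu> e\<close>, so that one constant serves
  all \<open>q\<close> and \<open>chi\<close>.\<close>

lemma norm_Lam_right_line:
  "\<exists>C>0. \<forall>q chi s. q \<ge> 2 \<longrightarrow> chi \<in> primitive_characters q \<longrightarrow> chi (-1) = e \<longrightarrow> Re s = 4 \<longrightarrow>
     norm (Lam q chi s) \<le> C * real (N q) ^ 2"
proof -
  define D where "D = (\<Sum>n. norm (lamF n) / real n powr 4)"
  define G where "G = (\<Prod>j<d. pi powr (- Re (4 + \<mu> e j) / 2) * Gamma (Re (4 + \<mu> e j) / 2))"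
  have D0: "D \<ge> 0" unfolding D_def by (intro suminf_nonneg summable_lamF) auto
  show ?thesis
  proof (intro exI[of _ "D * \<bar>G\<bar> + 1"] conjI allI impI)
    show "D * \<bar>G\<bar> + 1 > 0" using D0 by (simp add: add_nonneg_pos)
    fix q chi s assume *: "q \<ge> 2" "chi \<in> primitive_characters q" "chi (-1) = e" "Re s = (4::real)"
    have mu: "Re (s + \<mu> e j) > 0" if "j < d" for j
      using Re_mu[OF *(1,2) that] theta_pos * by simp
    have "norm (L_infinity d (N q) (\<mu> e) s) = real (N q) powr 2 * (\<Prod>j<d. norm (Gamma_R (s + \<mu> e j)))"
      unfolding L_infinity_def norm_mult prod_norm using * by (simp add: norm_of_nat_powr)
    also have "\<dots> \<le> real (N q) powr 2 * G"
      unfolding G_def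
    proof (intro mult_left_mono prod_mono conjI)
      fix j assume "j \<in> {..<d}"
      then show "norm (Gamma_R (s + \<mu> e j)) \<le> pi powr (- Re (4 + \<mu> e j) / 2) * Gamma (Re (4 + \<mu> e j) / 2)"
        using norm_Gamma_R_le[OF mu, of j] * by simp
    qed auto
    also have "\<dots> \<le> real (N q) powr 2 * \<bar>G\<bar>" by (intro mult_left_mono) auto
    also have "real (N q) powr 2 = real (N q) ^ 2"
      using N_pos[OF *(1,2)] by (intro powr_numeral) simp
    finally have L: "norm (L_infinity d (N q) (\<mu> e) s) \<le> real (N q) ^ 2 * \<bar>G\<bar>" .
    have "norm (Lam q chi s) \<le> D * (real (N q) ^ 2 * \<bar>G\<bar>)"
      using norm_dirichlet_series_twist_le[OF *(1,2), of s] * L D0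
      by (auto simp: Lam_eq norm_mult D_def intro!: mult_mono)
    also have "\<dots> \<le> (D * \<bar>G\<bar> + 1) * real (N q) ^ 2"
      by (simp add: algebra_simps)
    finally show "norm (Lam q chi s) \<le> (D * \<bar>G\<bar> + 1) * real (N q) ^ 2" .
  qed
qed

text \<open>The functional equation carries the bound from \<open>Re s = 4\<close> to
  \<open>Re s = -3\<close>, and the maximum principle fills the strip of width 7, whence
  \<open>exp 49\<close>.\<close>

lemma norm_Lam_strip:
  "\<exists>C>0. \<forall>q chi s. q \<ge> 2 \<longrightarrow> chi \<in> primitive_characters q \<longrightarrow> chi (-1) = e \<longrightarrow> -3 \<le> Re s \<longrightarrow> Re s \<le> 4 \<longrightarrow>
     norm (Lam q chi s) \<le> C * real (N q) ^ 2"
proof -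
  obtain C where C: "C > 0" "\<And>q chi s. q \<ge> 2 \<Longrightarrow> chi \<in> primitive_characters q \<Longrightarrow> chi (-1) = e \<Longrightarrow> Re s = 4 \<Longrightarrow>
     norm (Lam q chi s) \<le> C * real (N q) ^ 2"
    using norm_Lam_right_line[of e] by blast
  show ?thesis
  proof (intro exI[of _ "C * exp 49"] conjI allI impI)
    fix q chi s assume *: "q \<ge> 2" "chi \<in> primitive_characters q" "chi (-1) = e" "-3 \<le> Re s" "Re s \<le> 4"
    have "norm (Lam q chi s) \<le> (C * real (N q) ^ 2) * exp ((4 - (-3))\<^sup>2)"
    proof (rule strip_maximum_modulus[where F = "Lam q chi" and a = "-3" and b = 4])
      show "(\<lambda>s. norm (Lam q chi s)) \<in> O[at_infinity](\<lambda>s. exp (norm s powr (3 / 2)))"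
        using order_1[OF *(1,2)] unfolding Lam_def by (rule exp_growth_order_1)
      show "C * real (N q) ^ 2 > 0" using C N_pos[OF *(1,2)] by simp
      show "norm (Lam q chi s) \<le> C * real (N q) ^ 2" if "Re s = -3 \<or> Re s = 4" for s
        using that
      proof
        assume "Re s = -3"
        then have "norm (Lam q chi (1 - cnj s)) \<le> C * real (N q) ^ 2"
          by (intro C(2) *) simp
        then show ?thesis using norm_Lam_reflect[OF *(1,2), of s] by simp
      qed (intro C(2) *)
    qed (use * holomorphic_Lam in auto)
    then show "norm (Lam q chi s) \<le> C * exp 49 * real (N q) ^ 2" by (simp add: mult_ac)
  qed (use C in simp)
qed

text \<open>For \<open>Re s > 1\<close> no Gamma argument is a pole, so \<open>L_infinity\<close> is
  cancelled by the other two factors, both entire; the product is therefore an entire continuation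
  of the Dirichlet series.\<close>

lemma L_twist_eq:
  assumes "q \<ge> 2" "chi \<in> primitive_characters q"
  shows "is_entire_continuation (dirichlet_series (twist lamF chi)) (L_twist lamF chi)"
    and "L_twist lamF chi s = Lam q chi s * of_nat (N q) powr (- s / 2) * inv_gam (chi (-1)) s"
proof -
  define F where "F s = Lam q chi s * of_nat (N q) powr (- s / 2) * inv_gam (chi (-1)) s" for s
  have N0: "of_nat (N q) \<noteq> (0::complex)" using conductor_pos[OF assms] by simp
  have "is_entire_continuation (dirichlet_series (twist lamF chi)) F"
    unfolding is_entire_continuation_def
  proof safe
    show "F holomorphic_on UNIV"
      unfolding F_def inv_gam_def using N0
      by (intro holomorphic_intros holomorphic_Lam[OF assms] holomorphic_on_compose_gen[OF _ holomorphic_rGamma, unfolded o_def]) auto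
    fix s :: complex assume s: "Re s > 1"
    have nz: "Gamma_R (s + \<mu> (chi (-1)) j) * (of_real pi powr ((s + \<mu> (chi (-1)) j) / 2) * rGamma ((s + \<mu> (chi (-1)) j) / 2)) = 1"
      if "j < d" for j
    proof -
      define z where "z = (s + \<mu> (chi (-1)) j) / 2"
      have "Re z > 0"
        using Re_mu[OF assms that] s theta_pos by (simp add: z_def)
      then have "z \<notin> \<int>\<^sub>\<le>\<^sub>0"
        by (auto elim!: nonpos_Ints_cases)
      then have "Gamma z * rGamma z = 1"
        by (simp add: rGamma_inverse_Gamma Gamma_eq_zero_iff)
      moreover have "of_real pi powr (- z) * of_real pi powr z = (1::complex)"
        by (simp add: powr_minus)
      moreover have "Gamma_R (s + \<mu> (chi (-1)) j) * (of_real pi powr z * rGamma z)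
          = (of_real pi powr (- z) * of_real pi powr z) * (Gamma z * rGamma z)"
        by (simp add: Gamma_R_def z_def mult_ac minus_divide_left)
      ultimately show ?thesis by (simp add: z_def)
    qed
    have "L_infinity d (N q) (\<mu> (chi (-1))) s * (of_nat (N q) powr (- s / 2) * inv_gam (chi (-1)) s)
        = (of_nat (N q) powr (s / 2) * of_nat (N q) powr (- s / 2)) *
          (\<Prod>j<d. Gamma_R (s + \<mu> (chi (-1)) j) * (of_real pi powr ((s + \<mu> (chi (-1)) j) / 2) * rGamma ((s + \<mu> (chi (-1)) j) / 2)))"
      by (simp add: L_infinity_def inv_gam_def prod.distrib mult_ac)
    also have "\<dots> = 1"
      using nz N0 by (simp add: powr_add[symmetric])
    finally have "L_infinity d (N q) (\<mu> (chi (-1))) s * (of_nat (N q) powr (- s / 2) * inv_gam (chi (-1)) s) = 1" .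
    then show "F s = dirichlet_series (twist lamF chi) s"
      by (simp add: F_def Lam_eq[OF assms s] mult.assoc)
  qed
  then have "L_twist lamF chi = F" "is_entire_continuation (dirichlet_series (twist lamF chi)) F"
    by (simp_all add: L_twist_def entire_continuation_eq)
  then show "is_entire_continuation (dirichlet_series (twist lamF chi)) (L_twist lamF chi)"
    "L_twist lamF chi s = Lam q chi s * of_nat (N q) powr (- s / 2) * inv_gam (chi (-1)) s"
    by (simp_all add: F_def)
qed

lemma norm_inv_gam_le:
  "\<exists>C. C \<ge> 0 \<and> (\<forall>s. A \<le> Re s \<and> Re s \<le> B \<longrightarrow> norm (inv_gam e s) \<le> C * exp (real d * (pi / 2) * \<bar>Im s\<bar>))"
proof -
  have "\<exists>C\<ge>0. \<forall>s. A \<le> Re s \<and> Re s \<le> B \<longrightarrow>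
      norm (of_real pi powr ((s + m) / 2) * rGamma ((s + m) / 2)) \<le> C * exp (pi / 2 * \<bar>Im s\<bar>)" for m :: complex
  proof -
    obtain C where C: "\<And>z. (A + Re m) / 2 \<le> Re z \<Longrightarrow> Re z \<le> (B + Re m) / 2 \<Longrightarrow> norm (rGamma z) \<le> C * exp (pi * \<bar>Im z\<bar>)"
      using rGamma_bound_strip[of "(A + Re m) / 2" "(B + Re m) / 2"] by blast
    show ?thesis
    proof (intro exI[of _ "pi powr ((B + Re m) / 2) * (\<bar>C\<bar> * exp (pi / 2 * \<bar>Im m\<bar>))"] conjI allI impI)
      fix s assume s: "A \<le> Re s \<and> Re s \<le> B"
      have 1: "norm (of_real pi powr ((s + m) / 2)) \<le> pi powr ((B + Re m) / 2)"
        using s pi_gt3 by (subst norm_powr_real_powr) (auto intro!: powr_mono)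
      have "norm (rGamma ((s + m) / 2)) \<le> C * exp (pi * \<bar>Im ((s + m) / 2)\<bar>)"
        using s by (intro C) auto
      also have "\<dots> \<le> \<bar>C\<bar> * exp (pi / 2 * \<bar>Im m\<bar> + pi / 2 * \<bar>Im s\<bar>)"
      proof (intro mult_mono)
        have "\<bar>Im s + Im m\<bar> * (pi / 2) \<le> (\<bar>Im s\<bar> + \<bar>Im m\<bar>) * (pi / 2)"
          by (intro mult_right_mono) auto
        then show "exp (pi * \<bar>Im ((s + m) / 2)\<bar>) \<le> exp (pi / 2 * \<bar>Im m\<bar> + pi / 2 * \<bar>Im s\<bar>)"
          by (simp add: algebra_simps)
      qed auto
      finally have 2: "norm (rGamma ((s + m) / 2)) \<le> \<bar>C\<bar> * exp (pi / 2 * \<bar>Im m\<bar>) * exp (pi / 2 * \<bar>Im s\<bar>)"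
        by (simp add: exp_add mult_ac)
      show "norm (of_real pi powr ((s + m) / 2) * rGamma ((s + m) / 2))
          \<le> pi powr ((B + Re m) / 2) * (\<bar>C\<bar> * exp (pi / 2 * \<bar>Im m\<bar>)) * exp (pi / 2 * \<bar>Im s\<bar>)"
        using mult_mono[OF 1 2] by (simp add: norm_mult mult_ac)
    qed auto
  qed
  then obtain C where C: "\<And>m::complex. C m \<ge> 0" "\<And>m s. A \<le> Re s \<Longrightarrow> Re s \<le> B \<Longrightarrow>
      norm (of_real pi powr ((s + m) / 2) * rGamma ((s + m) / 2)) \<le> C m * exp (pi / 2 * \<bar>Im s\<bar>)"
    by metis
  show ?thesis
  proof (intro exI[of _ "\<Prod>j<d. C (\<mu> e j)"] conjI allI impI prod_nonneg C(1))
    fix s assume s: "A \<le> Re s \<and> Re s \<le> B"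
    have "norm (inv_gam e s) \<le> (\<Prod>j<d. C (\<mu> e j) * exp (pi / 2 * \<bar>Im s\<bar>))"
      unfolding inv_gam_def prod_norm[symmetric] using s by (intro prod_mono conjI C(2)) auto
    also have "\<dots> = (\<Prod>j<d. C (\<mu> e j)) * exp (pi / 2 * \<bar>Im s\<bar>) ^ d"
      by (simp add: prod.distrib)
    also have "exp (pi / 2 * \<bar>Im s\<bar>) ^ d = exp (real d * (pi / 2) * \<bar>Im s\<bar>)"
      by (simp only: mult.assoc exp_of_nat_mult)
    finally show "norm (inv_gam e s) \<le> (\<Prod>j<d. C (\<mu> e j)) * exp (real d * (pi / 2) * \<bar>Im s\<bar>)" .
  qed
qed

text \<open>The power \<open>N powr (- s / 2)\<close> has modulus at most 1 here. Powers of
  \<open>N\<close> and exponentials of \<open>Im s\<close> are harmless, because only the logarithm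
  of the bound is used.\<close>

lemma norm_L_twist_le:
  "\<exists>C>0. \<forall>q chi s. q \<ge> 2 \<longrightarrow> chi \<in> primitive_characters q \<longrightarrow> chi (-1) = e \<longrightarrow> 0 \<le> Re s \<longrightarrow> Re s \<le> 4 \<longrightarrow>
     norm (L_twist lamF chi s) \<le> C * real (N q) ^ 2 * exp (C * \<bar>Im s\<bar>)"
proof -
  obtain C1 where C1: "C1 > 0" "\<And>q chi s. q \<ge> 2 \<Longrightarrow> chi \<in> primitive_characters q \<Longrightarrow> chi (-1) = e \<Longrightarrow> -3 \<le> Re s \<Longrightarrow> Re s \<le> 4 \<Longrightarrow>
     norm (Lam q chi s) \<le> C1 * real (N q) ^ 2"
    using norm_Lam_strip[of e] by blast
  obtain C2 where C2: "C2 \<ge> 0" "\<And>s. 0 \<le> Re s \<Longrightarrow> Re s \<le> 4 \<Longrightarrow>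
     norm (inv_gam e s) \<le> C2 * exp (real d * (pi / 2) * \<bar>Im s\<bar>)"
    using norm_inv_gam_le[of 0 4 e] by blast
  define C where "C = max (C1 * C2 + 1) (real d * (pi / 2))"
  show ?thesis
  proof (intro exI[of _ C] conjI allI impI)
    have "C1 * C2 + 1 > 0" using C1 C2 by (simp add: add_nonneg_pos)
    then show "C > 0" unfolding C_def by simp
    fix q chi s assume *: "q \<ge> 2" "chi \<in> primitive_characters q" "chi (-1) = e" "0 \<le> Re s" "Re s \<le> (4::real)"
    have N1: "norm (of_nat (N q) powr (- s / 2)) \<le> 1"
      using N_pos[OF *(1,2)] * powr_mono[of "- Re s / 2" 0 "real (N q)"] by (simp add: norm_of_nat_powr)
    have "norm (L_twist lamF chi s) = norm (Lam q chi s) * norm (of_nat (N q) powr (- s / 2)) * norm (inv_gam e s)"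
      unfolding L_twist_eq(2)[OF *(1,2)] norm_mult *(3) ..
    also have "\<dots> \<le> C1 * real (N q) ^ 2 * 1 * (C2 * exp (real d * (pi / 2) * \<bar>Im s\<bar>))"
      using * C1 C2 by (intro mult_mono N1 C1(2) C2(2)) auto
    also have "\<dots> = (C1 * C2) * (real (N q) ^ 2 * exp (real d * (pi / 2) * \<bar>Im s\<bar>))" by simp
    also have "\<dots> \<le> C * (real (N q) ^ 2 * exp (C * \<bar>Im s\<bar>))"
    proof (rule mult_mono)
      show "C1 * C2 \<le> C" by (simp add: C_def)
      have "real d * (pi / 2) * \<bar>Im s\<bar> \<le> C * \<bar>Im s\<bar>"
        by (rule mult_right_mono) (simp_all add: C_def)
      then show "real (N q) ^ 2 * exp (real d * (pi / 2) * \<bar>Im s\<bar>) \<le> real (N q) ^ 2 * exp (C * \<bar>Im s\<bar>)"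
        by (intro mult_left_mono iffD2[OF exp_le_cancel_iff]) auto
      show "0 \<le> C" using \<open>C1 * C2 + 1 > 0\<close> by (simp add: C_def)
    qed auto
    finally show "norm (L_twist lamF chi s) \<le> C * real (N q) ^ 2 * exp (C * \<bar>Im s\<bar>)" by (simp add: mult_ac)
  qed
qed

end

section \<open>Local roots and mean squares of the coefficients\<close>

lemma summable_polynomial_geometric:
  fixes x b :: real
  assumes x: "x > 1" and b: "b > 0"
  shows "summable (\<lambda>r. (real r + b) ^ m / x ^ r)"
proof -
  have "(\<lambda>r. ((real (Suc r) + b) / (real r + b)) ^ m) \<longlonglongrightarrow> 1 ^ m"
    by (intro tendsto_power) real_asymp
  moreover have "(1 + x) / 2 > 1 ^ m" using x by simp
  ultimately have "eventually (\<lambda>r. ((real (Suc r) + b) / (real r + b)) ^ m < (1 + x) / 2) sequentially"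
    by (rule order_tendstoD)
  then obtain R where R: "\<And>r. r \<ge> R \<Longrightarrow> ((real (Suc r) + b) / (real r + b)) ^ m < (1 + x) / 2"
    by (auto simp: eventually_sequentially)
  show ?thesis
  proof (rule summable_ratio_test[where N = R and c = "(1 + x) / 2 / x"])
    show "(1 + x) / 2 / x < 1" using x by (simp add: field_simps)
    fix r assume "R \<le> r"
    from R[OF this] have "(real (Suc r) + b) ^ m / (real r + b) ^ m \<le> (1 + x) / 2"
      by (simp add: power_divide)
    moreover have "(real r + b) ^ m > 0" using b by (intro zero_less_power) (simp add: add_nonneg_pos)
    ultimately have "(real (Suc r) + b) ^ m \<le> (1 + x) / 2 * (real r + b) ^ m"
      by (simp only: pos_divide_le_eq)
    then have "(real (Suc r) + b) ^ m / x ^ Suc r \<le> (1 + x) / 2 * (real r + b) ^ m / x ^ Suc r"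
      using x by (intro divide_right_mono) auto
    also have "\<dots> = (1 + x) / 2 / x * ((real r + b) ^ m / x ^ r)" by simp
    finally show "norm ((real (Suc r) + b) ^ m / x ^ Suc r) \<le> (1 + x) / 2 / x * norm ((real r + b) ^ m / x ^ r)"
      using x b by simp
  qed
qed

section \<open>Complete symmetric polynomials and the size of the local roots\<close>

definition compositions :: "'a set \<Rightarrow> nat \<Rightarrow> ('a \<Rightarrow> nat) set" where
  "compositions J r = {e \<in> J \<rightarrow>\<^sub>E UNIV. (\<Sum>j\<in>J. e j) = r}"

text \<open>The complete homogeneous symmetric polynomial of degree \<open>r\<close>; at the local
  roots of a prime \<open>p\<close> it gives \<open>lamF (p ^ r)\<close>.\<close>

definition complete_symmetric :: "('a \<Rightarrow> complex) \<Rightarrow> 'a set \<Rightarrow> nat \<Rightarrow> complex" where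
  "complete_symmetric a J r = (\<Sum>e\<in>compositions J r. \<Prod>j\<in>J. a j ^ e j)"

lemma finite_compositions: "finite J \<Longrightarrow> finite (compositions J r)"
proof (rule finite_subset)
  assume J: "finite J"
  show "compositions J r \<subseteq> J \<rightarrow>\<^sub>E {..r}"
  proof (rule subsetI)
    fix e assume e: "e \<in> compositions J r"
    have "e j \<le> r" if "j \<in> J" for j
      using member_le_sum[of j J e] J e that by (auto simp: compositions_def)
    then show "e \<in> J \<rightarrow>\<^sub>E {..r}" using e by (auto simp: compositions_def PiE_iff)
  qed
qed (auto intro: finite_PiE)

text \<open>Here \<open>k\<close> is the exponent of the new variable; on generating functions this
  is multiplication by \<open>1 / (1 - a i * X)\<close>.\<close>

lemma complete_symmetric_insert:
  assumes J: "finite J" and i: "i \<notin> J"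
  shows "complete_symmetric a (insert i J) r = (\<Sum>k\<le>r. a i ^ k * complete_symmetric a J (r - k))"
proof -
  have "(\<Sum>k\<le>r. a i ^ k * complete_symmetric a J (r - k))
      = (\<Sum>k\<le>r. \<Sum>e\<in>compositions J (r - k). a i ^ k * (\<Prod>j\<in>J. a j ^ e j))"
    by (simp add: complete_symmetric_def sum_distrib_left)
  also have "\<dots> = (\<Sum>(k, e)\<in>(SIGMA k:{..r}. compositions J (r - k)). a i ^ k * (\<Prod>j\<in>J. a j ^ e j))"
    using J finite_compositions by (subst sum.Sigma) auto
  also have "\<dots> = complete_symmetric a (insert i J) r"
    unfolding complete_symmetric_def
  proof (rule sum.reindex_bij_witness[where i = "\<lambda>e. (e i, e(i := undefined))" and j = "\<lambda>(k, e). e(i := k)"])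
    fix x assume "x \<in> (SIGMA k:{..r}. compositions J (r - k))"
    then obtain k e where x: "x = (k, e)" "k \<le> r" "e \<in> J \<rightarrow>\<^sub>E UNIV" "(\<Sum>j\<in>J. e j) = r - k"
      by (auto simp: compositions_def)
    have "e i = undefined" using x i by (auto simp: PiE_iff extensional_def)
    then show "(((case x of (k, e) \<Rightarrow> e(i := k)) i), (case x of (k, e) \<Rightarrow> e(i := k))(i := undefined)) = x"
      using x by auto
    have J': "(\<Sum>j\<in>J. (e(i := k)) j) = (\<Sum>j\<in>J. e j)" using i by (intro sum.cong) auto
    show "(case x of (k, e) \<Rightarrow> e(i := k)) \<in> compositions (insert i J) r"
      using x J i J' by (auto simp: compositions_def PiE_iff extensional_def)
    have "(\<Prod>j\<in>J. a j ^ (e(i := k)) j) = (\<Prod>j\<in>J. a j ^ e j)" using i by (intro prod.cong) auto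
    then show "(\<Prod>j\<in>insert i J. a j ^ (case x of (k, e) \<Rightarrow> e(i := k)) j) = (case x of (k, e) \<Rightarrow> a i ^ k * (\<Prod>j\<in>J. a j ^ e j))"
      using x J i by simp
  next
    fix e assume e: "e \<in> compositions (insert i J) r"
    then show "(case (e i, e(i := undefined)) of (k, e) \<Rightarrow> e(i := k)) = e" by simp
    have J': "(\<Sum>j\<in>J. (e(i := undefined)) j) = (\<Sum>j\<in>J. e j)" using i by (intro sum.cong) auto
    show "(e i, e(i := undefined)) \<in> (SIGMA k:{..r}. compositions J (r - k))"
      using e J i J' by (auto simp: compositions_def PiE_iff extensional_def)
  qed
  finally show ?thesis by simp
qed

lemma complete_symmetric_insert_Suc:
  assumes "finite J" "i \<notin> J"
  shows "complete_symmetric a (insert i J) (Suc r) =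
     complete_symmetric a J (Suc r) + a i * complete_symmetric a (insert i J) r"
  unfolding complete_symmetric_insert[OF assms]
  by (subst sum.atMost_Suc_shift) (simp add: sum_distrib_left mult.assoc)

lemma complete_symmetric_empty: "complete_symmetric a {} r = (if r = 0 then 1 else 0)"
  by (auto simp: complete_symmetric_def compositions_def)

lemma complete_symmetric_0: "finite J \<Longrightarrow> complete_symmetric a J 0 = 1"
proof (induction J rule: finite_induct)
  case (insert i J)
  then show ?case by (simp add: complete_symmetric_insert)
qed (simp add: complete_symmetric_empty)

lemma complete_symmetric_1: "finite J \<Longrightarrow> complete_symmetric a J 1 = (\<Sum>j\<in>J. a j)"
proof (induction J rule: finite_induct)
  case (insert i J)
  then show ?case
    using complete_symmetric_insert_Suc[OF insert(1,2), of a 0] by (simp add: complete_symmetric_0)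
qed (simp add: complete_symmetric_empty)

text \<open>Dropping a variable \<open>a i\<close> multiplies the generating function by
  \<open>1 - a i * X\<close>, that is, it subtracts \<open>a i\<close> times the preceding
  coefficient; this preserves polynomial growth in \<open>r\<close>.\<close>

lemma complete_symmetric_polynomial_bound_diff:
  assumes "finite I" "finite J" "I \<inter> J = {}"
    and "\<exists>C\<ge>0. \<forall>r. norm (complete_symmetric a (I \<union> J) r) \<le> C * (real r + 1) ^ m"
  shows "\<exists>C\<ge>0. \<forall>r. norm (complete_symmetric a J r) \<le> C * (real r + 1) ^ m"
  using assms
proof (induction I rule: finite_induct)
  case (insert i I)
  then obtain C where C: "C \<ge> 0" "\<And>r. norm (complete_symmetric a (insert i (I \<union> J)) r) \<le> C * (real r + 1) ^ m"
    by auto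
  have i: "finite (I \<union> J)" "i \<notin> I \<union> J" using insert by auto
  have "norm (complete_symmetric a (I \<union> J) r) \<le> (C + norm (a i) * C + 1) * (real r + 1) ^ m" for r
  proof (cases r)
    case 0
    then show ?thesis using C(1) i by (simp add: complete_symmetric_0)
  next
    case (Suc s)
    have "norm (complete_symmetric a (I \<union> J) r) =
        norm (complete_symmetric a (insert i (I \<union> J)) r - a i * complete_symmetric a (insert i (I \<union> J)) s)"
      using complete_symmetric_insert_Suc[OF i, of a s] Suc by simp
    also have "\<dots> \<le> norm (complete_symmetric a (insert i (I \<union> J)) r) + norm (a i) * norm (complete_symmetric a (insert i (I \<union> J)) s)"
      by (metis norm_mult norm_triangle_ineq4)
    also have "\<dots> \<le> C * (real r + 1) ^ m + norm (a i) * (C * (real r + 1) ^ m)"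
    proof (intro add_mono mult_left_mono C)
      have "C * (real s + 1) ^ m \<le> C * (real r + 1) ^ m"
        using C(1) Suc by (intro mult_left_mono power_mono) auto
      then show "norm (complete_symmetric a (insert i (I \<union> J)) s) \<le> C * (real r + 1) ^ m"
        using C(2)[of s] by linarith
    qed auto
    also have "\<dots> \<le> (C + norm (a i) * C + 1) * (real r + 1) ^ m"
      by (simp add: algebra_simps)
    finally show ?thesis .
  qed
  then have "\<exists>C\<ge>0. \<forall>r. norm (complete_symmetric a (I \<union> J) r) \<le> C * (real r + 1) ^ m"
    using C(1) by (intro exI[of _ "C + norm (a i) * C + 1"]) auto
  then show ?case using insert by auto
qed simp

text \<open>All variables except \<open>a j\<close> are removed, and the remaining powers of
  \<open>a j\<close> can grow polynomially only if \<open>norm (a j) \<le> 1\<close>. In this way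
  the bound on the coefficients at prime powers passes to the local roots.\<close>

lemma norm_le_1_if_complete_symmetric_bounded:
  assumes J: "finite J" "j \<in> J"
    and b: "\<And>r. norm (complete_symmetric a J r) \<le> C * (real r + 1) ^ m"
  shows "norm (a j) \<le> 1"
proof (rule ccontr)
  assume "\<not> norm (a j) \<le> 1"
  then have gt: "norm (a j) > 1" by simp
  have C0: "C \<ge> 0" using order_trans[OF norm_ge_zero b[of 0]] by simp
  have "\<exists>C\<ge>0. \<forall>r. norm (complete_symmetric a {j} r) \<le> C * (real r + 1) ^ m"
  proof (rule complete_symmetric_polynomial_bound_diff[where I = "J - {j}"])
    have "J - {j} \<union> {j} = J" using J by auto
    then show "\<exists>C\<ge>0. \<forall>r. norm (complete_symmetric a (J - {j} \<union> {j}) r) \<le> C * (real r + 1) ^ m"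
      using b C0 by auto
  qed (use J in auto)
  then obtain D where D: "\<And>r. norm (complete_symmetric a {j} r) \<le> D * (real r + 1) ^ m" by blast
  have "complete_symmetric a {j} r = a j ^ r" for r
    by (induction r) (simp_all add: complete_symmetric_0 complete_symmetric_insert_Suc complete_symmetric_empty)
  then have D': "norm (a j) ^ r \<le> D * (real r + 1) ^ m" for r using D[of r] by (simp add: norm_power)
  have "(\<lambda>r. (real r + 1) ^ m / norm (a j) ^ r) \<longlonglongrightarrow> 0"
    by (rule summable_LIMSEQ_zero, rule summable_polynomial_geometric) (use gt in auto)
  then have "(\<lambda>r. D * ((real r + 1) ^ m / norm (a j) ^ r)) \<longlonglongrightarrow> D * 0"
    by (rule tendsto_mult_left)
  then have "eventually (\<lambda>r. D * ((real r + 1) ^ m / norm (a j) ^ r) < 1) sequentially"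
    by (rule order_tendstoD) simp
  then obtain r where "D * ((real r + 1) ^ m / norm (a j) ^ r) < 1"
    by (auto simp: eventually_sequentially)
  then have "D * (real r + 1) ^ m / norm (a j) ^ r < 1" by simp
  moreover have "norm (a j) ^ r > 0" by (rule zero_less_power) (use gt in linarith)
  ultimately have "D * (real r + 1) ^ m < norm (a j) ^ r" by (simp only: pos_divide_less_eq)
  with D'[of r] show False by simp
qed

text \<open>Every divisor of \<open>p ^ k\<close> is one of \<open>k + 1\<close> powers of
  \<open>p\<close>; the crude count is polynomial in \<open>k\<close> and uniform in
  \<open>p\<close>, as the bound on the local roots requires.\<close>

lemma tau_prime_power_le:
  assumes "prime p"
  shows "tau d (p ^ k) \<le> (k + 1) ^ d"
proof -
  have "{f \<in> {..<d} \<rightarrow>\<^sub>E UNIV. (\<Prod>j<d. f j) = p ^ k} \<subseteq> {..<d} \<rightarrow>\<^sub>E ((\<lambda>i. p ^ i) ` {..k})"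
  proof (rule subsetI)
    fix f assume "f \<in> {f \<in> {..<d} \<rightarrow>\<^sub>E UNIV. (\<Prod>j<d. f j) = p ^ k}"
    then have f: "f \<in> {..<d} \<rightarrow>\<^sub>E UNIV" "(\<Prod>j<d. f j) = p ^ k" by auto
    have "f j \<in> (\<lambda>i. p ^ i) ` {..k}" if "j < d" for j
    proof -
      have "f j dvd p ^ k" unfolding f(2)[symmetric] using that by (intro dvd_prodI) auto
      then show ?thesis using assms by (auto simp: divides_primepow_nat)
    qed
    then show "f \<in> {..<d} \<rightarrow>\<^sub>E ((\<lambda>i. p ^ i) ` {..k})" using f by (auto simp: PiE_iff)
  qed
  then have "tau d (p ^ k) \<le> card ({..<d} \<rightarrow>\<^sub>E ((\<lambda>i. p ^ i) ` {..k}))"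
    unfolding tau_def by (intro card_mono finite_PiE) auto
  also have "\<dots> = card ((\<lambda>i. p ^ i) ` {..k}) ^ d" by (simp add: card_PiE)
  also have "\<dots> \<le> (k + 1) ^ d"
    by (intro power_mono) (use card_image_le[of "{..k}" "\<lambda>i. p ^ i"] in auto)
  finally show ?thesis .
qed

locale L_function_bounds = L_function_framework +
  assumes Ramanujan: "\<And>n. n \<ge> 1 \<Longrightarrow> norm (lamF n) \<le> real (tau d n)"
    and sifted: "\<exists>K. \<forall>P1 P2 X :: real. 2 \<le> P1 \<and> P1 \<le> P2 \<and> P2 \<le> X \<longrightarrow>
               (\<Sum>n | 1 \<le> n \<and> real n \<le> X \<and>
                      coprime n (\<Prod>p | prime p \<and> P1 \<le> real p \<and> real p \<le> P2. p).
                  (norm (lamF n))\<^sup>2)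
               \<le> K * (X * (ln P1 / ln P2))"
begin

lemma norm_lamF_prime_power_le:
  assumes "prime p"
  shows "norm (lamF (p ^ k)) \<le> (real k + 1) ^ d"
proof -
  have "norm (lamF (p ^ k)) \<le> real (tau d (p ^ k))"
    using assms by (intro Ramanujan) (simp add: prime_gt_0_nat Suc_le_eq)
  also have "\<dots> \<le> real ((k + 1) ^ d)" using tau_prime_power_le[OF assms] of_nat_mono by blast
  finally show ?thesis by (simp add: add.commute)
qed

lemma lamF_prime_power_eq:
  "prime p \<Longrightarrow> lamF (p ^ r) = complete_symmetric (\<lambda>j. \<alpha> j p) {..<d} r"
  by (simp add: prime_power complete_symmetric_def compositions_def)

lemma norm_alpha_le_1:
  assumes "prime p" "j < d"
  shows "norm (\<alpha> j p) \<le> 1"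
  using norm_le_1_if_complete_symmetric_bounded[where J = "{..<d}" and j = j and a = "\<lambda>j. \<alpha> j p" and C = 1 and m = d]
    norm_lamF_prime_power_le[OF assms(1)] assms lamF_prime_power_eq[OF assms(1)] by simp

lemma lamF_prime: "prime p \<Longrightarrow> lamF p = (\<Sum>j<d. \<alpha> j p)"
  using lamF_prime_power_eq[of p 1] complete_symmetric_1[of "{..<d}" "\<lambda>j. \<alpha> j p"] by simp

lemma norm_lamF_prime_le: "prime p \<Longrightarrow> norm (lamF p) \<le> real d"
  unfolding lamF_prime by (rule order_trans[OF norm_sum]) (use norm_alpha_le_1 sum_bounded_above[of "{..<d}" "\<lambda>j. norm (\<alpha> j p)" 1] in auto)

lemma norm_lamF_1_le: "norm (lamF 1) \<le> 1"
  using norm_lamF_prime_power_le[of 2 0] by simp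

text \<open>For \<open>P1 = P2 = 5/2\<close> the interval contains no prime and the logarithms
  cancel, so (A3) becomes the full mean square. It requires \<open>P2 \<le> M\<close>, and the
  values of \<open>M\<close> below 3 are checked by hand.\<close>

lemma mean_square_lamF:
  "\<exists>K\<ge>1. \<forall>M::nat. (\<Sum>n\<in>{1..<M}. (norm (lamF n))\<^sup>2) \<le> K * real M"
proof -
  obtain K where K: "\<And>P1 P2 X :: real. 2 \<le> P1 \<Longrightarrow> P1 \<le> P2 \<Longrightarrow> P2 \<le> X \<Longrightarrow>
               (\<Sum>n | 1 \<le> n \<and> real n \<le> X \<and>
                      coprime n (\<Prod>p | prime p \<and> P1 \<le> real p \<and> real p \<le> P2. p).
                  (norm (lamF n))\<^sup>2)
               \<le> K * (X * (ln P1 / ln P2))"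
    using sifted by blast
  have empty: "{p::nat. prime p \<and> (5 / 2 :: real) \<le> real p \<and> real p \<le> 5 / 2} = {}"
  proof safe
    fix p :: nat assume "(5 / 2 :: real) \<le> real p" "real p \<le> 5 / 2"
    then have "real (2 * p) = real 5" by simp
    then have "2 * p = 5" by (simp only: of_nat_eq_iff)
    then have False by presburger
    then show "p \<in> {}" by blast
  qed
  show ?thesis
  proof (intro exI[of _ "max K 1"] conjI allI)
    fix M :: nat
    show "(\<Sum>n\<in>{1..<M}. (norm (lamF n))\<^sup>2) \<le> max K 1 * real M"
    proof (cases "M \<ge> 3")
      case True
      have ln: "ln (5 / 2) / ln (5 / 2) = (1::real)" by simp
      have "(\<Sum>n | 1 \<le> n \<and> real n \<le> real M. (norm (lamF n))\<^sup>2) \<le> K * (real M * 1)"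
        using K[of "5/2" "5/2" "real M"] True unfolding empty ln by simp
      moreover have "(\<Sum>n\<in>{1..<M}. (norm (lamF n))\<^sup>2) \<le> (\<Sum>n | 1 \<le> n \<and> real n \<le> real M. (norm (lamF n))\<^sup>2)"
        by (rule sum_mono2) (auto intro: finite_subset[of _ "{..M}"])
      moreover have "K * (real M * 1) \<le> max K 1 * real M" by (simp add: mult_right_mono)
      ultimately show ?thesis by linarith
    next
      case False
      then consider "M = 0" | "M = 1" | "M = 2" by linarith
      then show ?thesis
      proof cases
        case 3
        then have "{1..<M} = {1}" by auto
        then show ?thesis using norm_lamF_1_le 3 power_le_one[OF norm_ge_zero norm_lamF_1_le, of 2] by simp
      qed auto
    qed
  qed auto
qed

lemma norm_lamF_le_sqrt: "\<exists>K\<ge>1. \<forall>n\<ge>1. norm (lamF n) \<le> K * sqrt (real n)"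
proof -
  obtain K where K: "K \<ge> 1" "\<And>M::nat. (\<Sum>n\<in>{1..<M}. (norm (lamF n))\<^sup>2) \<le> K * real M"
    using mean_square_lamF by blast
  show ?thesis
  proof (intro exI[of _ "sqrt (2 * K)"] conjI allI impI)
    fix n :: nat assume n: "n \<ge> 1"
    have "(norm (lamF n))\<^sup>2 \<le> (\<Sum>n\<in>{1..<n + 1}. (norm (lamF n))\<^sup>2)"
      using n by (intro member_le_sum) auto
    also have "\<dots> \<le> K * real (n + 1)" by (rule K(2))
    also have "\<dots> \<le> K * (2 * real n)" using K n by (intro mult_left_mono) auto
    finally have "norm (lamF n) \<le> sqrt (K * (2 * real n))" by (rule real_le_rsqrt)
    then show "norm (lamF n) \<le> sqrt (2 * K) * sqrt (real n)" by (simp add: real_sqrt_mult mult_ac)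
  qed (use K in simp)
qed

text \<open>Sorting by the exact power \<open>p ^ k\<close> dividing \<open>n\<close>,
  multiplicativity leaves \<open>(k + 1)^(2 * d)\<close> times a mean square of length
  \<open>M / p ^ k\<close>. The sum over \<open>k \<ge> a\<close> is of the order of
  \<open>p ^ (- a)\<close>, uniformly in \<open>p \<ge> 2\<close>; for \<open>a \<le> 2\<close> one
  has \<open>k + 1 \<le> (k - a) + 3\<close>, which makes the constant uniform in \<open>a\<close>
  too.\<close>

lemma mean_square_lamF_dvd:
  "\<exists>K\<ge>1. \<forall>p a. \<forall>M::nat. prime p \<longrightarrow> a \<le> 2 \<longrightarrow>
     (\<Sum>n | n \<in> {1..<M} \<and> p ^ a dvd n. (norm (lamF n))\<^sup>2) \<le> K * real M / real p ^ a"
proof -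
  obtain K where K: "K \<ge> 1" "\<And>M::nat. (\<Sum>n\<in>{1..<M}. (norm (lamF n))\<^sup>2) \<le> K * real M"
    using mean_square_lamF by blast
  define S where "S = (\<Sum>i. (real i + 3) ^ (2 * d) / 2 ^ i)"
  have summ: "summable (\<lambda>i. (real i + 3) ^ (2 * d) / 2 ^ i)"
    using summable_polynomial_geometric[of 2 3] by simp
  have S0: "S \<ge> 0" unfolding S_def by (rule suminf_nonneg[OF summ]) auto
  show ?thesis
  proof (intro exI[of _ "2 * K * S + 1"] conjI allI impI)
    show "2 * K * S + 1 \<ge> 1" using K S0 by simp
    fix p a M :: nat assume p: "prime p" and a: "a \<le> 2"
    have p2: "real p \<ge> 2" using prime_ge_2_nat[OF p] by simp
    define T where "T = {n. n \<in> {1..<M} \<and> p ^ a dvd n}"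
    have mult_in: "multiplicity p n \<in> {a..M}" if "n \<in> T" for n
    proof -
      have n: "n \<noteq> 0" "p ^ a dvd n" "n < M" using that by (auto simp: T_def)
      have "\<not> is_unit p" using p by auto
      then have "a \<le> multiplicity p n" using n by (simp add: multiplicity_geI)
      moreover have "p ^ multiplicity p n \<le> n" using n by (intro dvd_imp_le multiplicity_dvd) auto
      moreover have "multiplicity p n < p ^ multiplicity p n" using prime_gt_1_nat[OF p] by (simp add: power_gt_expt)
      ultimately show ?thesis using n by simp
    qed
    have part: "(\<Sum>n | n \<in> T \<and> multiplicity p n = k. (norm (lamF n))\<^sup>2) \<le> (real k + 1) ^ (2 * d) * (2 * K * real M / real p ^ k)" for k
    proof (cases "{n. n \<in> T \<and> multiplicity p n = k} = {}")
      case True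
      show ?thesis unfolding True using K(1) by simp
    next
      case False
      define Tk where "Tk = {n. n \<in> T \<and> multiplicity p n = k}"
      have fin: "finite Tk" by (rule finite_subset[of _ "{..M}"]) (auto simp: Tk_def T_def)
      have dec: "n = p ^ k * (n div p ^ k) \<and> coprime (p ^ k) (n div p ^ k) \<and> n div p ^ k \<in> {1..<M div p ^ k + 1}" if "n \<in> Tk" for n
      proof -
        have n: "n \<noteq> 0" "multiplicity p n = k" "n < M" using that by (auto simp: Tk_def T_def)
        have d: "p ^ k dvd n" using n multiplicity_dvd[of p n] by simp
        then have 1: "n = p ^ k * (n div p ^ k)" by simp
        have "\<not> p dvd n div p ^ k"
          using n p multiplicity_decompose[of n p] by (metis not_prime_unit)
        then have 2: "coprime (p ^ k) (n div p ^ k)"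
          using p by (simp add: prime_imp_coprime)
        have "n div p ^ k \<noteq> 0" using 1 n(1) by (metis mult_0_right)
        moreover have "n div p ^ k \<le> M div p ^ k" using n by (intro div_le_mono) simp
        ultimately show ?thesis using 1 2 by simp
      qed
      have inj: "inj_on (\<lambda>n. n div p ^ k) Tk"
        by (rule inj_onI) (metis dec)
      \<comment> \<open>A nonempty class forces \<open>p ^ k \<le> M\<close>, which absorbs the 1 in
        \<open>M div p ^ k + 1\<close>.\<close>
      obtain n0 where n0: "n0 \<in> Tk" using False by (auto simp: Tk_def)
      have "p ^ k \<le> n0" using dec[OF n0] by (metis One_nat_def atLeastLessThan_iff le_add1 mult.right_neutral mult_le_mono2)
      moreover have "n0 < M" using n0 by (simp add: Tk_def T_def)
      ultimately have pk: "real p ^ k \<le> real M" by (metis less_imp_le_nat of_nat_le_iff of_nat_power order_trans)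
      have "(\<Sum>n\<in>Tk. (norm (lamF n))\<^sup>2) = (\<Sum>n\<in>Tk. (norm (lamF (p ^ k)))\<^sup>2 * (norm (lamF (n div p ^ k)))\<^sup>2)"
      proof (intro sum.cong refl)
        fix n assume "n \<in> Tk"
        from dec[OF this] have "lamF n = lamF (p ^ k) * lamF (n div p ^ k)"
          using multiplicative[of "p ^ k" "n div p ^ k"] by metis
        then show "(norm (lamF n))\<^sup>2 = (norm (lamF (p ^ k)))\<^sup>2 * (norm (lamF (n div p ^ k)))\<^sup>2"
          by (simp add: norm_mult power_mult_distrib)
      qed
      also have "\<dots> = (norm (lamF (p ^ k)))\<^sup>2 * (\<Sum>m\<in>(\<lambda>n. n div p ^ k) ` Tk. (norm (lamF m))\<^sup>2)"
        by (simp add: sum.reindex[OF inj] sum_distrib_left)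
      also have "\<dots> \<le> ((real k + 1) ^ d)\<^sup>2 * (\<Sum>m\<in>{1..<M div p ^ k + 1}. (norm (lamF m))\<^sup>2)"
      proof (intro mult_mono power_mono norm_lamF_prime_power_le p sum_mono2)
        show "(\<lambda>n. n div p ^ k) ` Tk \<subseteq> {1..<M div p ^ k + 1}" using dec by blast
      qed (auto intro: sum_nonneg)
      also have "\<dots> \<le> ((real k + 1) ^ d)\<^sup>2 * (K * real (M div p ^ k + 1))"
        by (intro mult_left_mono K(2)) auto
      also have "\<dots> \<le> ((real k + 1) ^ d)\<^sup>2 * (K * (2 * real M / real p ^ k))"
      proof (intro mult_left_mono)
        have "real (M div p ^ k) \<le> real M / real p ^ k"
          using of_nat_div_le_of_nat[of M "p ^ k", where ?'a = real] by simp
        moreover have "1 \<le> real M / real p ^ k" using pk p2 by (simp add: pos_le_divide_eq)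
        ultimately show "real (M div p ^ k + 1) \<le> 2 * real M / real p ^ k" by simp
      qed (use K in auto)
      also have "\<dots> = (real k + 1) ^ (2 * d) * (2 * K * real M / real p ^ k)"
        by (simp add: power_mult[symmetric] mult.commute[of d])
      finally show ?thesis by (simp add: Tk_def)
    qed
    have "(\<Sum>n\<in>T. (norm (lamF n))\<^sup>2) = (\<Sum>k\<in>{a..M}. \<Sum>n | n \<in> T \<and> multiplicity p n = k. (norm (lamF n))\<^sup>2)"
      by (rule sum.group[symmetric]) (use mult_in in \<open>auto simp: T_def\<close>)
    also have "\<dots> \<le> (\<Sum>k\<in>{a..M}. (real k + 1) ^ (2 * d) * (2 * K * real M / real p ^ k))"
      by (intro sum_mono part)
    also have "\<dots> \<le> (\<Sum>k\<in>{a..M}. (2 * K * real M / real p ^ a) * ((real (k - a) + 3) ^ (2 * d) / 2 ^ (k - a)))"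
    proof (intro sum_mono)
      fix k assume k: "k \<in> {a..M}"
      have "(real k + 1) ^ (2 * d) \<le> (real (k - a) + 3) ^ (2 * d)"
        using k a by (intro power_mono) auto
      moreover have "1 / real p ^ k \<le> 1 / real p ^ a * (1 / 2 ^ (k - a))"
      proof -
        have "real p ^ a * 2 ^ (k - a) \<le> real p ^ a * real p ^ (k - a)"
          using p2 by (intro mult_left_mono power_mono) auto
        also have "\<dots> = real p ^ k" using k by (simp add: power_add[symmetric])
        finally show ?thesis using p2 by (simp add: frac_le)
      qed
      ultimately have "(real k + 1) ^ (2 * d) * (1 / real p ^ k) \<le> (real (k - a) + 3) ^ (2 * d) * (1 / real p ^ a * (1 / 2 ^ (k - a)))"
        using p2 by (intro mult_mono) auto
      then have "2 * K * real M * ((real k + 1) ^ (2 * d) * (1 / real p ^ k)) \<le> 2 * K * real M * ((real (k - a) + 3) ^ (2 * d) * (1 / real p ^ a * (1 / 2 ^ (k - a))))"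
        using K(1) by (intro mult_left_mono) auto
      then show "(real k + 1) ^ (2 * d) * (2 * K * real M / real p ^ k) \<le> (2 * K * real M / real p ^ a) * ((real (k - a) + 3) ^ (2 * d) / 2 ^ (k - a))"
        by (simp add: mult_ac)
    qed
    also have "\<dots> = (2 * K * real M / real p ^ a) * (\<Sum>k\<in>{a..M}. (real (k - a) + 3) ^ (2 * d) / 2 ^ (k - a))"
      by (simp add: sum_distrib_left)
    also have "\<dots> \<le> (2 * K * real M / real p ^ a) * S"
    proof (intro mult_left_mono)
      have "(\<Sum>k\<in>{a..M}. (real (k - a) + 3) ^ (2 * d) / 2 ^ (k - a)) = (\<Sum>i\<in>(\<lambda>k. k - a) ` {a..M}. (real i + 3) ^ (2 * d) / 2 ^ i)"
        by (subst sum.reindex) (auto simp: inj_on_def)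
      also have "\<dots> \<le> S" unfolding S_def
        by (intro sum_le_suminf[OF summ]) auto
      finally show "(\<Sum>k\<in>{a..M}. (real (k - a) + 3) ^ (2 * d) / 2 ^ (k - a)) \<le> S" .
    qed (use K in auto)
    also have "\<dots> = (2 * K * S) * real M / real p ^ a" by simp
    also have "\<dots> \<le> (2 * K * S + 1) * real M / real p ^ a"
      by (intro divide_right_mono mult_right_mono) auto
    finally show "(\<Sum>n | n \<in> {1..<M} \<and> p ^ a dvd n. (norm (lamF n))\<^sup>2) \<le> (2 * K * S + 1) * real M / real p ^ a"
      by (simp only: T_def)
  qed
qed

end

section \<open>Approximate functional equation\<close>

context L_function_framework
begin

text \<open>Here a Gamma factor has a pole at the central point while the completed function is
  entire, so the L-function vanishes. The case is split off because the kernel below divides by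
  \<open>1 / 2 + \<mu> e j\<close>.\<close>

lemma L_twist_half_eq_0:
  assumes "q \<ge> 2" "chi \<in> primitive_characters q" "j < d" "1 / 2 + \<mu> (chi (-1)) j = 0"
  shows "L_twist lamF chi (1 / 2) = 0"
proof -
  have "rGamma ((1 / 2 + \<mu> (chi (-1)) j) / 2) = (0 :: complex)"
    unfolding assms(4) by simp
  then have "inv_gam (chi (-1)) (1 / 2) = 0"
    unfolding inv_gam_def using assms(3) by (intro prod_zero) auto
  then show ?thesis by (simp add: L_twist_eq(2)[OF assms(1,2)])
qed

text \<open>The kernel vanishes at the poles \<open>w = -1/2 - \<mu> j\<close> of the Gamma factor, which may lie to
  the right of 0, and takes the value 1 at 0.\<close>

definition afe_kernel :: "complex \<Rightarrow> complex \<Rightarrow> complex" where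
  "afe_kernel e w = exp (w\<^sup>2) * (\<Prod>j<d. (1 / 2 + \<mu> e j + w) / (1 / 2 + \<mu> e j))
     * (\<Prod>j<d. (cnj (1 / 2 + \<mu> e j) - w) / cnj (1 / 2 + \<mu> e j))"

text \<open>The kernel times the Gamma factors over \<open>w\<close>, with
  \<open>1 / 2 + \<mu> e j + w\<close> absorbed through \<open>z * Gamma z = Gamma (z + 1)\<close>.
  This form is holomorphic for all \<open>Re w > 0\<close>, although
  \<open>Gamma_R (1 / 2 + w + \<mu> e j)\<close> itself may have a pole there.\<close>

definition afe_weight :: "complex \<Rightarrow> complex \<Rightarrow> complex" where
  "afe_weight e w = exp (w\<^sup>2)
     * (\<Prod>j<d. (cnj (1 / 2 + \<mu> e j) - w) / cnj (1 / 2 + \<mu> e j))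
     * (\<Prod>j<d. 2 / (1 / 2 + \<mu> e j) * (of_real pi powr (- (1 / 2 + w + \<mu> e j) / 2)
           * Gamma ((1 / 2 + w + \<mu> e j) / 2 + 1))) / w"

text \<open>The second product in the kernel is there for this symmetry. It matches the reflection
  \<open>1 - cnj s\<close> in the functional equation, so that the integrals over
  \<open>Re w = 1\<close> and \<open>Re w = -1\<close> are conjugate up to a constant
  factor.\<close>

lemma afe_kernel_reflect: "cnj (afe_kernel e (- cnj w)) = afe_kernel e w"
  unfolding afe_kernel_def
  by (simp add: exp_cnj mult_ac)

lemma holomorphic_exp_square: "(\<lambda>w::complex. exp (w\<^sup>2)) holomorphic_on A"
  by (intro holomorphic_intros)

lemma half_shift_pos: "0 < (1 / 2 + y + x) / 2 + 1" if "x > -1" "y > 0" for x y :: real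
  using that by (simp add: field_simps)

lemma holomorphic_linear_factor:
  "(\<lambda>w. (a + w) / b) holomorphic_on A" "(\<lambda>w. (a - w) / b) holomorphic_on A" for b :: complex
  by (cases "b = 0"; auto intro!: holomorphic_intros)+

lemma holomorphic_afe_kernel: "afe_kernel e holomorphic_on A"
  unfolding afe_kernel_def
  by (intro holomorphic_on_mult holomorphic_on_prod holomorphic_linear_factor holomorphic_exp_square)

text \<open>Bounding each linear factor by an exponential in \<open>Im w\<close> lets the Gaussian
  absorb all of them together.\<close>

lemma norm_linear_factor_le:
  fixes a w :: complex
  assumes "\<bar>Re w\<bar> \<le> r"
  shows "norm ((a + w) / b) \<le> (norm a + r + 1) / norm b * exp \<bar>Im w\<bar>"
    and "norm ((a - w) / b) \<le> (norm a + r + 1) / norm b * exp \<bar>Im w\<bar>"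
proof -
  have e: "1 + \<bar>Im w\<bar> \<le> exp \<bar>Im w\<bar>" by (rule exp_ge_add_one_self)
  have "norm w \<le> r + \<bar>Im w\<bar>" using cmod_le[of w] assms by linarith
  moreover have "(norm a + r + 1) * (1 + \<bar>Im w\<bar>) \<le> (norm a + r + 1) * exp \<bar>Im w\<bar>"
    using assms by (intro mult_left_mono e) auto
  moreover have "norm a + (r + \<bar>Im w\<bar>) \<le> (norm a + r + 1) * (1 + \<bar>Im w\<bar>)"
    using assms by (simp add: algebra_simps add_nonneg_nonneg)
  ultimately have *: "norm a + norm w \<le> (norm a + r + 1) * exp \<bar>Im w\<bar>" by linarith
  then have "norm (a + w) \<le> (norm a + r + 1) * exp \<bar>Im w\<bar>" "norm (a - w) \<le> (norm a + r + 1) * exp \<bar>Im w\<bar>"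
    using norm_triangle_ineq[of a w] norm_triangle_ineq4[of a w] by linarith+
  from this[THEN divide_right_mono, of "norm b"]
  show "norm ((a + w) / b) \<le> (norm a + r + 1) / norm b * exp \<bar>Im w\<bar>"
    and "norm ((a - w) / b) \<le> (norm a + r + 1) / norm b * exp \<bar>Im w\<bar>"
    by (simp_all add: norm_divide)
qed

lemma norm_prod_exp_le:
  assumes "\<And>j. j < d \<Longrightarrow> norm (f j :: complex) \<le> c j * exp x"
  shows "norm (\<Prod>j<d. f j) \<le> (\<Prod>j<d. c j) * exp (real d * x)"
proof -
  have "norm (\<Prod>j<d. f j) \<le> (\<Prod>j<d. c j * exp x)"
    unfolding prod_norm[symmetric] using assms by (intro prod_mono conjI) auto
  also have "\<dots> = (\<Prod>j<d. c j) * exp (real d * x)"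
    by (simp add: prod.distrib exp_of_nat_mult)
  finally show ?thesis .
qed

lemma norm_exp_square_le:
  assumes "\<bar>Re w\<bar> \<le> r"
  shows "norm (exp (w\<^sup>2)) \<le> exp (r\<^sup>2) * exp (- (Im w)\<^sup>2)"
proof -
  have "(Re w)\<^sup>2 \<le> r\<^sup>2" using assms by (metis abs_le_square_iff abs_of_nonneg abs_ge_zero order_trans)
  then show ?thesis unfolding norm_exp_square by (simp add: exp_add[symmetric])
qed

lemma norm_afe_kernel_le:
  "\<exists>C\<ge>0. \<forall>w. \<bar>Re w\<bar> \<le> r \<longrightarrow> norm (afe_kernel e w) \<le> C / (1 + (Im w)\<^sup>2)\<^sup>2"
proof -
  define c1 where "c1 = (\<Prod>j<d. (norm (1 / 2 + \<mu> e j) + r + 1) / norm (1 / 2 + \<mu> e j))"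
  define c2 where "c2 = (\<Prod>j<d. (norm (cnj (1 / 2 + \<mu> e j)) + r + 1) / norm (cnj (1 / 2 + \<mu> e j)))"
  define C where "C = exp (r\<^sup>2) * \<bar>c1\<bar> * \<bar>c2\<bar> * exp ((real d + real d + 4)\<^sup>2 / 4)"
  show ?thesis
  proof (intro exI[of _ C] conjI allI impI)
    show "0 \<le> C" by (simp add: C_def)
    fix w assume w: "\<bar>Re w\<bar> \<le> r"
    let ?y = "Im w"
    have "norm (\<Prod>j<d. (1 / 2 + \<mu> e j + w) / (1 / 2 + \<mu> e j)) \<le> c1 * exp (real d * \<bar>?y\<bar>)"
      unfolding c1_def by (rule norm_prod_exp_le, rule norm_linear_factor_le(1)[OF w])
    also have "\<dots> \<le> \<bar>c1\<bar> * exp (real d * \<bar>?y\<bar>)" by (intro mult_right_mono) auto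
    finally have 1: "norm (\<Prod>j<d. (1 / 2 + \<mu> e j + w) / (1 / 2 + \<mu> e j)) \<le> \<bar>c1\<bar> * exp (real d * \<bar>?y\<bar>)" .
    have "norm (\<Prod>j<d. (cnj (1 / 2 + \<mu> e j) - w) / cnj (1 / 2 + \<mu> e j)) \<le> c2 * exp (real d * \<bar>?y\<bar>)"
      unfolding c2_def by (rule norm_prod_exp_le, rule norm_linear_factor_le(2)[OF w])
    also have "\<dots> \<le> \<bar>c2\<bar> * exp (real d * \<bar>?y\<bar>)" by (intro mult_right_mono) auto
    finally have 2: "norm (\<Prod>j<d. (cnj (1 / 2 + \<mu> e j) - w) / cnj (1 / 2 + \<mu> e j)) \<le> \<bar>c2\<bar> * exp (real d * \<bar>?y\<bar>)" .
    have "norm (afe_kernel e w) \<le> (exp (r\<^sup>2) * exp (- ?y\<^sup>2)) * (\<bar>c1\<bar> * exp (real d * \<bar>?y\<bar>)) * (\<bar>c2\<bar> * exp (real d * \<bar>?y\<bar>))"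
      unfolding afe_kernel_def norm_mult
      by (intro mult_mono norm_exp_square_le[OF w] 1 2) auto
    also have "\<dots> = exp (r\<^sup>2) * \<bar>c1\<bar> * \<bar>c2\<bar> * (exp (- ?y\<^sup>2) * exp (real d * \<bar>?y\<bar>) * exp (real d * \<bar>?y\<bar>))"
      by (simp only: mult_ac)
    also have "exp (- ?y\<^sup>2) * exp (real d * \<bar>?y\<bar>) * exp (real d * \<bar>?y\<bar>) = exp ((real d + real d) * \<bar>?y\<bar> - ?y\<^sup>2)"
      unfolding exp_add[symmetric] by (simp add: algebra_simps)
    also have "exp (r\<^sup>2) * \<bar>c1\<bar> * \<bar>c2\<bar> * exp ((real d + real d) * \<bar>?y\<bar> - ?y\<^sup>2)
        \<le> exp (r\<^sup>2) * \<bar>c1\<bar> * \<bar>c2\<bar> * (exp ((real d + real d + 4)\<^sup>2 / 4) / (1 + ?y\<^sup>2)\<^sup>2)"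
      by (intro mult_left_mono exp_linear_minus_square_le) auto
    finally show "norm (afe_kernel e w) \<le> C / (1 + ?y\<^sup>2)\<^sup>2" by (simp add: C_def)
  qed
qed

lemma Re_mu_parity:
  assumes "q \<ge> 2" "chi \<in> primitive_characters q" "chi (-1) = e" "j < d"
  shows "Re (\<mu> e j) > -1"
  using Re_mu[OF assms(1,2,4)] theta_pos assms(3) by simp

text \<open>The Gamma factors are merely bounded on the strip; the decay comes from
  \<open>exp (w^2)\<close> alone.\<close>

lemma norm_afe_weight_le:
  assumes mu: "\<And>j. j < d \<Longrightarrow> Re (\<mu> e j) > -1" and a: "0 < a"
  shows "\<exists>C\<ge>0. \<forall>w. a \<le> Re w \<and> Re w \<le> b \<longrightarrow> norm (afe_weight e w) \<le> C / (1 + (Im w)\<^sup>2)\<^sup>2"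
proof -
  define c2 where "c2 = (\<Prod>j<d. (norm (cnj (1 / 2 + \<mu> e j)) + b + 1) / norm (cnj (1 / 2 + \<mu> e j)))"
  have "\<forall>j\<in>{..<d}. \<exists>K\<ge>0. \<forall>w. a \<le> Re w \<and> Re w \<le> b \<longrightarrow>
      norm (2 / (1 / 2 + \<mu> e j) * (of_real pi powr (- (1 / 2 + w + \<mu> e j) / 2)
           * Gamma ((1 / 2 + w + \<mu> e j) / 2 + 1))) \<le> K"
  proof
    fix j assume "j \<in> {..<d}"
    then have m: "Re (\<mu> e j) > -1" using mu by simp
    have pos: "0 < (1 / 2 + a + Re (\<mu> e j)) / 2 + 1" using m a by (rule half_shift_pos)
    from Gamma_bound_interval[OF pos, of "(1 / 2 + b + Re (\<mu> e j)) / 2 + 1"]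
    obtain K where K: "K \<ge> 0" "\<And>z. (1 / 2 + a + Re (\<mu> e j)) / 2 + 1 \<le> Re z \<Longrightarrow>
        Re z \<le> (1 / 2 + b + Re (\<mu> e j)) / 2 + 1 \<Longrightarrow> norm (Gamma z) \<le> K" by blast
    show "\<exists>K\<ge>0. \<forall>w. a \<le> Re w \<and> Re w \<le> b \<longrightarrow>
      norm (2 / (1 / 2 + \<mu> e j) * (of_real pi powr (- (1 / 2 + w + \<mu> e j) / 2)
           * Gamma ((1 / 2 + w + \<mu> e j) / 2 + 1))) \<le> K"
    proof (intro exI[of _ "norm (2 / (1 / 2 + \<mu> e j)) * (pi powr (1 / 2) * K)"] conjI allI impI)
      fix w assume w: "a \<le> Re w \<and> Re w \<le> b"
      have "norm (of_real pi powr (- (1 / 2 + w + \<mu> e j) / 2) :: complex) = pi powr (- (1 / 2 + Re w + Re (\<mu> e j)) / 2)"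
        by (subst norm_powr_real_powr) auto
      also have "\<dots> \<le> pi powr (1 / 2)"
        using m a w pi_gt3 by (intro powr_mono) auto
      finally have 1: "norm (of_real pi powr (- (1 / 2 + w + \<mu> e j) / 2) :: complex) \<le> pi powr (1 / 2)" .
      have 2: "norm (Gamma ((1 / 2 + w + \<mu> e j) / 2 + 1)) \<le> K"
        using w by (intro K(2)) auto
      show "norm (2 / (1 / 2 + \<mu> e j) * (of_real pi powr (- (1 / 2 + w + \<mu> e j) / 2)
           * Gamma ((1 / 2 + w + \<mu> e j) / 2 + 1))) \<le> norm (2 / (1 / 2 + \<mu> e j)) * (pi powr (1 / 2) * K)"
        unfolding norm_mult using 1 2 by (intro mult_left_mono mult_mono) auto
    qed (use K in auto)
  qed
  then obtain K where K: "\<And>j. j < d \<Longrightarrow> K j \<ge> 0" "\<And>j w. j < d \<Longrightarrow> a \<le> Re w \<Longrightarrow> Re w \<le> b \<Longrightarrow>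
      norm (2 / (1 / 2 + \<mu> e j) * (of_real pi powr (- (1 / 2 + w + \<mu> e j) / 2)
           * Gamma ((1 / 2 + w + \<mu> e j) / 2 + 1))) \<le> K j"
    unfolding Ball_def lessThan_iff by metis
  define k where "k = (\<Prod>j<d. K j)"
  have k0: "k \<ge> 0" unfolding k_def using K(1) by (intro prod_nonneg) auto
  define C where "C = exp (b\<^sup>2) * \<bar>c2\<bar> * k / a * exp ((real d + 4)\<^sup>2 / 4)"
  show ?thesis
  proof (intro exI[of _ C] conjI allI impI)
    show "0 \<le> C" using k0 a by (simp add: C_def)
    fix w assume ab: "a \<le> Re w \<and> Re w \<le> b"
    then have w: "\<bar>Re w\<bar> \<le> b" using a by auto
    let ?y = "Im w"
    have "norm (\<Prod>j<d. (cnj (1 / 2 + \<mu> e j) - w) / cnj (1 / 2 + \<mu> e j)) \<le> c2 * exp (real d * \<bar>?y\<bar>)"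
      unfolding c2_def by (rule norm_prod_exp_le, rule norm_linear_factor_le(2)[OF w])
    also have "\<dots> \<le> \<bar>c2\<bar> * exp (real d * \<bar>?y\<bar>)" by (intro mult_right_mono) auto
    finally have 2: "norm (\<Prod>j<d. (cnj (1 / 2 + \<mu> e j) - w) / cnj (1 / 2 + \<mu> e j)) \<le> \<bar>c2\<bar> * exp (real d * \<bar>?y\<bar>)" .
    have 3: "norm (\<Prod>j<d. 2 / (1 / 2 + \<mu> e j) * (of_real pi powr (- (1 / 2 + w + \<mu> e j) / 2)
           * Gamma ((1 / 2 + w + \<mu> e j) / 2 + 1))) \<le> k"
      unfolding k_def prod_norm[symmetric] using K ab by (intro prod_mono conjI norm_ge_zero) auto
    have nw: "a \<le> norm w" using ab complex_Re_le_cmod[of w] by linarith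
    have "norm (afe_weight e w) \<le> (exp (b\<^sup>2) * exp (- ?y\<^sup>2)) * (\<bar>c2\<bar> * exp (real d * \<bar>?y\<bar>)) * k / a"
      unfolding afe_weight_def norm_mult norm_divide
      by (intro frac_le mult_mono norm_exp_square_le[OF w] 2 3 nw mult_nonneg_nonneg k0 a
          order_trans[OF norm_ge_zero 3]) auto
    also have "\<dots> = exp (b\<^sup>2) * \<bar>c2\<bar> * k / a * exp (real d * \<bar>?y\<bar> - ?y\<^sup>2)"
      by (simp add: exp_diff exp_minus divide_inverse mult_ac)
    also have "\<dots> \<le> exp (b\<^sup>2) * \<bar>c2\<bar> * k / a * (exp ((real d + 4)\<^sup>2 / 4) / (1 + ?y\<^sup>2)\<^sup>2)"
      using k0 a by (intro mult_left_mono exp_linear_minus_square_le) auto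
    finally show "norm (afe_weight e w) \<le> C / (1 + ?y\<^sup>2)\<^sup>2" by (simp add: C_def)
  qed
qed

lemma Gamma_arg_not_nonpos_Int:
  fixes z :: complex
  assumes "Re z > 0"
  shows "z \<notin> \<int>\<^sub>\<le>\<^sub>0"
  using assms by (auto elim!: nonpos_Ints_cases)

lemma holomorphic_afe_weight:
  assumes mu: "\<And>j. j < d \<Longrightarrow> Re (\<mu> e j) > -1"
  shows "afe_weight e holomorphic_on {w. Re w > 0}"
proof -
  have "(\<lambda>w. Gamma ((1 / 2 + w + \<mu> e j) / 2 + 1)) holomorphic_on {w. Re w > 0}" if "j < d" for j
  proof -
    have "(Gamma \<circ> (\<lambda>w. (1 / 2 + w + \<mu> e j) / 2 + 1)) holomorphic_on {w. Re w > 0}"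
    proof (rule holomorphic_on_compose_gen[where t = "{z. Re z > 0}"])
      show "Gamma holomorphic_on {z. Re z > 0}"
        using Gamma_arg_not_nonpos_Int by (intro holomorphic_Gamma) auto
      have "0 < (1 / 2 + Re w + Re (\<mu> e j)) / 2 + 1" if "Re w > 0" for w
        using mu[OF \<open>j < d\<close>] that by (rule half_shift_pos)
      then show "(\<lambda>w. (1 / 2 + w + \<mu> e j) / 2 + 1) ` {w. Re w > 0} \<subseteq> {z. Re z > 0}"
        by auto
    qed (auto intro!: holomorphic_intros)
    then show ?thesis by (simp add: o_def)
  qed
  then have 3: "(\<lambda>w. 2 / (1 / 2 + \<mu> e j) * (of_real pi powr (- (1 / 2 + w + \<mu> e j) / 2)
           * Gamma ((1 / 2 + w + \<mu> e j) / 2 + 1))) holomorphic_on {w. Re w > 0}" if "j < d" for j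
    using that by (intro holomorphic_on_mult holomorphic_on_const) (auto intro!: holomorphic_intros)
  show ?thesis
    unfolding afe_weight_def
    by (rule holomorphic_on_divide, rule holomorphic_on_mult, rule holomorphic_on_mult, rule holomorphic_exp_square,
        rule holomorphic_on_prod, rule holomorphic_linear_factor, rule holomorphic_on_prod, rule 3)
       (auto intro: holomorphic_on_ident)
qed

text \<open>For \<open>Re w > 1 / 2\<close> the Gamma arguments have positive real part, since
  \<open>Re (\<mu> e j) > -1\<close>, and \<open>Gamma (z + 1) = z * Gamma z\<close> may be read
  backwards.\<close>

lemma afe_weight_eq:
  assumes mu: "\<And>j. j < d \<Longrightarrow> Re (\<mu> e j) > -1" and nz: "\<And>j. j < d \<Longrightarrow> 1 / 2 + \<mu> e j \<noteq> 0"
    and w: "Re w > 1 / 2"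
  shows "afe_weight e w = afe_kernel e w * (\<Prod>j<d. Gamma_R (1 / 2 + w + \<mu> e j)) / w"
proof -
  have "(1 / 2 + \<mu> e j + w) / (1 / 2 + \<mu> e j) * Gamma_R (1 / 2 + w + \<mu> e j) =
      2 / (1 / 2 + \<mu> e j) * (of_real pi powr (- (1 / 2 + w + \<mu> e j) / 2) * Gamma ((1 / 2 + w + \<mu> e j) / 2 + 1))"
    if j: "j < d" for j
  proof -
    define z where "z = (1 / 2 + w + \<mu> e j) / 2"
    have "Re z > 0" using mu[OF j] w by (simp add: z_def)
    then have "Gamma (z + 1) = z * Gamma z"
      by (intro Gamma_plus1 Gamma_arg_not_nonpos_Int)
    moreover have "1 / 2 + \<mu> e j + w = 2 * z" by (simp add: z_def)
    ultimately show ?thesis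
      by (simp add: Gamma_R_def z_def[symmetric])
  qed
  then have "(\<Prod>j<d. (1 / 2 + \<mu> e j + w) / (1 / 2 + \<mu> e j)) * (\<Prod>j<d. Gamma_R (1 / 2 + w + \<mu> e j)) =
      (\<Prod>j<d. 2 / (1 / 2 + \<mu> e j) * (of_real pi powr (- (1 / 2 + w + \<mu> e j) / 2) * Gamma ((1 / 2 + w + \<mu> e j) / 2 + 1)))"
    unfolding prod.distrib[symmetric] by (intro prod.cong) auto
  then show ?thesis by (simp add: afe_weight_def afe_kernel_def mult_ac)
qed

end

text \<open>A smooth cut-off for \<open>n\<close> at \<open>sqrt M\<close>.\<close>

definition mellin_weight :: "(complex \<Rightarrow> complex) \<Rightarrow> real \<Rightarrow> nat \<Rightarrow> nat \<Rightarrow> complex" where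
  "mellin_weight h c M n = (LBINT y. of_nat M powr (Complex c y / 2) / of_nat n powr (Complex c y) * h (Complex c y))"

text \<open>From here on only these two properties of the weight matter; they also admit the zero
  weight, which serves when the central value vanishes. The square of \<open>1 + y^2\<close> leaves
  room for a factor \<open>1 + \<bar>y\<bar>\<close> that comes with the prime sums.\<close>

locale decaying_weight =
  fixes h :: "complex \<Rightarrow> complex"
  assumes holomorphic: "h holomorphic_on {w. Re w > 0}"
    and decay: "\<And>a b. 0 < a \<Longrightarrow> \<exists>C\<ge>0. \<forall>w. a \<le> Re w \<and> Re w \<le> b \<longrightarrow> norm (h w) \<le> C / (1 + (Im w)\<^sup>2)\<^sup>2"
begin

lemma decay_weak:
  assumes "0 < a"
  shows "\<exists>C\<ge>0. \<forall>w. a \<le> Re w \<and> Re w \<le> b \<longrightarrow> norm (h w) \<le> C / (1 + (Im w)\<^sup>2)"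
proof -
  obtain C where C: "C \<ge> 0" "\<And>w. a \<le> Re w \<Longrightarrow> Re w \<le> b \<Longrightarrow> norm (h w) \<le> C / (1 + (Im w)\<^sup>2)\<^sup>2"
    using decay[OF assms, of b] by blast
  have "C / (1 + y\<^sup>2)\<^sup>2 \<le> C / (1 + y\<^sup>2)" for y
  proof -
    have "1 \<le> 1 + y\<^sup>2" by simp
    then have "(1 + y\<^sup>2) * 1 \<le> (1 + y\<^sup>2) * (1 + y\<^sup>2)" by (intro mult_left_mono) auto
    then show ?thesis using C(1) by (intro divide_left_mono) (auto simp: power2_eq_square add_pos_nonneg intro!: mult_pos_pos)
  qed
  then show ?thesis using C by (meson order_trans)
qed

lemma continuous_on_line: "c > 0 \<Longrightarrow> continuous_on UNIV (\<lambda>y. h (Complex c y))"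
  by (rule continuous_on_compose2[OF holomorphic_on_imp_continuous_on[OF holomorphic]])
     (auto intro!: continuous_intros simp: Complex_eq)

text \<open>The same weight is thus bounded by every positive power of \<open>sqrt M / n\<close>,
  and the line can be chosen to suit the size of \<open>n\<close>.\<close>

lemma mellin_weight_shift:
  assumes c: "0 < c" "0 < c'" and pos: "M \<ge> 1" "n \<ge> 1"
  shows "mellin_weight h c M n = mellin_weight h c' M n"
proof -
  have *: "mellin_weight h a M n = mellin_weight h b M n" if ab: "0 < a" "a < b" for a b
  proof -
    obtain C where C: "C \<ge> 0" "\<And>w. a \<le> Re w \<Longrightarrow> Re w \<le> b \<Longrightarrow> norm (h w) \<le> C / (1 + (Im w)\<^sup>2)"
      using decay_weak[OF ab(1), of b] by blast
    define f where "f w = of_nat M powr (w / 2) / of_nat n powr w * h w" for w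
    have hol: "f holomorphic_on {z. a \<le> Re z \<and> Re z \<le> b}"
      unfolding f_def using pos ab
      by (intro holomorphic_intros holomorphic_on_subset[OF holomorphic]) (auto)
    have bd: "norm (f z) \<le> (real M powr (b / 2) * C) / (1 + (Im z)\<^sup>2)" if z: "a \<le> Re z" "Re z \<le> b" for z
    proof -
      have "real M powr (Re z / 2) \<le> real M powr (b / 2)"
        using pos z ab by (auto intro!: powr_mono)
      moreover have "real n powr (Re z) \<ge> 1"
        using pos z ab by (intro ge_one_powr_ge_zero) auto
      ultimately have "norm (of_nat M powr (z / 2) / of_nat n powr z :: complex) \<le> real M powr (b / 2) / 1"
        unfolding norm_divide norm_of_nat_powr using pos by (intro frac_le) auto
      then have "norm (f z) \<le> real M powr (b / 2) / 1 * (C / (1 + (Im z)\<^sup>2))"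
        unfolding f_def norm_mult using C(2)[OF z] by (intro mult_mono) auto
      then show ?thesis by simp
    qed
    show ?thesis
      using vertical_line_shift(3)[OF ab(2) hol bd] unfolding mellin_weight_def f_def by simp
  qed
  consider "c < c'" | "c = c'" | "c' < c" by linarith
  then show ?thesis
  proof cases
    case 1
    then show ?thesis by (rule *[OF c(1)])
  next
    case 3
    then show ?thesis by (rule *[OF c(2), symmetric])
  qed simp
qed

lemma norm_mellin_weight_le:
  assumes c: "c > 0"
  shows "\<exists>C\<ge>0. \<forall>M\<ge>1. \<forall>n\<ge>1. norm (mellin_weight h c M n) \<le> C * (sqrt (real M) / real n) powr c"
proof -
  obtain C where C: "C \<ge> 0" "\<And>w. c \<le> Re w \<Longrightarrow> Re w \<le> c \<Longrightarrow> norm (h w) \<le> C / (1 + (Im w)\<^sup>2)"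
    using decay_weak[OF c, of c] by blast
  define I where "I = (LBINT y. inverse (1 + y\<^sup>2 :: real))"
  have I0: "I \<ge> 0" unfolding I_def by (rule integral_nonneg_AE) (auto simp: add_nonneg_nonneg)
  show ?thesis
  proof (intro exI[of _ "C * I"] conjI allI impI)
    fix M n :: nat assume pos: "M \<ge> 1" "n \<ge> 1"
    define K where "K = (sqrt (real M) / real n) powr c"
    have K: "norm (of_nat M powr (Complex c y / 2) / of_nat n powr (Complex c y) :: complex) = K" for y
      using pos unfolding norm_divide norm_of_nat_powr K_def
      by (simp add: powr_divide powr_half_sqrt[symmetric] powr_powr)
    have int: "integrable lborel (\<lambda>y. K * C * inverse (1 + y\<^sup>2))"
      using integrable_inverse_1_plus_square_lborel by simp
    have K0: "K \<ge> 0" by (simp add: K_def)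
    have "norm (mellin_weight h c M n) \<le> (LBINT y. norm (of_nat M powr (Complex c y / 2) / of_nat n powr (Complex c y) * h (Complex c y)))"
      unfolding mellin_weight_def by (rule Bochner_Integration.integral_norm_bound)
    also have "\<dots> \<le> (LBINT y. K * C * inverse (1 + y\<^sup>2))"
    proof (rule integral_mono'[OF int])
      fix y
      have "norm (h (Complex c y)) \<le> C / (1 + y\<^sup>2)" using C(2)[of "Complex c y"] by simp
      then have "K * norm (h (Complex c y)) \<le> K * (C / (1 + y\<^sup>2))"
        using K0 by (rule mult_left_mono)
      then show "norm (of_nat M powr (Complex c y / 2) / of_nat n powr (Complex c y) * h (Complex c y))
          \<le> K * C * inverse (1 + y\<^sup>2)"
        unfolding norm_mult[of _ "h _"] K by (simp add: divide_inverse mult.assoc)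
      show "0 \<le> K * C * inverse (1 + y\<^sup>2)" using K0 C(1) by (simp add: add_nonneg_nonneg)
    qed
    also have "\<dots> = C * I * K" by (simp add: I_def)
    finally show "norm (mellin_weight h c M n) \<le> C * I * (sqrt (real M) / real n) powr c"
      by (simp only: K_def)
  qed (use C I0 in simp)
qed

lemma integrable_line:
  assumes "c > 0"
  shows "integrable lborel (\<lambda>y. h (Complex c y))"
proof -
  obtain C where C: "C \<ge> 0" "\<And>w. c \<le> Re w \<Longrightarrow> Re w \<le> c \<Longrightarrow> norm (h w) \<le> C / (1 + (Im w)\<^sup>2)"
    using decay_weak[OF assms, of c] by blast
  show ?thesis
    by (rule integrable_lborel_inverse_square_bound[OF continuous_on_line[OF assms], of C])
       (use C(2)[of "Complex c _"] in simp)
qed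

end

lemma decaying_weight_0: "decaying_weight (\<lambda>_. 0)"
  by standard (auto intro!: exI[of _ 0])

lemma decaying_weight_cmult:
  assumes "decaying_weight h"
  shows "decaying_weight (\<lambda>w. k * h w)"
proof
  interpret decaying_weight h by fact
  show "(\<lambda>w. k * h w) holomorphic_on {w. Re w > 0}" by (intro holomorphic_intros holomorphic)
  fix a b :: real assume "0 < a"
  from decay[OF this, of b] obtain C where C: "C \<ge> 0"
    "\<And>w. a \<le> Re w \<Longrightarrow> Re w \<le> b \<Longrightarrow> norm (h w) \<le> C / (1 + (Im w)\<^sup>2)\<^sup>2" by blast
  show "\<exists>C\<ge>0. \<forall>w. a \<le> Re w \<and> Re w \<le> b \<longrightarrow> norm (k * h w) \<le> C / (1 + (Im w)\<^sup>2)\<^sup>2"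
  proof (intro exI[of _ "norm k * C"] conjI allI impI)
    fix w assume "a \<le> Re w \<and> Re w \<le> b"
    then have "norm k * norm (h w) \<le> norm k * (C / (1 + (Im w)\<^sup>2)\<^sup>2)"
      using C by (intro mult_left_mono) auto
    then show "norm (k * h w) \<le> norm k * C / (1 + (Im w)\<^sup>2)\<^sup>2" by (simp add: norm_mult)
  qed (use C in simp)
qed

lemma mellin_weight_cmult: "mellin_weight (\<lambda>w. k * h w) c M n = k * mellin_weight h c M n"
  unfolding mellin_weight_def by (subst integral_mult_right_zero[symmetric]) (simp add: mult_ac)

context L_function_framework
begin

lemma decaying_afe_weight:
  assumes "\<And>j. j < d \<Longrightarrow> Re (\<mu> e j) > -1"
  shows "decaying_weight (afe_weight e)"
proof (rule decaying_weight.intro)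
  show "afe_weight e holomorphic_on {w. Re w > 0}"
    by (rule holomorphic_afe_weight) (rule assms)
  show "\<exists>C\<ge>0. \<forall>w. a \<le> Re w \<and> Re w \<le> b \<longrightarrow> norm (afe_weight e w) \<le> C / (1 + (Im w)\<^sup>2)\<^sup>2"
    if "0 < a" for a b
    by (rule norm_afe_weight_le[OF _ that]) (rule assms)
qed

text \<open>Moving the line from 1 to -1 picks up the central value at \<open>w = 0\<close>, and the
  functional equation turns the left integral into \<open>- \<kappa> * cnj I\<close>. Hence
  \<open>2 * pi * Lam q chi (1 / 2) = I + \<kappa> * cnj I\<close>. For an upper bound the dual part
  has the same modulus as \<open>I\<close>, so a single sum suffices.\<close>

lemma afe_half_bound:
  assumes q: "q \<ge> 2" and chi: "chi \<in> primitive_characters q" and e: "chi (-1) = e"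
    and nz: "\<forall>j<d. 1 / 2 + \<mu> e j \<noteq> 0"
  shows "pi * norm (Lam q chi (1 / 2)) \<le>
    norm (LBINT y. Lam q chi (1 / 2 + Complex 1 y) * afe_kernel e (Complex 1 y) / Complex 1 y)"
proof -
  define F where "F w = Lam q chi (1 / 2 + w) * afe_kernel e w" for w
  obtain C1 where C1: "C1 > 0" "\<And>s. -3 \<le> Re s \<Longrightarrow> Re s \<le> 4 \<Longrightarrow> norm (Lam q chi s) \<le> C1 * real (N q) ^ 2"
    using norm_Lam_strip[of e] q chi e by blast
  obtain C2 where C2: "C2 \<ge> 0" "\<And>w. \<bar>Re w\<bar> \<le> 1 \<Longrightarrow> norm (afe_kernel e w) \<le> C2 / (1 + (Im w)\<^sup>2)\<^sup>2"
    using norm_afe_kernel_le[of 1 e] by blast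
  have hol: "F holomorphic_on {z. -1 \<le> Re z \<and> Re z \<le> 1}"
  proof -
    have "(Lam q chi \<circ> (\<lambda>w. 1 / 2 + w)) holomorphic_on {z. -1 \<le> Re z \<and> Re z \<le> 1}"
      by (rule holomorphic_on_compose_gen[OF _ holomorphic_Lam[OF q chi, of UNIV]]) (auto intro!: holomorphic_intros)
    then show ?thesis unfolding F_def o_def
      by (intro holomorphic_intros holomorphic_afe_kernel)
  qed
  have bound: "norm (F z / z) \<le> (C1 * real (N q) ^ 2 * C2) / (1 + (Im z)\<^sup>2)"
    if z: "-1 \<le> Re z" "Re z \<le> 1" "\<bar>Im z\<bar> \<ge> 1" for z
  proof -
    have z1: "norm z \<ge> 1" using abs_Im_le_cmod[of z] z by linarith
    have "C2 / (1 + (Im z)\<^sup>2)\<^sup>2 \<le> C2 / (1 + (Im z)\<^sup>2)"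
    proof (intro divide_left_mono C2)
      have "1 \<le> 1 + (Im z)\<^sup>2" by simp
      then show "1 + (Im z)\<^sup>2 \<le> (1 + (Im z)\<^sup>2)\<^sup>2" by (rule self_le_power) simp
      show "0 < (1 + (Im z)\<^sup>2)\<^sup>2 * (1 + (Im z)\<^sup>2)" by (intro mult_pos_pos zero_less_power add_pos_nonneg) auto
    qed
    then have "norm (afe_kernel e z) \<le> C2 / (1 + (Im z)\<^sup>2)" using C2(2)[of z] z by fastforce
    then have "norm (F z) \<le> C1 * real (N q) ^ 2 * (C2 / (1 + (Im z)\<^sup>2))"
      unfolding F_def norm_mult using z C1 by (intro mult_mono C1(2)) auto
    moreover have "norm (F z / z) \<le> norm (F z)"
      unfolding norm_divide using z1 frac_le[of "norm (F z)" "norm (F z)" 1 "norm z"] by simp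
    ultimately show ?thesis by simp
  qed
  note S = vertical_line_shift_pole[of "-1" 1, OF _ _ hol bound, simplified]
  define I where "I = (LBINT y. F (Complex 1 y) / Complex 1 y)"
  obtain \<kappa> where \<kappa>: "norm \<kappa> = 1" "\<And>s. Lam q chi s = \<kappa> * cnj (Lam q chi (1 - cnj s))"
    by (rule Lam_functional_equation[OF q chi]) blast
  have refl: "F (Complex (-1) y) / Complex (-1) y = (- \<kappa>) * cnj (F (Complex 1 y) / Complex 1 y)" for y
  proof -
    have c: "Complex (-1) y = - cnj (Complex 1 y)" by (simp add: complex_eq_iff)
    have "1 - cnj (1 / 2 + - cnj (Complex 1 y)) = 1 / 2 + Complex 1 y" by (simp add: complex_eq_iff)
    then have "Lam q chi (1 / 2 + - cnj (Complex 1 y)) = \<kappa> * cnj (Lam q chi (1 / 2 + Complex 1 y))"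
      using \<kappa>(2)[of "1 / 2 + - cnj (Complex 1 y)"] by simp
    moreover have "afe_kernel e (- cnj (Complex 1 y)) = cnj (afe_kernel e (Complex 1 y))"
      using arg_cong[OF afe_kernel_reflect[of e "Complex 1 y"], of cnj] by simp
    ultimately show ?thesis unfolding c F_def by simp
  qed
  have "(LBINT y. F (Complex (-1) y) / Complex (-1) y) = (- \<kappa>) * cnj I"
    unfolding refl I_def
    by (simp only: integral_mult_right_zero Bochner_Integration.integral_cnj[of lborel "\<lambda>y. F (Complex 1 y) / Complex 1 y"])
  moreover have "F 0 = Lam q chi (1 / 2)"
  proof -
    have 1: "(\<Prod>j<d. (1 / 2 + \<mu> e j + 0) / (1 / 2 + \<mu> e j)) = 1"
      by (rule prod.neutral) (use nz in simp)
    have 2: "(\<Prod>j<d. (cnj (1 / 2 + \<mu> e j) - 0) / cnj (1 / 2 + \<mu> e j)) = 1"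
    proof (rule prod.neutral, rule ballI)
      fix j assume "j \<in> {..<d}"
      then have "cnj (1 / 2 + \<mu> e j) \<noteq> 0" using nz by (simp only: complex_cnj_zero_iff lessThan_iff) blast
      then show "(cnj (1 / 2 + \<mu> e j) - 0) / cnj (1 / 2 + \<mu> e j) = 1" unfolding diff_zero by (rule divide_self)
    qed
    show ?thesis unfolding F_def afe_kernel_def 1 2 by simp
  qed
  ultimately have "I + \<kappa> * cnj I = 2 * pi * Lam q chi (1 / 2)"
    using S(3) by (simp add: I_def)
  then have "2 * pi * norm (Lam q chi (1 / 2)) = norm (I + \<kappa> * cnj I)"
    by (simp add: norm_mult)
  also have "\<dots> \<le> norm I + norm (\<kappa> * cnj I)" by (rule norm_triangle_ineq)
  also have "\<dots> = 2 * norm I" using \<kappa>(1) by (simp add: norm_mult)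
  finally show ?thesis by (simp add: I_def F_def)
qed

text \<open>On \<open>Re w = 1\<close> the argument \<open>1 / 2 + w\<close> has real part
  \<open>3 / 2\<close>, where the Dirichlet series converges absolutely and may be integrated term
  by term.\<close>

lemma afe_integral_eq_sum:
  assumes q: "q \<ge> 2" and chi: "chi \<in> primitive_characters q" and e: "chi (-1) = e"
    and nz: "\<forall>j<d. 1 / 2 + \<mu> e j \<noteq> 0"
  shows "(LBINT y. Lam q chi (1 / 2 + Complex 1 y) * afe_kernel e (Complex 1 y) / Complex 1 y)
     = of_nat (N q) powr (1 / 4) * (\<Sum>n. twist lamF chi n / of_nat n powr (1 / 2) * mellin_weight (afe_weight e) 1 (N q) n)"
    (is ?eq)
    and "summable (\<lambda>n. twist lamF chi n / of_nat n powr (1 / 2) * mellin_weight (afe_weight e) 1 (N q) n)" (is ?summ)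
proof -
  have mu: "Re (\<mu> e j) > -1" if "j < d" for j by (rule Re_mu_parity[OF q chi e that])
  interpret decaying_weight "afe_weight e" by (rule decaying_afe_weight[OF mu])
  define t where "t n y = twist lamF chi n / of_nat n powr (1 / 2) * of_nat (N q) powr (1 / 4) *
     (of_nat (N q) powr (Complex 1 y / 2) / of_nat n powr (Complex 1 y) * afe_weight e (Complex 1 y))" for n y
  have Npos: "N q > 0" using conductor_pos[OF q chi] .
  have t_eq: "t n y = twist lamF chi n / of_nat n powr (1 / 2 + Complex 1 y) *
      (of_nat (N q) powr ((1 / 2 + Complex 1 y) / 2) * afe_weight e (Complex 1 y))" for n y
    by (simp add: t_def powr_add add_divide_distrib mult_ac)
  have sums: "Lam q chi (1 / 2 + Complex 1 y) * afe_kernel e (Complex 1 y) / Complex 1 y = (\<Sum>n. t n y)" for y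
  proof -
    have s: "Re (1 / 2 + Complex 1 y) > 1" by simp
    have "(\<Sum>n. t n y) = (\<Sum>n. twist lamF chi n / of_nat n powr (1 / 2 + Complex 1 y)) *
      (of_nat (N q) powr ((1 / 2 + Complex 1 y) / 2) * afe_weight e (Complex 1 y))"
      unfolding t_eq by (rule suminf_mult2[symmetric], rule summable_norm_cancel, rule summable_twist[OF q chi s])
    also have "\<dots> = dirichlet_series (twist lamF chi) (1 / 2 + Complex 1 y) *
      (of_nat (N q) powr ((1 / 2 + Complex 1 y) / 2) * afe_weight e (Complex 1 y))"
      by (simp only: dirichlet_series_twist_eq[OF q chi s])
    also have "\<dots> = Lam q chi (1 / 2 + Complex 1 y) * afe_kernel e (Complex 1 y) / Complex 1 y"
      unfolding Lam_eq[OF q chi s] L_infinity_def e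
      by (subst afe_weight_eq[OF mu nz[rule_format]]) (simp_all add: mult_ac)
    finally show ?thesis by simp
  qed
  define W where "W = (LBINT y. norm (afe_weight e (Complex 1 y)))"
  have int_norm: "integrable lborel (\<lambda>y. norm (afe_weight e (Complex 1 y)))"
    using integrable_line[of 1] by (intro integrable_norm) auto
  have norm_t: "norm (t n y) = norm (twist lamF chi n / of_nat n powr (of_real (3 / 2))) * real (N q) powr (3 / 4) * norm (afe_weight e (Complex 1 y))" for n y
    unfolding t_eq norm_mult norm_divide norm_of_nat_powr by simp
  have int_t: "integrable lborel (t n)" for n
  proof (rule Bochner_Integration.integrable_bound)
    show "integrable lborel (\<lambda>y. norm (twist lamF chi n / of_nat n powr (of_real (3 / 2))) * real (N q) powr (3 / 4) * norm (afe_weight e (Complex 1 y)))"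
      using int_norm by simp
    have "continuous_on UNIV (t n)"
    proof (cases "n = 0")
      case False
      then show ?thesis unfolding t_def using Npos
        by (intro continuous_intros continuous_on_line) (auto simp: Complex_eq intro!: continuous_intros)
    qed (simp add: t_def)
    then show "t n \<in> borel_measurable lborel" using borel_measurable_continuous_onI by auto
  qed (simp add: norm_t)
  have sum32: "summable (\<lambda>n. norm (twist lamF chi n / of_nat n powr (of_real (3 / 2))))"
    by (rule summable_twist[OF q chi]) simp
  have AE: "AE y in lborel. summable (\<lambda>n. norm (t n y))"
    unfolding norm_t by (intro AE_I2 summable_mult2 sum32)
  have summ_norm: "summable (\<lambda>n. LBINT y. norm (t n y))"
    unfolding norm_t integral_mult_right_zero by (intro summable_mult2 sum32)
  have "summable (\<lambda>n. LBINT y. t n y)"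
    by (rule summable_integral[OF int_t AE summ_norm])
  then have "summable (\<lambda>n. of_nat (N q) powr (1 / 4) * (twist lamF chi n / of_nat n powr (1 / 2) * mellin_weight (afe_weight e) 1 (N q) n))"
    unfolding t_def mellin_weight_def integral_mult_right_zero by (simp add: mult_ac)
  then have summ: ?summ
    by (rule summable_mult_D) (use Npos in simp)
  have "(LBINT y. (\<Sum>n. t n y)) = (\<Sum>n. LBINT y. t n y)"
    by (rule integral_suminf[OF int_t AE summ_norm])
  also have "\<dots> = (\<Sum>n. of_nat (N q) powr (1 / 4) * (twist lamF chi n / of_nat n powr (1 / 2) * mellin_weight (afe_weight e) 1 (N q) n))"
    unfolding t_def mellin_weight_def integral_mult_right_zero by (simp add: mult_ac)
  also have "\<dots> = of_nat (N q) powr (1 / 4) * (\<Sum>n. twist lamF chi n / of_nat n powr (1 / 2) * mellin_weight (afe_weight e) 1 (N q) n)"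
    by (rule suminf_mult[OF summ])
  finally show ?eq by (simp only: sums)
  show ?summ by (rule summ)
qed

lemma approximate_functional_equation:
  "\<exists>h. decaying_weight h \<and> (\<forall>q chi. q \<ge> 2 \<longrightarrow> chi \<in> primitive_characters q \<longrightarrow> chi (-1) = e \<longrightarrow>
     norm (L_twist lamF chi (1 / 2)) \<le>
     norm (\<Sum>n. twist lamF chi n / of_nat n powr (1 / 2) * mellin_weight h 1 (N q) n))"
\<comment> \<open>If no character has parity \<open>e\<close> the claim is vacuous, and if a Gamma
  factor has a pole at the central point the value is 0; the zero weight serves both cases.\<close>
proof (cases "(\<exists>q chi. q \<ge> 2 \<and> chi \<in> primitive_characters q \<and> chi (-1) = e) \<and> (\<forall>j<d. 1 / 2 + \<mu> e j \<noteq> 0)")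
  case False
  then show ?thesis
    using L_twist_half_eq_0 decaying_weight_0 by (intro exI[of _ "\<lambda>_. 0"]) fastforce
next
  case True
  then have mu: "\<And>j. j < d \<Longrightarrow> Re (\<mu> e j) > -1" using Re_mu_parity by blast
  \<comment> \<open>The \<open>pi\<close> comes from \<open>afe_half_bound\<close>; the powers of
    \<open>N q\<close> cancel, so that the weight depends on the parity only.\<close>
  define k where "k = norm (inv_gam e (1 / 2)) / pi"
  define h where "h = (\<lambda>w. of_real k * afe_weight e w)"
  show ?thesis
  proof (intro exI[of _ h] conjI allI impI)
    show "decaying_weight h" unfolding h_def by (intro decaying_weight_cmult decaying_afe_weight mu)
    fix q chi assume *: "q \<ge> 2" "chi \<in> primitive_characters q" "chi (-1) = e"
    define S where "S = (\<Sum>n. twist lamF chi n / of_nat n powr (1 / 2) * mellin_weight (afe_weight e) 1 (N q) n)"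
    define T where "T = (\<Sum>n. twist lamF chi n / of_nat n powr (1 / 2) * mellin_weight h 1 (N q) n)"
    have nz: "\<forall>j<d. 1 / 2 + \<mu> e j \<noteq> 0" using True by blast
    have le: "pi * norm (Lam q chi (1 / 2)) \<le> real (N q) powr (1 / 4) * norm S"
      using afe_half_bound[OF * nz] unfolding afe_integral_eq_sum(1)[OF * nz] S_def[symmetric]
      by (simp add: norm_mult norm_of_nat_powr)
    have N0: "real (N q) powr (1 / 4) * real (N q) powr (- 1 / 4) = 1"
      using N_pos[OF *(1,2)] by (simp add: powr_add[symmetric])
    have k0: "k \<ge> 0" by (simp add: k_def)
    have "norm (L_twist lamF chi (1 / 2)) = norm (Lam q chi (1 / 2)) * real (N q) powr (- 1 / 4) * norm (inv_gam e (1 / 2))"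
      unfolding L_twist_eq(2)[OF *(1,2)] norm_mult norm_of_nat_powr *(3) by simp
    also have "\<dots> = k * real (N q) powr (- 1 / 4) * (pi * norm (Lam q chi (1 / 2)))"
      by (simp add: k_def)
    also have "\<dots> \<le> k * real (N q) powr (- 1 / 4) * (real (N q) powr (1 / 4) * norm S)"
      using k0 by (intro mult_left_mono le) auto
    also have "\<dots> = k * norm S * (real (N q) powr (1 / 4) * real (N q) powr (- 1 / 4))" by simp
    also have "\<dots> = norm (of_real k * S)" unfolding N0 using k0 by (simp add: norm_mult)
    also have "of_real k * S = T"
      unfolding S_def T_def h_def mellin_weight_cmult
      by (subst suminf_mult[symmetric, OF afe_integral_eq_sum(2)[OF * nz]]) (simp_all add: mult_ac)
    finally show "norm (L_twist lamF chi (1 / 2)) \<le>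
        norm (\<Sum>n. twist lamF chi n / of_nat n powr (1 / 2) * mellin_weight h 1 (N q) n)"
      unfolding T_def .
  qed
qed

end

section \<open>The logarithm of the L-function in a zero-free region\<close>

text \<open>By the mean value theorem each term from \<open>n = 2\<close> on is at most a difference
  of consecutive values of \<open>n powr (- \<kappa>) / \<kappa>\<close>, so the partial sums
  telescope.\<close>

lemma powr_series_bound:
  fixes \<kappa> :: real
  assumes k: "\<kappa> > 0"
  shows "summable (\<lambda>n. 1 / real n powr (1 + \<kappa>))" "(\<Sum>n. 1 / real n powr (1 + \<kappa>)) \<le> 1 + 1 / \<kappa>"
proof -
  have step: "1 / real (Suc n) powr (1 + \<kappa>) \<le> (real n powr (- \<kappa>) - real (Suc n) powr (- \<kappa>)) / \<kappa>" if n: "n \<ge> 1" for n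
  proof -
    have "\<exists>z. real n < z \<and> z < real n + 1 \<and> (real n + 1) powr (- \<kappa>) - real n powr (- \<kappa>) = ((real n + 1) - real n) * (- \<kappa> * z powr (- \<kappa> - 1))"
      using n by (intro MVT2) (auto intro!: derivative_eq_intros simp: powr_diff)
    then obtain z where z: "real n < z" "z < real n + 1"
      "(real n + 1) powr (- \<kappa>) - real n powr (- \<kappa>) = - \<kappa> * z powr (- \<kappa> - 1)" by auto
    have "(real n + 1) powr (- \<kappa> - 1) \<le> z powr (- \<kappa> - 1)"
      using z n k by (intro powr_mono2') auto
    then have "\<kappa> * (real n + 1) powr (- \<kappa> - 1) \<le> \<kappa> * z powr (- \<kappa> - 1)"
      using k by (intro mult_left_mono) auto
    then have "\<kappa> * (real n + 1) powr (- \<kappa> - 1) \<le> real n powr (- \<kappa>) - (real n + 1) powr (- \<kappa>)"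
      using z(3) by linarith
    then have "(real n + 1) powr (- \<kappa> - 1) \<le> (real n powr (- \<kappa>) - (real n + 1) powr (- \<kappa>)) / \<kappa>"
      using k by (simp only: pos_le_divide_eq mult.commute)
    moreover have "1 / real (Suc n) powr (1 + \<kappa>) = (real n + 1) powr (- \<kappa> - 1)"
    proof -
      have e: "- \<kappa> - 1 = - (1 + \<kappa>)" by simp
      show ?thesis unfolding e powr_minus_divide by (simp add: add.commute)
    qed
    ultimately show ?thesis by (simp add: add.commute)
  qed
  have part: "(\<Sum>i<n. 1 / real i powr (1 + \<kappa>)) \<le> 1 + 1 / \<kappa>" for n
  proof -
    have "(\<Sum>i<Suc (Suc m). 1 / real i powr (1 + \<kappa>)) \<le> 1 + (1 - real (Suc m) powr (- \<kappa>)) / \<kappa>" for m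
    proof (induction m)
      case (Suc m)
      then show ?case using step[of "Suc m"] by (simp add: diff_divide_distrib)
    qed simp
    moreover have "1 + (1 - real (Suc m) powr (- \<kappa>)) / \<kappa> \<le> 1 + 1 / \<kappa>" for m
      using k by (simp add: divide_right_mono)
    moreover have "(\<Sum>i<n. 1 / real i powr (1 + \<kappa>)) \<le> (\<Sum>i<Suc (Suc n). 1 / real i powr (1 + \<kappa>))"
      by (intro sum_mono2) auto
    ultimately show ?thesis by (meson order_trans)
  qed
  show summ: "summable (\<lambda>n. 1 / real n powr (1 + \<kappa>))"
    by (rule summableI_nonneg_bounded[OF _ part]) auto
  show "(\<Sum>n. 1 / real n powr (1 + \<kappa>)) \<le> 1 + 1 / \<kappa>"
    by (rule suminf_le_const[OF summ part])
qed

text \<open>The radius \<open>3 / 5\<close> exceeds \<open>2 powr (- 3 / 4)\<close>, the largest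
  modulus of \<open>1 / p powr s\<close> for a prime \<open>p\<close> and
  \<open>Re s \<ge> 3 / 4\<close>.\<close>

lemma norm_neg_Ln_minus_linear_le:
  fixes z :: complex
  assumes "norm z \<le> 3 / 5"
  shows "norm (- Ln (1 - z) - z) \<le> 5 / 2 * (norm z)\<^sup>2"
proof -
  have "norm (ln (1 + (- z)) - (- z)) \<le> norm (- z) ^ 2 / (1 - norm (- z))"
    using assms by (intro Ln_approx_linear) simp
  also have "\<dots> \<le> norm z ^ 2 / (2 / 5)"
    using assms by (intro frac_le) auto
  finally have "norm (Ln (1 - z) + z) \<le> 5 / 2 * (norm z)\<^sup>2" by simp
  moreover have "- Ln (1 - z) - z = - (Ln (1 - z) + z)" by simp
  ultimately show ?thesis by (simp only: norm_minus_cancel)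
qed

lemma Re_one_minus_pos: "norm z < 1 \<Longrightarrow> Re (1 - z) > 0" for z :: complex
  using complex_Re_le_cmod[of z] by simp

context L_function_bounds
begin

definition log_local :: "(int \<Rightarrow> complex) \<Rightarrow> nat \<Rightarrow> complex \<Rightarrow> complex" where
  "log_local chi n s = (if prime n then \<Sum>j<d. - Ln (1 - \<alpha> j n * chi (int n) / of_nat n powr s) else 0)"

definition prime_term :: "(int \<Rightarrow> complex) \<Rightarrow> nat \<Rightarrow> complex \<Rightarrow> complex" where
  "prime_term chi n s = (if prime n then twist lamF chi n / of_nat n powr s else 0)"

definition prime_series :: "(int \<Rightarrow> complex) \<Rightarrow> complex \<Rightarrow> complex" where
  "prime_series chi s = (\<Sum>n. prime_term chi n s)"

text \<open>The contribution of the higher prime powers. Its terms have size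
  \<open>n powr (- 2 * Re s)\<close>, so it is bounded well to the left of \<open>Re s = 1\<close>,
  and continuing \<open>prime_series\<close> amounts to continuing the logarithm of the
  L-function.\<close>

definition log_remainder :: "(int \<Rightarrow> complex) \<Rightarrow> complex \<Rightarrow> complex" where
  "log_remainder chi s = (\<Sum>n. log_local chi n s - prime_term chi n s)"

lemma norm_local_root_le:
  assumes "q \<ge> 2" "chi \<in> primitive_characters q" "prime p" "j < d"
  shows "norm (\<alpha> j p * chi (int p) / of_nat p powr s) \<le> 1 / real p powr Re s"
proof -
  have "norm (\<alpha> j p) * norm (chi (int p)) \<le> 1 * 1"
    using norm_alpha_le_1[OF assms(3,4)] norm_character_le[OF primitive_imp_character[OF assms(2)]] assms(1)
    by (intro mult_mono) auto
  then show ?thesis unfolding norm_divide norm_mult norm_of_nat_powr by (intro divide_right_mono) auto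
qed

lemma prime_powr_le_3_5:
  assumes "prime p" "\<sigma> \<ge> 3 / 4"
  shows "1 / real p powr \<sigma> \<le> 3 / 5"
proof -
  have "(5 / 3 :: real) = (5 / 3) powr 1" by simp
  also have "(5 / 3 :: real) powr 1 = ((5 / 3) ^ 4) powr (1 / 4)"
    by (simp add: powr_powr flip: powr_numeral)
  \<comment> \<open>\<open>(5 / 3)^4 = 625 / 81 < 8\<close>.\<close>
  also have "\<dots> \<le> (2 ^ 3) powr (1 / 4)" by (intro powr_mono2) (auto simp: power_divide)
  also have "(2 ^ 3 :: real) powr (1 / 4) = (2 powr 3) powr (1 / 4)" by simp
  also have "\<dots> = 2 powr (3 / 4)" unfolding powr_powr by simp
  also have "\<dots> \<le> real p powr (3 / 4)" using prime_ge_2_nat[OF assms(1)] by (intro powr_mono2) auto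
  also have "\<dots> \<le> real p powr \<sigma>" using prime_ge_1_nat[OF assms(1)] assms(2) by (intro powr_mono) auto
  finally show ?thesis using frac_le[of 1 1 "5 / 3" "real p powr \<sigma>"] by simp
qed

lemma prime_term_eq:
  assumes "prime n"
  shows "prime_term chi n s = (\<Sum>j<d. \<alpha> j n * chi (int n) / of_nat n powr s)"
  using assms by (simp add: prime_term_def twist_def lamF_prime sum_distrib_right sum_divide_distrib)

lemma norm_prime_term_le:
  assumes "q \<ge> 2" "chi \<in> primitive_characters q"
  shows "norm (prime_term chi n s) \<le> real d * (1 / real n powr Re s)"
proof (cases "prime n")
  case True
  have "norm (prime_term chi n s) \<le> (\<Sum>j<d. 1 / real n powr Re s)"
    unfolding prime_term_eq[OF True] using norm_local_root_le[OF assms True]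
    by (intro order_trans[OF norm_sum] sum_mono) auto
  then show ?thesis by simp
qed (simp add: prime_term_def)

lemma norm_log_remainder_term_le:
  assumes q: "q \<ge> 2" "chi \<in> primitive_characters q" and s: "Re s \<ge> 3 / 4"
  shows "norm (log_local chi n s - prime_term chi n s) \<le> real d * (5 / 2) * (1 / real n powr (1 + 1 / 2))"
proof (cases "prime n")
  case True
  have "norm (log_local chi n s - prime_term chi n s) =
      norm (\<Sum>j<d. - Ln (1 - \<alpha> j n * chi (int n) / of_nat n powr s) - \<alpha> j n * chi (int n) / of_nat n powr s)"
    unfolding prime_term_eq[OF True] using True by (simp add: log_local_def sum_subtractf)
  also have "\<dots> \<le> (\<Sum>j<d. 5 / 2 * (1 / real n powr (1 + 1 / 2)))"
  proof (intro order_trans[OF norm_sum] sum_mono)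
    fix j assume "j \<in> {..<d}"
    then have le: "norm (\<alpha> j n * chi (int n) / of_nat n powr s) \<le> 1 / real n powr Re s"
      using norm_local_root_le[OF q True] by simp
    then have "norm (\<alpha> j n * chi (int n) / of_nat n powr s) \<le> 3 / 5"
      using prime_powr_le_3_5[OF True s] by linarith
    then have "norm (- Ln (1 - \<alpha> j n * chi (int n) / of_nat n powr s) - \<alpha> j n * chi (int n) / of_nat n powr s)
        \<le> 5 / 2 * (norm (\<alpha> j n * chi (int n) / of_nat n powr s))\<^sup>2"
      by (rule norm_neg_Ln_minus_linear_le)
    also have "\<dots> \<le> 5 / 2 * (1 / real n powr Re s)\<^sup>2"
      using le by (intro mult_left_mono power_mono) auto
    also have "(1 / real n powr Re s)\<^sup>2 = 1 / real n powr (2 * Re s)"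
      by (simp add: power2_eq_square powr_add[symmetric])
    also have "5 / 2 * (1 / real n powr (2 * Re s)) \<le> 5 / 2 * (1 / real n powr (1 + 1 / 2))"
      using prime_ge_1_nat[OF True] s by (intro mult_left_mono divide_left_mono powr_mono) auto
    finally show "norm (- Ln (1 - \<alpha> j n * chi (int n) / of_nat n powr s) - \<alpha> j n * chi (int n) / of_nat n powr s)
        \<le> 5 / 2 * (1 / real n powr (1 + 1 / 2))" .
  qed
  finally show ?thesis by simp
qed (simp add: log_local_def prime_term_def)

lemma holomorphic_prime_term: "prime_term chi n holomorphic_on A"
proof (cases "prime n")
  case True
  then have "of_nat n \<noteq> (0 :: complex)" by auto
  then have "(\<lambda>s. twist lamF chi n / of_nat n powr s) holomorphic_on A"
    by (intro holomorphic_intros) auto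
  moreover have "prime_term chi n = (\<lambda>s. twist lamF chi n / of_nat n powr s)"
    using True by (simp add: prime_term_def fun_eq_iff)
  ultimately show ?thesis by simp
next
  case False
  then have "prime_term chi n = (\<lambda>_. 0)" by (simp add: prime_term_def fun_eq_iff)
  then show ?thesis by simp
qed

lemma holomorphic_log_local:
  assumes q: "q \<ge> 2" "chi \<in> primitive_characters q"
  shows "log_local chi n holomorphic_on {s. Re s > 3 / 4}"
proof (cases "prime n")
  case True
  then have nz: "of_nat n \<noteq> (0 :: complex)" by auto
  have "(\<lambda>s. - Ln (1 - \<alpha> j n * chi (int n) / of_nat n powr s)) holomorphic_on {s. Re s > 3 / 4}" if "j < d" for j
  proof (rule holomorphic_on_minus, rule holomorphic_on_Ln')
    fix s :: complex assume s: "s \<in> {s. Re s > 3 / 4}"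
    have "norm (\<alpha> j n * chi (int n) / of_nat n powr s) \<le> 3 / 5"
      using norm_local_root_le[OF q True that, of s] prime_powr_le_3_5[OF True, of "Re s"] s by auto
    then have "Re (1 - \<alpha> j n * chi (int n) / of_nat n powr s) > 0"
      by (intro Re_one_minus_pos) linarith
    then show "1 - \<alpha> j n * chi (int n) / of_nat n powr s \<notin> \<real>\<^sub>\<le>\<^sub>0"
      by (auto simp only: complex_nonpos_Reals_iff)
  next
    show "(\<lambda>s. 1 - \<alpha> j n * chi (int n) / of_nat n powr s) holomorphic_on {s. Re s > 3 / 4}"
      using nz by (intro holomorphic_intros) auto
  qed
  then have "(\<lambda>s. \<Sum>j<d. - Ln (1 - \<alpha> j n * chi (int n) / of_nat n powr s)) holomorphic_on {s. Re s > 3 / 4}"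
    by (intro holomorphic_on_sum) auto
  moreover have "log_local chi n = (\<lambda>s. \<Sum>j<d. - Ln (1 - \<alpha> j n * chi (int n) / of_nat n powr s))"
    using True by (simp add: log_local_def fun_eq_iff)
  ultimately show ?thesis by simp
next
  case False
  then have "log_local chi n = (\<lambda>_. 0)" by (simp add: log_local_def fun_eq_iff)
  then show ?thesis by simp
qed

lemma log_remainder_properties:
  assumes q: "q \<ge> 2" "chi \<in> primitive_characters q"
  shows "log_remainder chi holomorphic_on {s. Re s > 3 / 4}"
    and "Re s \<ge> 3 / 4 \<Longrightarrow> norm (log_remainder chi s) \<le> real d * (5 / 2) * 3"
    and "Re s \<ge> 3 / 4 \<Longrightarrow> summable (\<lambda>n. log_local chi n s - prime_term chi n s)"
proof -
  note Z = powr_series_bound[of "1/2"]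
  have summ: "summable (\<lambda>n. real d * (5 / 2) * (1 / real n powr (1 + 1 / 2)))"
    by (intro summable_mult Z(1)) simp
  show "log_remainder chi holomorphic_on {s. Re s > 3 / 4}"
    unfolding log_remainder_def
  proof (rule holomorphic_suminf_M_test[OF open_halfspace_Re_gt _ _ summ])
    show "(\<lambda>s. log_local chi n s - prime_term chi n s) holomorphic_on {s. Re s > 3 / 4}" for n
      by (intro holomorphic_on_diff holomorphic_log_local[OF q] holomorphic_prime_term)
    show "norm (log_local chi n s - prime_term chi n s) \<le> real d * (5 / 2) * (1 / real n powr (1 + 1 / 2))"
      if "s \<in> {s. Re s > 3 / 4}" for n s
      using that by (intro norm_log_remainder_term_le[OF q]) simp
  qed
  assume s: "Re s \<ge> 3 / 4"
  show "summable (\<lambda>n. log_local chi n s - prime_term chi n s)"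
    by (rule summable_comparison_test'[OF summ]) (rule norm_log_remainder_term_le[OF q s])
  have "norm (log_remainder chi s) \<le> (\<Sum>n. real d * (5 / 2) * (1 / real n powr (1 + 1 / 2)))"
    unfolding log_remainder_def by (rule norm_suminf_le[OF norm_log_remainder_term_le[OF q s] summ])
  also have "\<dots> = real d * (5 / 2) * (\<Sum>n. 1 / real n powr (1 + 1 / 2))"
    by (rule suminf_mult) (rule Z(1), simp)
  also have "\<dots> \<le> real d * (5 / 2) * 3"
    using Z(2) by (intro mult_left_mono) auto
  finally show "norm (log_remainder chi s) \<le> real d * (5 / 2) * 3" .
qed

lemma prime_series_properties:
  assumes q: "q \<ge> 2" "chi \<in> primitive_characters q" and k: "\<kappa> > 0"
  shows "prime_series chi holomorphic_on {s. Re s > 1 + \<kappa>}"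
    and "Re s \<ge> 1 + \<kappa> \<Longrightarrow> norm (prime_series chi s) \<le> real d * (1 + 1 / \<kappa>)"
    and "Re s \<ge> 1 + \<kappa> \<Longrightarrow> summable (\<lambda>n. norm (prime_term chi n s))"
proof -
  note Z = powr_series_bound[OF k]
  have summ: "summable (\<lambda>n. real d * (1 / real n powr (1 + \<kappa>)))"
    by (intro summable_mult Z(1))
  have term_le: "norm (prime_term chi n s) \<le> real d * (1 / real n powr (1 + \<kappa>))" if "Re s \<ge> 1 + \<kappa>" for n s
  proof (cases "n = 0")
    case False
    have "norm (prime_term chi n s) \<le> real d * (1 / real n powr Re s)" by (rule norm_prime_term_le[OF q])
    also have "\<dots> \<le> real d * (1 / real n powr (1 + \<kappa>))"
      using False that by (intro mult_left_mono divide_left_mono powr_mono) auto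
    finally show ?thesis .
  qed (simp add: prime_term_def)
  show "prime_series chi holomorphic_on {s. Re s > 1 + \<kappa>}"
    unfolding prime_series_def
  proof (rule holomorphic_suminf_M_test[OF open_halfspace_Re_gt _ _ summ])
    show "prime_term chi n holomorphic_on {s. Re s > 1 + \<kappa>}" for n
      by (rule holomorphic_prime_term)
    show "norm (prime_term chi n s) \<le> real d * (1 / real n powr (1 + \<kappa>))" if "s \<in> {s. Re s > 1 + \<kappa>}" for n s
      using that by (intro term_le) simp
  qed
  assume s: "Re s \<ge> 1 + \<kappa>"
  show "summable (\<lambda>n. norm (prime_term chi n s))"
    by (rule summable_comparison_test'[OF summ]) (use term_le[OF s] in simp)
  have "norm (prime_series chi s) \<le> (\<Sum>n. real d * (1 / real n powr (1 + \<kappa>)))"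
    unfolding prime_series_def by (rule norm_suminf_le[OF term_le[OF s] summ])
  also have "\<dots> = real d * (\<Sum>n. 1 / real n powr (1 + \<kappa>))"
    by (rule suminf_mult[OF Z(1)])
  also have "\<dots> \<le> real d * (1 + 1 / \<kappa>)"
    using Z(2) by (intro mult_left_mono) auto
  finally show "norm (prime_series chi s) \<le> real d * (1 + 1 / \<kappa>)" .
qed

lemma holomorphic_prime_series:
  assumes q: "q \<ge> 2" "chi \<in> primitive_characters q"
  shows "prime_series chi holomorphic_on {s. Re s > 1}"
proof -
  have "prime_series chi field_differentiable at s" if s: "Re s > 1" for s
  proof -
    define k where "k = (Re s - 1) / 2"
    have k: "k > 0" "Re s > 1 + k" using s by (auto simp: k_def field_simps)
    show ?thesis
      using prime_series_properties(1)[OF q k(1)] k(2)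
      by (auto intro: holomorphic_on_imp_differentiable_at simp: open_halfspace_Re_gt)
  qed
  then show ?thesis
    by (auto simp: holomorphic_on_def intro: field_differentiable_at_within)
qed

text \<open>Exponentials of partial sums of \<open>log_local\<close> are partial products of the
  Euler product; comparing limits after exponentiation avoids choosing a branch of the logarithm of
  the L-function.\<close>

lemma L_twist_eq_exp:
  assumes q: "q \<ge> 2" "chi \<in> primitive_characters q" and s: "Re s > 1"
  shows "L_twist lamF chi s = exp (prime_series chi s + log_remainder chi s)"
proof -
  define k where "k = (Re s - 1)"
  have k: "k > 0" "Re s \<ge> 1 + k" using s by (auto simp: k_def)
  have s34: "Re s \<ge> 3 / 4" using s by simp
  have "summable (\<lambda>n. prime_term chi n s)"
    by (rule summable_norm_cancel[OF prime_series_properties(3)[OF q k]])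
  then have sums: "(\<lambda>n. prime_term chi n s + (log_local chi n s - prime_term chi n s)) sums (prime_series chi s + log_remainder chi s)"
    unfolding prime_series_def log_remainder_def
    by (intro sums_add summable_sums log_remainder_properties(3)[OF q s34])
  then have "(\<lambda>n. \<Sum>i<n. log_local chi i s) \<longlonglongrightarrow> prime_series chi s + log_remainder chi s"
    by (simp add: sums_def)
  then have 1: "(\<lambda>n. exp (\<Sum>i<n. log_local chi i s)) \<longlonglongrightarrow> exp (prime_series chi s + log_remainder chi s)"
    by (rule tendsto_exp)
  have local: "exp (log_local chi n s) = (if prime n then euler_factor d (\<lambda>j p. \<alpha> j p * chi (int p)) n s else 1)" for n
  proof (cases "prime n")
    case True
    have "exp (- Ln (1 - \<alpha> j n * chi (int n) / of_nat n powr s)) = inverse (1 - \<alpha> j n * chi (int n) / of_nat n powr s)" if "j < d" for j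
    proof -
      have "norm (\<alpha> j n * chi (int n) / of_nat n powr s) \<le> 3 / 5"
        using norm_local_root_le[OF q True that, of s] prime_powr_le_3_5[OF True s34] by linarith
      then have "Re (1 - \<alpha> j n * chi (int n) / of_nat n powr s) > 0"
        by (intro Re_one_minus_pos) linarith
      then have "1 - \<alpha> j n * chi (int n) / of_nat n powr s \<noteq> 0" by (metis less_irrefl zero_complex.sel(1))
      then show ?thesis by (simp add: exp_minus)
    qed
    then show ?thesis using True by (simp add: log_local_def euler_factor_def exp_sum)
  qed (simp add: log_local_def)
  have "(\<lambda>n. if prime n then euler_factor d (\<lambda>j p. \<alpha> j p * chi (int p)) n s else 1) has_prod dirichlet_series (twist lamF chi) s"
    using euler_product_twist[OF q] s unfolding has_euler_product_def by blast
  from has_prod_imp_tendsto'[OF this]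
  have 2: "(\<lambda>n. exp (\<Sum>i<n. log_local chi i s)) \<longlonglongrightarrow> dirichlet_series (twist lamF chi) s"
    by (simp add: exp_sum local)
  have "dirichlet_series (twist lamF chi) s = exp (prime_series chi s + log_remainder chi s)"
    by (rule LIMSEQ_unique[OF 2 1])
  then show ?thesis
    using L_twist_eq(1)[OF q] s by (simp add: is_entire_continuation_def)
qed

text \<open>On a convex region without zeros there is a holomorphic logarithm \<open>l\<close>. In
  \<open>Re s > 1\<close> it agrees with \<open>prime_series + log_remainder\<close> up to a
  constant, so subtracting the constant and the remainder continues \<open>prime_series\<close>. Its
  size comes from Borel-Caratheodory: only an upper bound for \<open>Re (l z)\<close>, the logarithm
  of the modulus of the L-function, is available.\<close>

lemma prime_series_continuation:
  "\<exists>C>0. \<forall>q chi \<delta> T. q \<ge> 2 \<longrightarrow> chi \<in> primitive_characters q \<longrightarrow> chi (-1) = e \<longrightarrow> 0 < \<delta> \<longrightarrow> \<delta> \<le> 1 / 4 \<longrightarrow> 4 \<le> T \<longrightarrow>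
     (\<forall>s. Re s > 1 - \<delta> \<and> \<bar>Im s\<bar> \<le> T \<longrightarrow> L_twist lamF chi s \<noteq> 0) \<longrightarrow>
     (\<exists>P. P holomorphic_on {s. Re s > 1 - \<delta> \<and> \<bar>Im s\<bar> < T} \<and>
        (\<forall>s. Re s > 1 \<and> \<bar>Im s\<bar> < T \<longrightarrow> P s = prime_series chi s) \<and>
        (\<forall>s. 1 - \<delta> / 2 \<le> Re s \<and> Re s \<le> 2 \<and> \<bar>Im s\<bar> \<le> T - 2 \<longrightarrow>
            norm (P s) \<le> C * (1 + ln (real (N q)) + T) / \<delta>))"
proof -
  obtain C0 where C0: "C0 > 0" "\<And>q chi s. q \<ge> 2 \<Longrightarrow> chi \<in> primitive_characters q \<Longrightarrow> chi (-1) = e \<Longrightarrow> 0 \<le> Re s \<Longrightarrow> Re s \<le> 4 \<Longrightarrow>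
     norm (L_twist lamF chi s) \<le> C0 * real (N q) ^ 2 * exp (C0 * \<bar>Im s\<bar>)"
    using norm_L_twist_le[of e] by blast
  define K where "K = real d * (5 / 2) * 3"
  have K0: "K \<ge> 0" by (simp add: K_def)
  define C where "C = 12 * (\<bar>ln C0\<bar> + 2 + C0 + 2 * K + 1) + 3 * K"
  have Cpos: "C > 0" using C0 K0 by (simp add: C_def add_nonneg_pos)
  show ?thesis
  proof (intro exI[of _ C] conjI allI impI Cpos)
    fix q chi \<delta> T
    assume q: "q \<ge> 2" "chi \<in> primitive_characters q" and e: "chi (-1) = e"
      and \<delta>: "0 < \<delta>" "\<delta> \<le> 1 / 4" and T: "4 \<le> (T::real)"
      and nz: "\<forall>s. Re s > 1 - \<delta> \<and> \<bar>Im s\<bar> \<le> T \<longrightarrow> L_twist lamF chi s \<noteq> 0"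
    define D where "D = {s. Re s > 1 - \<delta> \<and> \<bar>Im s\<bar> < T}"
    have D_eq: "D = {s. Re s > 1 - \<delta>} \<inter> {s. Im s < T} \<inter> {s. Im s > - T}"
      by (auto simp: D_def)
    have convD: "convex D" unfolding D_eq
      by (intro convex_Int convex_halfspace_Re_gt convex_halfspace_Im_lt convex_halfspace_Im_gt)
    have openD: "open D" unfolding D_eq
      by (intro open_Int open_halfspace_Re_gt open_halfspace_Im_lt open_halfspace_Im_gt)
    have Lhol: "L_twist lamF chi holomorphic_on A" for A
      using L_twist_eq(1)[OF q] holomorphic_on_subset by (auto simp: is_entire_continuation_def)
    have "2 \<in> D" using \<delta> T by (auto simp: D_def)
    then obtain l where l: "l holomorphic_on D" "\<And>s. s \<in> D \<Longrightarrow> exp (l s) = L_twist lamF chi s"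
      using holomorphic_logarithm_exists[OF convD openD Lhol, of 2] nz by (auto simp: D_def)
    define D1 where "D1 = D \<inter> {s. Re s > 1}"
    have convD1: "convex D1" and openD1: "open D1"
      unfolding D1_def using convD openD by (auto intro: convex_Int convex_halfspace_Re_gt open_Int open_halfspace_Re_gt)
    \<comment> \<open>Both logarithms have the same exponential, so \<open>exp (g s) = 1\<close> on
      \<open>D1\<close> and the derivative of \<open>g\<close> vanishes.\<close>
    define g where "g s = l s - (prime_series chi s + log_remainder chi s)" for s
    have ghol: "g holomorphic_on D1"
      unfolding g_def
      by (intro holomorphic_on_diff holomorphic_on_add holomorphic_on_subset[OF l(1)]
          holomorphic_on_subset[OF holomorphic_prime_series[OF q]]
          holomorphic_on_subset[OF log_remainder_properties(1)[OF q]]) (auto simp: D1_def)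
    have expg: "exp (g s) = 1" if "s \<in> D1" for s
      using that l(2)[of s] L_twist_eq_exp[OF q, of s] by (simp add: g_def exp_diff D1_def)
    have "\<exists>c. \<forall>s\<in>D1. g s = c"
    proof (rule has_field_derivative_zero_constant[OF convD1])
      fix s assume s: "s \<in> D1"
      have dg: "(g has_field_derivative deriv g s) (at s)" by (rule holomorphic_derivI[OF ghol openD1 s])
      then have "((\<lambda>s. exp (g s)) has_field_derivative exp (g s) * deriv g s) (at s)"
        by (auto intro!: derivative_eq_intros)
      moreover have "((\<lambda>s. exp (g s)) has_field_derivative 0) (at s)"
        by (rule has_field_derivative_transform_within_open[OF DERIV_const openD1 s]) (use expg in simp)
      ultimately have "exp (g s) * deriv g s = 0" by (rule DERIV_unique)
      then have "deriv g s = 0" by simp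
      then show "(g has_field_derivative 0) (at s within D1)"
        using dg by (simp add: has_field_derivative_at_within)
    qed
    then obtain c where c: "\<And>s. s \<in> D1 \<Longrightarrow> g s = c" by blast
    define P where "P s = l s - c - log_remainder chi s" for s
    have P_eq: "P s = prime_series chi s" if "s \<in> D1" for s
      using c[OF that] by (simp add: P_def g_def algebra_simps)
    have R34: "D \<subseteq> {s. Re s > 3 / 4}" using \<delta> by (auto simp: D_def)
    show "\<exists>P. P holomorphic_on {s. Re s > 1 - \<delta> \<and> \<bar>Im s\<bar> < T} \<and>
        (\<forall>s. Re s > 1 \<and> \<bar>Im s\<bar> < T \<longrightarrow> P s = prime_series chi s) \<and>
        (\<forall>s. 1 - \<delta> / 2 \<le> Re s \<and> Re s \<le> 2 \<and> \<bar>Im s\<bar> \<le> T - 2 \<longrightarrow>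
            norm (P s) \<le> C * (1 + ln (real (N q)) + T) / \<delta>)"
    proof (intro exI[of _ P] conjI allI impI)
      show "P holomorphic_on {s. Re s > 1 - \<delta> \<and> \<bar>Im s\<bar> < T}"
        unfolding P_def D_def[symmetric]
        by (intro holomorphic_intros l(1) holomorphic_on_subset[OF log_remainder_properties(1)[OF q] R34])
      show "P s = prime_series chi s" if "Re s > 1 \<and> \<bar>Im s\<bar> < T" for s
        using that \<delta> by (intro P_eq) (auto simp: D1_def D_def)
      fix s assume s: "1 - \<delta> / 2 \<le> Re s \<and> Re s \<le> 2 \<and> \<bar>Im s\<bar> \<le> T - 2"
      define z0 where "z0 = Complex 2 (Im s)"
      \<comment> \<open>With centre at real part 2, the inner disc reaches
        \<open>1 - \<delta> / 2\<close>, the outer one stays to the right of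
        \<open>1 - \<delta>\<close>, and the gap \<open>R - r = \<delta> / 4\<close> costs the
        factor \<open>1 / \<delta>\<close>. As \<open>R \<le> 2\<close>, a centre at height at most
        \<open>T - 2\<close> keeps the disc below height \<open>T\<close>.\<close>
      define R where "R = 1 + 3 * \<delta> / 4"
      define r where "r = 1 + \<delta> / 2"
      define f where "f z = l z - l z0" for z
      have lnN: "ln (real (N q)) \<ge> 0" using N_pos[OF q] by simp
      \<comment> \<open>The last summand 1 makes the inequality \<open>Re (f z) < A\<close>
        strict.\<close>
      define A where "A = \<bar>ln C0\<bar> + 2 * ln (real (N q)) + C0 * T + 2 * K + 1"
      have z0: "z0 \<in> D1" using s \<delta> T by (auto simp: z0_def D1_def D_def)
      have ball: "Re z > 1 - \<delta>" "Re z \<le> 4" "\<bar>Im z\<bar> < T" if "z \<in> ball z0 R" for z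
      proof -
        have "norm (z - z0) < R" using that by (simp add: dist_norm norm_minus_commute)
        then have "\<bar>Re z - 2\<bar> < R" "\<bar>Im z - Im s\<bar> < R"
          using abs_Re_le_cmod[of "z - z0"] abs_Im_le_cmod[of "z - z0"] by (auto simp: z0_def)
        moreover have "R \<le> 2" "R < 1 + \<delta>" using \<delta> by (auto simp: R_def)
        ultimately show "Re z > 1 - \<delta>" "Re z \<le> 4" "\<bar>Im z\<bar> < T" using s by linarith+
      qed
      have ballD: "ball z0 R \<subseteq> D" using ball by (auto simp: D_def)
      have "norm (prime_series chi z0) \<le> real d * (1 + 1 / 1)"
        by (rule prime_series_properties(2)[OF q]) (simp_all add: z0_def)
      then have lz0: "norm (prime_series chi z0) \<le> K" by (simp add: K_def)
      have lz0': "norm (log_remainder chi z0) \<le> K"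
        unfolding K_def by (rule log_remainder_properties(2)[OF q]) (simp add: z0_def)
      have Rel: "Re (l z) = ln (norm (L_twist lamF chi z))" if "z \<in> D" for z
        using l(2)[OF that] by (metis ln_exp norm_exp_eq_Re)
      have "norm (f s) \<le> 2 * A * r / (R - r)"
      proof (rule Borel_Caratheodory[where f = f and z = s and z0 = z0])
        show "f holomorphic_on ball z0 R"
          unfolding f_def by (intro holomorphic_intros holomorphic_on_subset[OF l(1) ballD])
        show "f z0 = 0" by (simp add: f_def)
        show "dist z0 s \<le> r" using s \<delta> by (auto simp: z0_def r_def dist_complex_def cmod_def)
        show "0 \<le> r" "r < R" using \<delta> by (auto simp: r_def R_def)
        fix z assume z: "z \<in> ball z0 R"
        have zD: "z \<in> D" using z ballD by auto
        have nzz: "norm (L_twist lamF chi z) > 0" using nz ball[OF z] by simp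
        have "ln (norm (L_twist lamF chi z)) \<le> ln (C0 * real (N q) ^ 2 * exp (C0 * \<bar>Im z\<bar>))"
          using nzz C0(2)[OF q e, of z] ball[OF z] \<delta> by (intro ln_mono) auto
        also have "\<dots> = ln C0 + 2 * ln (real (N q)) + C0 * \<bar>Im z\<bar>"
          using C0(1) N_pos[OF q] by (simp add: ln_mult ln_realpow)
        also have "\<dots> \<le> \<bar>ln C0\<bar> + 2 * ln (real (N q)) + C0 * T"
          using ball[OF z] C0(1) by (intro add_mono mult_left_mono) auto
        finally have 1: "Re (l z) \<le> \<bar>ln C0\<bar> + 2 * ln (real (N q)) + C0 * T" using Rel[OF zD] by simp
        have "norm (L_twist lamF chi z0) = exp (Re (prime_series chi z0 + log_remainder chi z0))"
          using L_twist_eq_exp[OF q, of z0] by (simp add: z0_def norm_exp_eq_Re)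
        then have "Re (l z0) = Re (prime_series chi z0 + log_remainder chi z0)"
          using Rel[of z0] z0 by (simp add: D1_def)
        also have "\<dots> \<ge> - (2 * K)"
          using lz0 lz0' abs_Re_le_cmod[of "prime_series chi z0"] abs_Re_le_cmod[of "log_remainder chi z0"] by (simp add: abs_le_iff)
        finally have 2: "Re (l z0) \<ge> - (2 * K)" .
        show "Re (f z) < A" using 1 2 by (simp add: f_def A_def)
      qed
      \<comment> \<open>\<open>2 * r / (R - r) = 8 * r / \<delta>\<close> with
        \<open>r \<le> 3 / 2\<close>.\<close>
      also have "\<dots> \<le> 12 * A / \<delta>"
      proof -
        have A0: "A \<ge> 0" using lnN C0 T K0 by (simp add: A_def)
        have "R - r = \<delta> / 4" by (simp add: R_def r_def)
        then have "2 * A * r / (R - r) = 8 * A * r / \<delta>" by (simp only:) simp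
        also have "\<dots> \<le> 12 * A / \<delta>"
          using A0 \<delta> by (intro divide_right_mono) (auto simp: r_def intro!: mult_left_mono[of "1 + \<delta> / 2" "3 / 2" "8 * A", simplified])
        finally show ?thesis .
      qed
      finally have fs: "norm (f s) \<le> 12 * A / \<delta>" .
      have Peq: "P s = f s + (prime_series chi z0 + log_remainder chi z0) - log_remainder chi s"
        using c[OF z0] by (simp add: P_def f_def g_def algebra_simps)
      have "norm (P s) \<le> norm (f s) + (norm (prime_series chi z0) + norm (log_remainder chi z0)) + norm (log_remainder chi s)"
        unfolding Peq using norm_triangle_ineq4[of "f s + (prime_series chi z0 + log_remainder chi z0)" "log_remainder chi s"]
          norm_triangle_ineq[of "f s" "prime_series chi z0 + log_remainder chi z0"]
          norm_triangle_ineq[of "prime_series chi z0" "log_remainder chi z0"] by linarith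
      moreover have "norm (log_remainder chi s) \<le> K"
        using log_remainder_properties(2)[OF q, of s] s \<delta> by (simp add: K_def)
      ultimately have Ps: "norm (P s) \<le> 12 * A / \<delta> + 3 * K" using fs lz0 lz0' by linarith
      define X where "X = 1 + ln (real (N q)) + T"
      have X: "1 \<le> X" "ln (real (N q)) \<le> X" "T \<le> X" using lnN T by (auto simp: X_def)
      have "A \<le> (\<bar>ln C0\<bar> + 2 + C0 + 2 * K + 1) * X"
      proof -
        have "\<bar>ln C0\<bar> * 1 \<le> \<bar>ln C0\<bar> * X" "C0 * T \<le> C0 * X" "(2 * K + 1) * 1 \<le> (2 * K + 1) * X"
          using mult_left_mono[OF X(1), of "\<bar>ln C0\<bar>"] mult_left_mono[OF X(3), of C0]
            mult_left_mono[OF X(1), of "2 * K + 1"] C0(1) K0 by simp_all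
        then show ?thesis using X by (simp add: A_def algebra_simps)
      qed
      then have "12 * A / \<delta> \<le> 12 * ((\<bar>ln C0\<bar> + 2 + C0 + 2 * K + 1) * X) / \<delta>"
        using \<delta> by (intro divide_right_mono) auto
      moreover have "3 * K \<le> 3 * K * X / \<delta>"
      proof -
        have "\<delta> * 1 \<le> 1 * X" using \<delta> X by (intro mult_mono) auto
        then have "3 * K * \<delta> \<le> 3 * K * X" using K0 by (intro mult_left_mono) auto
        then show ?thesis using \<delta> by (simp add: pos_le_divide_eq)
      qed
      ultimately have "norm (P s) \<le> 12 * ((\<bar>ln C0\<bar> + 2 + C0 + 2 * K + 1) * X) / \<delta> + 3 * K * X / \<delta>"
        using Ps by linarith
      also have "\<dots> = C * X / \<delta>" by (simp add: C_def add_divide_distrib[symmetric] algebra_simps)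
      finally show "norm (P s) \<le> C * (1 + ln (real (N q)) + T) / \<delta>" by (simp only: X_def)
    qed
  qed
qed

end

section \<open>Smoothed sums over primes\<close>

text \<open>Near 0 the closed formula is useless and compactness is used; elsewhere its numerator is
  bounded for \<open>\<bar>Re w\<bar> \<le> 1\<close> and the denominator supplies the
  decay.\<close>

lemma norm_hat_transform_le:
  "\<exists>K\<ge>0. \<forall>w. \<bar>Re w\<bar> \<le> 1 \<longrightarrow> norm (hat_transform w) \<le> K * inverse (1 + (Im w)\<^sup>2)"
proof -
  have "hat_transform holomorphic_on UNIV"
    unfolding hat_transform_def by (intro holomorphic_intros holomorphic_expm1_quot)
  then have "continuous_on (cbox (Complex (-1) (-1)) (Complex 1 1)) hat_transform"
    using holomorphic_on_imp_continuous_on continuous_on_subset by blast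
  then have "compact (hat_transform ` cbox (Complex (-1) (-1)) (Complex 1 1))"
    by (intro compact_continuous_image) auto
  then obtain K0 where K0: "\<And>w. w \<in> cbox (Complex (-1) (-1)) (Complex 1 1) \<Longrightarrow> norm (hat_transform w) \<le> K0"
    by (meson bounded_iff compact_imp_bounded imageI)
  show ?thesis
  proof (intro exI[of _ "2 * \<bar>K0\<bar> + 2 * (2 + 2 * exp 1)"] conjI allI impI)
    fix w assume w: "\<bar>Re w\<bar> \<le> 1"
    have pos: "1 + (Im w)\<^sup>2 > 0" by (simp add: add_pos_nonneg)
    show "norm (hat_transform w) \<le> (2 * \<bar>K0\<bar> + 2 * (2 + 2 * exp 1)) * inverse (1 + (Im w)\<^sup>2)"
    proof (cases "\<bar>Im w\<bar> \<ge> 1")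
      case True
      then have "w \<noteq> 0" by auto
      have "exp (Re w) \<le> exp 1" "exp (- Re w) \<le> exp 1" using w by auto
      then have "norm (exp w) \<le> exp 1" "norm (exp (- w)) \<le> exp 1" by (simp_all add: norm_exp_eq_Re)
      then have "norm (exp w - 2 + exp (- w)) \<le> 2 + 2 * exp 1"
        using norm_triangle_ineq[of "exp w - 2" "exp (- w)"] norm_triangle_ineq4[of "exp w" 2] norm_numeral[of "num.Bit0 num.One", where ?'a = complex]
        by linarith
      then have "norm (exp w - 2 + exp (- w)) * (1 / (norm w)\<^sup>2) \<le> (2 + 2 * exp 1) * (2 / (1 + (Im w)\<^sup>2))"
        by (intro mult_mono inverse_norm_square_le True) auto
      moreover have "norm (hat_transform w) = norm (exp w - 2 + exp (- w)) * (1 / (norm w)\<^sup>2)"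
        by (simp add: hat_transform_eq[OF \<open>w \<noteq> 0\<close>] norm_divide norm_power)
      moreover have "(2 + 2 * exp 1) * (2 / (1 + (Im w)\<^sup>2)) = (2 * (2 + 2 * exp 1)) * inverse (1 + (Im w)\<^sup>2)"
        by (simp add: divide_inverse)
      ultimately have "norm (hat_transform w) \<le> (2 * (2 + 2 * exp 1)) * inverse (1 + (Im w)\<^sup>2)"
        by linarith
      also have "\<dots> \<le> (2 * \<bar>K0\<bar> + 2 * (2 + 2 * exp 1)) * inverse (1 + (Im w)\<^sup>2)"
        using pos by (intro mult_right_mono) auto
      finally show ?thesis .
    next
      case False
      then have "norm (hat_transform w) \<le> \<bar>K0\<bar>"
        using K0[of w] w by (force simp: in_cbox_complex_iff abs_le_iff)
      also have "\<dots> \<le> 2 * \<bar>K0\<bar> * inverse (1 + (Im w)\<^sup>2)"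
      proof -
        have "(Im w)\<^sup>2 \<le> 1" using False by (simp add: abs_square_le_1)
        then have "\<bar>K0\<bar> * (1 + (Im w)\<^sup>2) \<le> \<bar>K0\<bar> * 2" by (intro mult_left_mono) auto
        then have "\<bar>K0\<bar> \<le> \<bar>K0\<bar> * 2 / (1 + (Im w)\<^sup>2)" using pos by (simp only: pos_le_divide_eq)
        then show ?thesis by (simp add: divide_inverse mult_ac)
      qed
      also have "\<dots> \<le> (2 * \<bar>K0\<bar> + 2 * (2 + 2 * exp 1)) * inverse (1 + (Im w)\<^sup>2)"
        using pos by (intro mult_right_mono) (auto simp: add_nonneg_nonneg)
      finally show ?thesis .
    qed
  qed (simp add: add_nonneg_nonneg)
qed

lemma holomorphic_hat_transform: "hat_transform holomorphic_on A"
  unfolding hat_transform_def by (intro holomorphic_intros holomorphic_expm1_quot)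

lemma inverse_le_scale: "inverse (2 * a) \<le> inverse (y * b) \<Longrightarrow> inverse a \<le> 2 / y * inverse b" for a b y :: real
proof -
  assume "inverse (2 * a) \<le> inverse (y * b)"
  then have "2 * inverse (2 * a) \<le> 2 * inverse (y * b)" by (rule mult_left_mono) simp
  moreover have "2 * inverse (2 * a) = inverse a" by (simp only: inverse_mult_distrib) simp
  moreover have "2 * inverse (y * b) = 2 / y * inverse b" by (simp only: inverse_mult_distrib divide_inverse mult.assoc)
  ultimately show "inverse a \<le> 2 / y * inverse b" by simp
qed

text \<open>The substitution \<open>y = Y * u\<close> moves the tail to
  \<open>\<bar>u\<bar> > 1\<close>, where \<open>1 / (1 + (Y * u)^2)\<close> is at most
  \<open>2 / Y^2\<close> times \<open>1 / (1 + u^2)\<close>.\<close>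

lemma integral_tail_inverse_1_plus_square:
  "\<exists>K\<ge>0. \<forall>Y>0. integrable lborel (\<lambda>y. indicator (- {-Y..Y}) y * inverse (1 + y\<^sup>2)) \<and>
     (LBINT y. indicator (- {-Y..Y}) y * inverse (1 + y\<^sup>2)) \<le> K / (Y::real)"
proof -
  define I where "I = (LBINT y. inverse (1 + y\<^sup>2 :: real))"
  have I0: "I \<ge> 0" unfolding I_def by (rule integral_nonneg_AE) (auto simp: add_nonneg_nonneg)
  show ?thesis
  proof (intro exI[of _ "2 * I"] conjI allI impI)
    fix Y :: real assume Y: "Y > 0"
    show "integrable lborel (\<lambda>y. indicator (- {-Y..Y}) y * inverse (1 + y\<^sup>2))"
      using integrable_mult_indicator[OF _ integrable_inverse_1_plus_square_lborel, of "- {-Y..Y}"]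
      by simp
    have "(LBINT y. indicator (- {-Y..Y}) y * inverse (1 + y\<^sup>2)) =
        Y * (LBINT u. indicator (- {-Y..Y}) (Y * u) * inverse (1 + (Y * u)\<^sup>2))"
      using lborel_integral_real_affine[of Y "\<lambda>y. indicator (- {-Y..Y}) y * inverse (1 + y\<^sup>2) :: real" 0] Y by simp
    also have "\<dots> \<le> Y * (LBINT u. 2 / Y\<^sup>2 * inverse (1 + u\<^sup>2))"
    proof (intro mult_left_mono integral_mono')
      show "integrable lborel (\<lambda>u. 2 / Y\<^sup>2 * inverse (1 + u\<^sup>2))"
        using integrable_inverse_1_plus_square_lborel by simp
      fix u :: real
      have pos: "1 + u\<^sup>2 > 0" by (simp add: add_pos_nonneg)
      then show "0 \<le> 2 / Y\<^sup>2 * inverse (1 + u\<^sup>2)" by simp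
      show "indicator (- {-Y..Y}) (Y * u) * inverse (1 + (Y * u)\<^sup>2) \<le> 2 / Y\<^sup>2 * inverse (1 + u\<^sup>2)"
      proof (cases "\<bar>u\<bar> \<le> 1")
        case True
        then have "u \<le> 1" "- u \<le> 1" by linarith+
        then have "Y * u \<le> Y * 1" "Y * (- u) \<le> Y * 1"
          using Y mult_left_mono[of u 1 Y] mult_left_mono[of "- u" 1 Y] by simp_all
        then have "Y * u \<in> {-Y..Y}" by auto
        then show ?thesis using pos by simp
      next
        case False
        then have "1 \<le> \<bar>u\<bar>\<^sup>2" by (intro one_le_power) auto
        then have "Y\<^sup>2 * 1 \<le> Y\<^sup>2 * u\<^sup>2" by (intro mult_left_mono) auto
        then have "Y\<^sup>2 * (1 + u\<^sup>2) \<le> 2 * (1 + (Y * u)\<^sup>2)"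
          by (simp add: power_mult_distrib algebra_simps)
        then have "inverse (2 * (1 + (Y * u)\<^sup>2)) \<le> inverse (Y\<^sup>2 * (1 + u\<^sup>2))"
          using Y pos by (intro le_imp_inverse_le) auto
        then have "inverse (1 + (Y * u)\<^sup>2) \<le> 2 / Y\<^sup>2 * inverse (1 + u\<^sup>2)"
          by (rule inverse_le_scale)
        moreover have "0 \<le> 2 / Y\<^sup>2 * inverse (1 + u\<^sup>2)" using pos by simp
        ultimately show ?thesis by (auto simp: indicator_def)
      qed
    qed (use Y in auto)
    also have "\<dots> = 2 * I / Y" using Y by (simp add: I_def power2_eq_square)
    finally show "(LBINT y. indicator (- {-Y..Y}) y * inverse (1 + y\<^sup>2)) \<le> 2 * I / Y" .
  qed (use I0 in simp)
qed

definition hat_primes :: "real \<Rightarrow> nat set" where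
  "hat_primes j = {p. prime p \<and> \<bar>ln (real p) - j\<bar> < 1}"

lemma hat_primes_bounds:
  assumes "p \<in> hat_primes j"
  shows "prime p" "exp (j - 1) < real p" "real p < exp (j + 1)"
proof -
  show p: "prime p" using assms by (simp add: hat_primes_def)
  have "real p > 0" using prime_gt_0_nat[OF p] by simp
  moreover have "j - 1 < ln (real p)" "ln (real p) < j + 1" using assms by (auto simp: hat_primes_def abs_less_iff)
  ultimately show "exp (j - 1) < real p" "real p < exp (j + 1)"
    by (metis exp_less_cancel_iff exp_ln)+
qed

lemma finite_hat_primes: "finite (hat_primes j)"
proof (rule finite_subset)
  show "hat_primes j \<subseteq> {..nat \<lceil>exp (j + 1)\<rceil>}"
    using hat_primes_bounds(3) by (force intro: order_trans[OF _ nat_mono] simp: le_nat_iff less_imp_le le_ceiling_iff)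
qed simp

lemma card_hat_primes_le: "real (card (hat_primes j)) \<le> exp (j + 1)"
proof -
  have "hat_primes j \<subseteq> {1..nat \<lfloor>exp (j + 1)\<rfloor>}"
  proof
    fix p assume p: "p \<in> hat_primes j"
    have "real p \<le> exp (j + 1)" using hat_primes_bounds(3)[OF p] by simp
    then have "p \<le> nat \<lfloor>exp (j + 1)\<rfloor>" by (simp add: le_nat_floor)
    then show "p \<in> {1..nat \<lfloor>exp (j + 1)\<rfloor>}" using prime_ge_1_nat[OF hat_primes_bounds(1)[OF p]] by simp
  qed
  then have "card (hat_primes j) \<le> nat \<lfloor>exp (j + 1)\<rfloor>"
    using card_mono[of "{1..nat \<lfloor>exp (j + 1)\<rfloor>}" "hat_primes j"] by simp
  also have "real (nat \<lfloor>exp (j + 1)\<rfloor>) \<le> exp (j + 1)" by (simp add: of_nat_floor)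
  finally show ?thesis by simp
qed

lemma hat_le_1: "0 \<le> hat u" "hat u \<le> 1"
  by (auto simp: hat_def)

context L_function_bounds
begin

text \<open>One window of primes on the logarithmic scale, the unit to which Mellin inversion is
  applied; windows at consecutive integers add up to the sieving weight.\<close>

definition hat_sum :: "(int \<Rightarrow> complex) \<Rightarrow> real \<Rightarrow> complex \<Rightarrow> complex" where
  "hat_sum chi j s = (\<Sum>p\<in>hat_primes j. of_real (hat (ln (real p) - j)) * (twist lamF chi p / of_nat p powr s))"

text \<open>At most \<open>exp (j + 1)\<close> primes contribute at most
  \<open>d * exp (1 - j)\<close> each. This bound serves at heights that the zero-free region does
  not reach.\<close>

lemma norm_hat_sum_trivial:
  assumes q: "q \<ge> 2" "chi \<in> primitive_characters q" and s: "Re s = 1"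
  shows "norm (hat_sum chi j s) \<le> real d * exp 2"
proof -
  have "norm (hat_sum chi j s) \<le> (\<Sum>p\<in>hat_primes j. real d * exp (1 - j))"
    unfolding hat_sum_def
  proof (intro order_trans[OF norm_sum] sum_mono)
    fix p assume p: "p \<in> hat_primes j"
    note b = hat_primes_bounds[OF p]
    have "norm (twist lamF chi p / of_nat p powr s) \<le> real d * exp (1 - j)"
    proof -
      have "norm (twist lamF chi p) \<le> real d"
        using norm_twist_le[OF q, of p] norm_lamF_prime_le[OF b(1)] by linarith
      moreover have "1 / real p \<le> exp (1 - j)"
      proof -
        have "1 / real p \<le> 1 / exp (j - 1)" using b(2) by (intro frac_le) auto
        also have "\<dots> = exp (1 - j)" by (simp add: exp_diff)
        finally show ?thesis .
      qed
      ultimately have "norm (twist lamF chi p) * (1 / real p) \<le> real d * exp (1 - j)"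
        by (intro mult_mono) auto
      then show ?thesis unfolding norm_divide norm_of_nat_powr s by simp
    qed
    then have "\<bar>hat (ln (real p) - j)\<bar> * norm (twist lamF chi p / of_nat p powr s) \<le> 1 * (real d * exp (1 - j))"
      using hat_le_1[of "ln (real p) - j"] by (intro mult_mono) auto
    then show "norm (of_real (hat (ln (real p) - j)) * (twist lamF chi p / of_nat p powr s)) \<le> real d * exp (1 - j)"
      unfolding norm_mult norm_of_real by simp
  qed
  also have "\<dots> = real (card (hat_primes j)) * (real d * exp (1 - j))" by simp
  also have "\<dots> \<le> exp (j + 1) * (real d * exp (1 - j))"
    by (intro mult_right_mono card_hat_primes_le) auto
  also have "\<dots> = real d * exp 2"
  proof -
    have "exp (j + 1) * exp (1 - j) = exp 2" unfolding exp_add[symmetric] by simp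
    then show ?thesis by (simp add: mult.left_commute)
  qed
  finally show ?thesis .
qed

text \<open>Mellin inversion of \<open>hat\<close>, summed over the primes; \<open>hat\<close> is
  even, so the sign of \<open>j - ln n\<close> does not matter.\<close>

lemma hat_sum_eq_integral:
  fixes j \<kappa> :: real
  assumes q: "q \<ge> 2" "chi \<in> primitive_characters q" and s: "Re s = 1" and k: "\<kappa> > 0"
  defines "G \<equiv> \<lambda>y. prime_series chi (s + Complex \<kappa> y) * (exp (of_real j * Complex \<kappa> y) * hat_transform (Complex \<kappa> y))"
  shows "2 * pi * hat_sum chi j s = (LBINT y. G y)" and "integrable lborel G"
proof -
  define t where "t n y = prime_term chi n s * (exp (of_real (j - ln (real n)) * Complex \<kappa> y) * hat_transform (Complex \<kappa> y))" for n y
  have t_eq: "t n y = prime_term chi n (s + Complex \<kappa> y) * (exp (of_real j * Complex \<kappa> y) * hat_transform (Complex \<kappa> y))" for n y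
  proof (cases "prime n")
    case True
    then have n: "real n > 0" using prime_gt_0_nat by simp
    have "of_nat n powr (Complex \<kappa> y) = exp (Complex \<kappa> y * of_real (ln (real n)))"
      using n by (simp add: powr_def Ln_of_nat)
    then have "exp (of_real (j - ln (real n)) * Complex \<kappa> y) = exp (of_real j * Complex \<kappa> y) / of_nat n powr (Complex \<kappa> y)"
      by (simp add: exp_diff[symmetric] algebra_simps)
    then show ?thesis using True by (simp add: t_def prime_term_def powr_add)
  qed (simp add: t_def prime_term_def)
  have ReG: "Re (s + Complex \<kappa> y) \<ge> 1 + \<kappa>" for y using s by simp
  have Gsum: "G y = (\<Sum>n. t n y)" for y
    unfolding G_def t_eq prime_series_def
    by (rule suminf_mult2, rule summable_norm_cancel, rule prime_series_properties(3)[OF q k ReG])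
  have ht: "integrable lborel (\<lambda>y. exp (of_real u * Complex \<kappa> y) * hat_transform (Complex \<kappa> y))" for u
    by (rule hat_inversion(1)[OF k])
  have int_t: "integrable lborel (t n)" for n
    unfolding t_def by (rule integrable_mult_right, rule ht)
  define W where "W = (LBINT y. norm (hat_transform (Complex \<kappa> y)))"
  have norm_t: "norm (t n y) = norm (prime_term chi n (s + of_real \<kappa>)) * exp (j * \<kappa>) * norm (hat_transform (Complex \<kappa> y))" for n y
  proof -
    have "norm (prime_term chi n (s + Complex \<kappa> y)) = norm (prime_term chi n (s + of_real \<kappa>))"
      unfolding prime_term_def by (simp add: norm_divide norm_of_nat_powr)
    then show ?thesis unfolding t_eq norm_mult norm_exp_eq_Re by simp
  qed
  have sum_p: "summable (\<lambda>n. norm (prime_term chi n (s + of_real \<kappa>)))"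
    by (rule prime_series_properties(3)[OF q k]) (use s in simp)
  have AE: "AE y in lborel. summable (\<lambda>n. norm (t n y))"
    unfolding norm_t by (intro AE_I2 summable_mult2 sum_p)
  have summ_norm: "summable (\<lambda>n. LBINT y. norm (t n y))"
    unfolding norm_t integral_mult_right_zero by (intro summable_mult2 sum_p)
  show "integrable lborel G"
    unfolding Gsum by (rule integrable_suminf[OF int_t AE summ_norm])
  have "(LBINT y. G y) = (\<Sum>n. LBINT y. t n y)"
    unfolding Gsum by (rule integral_suminf[OF int_t AE summ_norm])
  also have "\<dots> = (\<Sum>n. prime_term chi n s * of_real (2 * pi * hat (j - ln (real n))))"
    unfolding t_def integral_mult_right_zero hat_inversion(2)[OF k] ..
  also have "\<dots> = (\<Sum>n\<in>hat_primes j. prime_term chi n s * of_real (2 * pi * hat (j - ln (real n))))"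
  proof (rule suminf_finite[OF finite_hat_primes])
    fix n assume "n \<notin> hat_primes j"
    then have "\<not> prime n \<or> hat (j - ln (real n)) = 0"
      by (auto simp: hat_primes_def hat_def abs_minus_commute)
    then show "prime_term chi n s * of_real (2 * pi * hat (j - ln (real n))) = 0"
      by (auto simp: prime_term_def)
  qed
  also have "\<dots> = 2 * pi * hat_sum chi j s"
    unfolding hat_sum_def sum_distrib_left
    by (intro sum.cong refl) (auto simp: prime_term_def hat_primes_def hat_def abs_minus_commute)
  finally show "2 * pi * hat_sum chi j s = (LBINT y. G y)" by simp
qed

text \<open>The integral is cut at height \<open>T / 4\<close>. The tail is estimated with the
  trivial bound for the series and gives \<open>j / T\<close>; the rest is moved to
  \<open>Re w = - \<delta> / 2\<close>, where \<open>exp (j * w)\<close> saves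
  \<open>exp (- j * \<delta> / 2)\<close>, and the horizontal sides give
  \<open>1 / T^2\<close>.\<close>

lemma hat_sum_bound:
  "\<exists>C>0. \<forall>q chi \<delta> T j s. q \<ge> 2 \<longrightarrow> chi \<in> primitive_characters q \<longrightarrow> chi (-1) = e \<longrightarrow> 0 < \<delta> \<longrightarrow> \<delta> \<le> 1 / 4 \<longrightarrow> 4 \<le> T \<longrightarrow>
     (\<forall>s. Re s > 1 - \<delta> \<and> \<bar>Im s\<bar> \<le> T \<longrightarrow> L_twist lamF chi s \<noteq> 0) \<longrightarrow> 1 \<le> j \<longrightarrow> Re s = 1 \<longrightarrow> \<bar>Im s\<bar> \<le> T / 4 \<longrightarrow>
     norm (hat_sum chi j s) \<le> C * (j / T + (1 + ln (real (N q)) + T) / \<delta> * (T * exp (- (j * \<delta> / 2)) + 1 / T\<^sup>2))"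
proof -
  obtain C0 where C0: "C0 > 0" and cont: "\<And>q chi \<delta> T. q \<ge> 2 \<Longrightarrow> chi \<in> primitive_characters q \<Longrightarrow> chi (-1) = e \<Longrightarrow> 0 < \<delta> \<Longrightarrow> \<delta> \<le> 1 / 4 \<Longrightarrow> 4 \<le> T \<Longrightarrow>
     (\<forall>s. Re s > 1 - \<delta> \<and> \<bar>Im s\<bar> \<le> T \<longrightarrow> L_twist lamF chi s \<noteq> 0) \<Longrightarrow>
     (\<exists>P. P holomorphic_on {s. Re s > 1 - \<delta> \<and> \<bar>Im s\<bar> < T} \<and>
        (\<forall>s. Re s > 1 \<and> \<bar>Im s\<bar> < T \<longrightarrow> P s = prime_series chi s) \<and>
        (\<forall>s. 1 - \<delta> / 2 \<le> Re s \<and> Re s \<le> 2 \<and> \<bar>Im s\<bar> \<le> T - 2 \<longrightarrow>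
            norm (P s) \<le> C0 * (1 + ln (real (N q)) + T) / \<delta>))"
    using prime_series_continuation[of e] by blast
  obtain K where K: "K \<ge> 0" "\<And>w. \<bar>Re w\<bar> \<le> 1 \<Longrightarrow> norm (hat_transform w) \<le> K * inverse (1 + (Im w)\<^sup>2)"
    using norm_hat_transform_le by blast
  obtain K1 where K1: "K1 \<ge> 0" "\<And>Y::real. Y > 0 \<Longrightarrow> integrable lborel (\<lambda>y. indicator (- {-Y..Y}) y * inverse (1 + y\<^sup>2))"
     "\<And>Y::real. Y > 0 \<Longrightarrow> (LBINT y. indicator (- {-Y..Y}) y * inverse (1 + y\<^sup>2)) \<le> K1 / Y"
    using integral_tail_inverse_1_plus_square by blast
  define C where "C = real d * 2 * exp 1 * K * K1 * 4 + C0 * K + C0 * exp 1 * K * 64 + 1"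
  show ?thesis
  proof (intro exI[of _ C] conjI allI impI)
    show "C > 0" using K K1 C0 by (simp add: C_def add_nonneg_pos)
    fix q chi \<delta> T j s
    assume q: "q \<ge> 2" "chi \<in> primitive_characters q" and e: "chi (-1) = e"
      and \<delta>: "0 < \<delta>" "\<delta> \<le> 1 / 4" and T: "4 \<le> (T::real)"
      and nz: "\<forall>s. Re s > 1 - \<delta> \<and> \<bar>Im s\<bar> \<le> T \<longrightarrow> L_twist lamF chi s \<noteq> 0"
      and j: "1 \<le> (j::real)" and s: "Re s = 1" "\<bar>Im s\<bar> \<le> T / 4"
    define B where "B = C0 * (1 + ln (real (N q)) + T) / \<delta>"
    obtain P where P: "P holomorphic_on {s. Re s > 1 - \<delta> \<and> \<bar>Im s\<bar> < T}"
        "\<And>s. Re s > 1 \<Longrightarrow> \<bar>Im s\<bar> < T \<Longrightarrow> P s = prime_series chi s"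
        "\<And>s. 1 - \<delta> / 2 \<le> Re s \<Longrightarrow> Re s \<le> 2 \<Longrightarrow> \<bar>Im s\<bar> \<le> T - 2 \<Longrightarrow> norm (P s) \<le> B"
      using cont[OF q e \<delta> T nz] unfolding B_def by blast
    have lnN: "ln (real (N q)) \<ge> 0" using N_pos[OF q] by simp
    have B0: "B \<ge> 0" using C0 lnN T \<delta> by (simp add: B_def)
    \<comment> \<open>With this abscissa \<open>exp (j * \<kappa>)\<close> is bounded, while the
      prime series on the line is at most \<open>d * (1 + j)\<close>.\<close>
    define \<kappa> where "\<kappa> = 1 / j"
    have k: "0 < \<kappa>" "\<kappa> \<le> 1" "j * \<kappa> = 1" using j by (auto simp: \<kappa>_def)
    \<comment> \<open>Then \<open>\<bar>Im (s + w)\<bar> \<le> T / 2 \<le> T - 2\<close> on the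
      rectangle, as \<open>T \<ge> 4\<close>, so the bound for \<open>P\<close> applies
      there.\<close>
    define Y where "Y = T / 4"
    have Y: "Y \<ge> 1" using T by (simp add: Y_def)
    define g where "g w = P (s + w) * (exp (of_real j * w) * hat_transform w)" for w
    define G where "G y = prime_series chi (s + Complex \<kappa> y) * (exp (of_real j * Complex \<kappa> y) * hat_transform (Complex \<kappa> y))" for y
    note GI = hat_sum_eq_integral[OF q s(1) k(1), of j, folded G_def]
    define p where "p = Complex (- (\<delta> / 2)) (- Y)"
    define r where "r = Complex \<kappa> Y"
    have region: "1 - \<delta> / 2 \<le> Re (s + w)" "Re (s + w) \<le> 2" "\<bar>Im (s + w)\<bar> \<le> T - 2" "\<bar>Im (s + w)\<bar> < T" "Re (s + w) > 1 - \<delta>" "\<bar>Re w\<bar> \<le> 1" "exp (j * Re w) \<le> exp 1"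
      if "w \<in> cbox p r" for w
    proof -
      have w: "- (\<delta> / 2) \<le> Re w" "Re w \<le> \<kappa>" "\<bar>Im w\<bar> \<le> Y"
        using that by (auto simp: in_cbox_complex_iff p_def r_def)
      have "\<bar>Im (s + w)\<bar> \<le> T / 2" using w(3) s(2) abs_triangle_ineq[of "Im s" "Im w"] by (simp add: Y_def)
      then show "\<bar>Im (s + w)\<bar> \<le> T - 2" "\<bar>Im (s + w)\<bar> < T" using T by linarith+
      show "1 - \<delta> / 2 \<le> Re (s + w)" "Re (s + w) \<le> 2" "Re (s + w) > 1 - \<delta>" "\<bar>Re w\<bar> \<le> 1"
        unfolding plus_complex.sel using w(1,2) s(1) k(1,2) \<delta> by linarith+
      have "j * Re w \<le> j * \<kappa>" using w j by (intro mult_left_mono) auto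
      then show "exp (j * Re w) \<le> exp 1" using k by simp
    qed
    have ghol: "g holomorphic_on cbox p r"
    proof -
      have "(P \<circ> (\<lambda>w. s + w)) holomorphic_on cbox p r"
        by (rule holomorphic_on_compose_gen[OF _ P(1)]) (use region in \<open>auto intro!: holomorphic_intros\<close>)
      then show ?thesis unfolding g_def o_def
        by (intro holomorphic_intros holomorphic_hat_transform)
    qed
    have g_le: "norm (g w) \<le> B * (exp (j * Re w) * (K * inverse (1 + (Im w)\<^sup>2)))" if "w \<in> cbox p r" for w
      unfolding g_def norm_mult using region[OF that] B0 K(1)
      by (intro mult_mono P(3) K(2)) (auto simp: norm_exp_eq_Re)
    have gcont: "continuous_on (cbox p r) g" by (rule holomorphic_on_imp_continuous_on[OF ghol])
    \<comment> \<open>No pole is crossed: the factor \<open>w\<close> cancels against the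
      denominator and puts Cauchy's theorem for \<open>g\<close> into the form of the integral
      formula at 0, with \<open>f 0 = 0\<close>.\<close>
    define f where "f w = w * g w" for w
    have fhol: "f holomorphic_on cbox p r" unfolding f_def by (intro holomorphic_intros ghol)
    have z: "0 \<in> box p r" using \<delta> k Y by (auto simp: in_box_complex_iff p_def r_def)
    have fg: "f w / (w - 0) = g w" if "w \<noteq> 0" for w using that by (simp add: f_def)
    note CF = Cauchy_integral_formula_rectangle[OF fhol z]
    define H1 where "H1 = contour_integral (linepath p (Complex (Re r) (Im p))) (\<lambda>w. f w / (w - 0))"
    define H2 where "H2 = contour_integral (linepath r (Complex (Re p) (Im r))) (\<lambda>w. f w / (w - 0))"
    define IR where "IR = integral {-Y..Y} (\<lambda>y. g (Complex \<kappa> y))"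
    define IL where "IL = integral {-Y..Y} (\<lambda>y. g (Complex (- (\<delta> / 2)) y))"
    have ne: "Complex \<kappa> y \<noteq> 0" "Complex (- (\<delta> / 2)) y \<noteq> 0" for y
      using k \<delta> by (auto simp: complex_eq_iff)
    have eq0: "\<i> * (IR - IL) + (H1 + H2) = 0"
      using CF(1) by (simp add: H1_def H2_def IR_def IL_def p_def r_def fg[OF ne(1), simplified] fg[OF ne(2), simplified] f_def[of 0])
    have hor: "norm (f w / (w - 0)) \<le> B * (exp 1 * (K * inverse (1 + Y\<^sup>2)))"
      if "w \<in> closed_segment p (Complex (Re r) (Im p)) \<or> w \<in> closed_segment r (Complex (Re p) (Im r))" for w
    proof -
      have w: "Re w \<in> {- (\<delta> / 2)..\<kappa>}" "\<bar>Im w\<bar> = Y"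
        using that k \<delta> Y closed_segment_same_Im[of p "Complex (Re r) (Im p)"]
            closed_segment_same_Im[of r "Complex (Re p) (Im r)"]
        by (auto simp: p_def r_def closed_segment_eq_real_ivl split: if_splits)
      then have wb: "w \<in> cbox p r" by (auto simp: in_cbox_complex_iff p_def r_def abs_if split: if_splits)
      have "w \<noteq> 0" using w Y by auto
      have Im2: "(Im w)\<^sup>2 = Y\<^sup>2" using w(2) by (metis power2_abs)
      have "norm (g w) \<le> B * (exp (j * Re w) * (K * inverse (1 + Y\<^sup>2)))" using g_le[OF wb] unfolding Im2 .
      also have "\<dots> \<le> B * (exp 1 * (K * inverse (1 + Y\<^sup>2)))"
        using region(7)[OF wb] B0 K(1) by (intro mult_left_mono mult_right_mono) (auto simp: add_nonneg_nonneg)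
      finally show ?thesis unfolding fg[OF \<open>w \<noteq> 0\<close>] .
    qed
    have len: "norm (Complex (Re r) (Im p) - p) \<le> 2" "norm (Complex (Re p) (Im r) - r) \<le> 2"
      using k \<delta> by (auto simp: p_def r_def cmod_def)
    define Hb where "Hb = B * (exp 1 * (K * inverse (1 + Y\<^sup>2)))"
    have Hb0: "Hb \<ge> 0" using B0 K(1) by (simp add: Hb_def add_nonneg_nonneg)
    have H1: "norm H1 \<le> Hb * 2"
      unfolding H1_def
      by (rule order_trans[OF contour_integral_bound_linepath[OF CF(2) Hb0] mult_left_mono[OF len(1) Hb0]])
         (use hor in \<open>auto simp: Hb_def\<close>)
    have H2: "norm H2 \<le> Hb * 2"
      unfolding H2_def
      by (rule order_trans[OF contour_integral_bound_linepath[OF CF(3) Hb0] mult_left_mono[OF len(2) Hb0]])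
         (use hor in \<open>auto simp: Hb_def\<close>)
    have IL: "norm IL \<le> B * (exp (- (j * \<delta> / 2)) * K) * (2 * Y)"
    proof -
      have inb: "Complex (- (\<delta> / 2)) y \<in> cbox p r" if "y \<in> {-Y..Y}" for y
        using that k \<delta> by (auto simp: in_cbox_complex_iff p_def r_def)
      have "continuous_on {-Y..Y} (\<lambda>y. g (Complex (- (\<delta> / 2)) y))"
        by (rule continuous_on_compose2[OF gcont]) (use inb in \<open>auto simp: Complex_eq intro!: continuous_intros\<close>)
      then have hi: "((\<lambda>y. g (Complex (- (\<delta> / 2)) y)) has_integral IL) {-Y..Y}"
        unfolding IL_def by (intro integrable_integral integrable_continuous_interval)
      have "norm (g (Complex (- (\<delta> / 2)) y)) \<le> B * (exp (- (j * \<delta> / 2)) * K)" if "y \<in> {-Y..Y}" for y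
      proof -
        have "norm (g (Complex (- (\<delta> / 2)) y)) \<le> B * (exp (- (j * \<delta> / 2)) * (K * inverse (1 + y\<^sup>2)))"
          using g_le[OF inb[OF that]] by simp
        also have "\<dots> \<le> B * (exp (- (j * \<delta> / 2)) * (K * 1))"
          using B0 K(1) by (intro mult_left_mono) (auto intro!: le_imp_inverse_le[of 1, simplified])
        finally show ?thesis by simp
      qed
      then have "norm IL \<le> (B * (exp (- (j * \<delta> / 2)) * K)) * Henstock_Kurzweil_Integration.content {-Y..Y}"
        using B0 K(1) by (intro has_integral_bound_real[OF _ _ hi]) auto
      then show ?thesis using Y by simp
    qed
    have IRb: "norm IR \<le> norm IL + norm H1 + norm H2"
    proof -
      have "\<i> * IR = \<i> * IL - (H1 + H2)" using eq0 by (simp add: algebra_simps)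
      then have "norm (\<i> * IR) = norm (\<i> * IL - (H1 + H2))" by (simp only:)
      then have "norm IR = norm (\<i> * IL - (H1 + H2))" by (simp add: norm_mult)
      also have "\<dots> \<le> norm (\<i> * IL) + norm (H1 + H2)" by (rule norm_triangle_ineq4)
      also have "\<dots> \<le> norm IL + (norm H1 + norm H2)"
        using norm_triangle_ineq[of H1 H2] by (simp add: norm_mult)
      finally show ?thesis by simp
    qed
    have IRG: "IR = (LBINT y. indicator {-Y..Y} y *\<^sub>R G y)"
    proof -
      have "set_integrable lborel {-Y..Y} G"
        unfolding set_integrable_def using GI(2) by (intro integrable_mult_indicator) auto
      from set_borel_integral_eq_integral(2)[OF this]
      have "(LBINT y. indicator {-Y..Y} y *\<^sub>R G y) = integral {-Y..Y} G"
        by (simp add: set_lebesgue_integral_def)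
      also have "\<dots> = IR" unfolding IR_def
      proof (rule Henstock_Kurzweil_Integration.integral_cong)
        fix y assume y: "y \<in> {-Y..Y}"
        have "Complex \<kappa> y \<in> cbox p r" using y k \<delta> by (auto simp: in_cbox_complex_iff p_def r_def)
        from region(4)[OF this] have "P (s + Complex \<kappa> y) = prime_series chi (s + Complex \<kappa> y)"
          using s k by (intro P(2)) auto
        then show "G y = g (Complex \<kappa> y)" by (simp add: G_def g_def)
      qed
      finally show ?thesis by simp
    qed
    define TL where "TL = (LBINT y. indicator (- {-Y..Y}) y *\<^sub>R G y)"
    have split: "(LBINT y. G y) = IR + TL"
    proof -
      have i1: "integrable lborel (\<lambda>y. indicator {-Y..Y} y *\<^sub>R G y)"
        and i2: "integrable lborel (\<lambda>y. indicator (- {-Y..Y}) y *\<^sub>R G y)"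
        using GI(2) by (auto intro!: integrable_mult_indicator)
      have "(LBINT y. G y) = (LBINT y. indicator {-Y..Y} y *\<^sub>R G y + indicator (- {-Y..Y}) y *\<^sub>R G y)"
        by (intro Bochner_Integration.integral_cong refl) (auto simp: indicator_def)
      then show ?thesis unfolding IRG TL_def using i1 i2 by simp
    qed
    define M where "M = real d * (1 + j) * (exp 1 * K)"
    have M0: "M \<ge> 0" using j K(1) by (simp add: M_def)
    have TL: "norm TL \<le> M * (K1 / Y)"
    proof -
      have Gy: "norm (G y) \<le> M * inverse (1 + y\<^sup>2)" for y
      proof -
        have "norm (prime_series chi (s + Complex \<kappa> y)) \<le> real d * (1 + 1 / \<kappa>)"
          by (rule prime_series_properties(2)[OF q k(1)]) (use s in simp)
        also have "1 / \<kappa> = j" by (simp add: \<kappa>_def)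
        finally have 1: "norm (prime_series chi (s + Complex \<kappa> y)) \<le> real d * (1 + j)" .
        have 2: "norm (hat_transform (Complex \<kappa> y)) \<le> K * inverse (1 + y\<^sup>2)" using K(2)[of "Complex \<kappa> y"] k by simp
        have "norm (G y) \<le> real d * (1 + j) * (exp 1 * (K * inverse (1 + y\<^sup>2)))"
          unfolding G_def norm_mult using 1 2 k j K(1)
          by (intro mult_mono) (auto simp: norm_exp_eq_Re)
        then show ?thesis by (simp add: M_def mult_ac)
      qed
      have "norm TL \<le> (LBINT y. norm (indicator (- {-Y..Y}) y *\<^sub>R G y))"
        unfolding TL_def by (rule Bochner_Integration.integral_norm_bound)
      also have "\<dots> \<le> (LBINT y. M * (indicator (- {-Y..Y}) y * inverse (1 + y\<^sup>2)))"
      proof (rule integral_mono')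
        show "integrable lborel (\<lambda>y. M * (indicator (- {-Y..Y}) y * inverse (1 + y\<^sup>2)))"
          using K1(2)[of Y] Y by (intro integrable_mult_right) auto
        show "norm (indicator (- {-Y..Y}) y *\<^sub>R G y) \<le> M * (indicator (- {-Y..Y}) y * inverse (1 + y\<^sup>2))" for y
          using Gy[of y] by (auto simp: indicator_def)
        show "0 \<le> M * (indicator (- {-Y..Y}) y * inverse (1 + y\<^sup>2))" for y
          using M0 by (auto simp: indicator_def add_nonneg_nonneg)
      qed
      also have "\<dots> = M * (LBINT y. indicator (- {-Y..Y}) y * inverse (1 + y\<^sup>2))" by simp
      also have "\<dots> \<le> M * (K1 / Y)" using M0 Y by (intro mult_left_mono K1(3)) auto
      finally show ?thesis .
    qed
    have "norm (hat_sum chi j s) \<le> 2 * pi * norm (hat_sum chi j s)"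
      using pi_gt3 mult_right_mono[of 1 "2 * pi" "norm (hat_sum chi j s)"] by simp
    also have "\<dots> = norm (2 * pi * hat_sum chi j s)" by (simp add: norm_mult)
    also have "\<dots> = norm (IR + TL)" unfolding GI(1) split ..
    also have "\<dots> \<le> norm IL + norm H1 + norm H2 + norm TL"
      using norm_triangle_ineq[of IR TL] IRb by linarith
    also have "\<dots> \<le> B * (exp (- (j * \<delta> / 2)) * K) * (2 * Y) + Hb * 4 + M * (K1 / Y)"
      using IL H1 H2 TL by linarith
    also have "\<dots> \<le> C * (j / T + B / C0 * (T * exp (- (j * \<delta> / 2)) + 1 / T\<^sup>2))"
    proof -
      define E where "E = exp (- (j * \<delta> / 2))"
      have 1: "B * (E * K) * (2 * Y) \<le> (C0 * K) * (B / C0 * (T * E))"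
      proof -
        have "0 \<le> B * E * K * T" using B0 K(1) T by (simp add: E_def)
        then show ?thesis using C0 by (simp add: Y_def)
      qed
      have 2: "Hb * 4 \<le> (C0 * exp 1 * K * 64) * (B / C0 * (1 / T\<^sup>2))"
      proof -
        have "inverse (1 + Y\<^sup>2) \<le> inverse (Y\<^sup>2)" using Y by (intro le_imp_inverse_le) auto
        also have "\<dots> = 16 / T\<^sup>2" by (simp add: Y_def power_divide)
        finally have "B * (exp 1 * (K * inverse (1 + Y\<^sup>2))) \<le> B * (exp 1 * (K * (16 / T\<^sup>2)))"
          using B0 K(1) by (intro mult_left_mono) auto
        moreover have "(C0 * exp 1 * K * 64) * (B / C0 * (1 / T\<^sup>2)) = 4 * (B * (exp 1 * (K * (16 / T\<^sup>2))))"
          using C0 by simp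
        ultimately show ?thesis unfolding Hb_def by linarith
      qed
      have 3: "M * (K1 / Y) \<le> (real d * 2 * exp 1 * K * K1 * 4) * (j / T)"
      proof -
        have "M \<le> real d * (2 * j) * (exp 1 * K)"
          unfolding M_def using j K(1) by (intro mult_right_mono mult_left_mono) auto
        then have "M * (K1 / Y) \<le> real d * (2 * j) * (exp 1 * K) * (K1 / Y)"
          using K1(1) Y by (intro mult_right_mono) auto
        then show ?thesis using T by (simp add: Y_def mult_ac)
      qed
      have n: "0 \<le> j / T" "0 \<le> B / C0 * (T * E)" "0 \<le> B / C0 * (1 / T\<^sup>2)"
        using j T B0 C0 by (simp_all add: E_def)
      have c: "real d * 2 * exp 1 * K * K1 * 4 \<le> C" "C0 * K \<le> C" "C0 * exp 1 * K * 64 \<le> C"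
        using K(1) K1(1) C0 by (simp_all add: C_def add_nonneg_nonneg)
      have "B * (E * K) * (2 * Y) + Hb * 4 + M * (K1 / Y) \<le> C * (B / C0 * (T * E)) + C * (B / C0 * (1 / T\<^sup>2)) + C * (j / T)"
        using 1 2 3 mult_right_mono[OF c(1) n(1)] mult_right_mono[OF c(2) n(2)] mult_right_mono[OF c(3) n(3)] by linarith
      also have "\<dots> = C * (j / T + B / C0 * (T * E + 1 / T\<^sup>2))" by (simp add: algebra_simps)
      finally show ?thesis by (simp only: E_def)
    qed
    also have "B / C0 = (1 + ln (real (N q)) + T) / \<delta>" using C0 by (simp add: B_def)
    finally show "norm (hat_sum chi j s) \<le> C * (j / T + (1 + ln (real (N q)) + T) / \<delta> * (T * exp (- (j * \<delta> / 2)) + 1 / T\<^sup>2))" .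
  qed
qed

end

section \<open>Mean squares over characters and sieve weights\<close>

definition l2norm :: "'a set \<Rightarrow> ('a \<Rightarrow> complex) \<Rightarrow> real" where
  "l2norm X f = L2_set (\<lambda>x. norm (f x)) X"

lemma l2norm_nonneg: "l2norm X f \<ge> 0"
  by (simp add: l2norm_def)

lemma l2norm_power2: "(l2norm X f)\<^sup>2 = (\<Sum>x\<in>X. (norm (f x))\<^sup>2)"
  by (simp add: l2norm_def L2_set_def sum_nonneg)

lemma l2norm_le_sqrtI: "(\<Sum>x\<in>X. (norm (f x))\<^sup>2) \<le> B \<Longrightarrow> l2norm X f \<le> sqrt B"
  by (simp add: l2norm_def L2_set_def)

lemma l2norm_mono: "(\<And>x. x \<in> X \<Longrightarrow> norm (f x) \<le> norm (g x)) \<Longrightarrow> l2norm X f \<le> l2norm X g"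
  unfolding l2norm_def by (intro L2_set_mono) auto

lemma l2norm_cong: "(\<And>x. x \<in> X \<Longrightarrow> f x = g x) \<Longrightarrow> l2norm X f = l2norm X g"
  by (simp add: l2norm_def L2_set_def)

lemma l2norm_triangle: "l2norm X (\<lambda>x. f x + g x) \<le> l2norm X f + l2norm X g"
proof -
  have "l2norm X (\<lambda>x. f x + g x) \<le> L2_set (\<lambda>x. norm (f x) + norm (g x)) X"
    unfolding l2norm_def by (intro L2_set_mono norm_triangle_ineq) auto
  also have "\<dots> \<le> l2norm X f + l2norm X g"
    unfolding l2norm_def by (rule L2_set_triangle_ineq)
  finally show ?thesis .
qed

lemma l2norm_minus: "l2norm X (\<lambda>x. - f x) = l2norm X f"
  by (simp add: l2norm_def)

lemma l2norm_diff: "l2norm X (\<lambda>x. f x - g x) \<le> l2norm X f + l2norm X g"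
  using l2norm_triangle[of X f "\<lambda>x. - g x"] by (simp add: l2norm_minus)

lemma l2norm_0: "l2norm X (\<lambda>x. 0) = 0"
  by (simp add: l2norm_def L2_set_def)

lemma l2norm_sum: "l2norm X (\<lambda>x. \<Sum>i\<in>A. f i x) \<le> (\<Sum>i\<in>A. l2norm X (f i))"
proof (induction A rule: infinite_finite_induct)
  case (insert i A)
  have "l2norm X (\<lambda>x. \<Sum>i\<in>insert i A. f i x) = l2norm X (\<lambda>x. f i x + (\<Sum>i\<in>A. f i x))"
    using insert by (intro l2norm_cong) simp
  also have "\<dots> \<le> l2norm X (f i) + l2norm X (\<lambda>x. \<Sum>i\<in>A. f i x)" by (rule l2norm_triangle)
  finally show ?case using insert by simp
qed (simp_all add: l2norm_0)

lemma l2norm_const_mult: "l2norm X (\<lambda>x. c * f x) = norm c * l2norm X f"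
  by (simp add: l2norm_def norm_mult L2_set_right_distrib)

lemma l2norm_le_const:
  assumes "\<And>x. x \<in> X \<Longrightarrow> norm (f x) \<le> c" "c \<ge> 0"
  shows "l2norm X f \<le> c * sqrt (real (card X))"
proof -
  have "(\<Sum>x\<in>X. (norm (f x))\<^sup>2) \<le> (\<Sum>x\<in>X. c\<^sup>2)"
    using assms by (intro sum_mono power_mono) auto
  then have "l2norm X f \<le> sqrt (real (card X) * c\<^sup>2)"
    by (intro l2norm_le_sqrtI) simp
  then show ?thesis using assms(2) by (simp add: real_sqrt_mult mult.commute)
qed

lemma norm_sum_mult_le_l2norm: "norm (\<Sum>x\<in>X. b x * a x) \<le> l2norm X b * l2norm X a"
proof -
  have "norm (\<Sum>x\<in>X. b x * a x) \<le> (\<Sum>x\<in>X. norm (b x) * norm (a x))"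
    by (intro order_trans[OF norm_sum] sum_mono) (simp add: norm_mult)
  also have "\<dots> = (\<Sum>x\<in>X. \<bar>norm (b x)\<bar> * \<bar>norm (a x)\<bar>)" by simp
  also have "\<dots> \<le> l2norm X b * l2norm X a"
    unfolding l2norm_def by (rule L2_set_mult_ineq)
  finally show ?thesis .
qed

text \<open>The extremal test vector is the conjugate of \<open>a\<close> divided by its norm.
  Estimates for families of numbers are thereby reduced to single complex numbers, for which mean
  value and integral inequalities are at hand.\<close>

lemma l2norm_dualI:
  assumes "\<And>b. l2norm X b \<le> 1 \<Longrightarrow> norm (\<Sum>x\<in>X. b x * a x) \<le> M" "M \<ge> 0"
  shows "l2norm X a \<le> M"
proof (cases "l2norm X a = 0")
  case False
  define D where "D = l2norm X a"
  have D: "D > 0" using False l2norm_nonneg[of X a] by (simp add: D_def)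
  define b where "b x = cnj (a x) / of_real D" for x
  have "l2norm X b = 1"
  proof -
    have "l2norm X b = l2norm X (\<lambda>x. of_real (1 / D) * cnj (a x))"
      by (intro l2norm_cong) (simp add: b_def)
    also have "\<dots> = 1 / D * l2norm X (\<lambda>x. cnj (a x))"
      unfolding l2norm_const_mult using D by (simp add: norm_divide)
    also have "l2norm X (\<lambda>x. cnj (a x)) = D" by (simp add: D_def l2norm_def)
    finally show ?thesis using D by simp
  qed
  then have "norm (\<Sum>x\<in>X. b x * a x) \<le> M" by (intro assms(1)) simp
  moreover have "(\<Sum>x\<in>X. b x * a x) = of_real D"
  proof -
    have "(\<Sum>x\<in>X. b x * a x) = (\<Sum>x\<in>X. of_real ((norm (a x))\<^sup>2)) / of_real D"
      unfolding b_def sum_divide_distrib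
      by (intro sum.cong refl) (simp add: complex_norm_square mult.commute del: of_real_power)
    also have "\<dots> = of_real ((\<Sum>x\<in>X. (norm (a x))\<^sup>2) / D)"
      by (simp only: of_real_sum of_real_divide)
    also have "(\<Sum>x\<in>X. (norm (a x))\<^sup>2) = D * D"
      using l2norm_power2[of X a] by (simp add: D_def power2_eq_square)
    finally show ?thesis using D by simp
  qed
  ultimately show ?thesis using D by (simp add: D_def)
qed (use assms in simp)

text \<open>Applied to the sums with sieve parameter \<open>t\<close>, this compares the full sum at
  0 with the sieved sum at 1; duality reduces it to the scalar mean value inequality.\<close>

lemma l2norm_mean_value:
  fixes F :: "real \<Rightarrow> 'a \<Rightarrow> complex"
  assumes X: "finite X"
    and der: "\<And>t x. x \<in> X \<Longrightarrow> ((\<lambda>t. F t x) has_vector_derivative F' t x) (at t)"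
    and le: "\<And>t. 0 \<le> t \<Longrightarrow> t \<le> 1 \<Longrightarrow> l2norm X (F' t) \<le> M"
  shows "l2norm X (\<lambda>x. F 1 x - F 0 x) \<le> M"
proof (rule l2norm_dualI)
  show M: "M \<ge> 0" using le[of 0] l2norm_nonneg[of X "F' 0"] by simp
  fix b assume b: "l2norm X b \<le> 1"
  define g where "g t = (\<Sum>x\<in>X. b x * F t x)" for t
  have gd: "(g has_vector_derivative (\<Sum>x\<in>X. b x * F' t x)) (at t)" for t
    unfolding g_def using der
    by (intro has_vector_derivative_sum has_vector_derivative_mult_right) auto
  have "norm (g 1 - g 0) \<le> M * norm (1 - 0 :: real)"
  proof (rule differentiable_bound[where S = "{0..1}" and f' = "\<lambda>t h. h *\<^sub>R (\<Sum>x\<in>X. b x * F' t x)"])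
    fix t :: real assume t: "t \<in> {0..1}"
    show "(g has_derivative (\<lambda>h. h *\<^sub>R (\<Sum>x\<in>X. b x * F' t x))) (at t within {0..1})"
      using has_vector_derivative_at_within[OF gd] by (simp add: has_vector_derivative_def)
    have "norm (\<Sum>x\<in>X. b x * F' t x) \<le> l2norm X b * l2norm X (F' t)" by (rule norm_sum_mult_le_l2norm)
    also have "\<dots> \<le> 1 * M" using b le[of t] t M l2norm_nonneg by (intro mult_mono) auto
    finally show "onorm (\<lambda>h. h *\<^sub>R (\<Sum>x\<in>X. b x * F' t x)) \<le> M"
      using M by (intro onorm_bound) (auto simp: mult.commute[of M] intro!: mult_left_mono)
  qed auto
  then show "norm (\<Sum>x\<in>X. b x * (F 1 x - F 0 x)) \<le> M"
    by (simp add: g_def algebra_simps sum_subtractf)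
qed

text \<open>Minkowski's integral inequality, which duality reduces to the triangle inequality for
  integrals of complex functions.\<close>

lemma l2norm_integral_le:
  fixes f :: "'a \<Rightarrow> 'b \<Rightarrow> complex"
  assumes X: "finite X" and f: "\<And>x. x \<in> X \<Longrightarrow> integrable M (f x)"
    and k: "integrable M k" and le: "\<And>y. l2norm X (\<lambda>x. f x y) \<le> k y"
  shows "l2norm X (\<lambda>x. \<integral>y. f x y \<partial>M) \<le> (\<integral>y. k y \<partial>M)"
proof (rule l2norm_dualI)
  have k0: "k y \<ge> 0" for y using order_trans[OF l2norm_nonneg le] .
  show "(\<integral>y. k y \<partial>M) \<ge> 0" using k0 by (intro integral_nonneg_AE) auto
  fix b assume b: "l2norm X b \<le> 1"
  have "(\<Sum>x\<in>X. b x * (\<integral>y. f x y \<partial>M)) = (\<integral>y. (\<Sum>x\<in>X. b x * f x y) \<partial>M)"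
    using f by simp
  also have "norm \<dots> \<le> (\<integral>y. norm (\<Sum>x\<in>X. b x * f x y) \<partial>M)"
    by (rule Bochner_Integration.integral_norm_bound)
  also have "\<dots> \<le> (\<integral>y. k y \<partial>M)"
  proof (rule integral_mono'[OF k])
    fix y
    have "norm (\<Sum>x\<in>X. b x * f x y) \<le> l2norm X b * l2norm X (\<lambda>x. f x y)" by (rule norm_sum_mult_le_l2norm)
    also have "\<dots> \<le> 1 * k y" using b le[of y] k0[of y] l2norm_nonneg by (intro mult_mono) auto
    finally show "norm (\<Sum>x\<in>X. b x * f x y) \<le> k y" by simp
  qed (rule k0)
  finally show "norm (\<Sum>x\<in>X. b x * (\<integral>y. f x y \<partial>M)) \<le> (\<integral>y. k y \<partial>M)" .
qed

lemma l2norm_large_sieve: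
  assumes X: "finite X" "\<And>chi. chi \<in> X \<Longrightarrow> dirichlet_character q chi" and q: "q \<ge> 1"
    and S: "S \<subseteq> {..<M}"
  shows "l2norm X (\<lambda>chi. \<Sum>n\<in>S. a n * chi (int n)) \<le> sqrt ((real q + real M) * (\<Sum>n\<in>S. (norm (a n))\<^sup>2))"
proof (rule l2norm_le_sqrtI)
  define b where "b n = (if n \<in> S then a n else 0)" for n
  have eq: "(\<Sum>n<M. b n * chi (int n)) = (\<Sum>n\<in>S. a n * chi (int n))" for chi
    using S by (intro sum.mono_neutral_cong_right) (auto simp: b_def)
  have eq2: "(\<Sum>n<M. (norm (b n))\<^sup>2) = (\<Sum>n\<in>S. (norm (a n))\<^sup>2)"
    using S by (intro sum.mono_neutral_cong_right) (auto simp: b_def)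
  show "(\<Sum>chi\<in>X. (norm (\<Sum>n\<in>S. a n * chi (int n)))\<^sup>2) \<le> (real q + real M) * (\<Sum>n\<in>S. (norm (a n))\<^sup>2)"
    using large_sieve[OF X q, of b M] unfolding eq eq2 .
qed

text \<open>The large sieve with \<open>M = 2\<close> and a sequence supported at
  \<open>n = 1\<close>, where every character has the value 1.\<close>

lemma card_characters_le:
  assumes X: "finite X" "\<And>chi. chi \<in> X \<Longrightarrow> dirichlet_character q chi" and q: "q \<ge> 1"
  shows "real (card X) \<le> real q + 2"
proof -
  have "(\<Sum>chi\<in>X. (norm (\<Sum>n<2. (if n = 1 then 1 else 0) * chi (int n)))\<^sup>2)
      \<le> (real q + real 2) * (\<Sum>n<2::nat. (norm (if n = 1 then 1 else 0 :: complex))\<^sup>2)"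
    by (rule large_sieve[OF X q])
  moreover have "(norm (\<Sum>n<2::nat. (if n = 1 then 1 else 0) * chi (int n)))\<^sup>2 = 1" if "chi \<in> X" for chi
    using character_1[OF X(2)[OF that]] by (simp add: numeral_2_eq_2)
  ultimately show ?thesis by (simp add: numeral_2_eq_2)
qed

text \<open>For a prime dividing \<open>n\<close> exactly, \<open>p\<close> and
  \<open>n div p\<close> are coprime, so that \<open>lamF\<close> and the sieve weight both factor.
  The \<open>n\<close> divisible by the square of a large prime are rare enough to count as an
  error.\<close>

definition sharp_primes :: "nat \<Rightarrow> nat set" where
  "sharp_primes n = {p. prime p \<and> p dvd n \<and> \<not> p ^ 2 dvd n}"

definition sieve_weight :: "(nat \<Rightarrow> real) \<Rightarrow> real \<Rightarrow> nat \<Rightarrow> real" where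
  "sieve_weight v x n = (\<Prod>p\<in>sharp_primes n. 1 - x * v p)"

lemma finite_sharp_primes: "n > 0 \<Longrightarrow> finite (sharp_primes n)"
  by (rule finite_subset[of _ "{..n}"]) (auto simp: sharp_primes_def dest: dvd_imp_le)

lemma sieve_weight_bounds:
  assumes "\<And>p. 0 \<le> v p" "\<And>p. v p \<le> 1" "0 \<le> x" "x \<le> 1"
  shows "0 \<le> sieve_weight v x n" "sieve_weight v x n \<le> 1"
proof -
  have "0 \<le> 1 - x * v p" "1 - x * v p \<le> 1" for p
    using assms mult_le_one[OF assms(4) assms(1,2), of p] by auto
  then show "0 \<le> sieve_weight v x n" "sieve_weight v x n \<le> 1"
    unfolding sieve_weight_def by (auto intro: prod_nonneg prod_le_1)
qed

lemma sieve_weight_0: "sieve_weight v 0 n = 1"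
  by (simp add: sieve_weight_def)

lemma sharp_primes_mult:
  assumes p: "prime p" and "\<not> p dvd m"
  shows "sharp_primes (p * m) = insert p (sharp_primes m)" "p \<notin> sharp_primes m"
proof -
  show "p \<notin> sharp_primes m" using assms by (simp add: sharp_primes_def)
  have pp: "\<not> p ^ 2 dvd p * m"
    using assms prime_gt_0_nat[OF p] by (simp add: power2_eq_square)
  have "r dvd p * m \<longleftrightarrow> r dvd m" "r ^ 2 dvd p * m \<longleftrightarrow> r ^ 2 dvd m" if "prime r" "r \<noteq> p" for r
  proof -
    have "coprime r p" using p that primes_coprime by blast
    then show "r dvd p * m \<longleftrightarrow> r dvd m" "r ^ 2 dvd p * m \<longleftrightarrow> r ^ 2 dvd m"
      by (simp_all add: coprime_dvd_mult_right_iff)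
  qed
  then show "sharp_primes (p * m) = insert p (sharp_primes m)"
    using p pp by (auto simp: sharp_primes_def)
qed

lemma sharp_primes_dvd:
  assumes "p \<in> sharp_primes n"
  shows "prime p" "n = p * (n div p)" "\<not> p dvd n div p"
proof -
  show "prime p" and n: "n = p * (n div p)" using assms by (auto simp: sharp_primes_def)
  show "\<not> p dvd n div p"
  proof
    assume "p dvd n div p"
    then have "p * p dvd p * (n div p)" by simp
    then show False using assms n by (simp add: sharp_primes_def power2_eq_square)
  qed
qed

lemma prod_linear_has_derivative:
  fixes v :: "'a \<Rightarrow> real"
  assumes "finite S"
  shows "((\<lambda>x. \<Prod>p\<in>S. 1 - x * v p) has_real_derivative - (\<Sum>p\<in>S. v p * (\<Prod>r\<in>S - {p}. 1 - x * v r))) (at x)"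
  using assms
proof (induction S rule: finite_induct)
  case (insert s S)
  define A where "A = (\<Sum>p\<in>S. v p * (\<Prod>r\<in>S - {p}. 1 - x * v r))"
  have der: "((\<lambda>x. (1 - x * v s) * (\<Prod>p\<in>S. 1 - x * v p)) has_real_derivative
      (1 - x * v s) * - A + - v s * (\<Prod>p\<in>S. 1 - x * v p)) (at x)"
    unfolding A_def by (rule DERIV_mult'[OF _ insert.IH]) (auto intro!: derivative_eq_intros)
  have "(\<Sum>p\<in>S. v p * (\<Prod>r\<in>insert s S - {p}. 1 - x * v r)) = (\<Sum>p\<in>S. (1 - x * v s) * (v p * (\<Prod>r\<in>S - {p}. 1 - x * v r)))"
  proof (rule sum.cong[OF refl])
    fix p assume "p \<in> S"
    then have "insert s S - {p} = insert s (S - {p})" using insert by auto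
    then show "v p * (\<Prod>r\<in>insert s S - {p}. 1 - x * v r) = (1 - x * v s) * (v p * (\<Prod>r\<in>S - {p}. 1 - x * v r))"
      using insert by simp
  qed
  also have "\<dots> = (1 - x * v s) * A" by (simp add: A_def sum_distrib_left)
  finally have A: "(\<Sum>p\<in>S. v p * (\<Prod>r\<in>insert s S - {p}. 1 - x * v r)) = (1 - x * v s) * A" .
  have "insert s S - {s} = S" using insert by auto
  then have "- (\<Sum>p\<in>insert s S. v p * (\<Prod>r\<in>insert s S - {p}. 1 - x * v r)) =
      (1 - x * v s) * - A + - v s * (\<Prod>p\<in>S. 1 - x * v p)"
    unfolding sum.insert[OF insert(1,2)] A by simp
  then show ?case using der unfolding prod.insert[OF insert(1,2)] by simp
qed simp

text \<open>Each term of the product rule omits one factor, and the product of the others is the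
  weight of \<open>n div p\<close>.\<close>

lemma sieve_weight_has_derivative:
  assumes "n > 0"
  shows "((\<lambda>x. sieve_weight v x n) has_real_derivative - (\<Sum>p\<in>sharp_primes n. v p * sieve_weight v x (n div p))) (at x)"
proof -
  have "sharp_primes (n div p) = sharp_primes n - {p}" if "p \<in> sharp_primes n" for p
    using sharp_primes_dvd[OF that] sharp_primes_mult[of p "n div p"] by auto
  then show ?thesis
    using prod_linear_has_derivative[OF finite_sharp_primes[OF assms], of v x]
    by (simp add: sieve_weight_def)
qed

section \<open>A partition of unity on the logarithmic scale of primes\<close>

definition hat_weight :: "nat \<Rightarrow> nat \<Rightarrow> nat \<Rightarrow> real" where
  "hat_weight J1 J2 p = (if prime p then \<Sum>j\<in>{J1..J2}. hat (ln (real p) - real j) else 0)"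

text \<open>Only the hats at \<open>k\<close>, the integer part of \<open>u\<close>, and at
  \<open>k + 1\<close> can be non-zero at \<open>u\<close>, and these two add up to 1; near the ends
  of the range one or both may be missing.\<close>

lemma hat_partition:
  fixes u :: real
  assumes "u \<ge> 0"
  shows "0 \<le> (\<Sum>j\<in>{J1..J2}. hat (u - real j))" "(\<Sum>j\<in>{J1..J2}. hat (u - real j)) \<le> 1"
    and "real J1 \<le> u \<Longrightarrow> u \<le> real J2 \<Longrightarrow> (\<Sum>j\<in>{J1..J2}. hat (u - real j)) = 1"
proof -
  show "0 \<le> (\<Sum>j\<in>{J1..J2}. hat (u - real j))" by (intro sum_nonneg hat_le_1)
  define k where "k = nat \<lfloor>u\<rfloor>"
  have k: "real k \<le> u" "u < real k + 1" using assms by (auto simp: k_def)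
  have zero: "hat (u - real j) = 0" if "j \<noteq> k" "j \<noteq> Suc k" for j
  proof -
    have "j < k \<or> j \<ge> k + 2" using that by linarith
    then have "real j \<le> real k - 1 \<or> real j \<ge> real k + 2" by (auto simp: of_nat_le_iff[symmetric] simp del: of_nat_le_iff)
    then show ?thesis using k by (auto simp: hat_def)
  qed
  have val: "hat (u - real k) = 1 - (u - real k)" "hat (u - real (Suc k)) = u - real k"
    using k by (auto simp: hat_def)
  have eq: "(\<Sum>j\<in>{J1..J2}. hat (u - real j)) = (\<Sum>j\<in>{J1..J2} \<inter> {k, Suc k}. hat (u - real j))"
    by (rule sum.mono_neutral_right) (auto intro: zero)
  have "(\<Sum>j\<in>{J1..J2} \<inter> {k, Suc k}. hat (u - real j)) \<le> (\<Sum>j\<in>{k, Suc k}. hat (u - real j))"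
    by (rule sum_mono2) (auto intro: hat_le_1)
  also have "\<dots> = 1" using val by simp
  finally show "(\<Sum>j\<in>{J1..J2}. hat (u - real j)) \<le> 1" using eq by simp
  assume u: "real J1 \<le> u" "u \<le> real J2"
  have "J1 \<le> k" using u(1) by (simp add: k_def le_nat_floor)
  show "(\<Sum>j\<in>{J1..J2}. hat (u - real j)) = 1"
  proof (cases "Suc k \<le> J2")
    case True
    then have "{J1..J2} \<inter> {k, Suc k} = {k, Suc k}" using \<open>J1 \<le> k\<close> by auto
    then show ?thesis using eq val by simp
  next
    case False
    then have "u = real k" using k u by (metis not_less_eq_eq of_nat_le_iff order_antisym order_trans)
    moreover have "k \<le> J2" using u k by (metis of_nat_le_iff order_trans)
    ultimately have "{J1..J2} \<inter> {k, Suc k} = {k}" using False \<open>J1 \<le> k\<close> by auto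
    then show ?thesis using eq val \<open>u = real k\<close> by simp
  qed
qed

lemma hat_weight_bounds: "0 \<le> hat_weight J1 J2 p" "hat_weight J1 J2 p \<le> 1"
proof -
  have "ln (real p) \<ge> 0" if "prime p" using prime_ge_1_nat[OF that] by simp
  then show "0 \<le> hat_weight J1 J2 p" "hat_weight J1 J2 p \<le> 1"
    using hat_partition(1,2) by (auto simp: hat_weight_def)
qed

lemma hat_weight_eq_1:
  assumes "prime p" "exp (real J1) \<le> real p" "real p \<le> exp (real J2)"
  shows "hat_weight J1 J2 p = 1"
proof -
  have p: "real p > 0" using prime_gt_0_nat[OF assms(1)] by simp
  have "real J1 \<le> ln (real p)" using assms p by (simp add: ln_ge_iff)
  moreover have "ln (real p) \<le> ln (exp (real J2))" by (subst ln_le_cancel_iff) (use p assms in auto)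
  ultimately show ?thesis using assms(1) hat_partition(3)[of "ln (real p)" J1 J2] prime_ge_1_nat[OF assms(1)]
    by (simp add: hat_weight_def)
qed

definition hat_support :: "nat \<Rightarrow> nat \<Rightarrow> nat set" where
  "hat_support J1 J2 = (\<Union>j\<in>{J1..J2}. hat_primes (real j))"

lemma hat_weight_eq_0:
  assumes "p \<notin> hat_support J1 J2"
  shows "hat_weight J1 J2 p = 0"
  using assms by (auto simp: hat_weight_def hat_support_def hat_primes_def hat_def intro!: sum.neutral)

lemma finite_hat_support: "finite (hat_support J1 J2)"
  by (simp add: hat_support_def finite_hat_primes)

lemma hat_support_bounds:
  assumes "p \<in> hat_support J1 J2"
  shows "prime p" "exp (real J1 - 1) < real p" "real p < exp (real J2 + 1)"
proof -
  obtain j where j: "j \<in> {J1..J2}" "p \<in> hat_primes (real j)" using assms by (auto simp: hat_support_def)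
  note b = hat_primes_bounds[OF j(2)]
  show "prime p" by (rule b)
  have "exp (real J1 - 1) \<le> exp (real j - 1)" "exp (real j + 1) \<le> exp (real J2 + 1)" using j by auto
  then show "exp (real J1 - 1) < real p" "real p < exp (real J2 + 1)" using b by linarith+
qed

lemma card_hat_support_le: "real (card (hat_support J1 J2)) \<le> exp (real J2 + 1)"
proof -
  have "hat_support J1 J2 \<subseteq> {1..nat \<lfloor>exp (real J2 + 1)\<rfloor>}"
  proof
    fix p assume p: "p \<in> hat_support J1 J2"
    have "real p \<le> exp (real J2 + 1)" using hat_support_bounds(3)[OF p] by simp
    then have "p \<le> nat \<lfloor>exp (real J2 + 1)\<rfloor>" by (simp add: le_nat_floor)
    then show "p \<in> {1..nat \<lfloor>exp (real J2 + 1)\<rfloor>}" using prime_ge_1_nat[OF hat_support_bounds(1)[OF p]] by simp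
  qed
  then have "card (hat_support J1 J2) \<le> nat \<lfloor>exp (real J2 + 1)\<rfloor>"
    using card_mono[of "{1..nat \<lfloor>exp (real J2 + 1)\<rfloor>}" "hat_support J1 J2"] by simp
  also have "real (nat \<lfloor>exp (real J2 + 1)\<rfloor>) \<le> exp (real J2 + 1)" by (simp add: of_nat_floor)
  finally show ?thesis by simp
qed

text \<open>Reindexing by \<open>n = p * m\<close>. The condition \<open>m < Z\<close> follows from
  \<open>p * m < Z\<close> but is kept, because it remains when the other two conditions are removed
  later.\<close>

lemma sum_sharp_primes_eq:
  fixes g :: "nat \<Rightarrow> nat \<Rightarrow> complex"
  assumes "\<And>p m. p \<notin> Q \<Longrightarrow> g p m = 0" "finite Q" "\<And>p. p \<in> Q \<Longrightarrow> prime p"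
  shows "(\<Sum>n\<in>{1..<Z}. \<Sum>p\<in>sharp_primes n. g p (n div p)) =
    (\<Sum>p\<in>Q. \<Sum>m | m \<in> {1..<Z} \<and> \<not> p dvd m \<and> p * m < Z. g p m)"
proof -
  have "(\<Sum>n\<in>{1..<Z}. \<Sum>p\<in>sharp_primes n. g p (n div p)) = (\<Sum>n\<in>{1..<Z}. \<Sum>p\<in>sharp_primes n \<inter> Q. g p (n div p))"
    using assms(1) finite_sharp_primes by (intro sum.cong refl sum.mono_neutral_right) auto
  also have "\<dots> = (\<Sum>(n, p)\<in>(SIGMA n:{1..<Z}. sharp_primes n \<inter> Q). g p (n div p))"
    using assms(2) by (subst sum.Sigma) auto
  also have "\<dots> = (\<Sum>(p, m)\<in>(SIGMA p:Q. {m. m \<in> {1..<Z} \<and> \<not> p dvd m \<and> p * m < Z}). g p m)"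
  proof (rule sum.reindex_bij_witness[where i = "\<lambda>(p, m). (p * m, p)" and j = "\<lambda>(n, p). (p, n div p)"])
    fix x assume "x \<in> (SIGMA n:{1..<Z}. sharp_primes n \<inter> Q)"
    then obtain n p where x: "x = (n, p)" "n \<in> {1..<Z}" "p \<in> sharp_primes n" "p \<in> Q" by auto
    note s = sharp_primes_dvd[OF x(3)]
    show "(case case x of (n, p) \<Rightarrow> (p, n div p) of (p, m) \<Rightarrow> (p * m, p)) = x" using x s by simp
    have "n div p \<noteq> 0" using s(2) x(2) by (metis atLeastLessThan_iff mult_0_right not_one_le_zero)
    moreover have "n div p < Z" using x(2) div_le_dividend[of n p] by (simp only: atLeastLessThan_iff) linarith
    moreover have "p * (n div p) < Z" using x(2) unfolding s(2)[symmetric] by simp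
    ultimately show "(case x of (n, p) \<Rightarrow> (p, n div p)) \<in> (SIGMA p:Q. {m. m \<in> {1..<Z} \<and> \<not> p dvd m \<and> p * m < Z})"
      using x(1,4) s(3) by auto
    show "(case case x of (n, p) \<Rightarrow> (p, n div p) of (p, m) \<Rightarrow> g p m) = (case x of (n, p) \<Rightarrow> g p (n div p))"
      using x by simp
  next
    fix x assume "x \<in> (SIGMA p:Q. {m. m \<in> {1..<Z} \<and> \<not> p dvd m \<and> p * m < Z})"
    then obtain p m where x: "x = (p, m)" "p \<in> Q" "m \<in> {1..<Z}" "\<not> p dvd m" "p * m < Z" by auto
    have p: "prime p" "p > 0" using assms(3)[OF x(2)] prime_gt_0_nat by auto
    then show "(case case x of (p, m) \<Rightarrow> (p * m, p) of (n, p) \<Rightarrow> (p, n div p)) = x" using x by simp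
    show "(case x of (p, m) \<Rightarrow> (p * m, p)) \<in> (SIGMA n:{1..<Z}. sharp_primes n \<inter> Q)"
      using x p sharp_primes_mult[OF p(1) x(4)] by auto
  qed
  also have "\<dots> = (\<Sum>p\<in>Q. \<Sum>m | m \<in> {1..<Z} \<and> \<not> p dvd m \<and> p * m < Z. g p m)"
    using assms(2) by (subst sum.Sigma) auto
  finally show ?thesis .
qed

section \<open>Dyadic decomposition of the second moment\<close>

definition dyadic :: "nat \<Rightarrow> nat set" where
  "dyadic i = {2 ^ i..<2 ^ Suc i}"

lemma dyadic_bounds: "n \<in> dyadic i \<Longrightarrow> n \<ge> 1" "n \<in> dyadic i \<Longrightarrow> real n \<ge> 2 ^ i"
proof -
  assume "n \<in> dyadic i"
  then have n: "2 ^ i \<le> n" by (simp add: dyadic_def)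
  show "n \<ge> 1" using n one_le_power[of "2::nat" i] by linarith
  show "real n \<ge> 2 ^ i" using n by (metis of_nat_le_iff of_nat_numeral of_nat_power)
qed

lemma finite_dyadic: "finite (dyadic i)"
  by (simp add: dyadic_def)

lemma dyadic_subset: "dyadic i \<subseteq> {1..<2 ^ Suc i}" "dyadic i \<subseteq> {..<2 ^ Suc i}"
  using dyadic_bounds(1) by (auto simp: dyadic_def)

lemma sum_dyadic: "(\<Sum>n\<in>{1..<2 ^ I}. f n) = (\<Sum>i<I. \<Sum>n\<in>dyadic i. f n)"
proof (induction I)
  case (Suc I)
  have "{1..<2 ^ Suc I} = {1..<2 ^ I} \<union> dyadic I" "{1..<2 ^ I} \<inter> dyadic I = {}"
    using one_le_power[of "2::nat" I] by (auto simp: dyadic_def)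
  then show ?case using Suc by (simp add: sum.union_disjoint finite_dyadic)
qed simp

lemma sum_dyadic_filter:
  "(\<Sum>n | n \<in> {1..<2 ^ I} \<and> P n. f n) = (\<Sum>i<I. \<Sum>n | n \<in> dyadic i \<and> P n. f n)"
proof -
  have "(\<Sum>n | n \<in> {1..<2 ^ I} \<and> P n. f n) = (\<Sum>n\<in>{1..<2 ^ I}. if P n then f n else 0)"
    by (rule sum.inter_filter) simp
  also have "\<dots> = (\<Sum>i<I. \<Sum>n | n \<in> dyadic i \<and> P n. f n)"
    unfolding sum_dyadic by (simp add: sum.inter_filter finite_dyadic)
  finally show ?thesis .
qed

lemma sum_cover_le:
  fixes f :: "'a \<Rightarrow> real"
  assumes fin: "finite A" "finite Q" "\<And>p. p \<in> Q \<Longrightarrow> finite (B p)"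
    and sub: "S \<subseteq> A \<union> (\<Union>p\<in>Q. B p)" and f: "\<And>x. f x \<ge> 0"
  shows "sum f S \<le> sum f A + (\<Sum>p\<in>Q. sum f (B p))"
proof -
  have U: "sum f (\<Union>p\<in>Q. B p) \<le> (\<Sum>p\<in>Q. sum f (B p))"
    using fin(2,3)
  proof (induction Q rule: finite_induct)
    case (insert p Q)
    have "sum f (B p \<union> (\<Union>p\<in>Q. B p)) \<le> sum f (B p) + sum f (\<Union>p\<in>Q. B p)"
      using insert sum.union_inter[of "B p" "\<Union>p\<in>Q. B p" f] sum_nonneg[of "B p \<inter> (\<Union>p\<in>Q. B p)" f] f
      by auto
    then show ?case using insert by simp
  qed simp
  have finU: "finite (\<Union>p\<in>Q. B p)" using fin by auto
  have "sum f S \<le> sum f (A \<union> (\<Union>p\<in>Q. B p))" using fin finU sub f by (intro sum_mono2) auto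
  also have "\<dots> \<le> sum f A + sum f (\<Union>p\<in>Q. B p)"
    using sum.union_inter[OF fin(1) finU, of f] sum_nonneg[of "A \<inter> (\<Union>p\<in>Q. B p)" f] f by auto
  finally show ?thesis using U by linarith
qed

lemma inverse_square_sums:
  "finite S \<Longrightarrow> (\<Sum>n\<in>S. 1 / (real n)\<^sup>2) \<le> 2" "summable (\<lambda>n. 1 / (real n)\<^sup>2)" "(\<Sum>n. 1 / (real n)\<^sup>2) \<le> 2"
proof -
  have eq: "1 / real n powr (1 + 1) = 1 / (real n)\<^sup>2" for n
    by (cases "n = 0") (simp_all add: powr_numeral)
  note b = powr_series_bound[of 1, unfolded eq, simplified]
  show "summable (\<lambda>n. 1 / (real n)\<^sup>2)" "(\<Sum>n. 1 / (real n)\<^sup>2) \<le> 2" using b by auto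
  show "(\<Sum>n\<in>S. 1 / (real n)\<^sup>2) \<le> 2" if "finite S"
    using sum_le_suminf[OF b(1) that] b(2) by simp
qed

text \<open>\<open>3 / 2 = 1 / 4 + 5 / 4\<close>: the first power gives the saving, as every
  \<open>p\<close> exceeds \<open>exp (J1 - 1)\<close> and \<open>exp (1 / 4) \<le> 3\<close>; the
  series with exponent \<open>5 / 4\<close> is at most 5.\<close>

lemma sum_hat_support_le: "(\<Sum>p\<in>hat_support J1 J2. real p powr (- 3 / 2)) \<le> 15 * exp (- real J1 / 4)"
proof -
  have "real p powr (- 3 / 2) \<le> 3 * exp (- real J1 / 4) * (1 / real p powr (1 + 1 / 4))" if p: "p \<in> hat_support J1 J2" for p
  proof -
    note b = hat_support_bounds[OF p]
    have p0: "real p > 0" using prime_gt_0_nat[OF b(1)] by simp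
    have "real p powr (- (1 / 4)) \<le> exp (real J1 - 1) powr (- (1 / 4))"
      by (rule powr_mono2') (use b(2) in auto)
    also have "\<dots> = exp (1 / 4) * exp (- real J1 / 4)"
      by (simp add: powr_def exp_add[symmetric] diff_divide_distrib)
    also have "\<dots> \<le> 3 * exp (- real J1 / 4)"
    proof (intro mult_right_mono)
      have "exp (1 / 4 :: real) \<le> exp 1" by simp
      then show "exp (1 / 4) \<le> (3::real)" using exp_le by linarith
    qed simp
    finally have "real p powr (- (1 / 4)) * real p powr (- (1 + 1 / 4)) \<le> 3 * exp (- real J1 / 4) * real p powr (- (1 + 1 / 4))"
      by (intro mult_right_mono) auto
    then show ?thesis using p0 by (simp add: powr_add[symmetric] powr_minus_divide)
  qed
  then have "(\<Sum>p\<in>hat_support J1 J2. real p powr (- 3 / 2)) \<le> (\<Sum>p\<in>hat_support J1 J2. 3 * exp (- real J1 / 4) * (1 / real p powr (1 + 1 / 4)))"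
    by (rule sum_mono)
  also have "\<dots> = 3 * exp (- real J1 / 4) * (\<Sum>p\<in>hat_support J1 J2. 1 / real p powr (1 + 1 / 4))"
    by (simp add: sum_distrib_left)
  also have "\<dots> \<le> 3 * exp (- real J1 / 4) * (1 + 1 / (1 / 4))"
    using sum_le_suminf[OF powr_series_bound(1)[of "1/4"] finite_hat_support[of J1 J2]] powr_series_bound(2)[of "1/4"]
    by (intro mult_left_mono) auto
  finally show ?thesis by simp
qed

text \<open>The data for one modulus, with \<open>K\<close> and \<open>W\<close> supplied from
  outside so that the bounds are uniform. \<open>Y\<close> is the scale of the cut-off,
  \<open>J1\<close> and \<open>J2\<close> are the logarithms of the ends of the range of primes, and
  \<open>\<epsilon>\<close> controls the prime sums. Each exponent of the weight has its use: 1/16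
  for blocks shorter than \<open>q\<close>, 1/4 and 3/4 for the two sides of \<open>Y\<close>, 1/2
  for the bilinear sums, 3 beyond \<open>2 ^ I\<close>.\<close>

locale dyadic_moment = L_function_bounds +
  fixes h :: "complex \<Rightarrow> complex" and K W Y \<epsilon> :: real and q J1 J2 I :: nat and X :: "(int \<Rightarrow> complex) set"
  assumes K: "K \<ge> 1" and W: "W \<ge> 1"
    and lamF_sqrt: "\<And>n. n \<ge> 1 \<Longrightarrow> norm (lamF n) \<le> K * sqrt (real n)"
    and lamF_square: "\<And>M::nat. (\<Sum>n\<in>{1..<M}. (norm (lamF n))\<^sup>2) \<le> K * real M"
    and lamF_square_dvd: "\<And>p a. \<And>M::nat. prime p \<Longrightarrow> a \<le> 2 \<Longrightarrow>
      (\<Sum>n | n \<in> {1..<M} \<and> p ^ a dvd n. (norm (lamF n))\<^sup>2) \<le> K * real M / real p ^ a"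
    and lamF_square_sifted: "\<And>P1 P2 x :: real. 2 \<le> P1 \<Longrightarrow> P1 \<le> P2 \<Longrightarrow> P2 \<le> x \<Longrightarrow>
      (\<Sum>n | 1 \<le> n \<and> real n \<le> x \<and> coprime n (\<Prod>p | prime p \<and> P1 \<le> real p \<and> real p \<le> P2. p).
          (norm (lamF n))\<^sup>2) \<le> K * (x * (ln P1 / ln P2))"
    and N1: "N q \<ge> 1"
    and weight: "\<And>c n. c \<in> {1/16, 1/4, 1/2, 3/4, 3} \<Longrightarrow> n \<ge> 1 \<Longrightarrow>
      norm (mellin_weight h 1 (N q) n) \<le> W * (sqrt (real (N q)) / real n) powr c"
    and weight_half: "\<And>n. n \<ge> 1 \<Longrightarrow> mellin_weight h 1 (N q) n = mellin_weight h (1/2) (N q) n"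
    and h_continuous: "continuous_on UNIV (\<lambda>y. h (Complex (1/2) y))"
    and h_integrable: "integrable lborel (\<lambda>y. (1 + \<bar>y\<bar>) * norm (h (Complex (1/2) y)))"
    and h_integral: "(LBINT y. (1 + \<bar>y\<bar>) * norm (h (Complex (1/2) y))) \<le> W"
    and q: "q \<ge> 2" and X: "finite X" "X \<subseteq> primitive_characters q"
    and Y: "Y \<ge> 1" "sqrt (real (N q)) \<le> Y"
    and J: "1 \<le> J1" "J1 \<le> J2" "exp (real J2) \<le> real q"
    and I: "Y ^ 3 \<le> 2 ^ I"
    and eps: "\<epsilon> \<ge> 0"
    and hat_sum_le: "\<And>chi j y. chi \<in> X \<Longrightarrow> j \<in> {J1..J2} \<Longrightarrow> norm (hat_sum chi (real j) (Complex 1 y)) \<le> \<epsilon> * (1 + \<bar>y\<bar>)"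
begin

abbreviation "v \<equiv> hat_weight J1 J2"
abbreviation "Q \<equiv> hat_support J1 J2"

definition beta :: "nat \<Rightarrow> complex" where
  "beta n = mellin_weight h 1 (N q) n / of_nat n powr (1/2)"

text \<open>The bound for a block shorter than \<open>q\<close>, where the large sieve costs
  \<open>q\<close> in place of the length. The exponent \<open>1/16\<close> keeps the loss in
  \<open>Y\<close> small: once \<open>Y \<ge> q powr (3/2)\<close>, this is smaller than
  \<open>sqrt Y\<close> by a power of \<open>q\<close>.\<close>

definition low_bound :: real where
  "low_bound = sqrt (6 * K * real q) * W * Y powr (1/16)"

lemma character_X: "chi \<in> X \<Longrightarrow> dirichlet_character q chi"
  using X primitive_imp_character by blast

lemma norm_chi: "chi \<in> X \<Longrightarrow> norm (chi n) \<le> 1"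
  using norm_character_le[OF character_X] q by simp

lemma low_bound_nonneg: "low_bound \<ge> 0"
  using K W by (simp add: low_bound_def)

lemma norm_beta_le:
  assumes c: "c \<in> {1/16, 1/4, 1/2, 3/4, 3}" and n: "n \<ge> 1"
  shows "norm (beta n) \<le> W * (Y / real n) powr c / sqrt (real n)"
proof -
  have "norm (beta n) = norm (mellin_weight h 1 (N q) n) / sqrt (real n)"
    by (simp add: beta_def norm_divide norm_of_nat_powr powr_half_sqrt)
  also have "\<dots> \<le> W * (sqrt (real (N q)) / real n) powr c / sqrt (real n)"
    using weight[OF c n] by (intro divide_right_mono) auto
  also have "\<dots> \<le> W * (Y / real n) powr c / sqrt (real n)"
    using W Y c n by (intro divide_right_mono mult_left_mono powr_mono2 divide_right_mono) auto
  finally show ?thesis .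
qed

lemma norm_beta_dyadic_le:
  assumes c: "c \<in> {1/16, 1/4, 1/2, 3/4, 3}" and p: "p \<ge> 1" and m: "m \<in> dyadic i"
  shows "norm (beta (p * m)) \<le> W * (Y / (real p * 2 ^ i)) powr c / sqrt (real p * 2 ^ i)"
proof -
  have pm: "p * m \<ge> 1" using p dyadic_bounds(1)[OF m] by simp
  have le: "real p * 2 ^ i \<le> real (p * m)" using dyadic_bounds(2)[OF m] by (simp add: mult_left_mono)
  have pos: "real p * 2 ^ i > 0" using p by simp
  have "norm (beta (p * m)) \<le> W * (Y / real (p * m)) powr c / sqrt (real (p * m))" by (rule norm_beta_le[OF c pm])
  also have "\<dots> \<le> W * (Y / (real p * 2 ^ i)) powr c / sqrt (real p * 2 ^ i)"
  proof (rule frac_le)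
    have "Y / real (p * m) \<le> Y / (real p * 2 ^ i)" using Y pos le by (intro divide_left_mono) auto
    then show "W * (Y / real (p * m)) powr c \<le> W * (Y / (real p * 2 ^ i)) powr c"
      using W Y c by (intro mult_left_mono powr_mono2) auto
  qed (use W pos le in auto)
  finally show ?thesis .
qed

lemma l2norm_dyadic_le:
  assumes S: "S \<subseteq> dyadic i" and b: "\<And>n. n \<in> S \<Longrightarrow> norm (b n) \<le> norm (lamF n) * B" and B: "B \<ge> 0"
    and R: "(\<Sum>n\<in>S. (norm (lamF n))\<^sup>2) \<le> R * 2 ^ i"
  shows "l2norm X (\<lambda>chi. \<Sum>n\<in>S. b n * chi (int n)) \<le> sqrt ((real q + 2 ^ Suc i) * (R * 2 ^ i)) * B"
proof -
  have "l2norm X (\<lambda>chi. \<Sum>n\<in>S. b n * chi (int n)) \<le> sqrt ((real q + real (2 ^ Suc i)) * (\<Sum>n\<in>S. (norm (b n))\<^sup>2))"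
    by (rule l2norm_large_sieve[OF X(1) character_X]) (use q S dyadic_subset(2) in auto)
  also have "(\<Sum>n\<in>S. (norm (b n))\<^sup>2) \<le> (\<Sum>n\<in>S. (norm (lamF n) * B)\<^sup>2)"
    using b by (intro sum_mono power_mono) auto
  also have "\<dots> = (\<Sum>n\<in>S. (norm (lamF n))\<^sup>2) * B\<^sup>2" by (simp add: power_mult_distrib sum_distrib_right)
  also have "\<dots> \<le> (R * 2 ^ i) * B\<^sup>2" using R by (intro mult_right_mono) auto
  finally have "l2norm X (\<lambda>chi. \<Sum>n\<in>S. b n * chi (int n)) \<le> sqrt ((real q + real (2 ^ Suc i)) * ((R * 2 ^ i) * B\<^sup>2))"
    by (simp add: mult_left_mono)
  also have "\<dots> = sqrt ((real q + 2 ^ Suc i) * (R * 2 ^ i)) * B"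
    using B by (simp add: real_sqrt_mult)
  finally show ?thesis .
qed

text \<open>Once the block is at least as long as \<open>q\<close>, the large sieve constant
  \<open>q + 2 ^ Suc i\<close> is at most \<open>3 * 2 ^ i\<close>, of the order of the
  length.\<close>

lemma l2norm_dyadic_high:
  assumes S: "S \<subseteq> dyadic i" and b: "\<And>n. n \<in> S \<Longrightarrow> norm (b n) \<le> norm (lamF n) * B" and B: "B \<ge> 0"
    and R: "(\<Sum>n\<in>S. (norm (lamF n))\<^sup>2) \<le> R * 2 ^ i" "R \<ge> 0" and high: "q \<le> 2 ^ i"
  shows "l2norm X (\<lambda>chi. \<Sum>n\<in>S. b n * chi (int n)) \<le> sqrt (3 * R) * 2 ^ i * B"
proof -
  have "real q \<le> 2 ^ i" using high by (metis of_nat_le_iff of_nat_numeral of_nat_power)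
  then have "(real q + 2 ^ Suc i) * (R * 2 ^ i) \<le> (3 * 2 ^ i) * (R * 2 ^ i)"
    using R by (intro mult_right_mono) auto
  also have "\<dots> = (3 * R) * (2 ^ i)\<^sup>2" by (simp add: power2_eq_square)
  finally have "sqrt ((real q + 2 ^ Suc i) * (R * 2 ^ i)) \<le> sqrt (3 * R) * 2 ^ i"
    using real_sqrt_le_mono by (fastforce simp: real_sqrt_mult)
  then have "sqrt ((real q + 2 ^ Suc i) * (R * 2 ^ i)) * B \<le> sqrt (3 * R) * 2 ^ i * B"
    using B by (rule mult_right_mono)
  then show ?thesis using l2norm_dyadic_le[OF S b B R(1)] by simp
qed

lemma lamF_square_dyadic: "S \<subseteq> dyadic i \<Longrightarrow> (\<Sum>n\<in>S. (norm (lamF n))\<^sup>2) \<le> 2 * K * 2 ^ i"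
proof -
  assume S: "S \<subseteq> dyadic i"
  have "(\<Sum>n\<in>S. (norm (lamF n))\<^sup>2) \<le> (\<Sum>n\<in>{1..<2 ^ Suc i}. (norm (lamF n))\<^sup>2)"
    using S dyadic_subset(1)[of i] by (intro sum_mono2) auto
  also have "\<dots> \<le> K * real (2 ^ Suc i)" by (rule lamF_square)
  finally show ?thesis by simp
qed

lemma low_dyadic:
  assumes p: "p \<ge> 1" and S: "S \<subseteq> dyadic i" and b: "\<And>m. m \<in> S \<Longrightarrow> norm (b m) \<le> norm (lamF m)" and low: "2 ^ i < q"
  shows "l2norm X (\<lambda>chi. \<Sum>m\<in>S. b m * beta (p * m) * chi (int m)) \<le> low_bound"
proof -
  define B where "B = W * Y powr (1/16) / sqrt (2 ^ i)"
  have B: "B \<ge> 0" using W by (simp add: B_def)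
  have "W * (Y / (real p * 2 ^ i)) powr (1/16) / sqrt (real p * 2 ^ i) \<le> B"
    unfolding B_def
  proof (rule frac_le)
    have p1: "1 \<le> real p * 2 ^ i" "2 ^ i \<le> real p * 2 ^ i" using p by (simp_all add: mult_ge1_I)
    have "Y / (real p * 2 ^ i) \<le> Y / 1" using Y p1 by (intro divide_left_mono) auto
    then show "W * (Y / (real p * 2 ^ i)) powr (1/16) \<le> W * Y powr (1/16)"
      using W Y by (intro mult_left_mono powr_mono2) auto
    show "sqrt (2 ^ i) \<le> sqrt (real p * 2 ^ i)" using p1 by simp
  qed (use W in auto)
  then have beta: "norm (beta (p * m)) \<le> B" if "m \<in> S" for m
    using norm_beta_dyadic_le[of "1/16" p m i] p S that by fastforce
  have "l2norm X (\<lambda>chi. \<Sum>m\<in>S. b m * beta (p * m) * chi (int m)) \<le> sqrt ((real q + 2 ^ Suc i) * (2 * K * 2 ^ i)) * B"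
    using b beta by (intro l2norm_dyadic_le[OF S _ B lamF_square_dyadic[OF S]]) (auto simp: norm_mult intro: mult_mono)
  also have "\<dots> \<le> sqrt ((6 * K * real q) * 2 ^ i) * B"
  proof (intro mult_right_mono B real_sqrt_le_mono)
    have "(2::real) ^ i \<le> real q" using low by (metis less_imp_le of_nat_le_iff of_nat_numeral of_nat_power)
    then have "(real q + 2 ^ Suc i) * (2 * K * 2 ^ i) \<le> (3 * real q) * (2 * K * 2 ^ i)"
      using K by (intro mult_right_mono) auto
    then show "(real q + 2 ^ Suc i) * (2 * K * 2 ^ i) \<le> 6 * K * real q * 2 ^ i" by simp
  qed
  also have "\<dots> = low_bound" by (simp add: B_def low_bound_def real_sqrt_mult)
  finally show ?thesis .
qed

text \<open>The share \<open>R\<close> of the mean square of \<open>lamF\<close> carried by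
  \<open>S\<close> enters as \<open>sqrt R\<close>; the sieve saving and the saving from
  divisibility by \<open>p\<close> are both fed in through it.\<close>

lemma high_dyadic:
  assumes p: "p \<ge> 1" and S: "S \<subseteq> dyadic i" and b: "\<And>m. m \<in> S \<Longrightarrow> norm (b m) \<le> norm (lamF m)" and high: "q \<le> 2 ^ i"
    and R: "(\<Sum>n\<in>S. (norm (lamF n))\<^sup>2) \<le> R * 2 ^ i" "R \<ge> 0" and c: "c \<in> {1/16, 1/4, 1/2, 3/4, 3}"
  shows "l2norm X (\<lambda>chi. \<Sum>m\<in>S. b m * beta (p * m) * chi (int m))
    \<le> sqrt (3 * R) * W * (Y / (real p * 2 ^ i)) powr c * sqrt (2 ^ i / real p)"
proof -
  define B where "B = W * (Y / (real p * 2 ^ i)) powr c / sqrt (real p * 2 ^ i)"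
  have B: "B \<ge> 0" using W by (simp add: B_def)
  have "norm (b m * beta (p * m)) \<le> norm (lamF m) * B" if "m \<in> S" for m
    unfolding norm_mult B_def
    by (intro mult_mono b that norm_beta_dyadic_le c p) (use S that in auto)
  then have "l2norm X (\<lambda>chi. \<Sum>m\<in>S. b m * beta (p * m) * chi (int m)) \<le> sqrt (3 * R) * 2 ^ i * B"
    by (rule l2norm_dyadic_high[OF S _ B R high])
  also have "sqrt (3 * R) * 2 ^ i * B = sqrt (3 * R) * W * (Y / (real p * 2 ^ i)) powr c * (2 ^ i / sqrt (real p * 2 ^ i))"
    by (simp add: B_def)
  also have "2 ^ i / sqrt (real p * 2 ^ i) = (sqrt (2 ^ i) * sqrt (2 ^ i)) / (sqrt (real p) * sqrt (2 ^ i))"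
    by (simp add: real_sqrt_mult)
  also have "\<dots> = sqrt (2 ^ i / real p)" 
  proof -
    have "sqrt (2 ^ i) \<noteq> (0::real)" by simp
    then show ?thesis unfolding real_sqrt_divide by (rule nonzero_mult_divide_mult_cancel_right)
  qed
  finally show ?thesis .
qed

text \<open>\<open>real J1 / real J2\<close> is the quotient of logarithms in (A3) for the primes
  from \<open>exp J1\<close> to \<open>exp J2\<close>; the exponential accounts for the
  \<open>n\<close> divisible by the square of a prime in \<open>Q\<close>.\<close>

definition sift_bound :: real where
  "sift_bound = 2 * K * (real J1 / real J2 + 15 * exp (- real J1 / 4))"

lemma sift_bound_nonneg: "sift_bound \<ge> 0"
  using K by (simp add: sift_bound_def)

text \<open>If the weight at \<open>x = 1\<close> is non-zero, no prime with \<open>v p = 1\<close>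
  divides \<open>n\<close> exactly. So \<open>n\<close> is either free of primes between
  \<open>exp J1\<close> and \<open>exp J2\<close>, which (A3) covers, or divisible by the square of
  one of them, which the case \<open>a = 2\<close> of \<open>lamF_square_dvd\<close> covers.\<close>

lemma lamF_square_unsieved:
  assumes high: "q \<le> 2 ^ i"
  shows "(\<Sum>n | n \<in> dyadic i \<and> sieve_weight v 1 n \<noteq> 0. (norm (lamF n))\<^sup>2) \<le> sift_bound * 2 ^ i"
proof -
  define P where "P = (\<Prod>p | prime p \<and> exp (real J1) \<le> real p \<and> real p \<le> exp (real J2). p)"
  define x :: real where "x = 2 ^ Suc i"
  define A where "A = {n. 1 \<le> n \<and> real n \<le> x \<and> coprime n P}"
  define B where "B p = {n. n \<in> {1..<2 ^ Suc i} \<and> p ^ 2 dvd n}" for p :: nat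
  have finA: "finite A"
  proof (rule finite_subset)
    show "A \<subseteq> {..2 ^ Suc i}"
    proof
      fix n assume "n \<in> A"
      then have "real n \<le> real (2 ^ Suc i)" by (simp add: A_def x_def)
      then show "n \<in> {..2 ^ Suc i}" by (simp only: of_nat_le_iff atMost_iff)
    qed
  qed simp
  have cover: "{n. n \<in> dyadic i \<and> sieve_weight v 1 n \<noteq> 0} \<subseteq> A \<union> (\<Union>p\<in>Q. B p)"
  proof
    fix n assume "n \<in> {n. n \<in> dyadic i \<and> sieve_weight v 1 n \<noteq> 0}"
    then have n: "n \<in> dyadic i" "sieve_weight v 1 n \<noteq> 0" by auto
    have n1: "n \<in> {1..<2 ^ Suc i}" using n(1) dyadic_subset(1) by blast
    show "n \<in> A \<union> (\<Union>p\<in>Q. B p)"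
    proof (cases "coprime n P")
      case True
      have "real n \<le> real (2 ^ Suc i)" using n1 by (simp only: of_nat_le_iff) simp
      then show ?thesis using True n1 by (simp add: A_def x_def)
    next
      case False
      then obtain p where p: "prime p" "exp (real J1) \<le> real p" "real p \<le> exp (real J2)" "\<not> coprime n p"
        unfolding P_def using prod_coprime_right[of "{p. prime p \<and> exp (real J1) \<le> real p \<and> real p \<le> exp (real J2)}" n "\<lambda>p. p"]
        by blast
      have "p dvd n" using p(1,4) by (metis coprime_commute prime_imp_coprime_nat)
      have v1: "v p = 1" by (rule hat_weight_eq_1[OF p(1-3)])
      have "p \<notin> sharp_primes n"
      proof
        assume "p \<in> sharp_primes n"
        then have "sieve_weight v 1 n = 0"
          unfolding sieve_weight_def using n1 v1 by (intro prod_zero finite_sharp_primes) auto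
        then show False using n by simp
      qed
      then have "p ^ 2 dvd n" using \<open>p dvd n\<close> p(1) by (simp add: sharp_primes_def)
      moreover have "p \<in> Q" using hat_weight_eq_0[of p J1 J2] v1 by fastforce
      ultimately show ?thesis using n1 by (auto simp: B_def)
    qed
  qed
  have A_le: "(\<Sum>n\<in>A. (norm (lamF n))\<^sup>2) \<le> K * (x * (ln (exp (real J1)) / ln (exp (real J2))))"
    unfolding A_def P_def
  proof (rule lamF_square_sifted)
    have "(2::real) \<le> exp 1" using exp_ge_add_one_self[of 1] by simp
    also have "\<dots> \<le> exp (real J1)" using J by simp
    finally show "2 \<le> exp (real J1)" .
    have "real q \<le> 2 ^ i" using high by (metis of_nat_le_iff of_nat_numeral of_nat_power)
    moreover have "(0::real) < 2 ^ i" by simp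
    ultimately show "exp (real J2) \<le> x" using J(3) unfolding x_def power_Suc by linarith
  qed (use J in simp)
  have "(\<Sum>n\<in>B p. (norm (lamF n))\<^sup>2) \<le> K * x * real p powr (- 3 / 2)" if p: "p \<in> Q" for p
  proof -
    note pr = hat_support_bounds(1)[OF p]
    have p1: "real p \<ge> 1" using prime_ge_1_nat[OF pr] by simp
    have "(\<Sum>n\<in>B p. (norm (lamF n))\<^sup>2) \<le> K * real (2 ^ Suc i) / real p ^ 2"
      unfolding B_def by (rule lamF_square_dvd[OF pr]) simp
    also have "\<dots> = K * x * real p powr (- 2)" using p1 by (simp add: x_def powr_minus powr_numeral divide_inverse)
    also have "\<dots> \<le> K * x * real p powr (- 3 / 2)"
      using K p1 by (intro mult_left_mono powr_mono) (auto simp: x_def)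
    finally show ?thesis .
  qed
  then have "(\<Sum>p\<in>Q. \<Sum>n\<in>B p. (norm (lamF n))\<^sup>2) \<le> (\<Sum>p\<in>Q. K * x * real p powr (- 3 / 2))" by (rule sum_mono)
  also have "\<dots> = K * x * (\<Sum>p\<in>Q. real p powr (- 3 / 2))" by (simp add: sum_distrib_left)
  also have "\<dots> \<le> K * x * (15 * exp (- real J1 / 4))"
    using K by (intro mult_left_mono sum_hat_support_le) (simp add: x_def)
  finally have "(\<Sum>p\<in>Q. \<Sum>n\<in>B p. (norm (lamF n))\<^sup>2) \<le> K * x * (15 * exp (- real J1 / 4))" .
  moreover have "(\<Sum>n | n \<in> dyadic i \<and> sieve_weight v 1 n \<noteq> 0. (norm (lamF n))\<^sup>2) \<le>
      (\<Sum>n\<in>A. (norm (lamF n))\<^sup>2) + (\<Sum>p\<in>Q. \<Sum>n\<in>B p. (norm (lamF n))\<^sup>2)"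
    using cover finA finite_hat_support by (intro sum_cover_le) (auto simp: B_def)
  ultimately have "(\<Sum>n | n \<in> dyadic i \<and> sieve_weight v 1 n \<noteq> 0. (norm (lamF n))\<^sup>2) \<le>
    K * (x * (real J1 / real J2)) + K * x * (15 * exp (- real J1 / 4))" using A_le by simp
  also have "\<dots> = sift_bound * 2 ^ i" by (simp add: sift_bound_def x_def algebra_simps)
  finally show ?thesis .
qed

definition smoothed :: "real \<Rightarrow> (int \<Rightarrow> complex) \<Rightarrow> complex" where
  "smoothed x chi = (\<Sum>n\<in>{1..<2 ^ I}. lamF n * of_real (sieve_weight v x n) * beta n * chi (int n))"

text \<open>The bound of \<open>sum_min_geometric_le\<close> for the ratio
  \<open>2 powr (1/4)\<close>, by which the quantity \<open>z i\<close> of the next proof grows from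
  one block to the next.\<close>

definition geometric_constant :: real where
  "geometric_constant = 2 / (2 powr (1/4) - 1) + 2"

lemma norm_lamF_sieve_le:
  assumes "0 \<le> x" "x \<le> 1"
  shows "norm (lamF n * of_real (sieve_weight v x n)) \<le> norm (lamF n)"
  using sieve_weight_bounds[of v, OF hat_weight_bounds assms, of n] by (simp add: norm_mult mult_left_le)

lemma l2norm_smoothed_1:
  "l2norm X (smoothed 1) \<le> real I * low_bound + sqrt (3 * sift_bound) * W * sqrt Y * geometric_constant"
proof -
  define c where "c n = lamF n * of_real (sieve_weight v 1 n)" for n
  have c_le: "norm (c n) \<le> norm (lamF n)" for n unfolding c_def by (rule norm_lamF_sieve_le) auto
  define f where "f i = (\<lambda>chi. \<Sum>n\<in>dyadic i. c n * beta n * chi (int n))" for i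
  define z where "z i = Y powr (- 1/4) * (2 powr (1/4)) ^ i" for i :: nat
  have z_pos: "z i > 0" for i using Y by (simp add: z_def)
  define H where "H = sqrt (3 * sift_bound) * W * sqrt Y"
  have H: "H \<ge> 0" using W Y sift_bound_nonneg by (simp add: H_def)
  have "l2norm X (f i) \<le> low_bound + H * min (z i) (1 / z i)" for i
  proof (cases "2 ^ i < q")
    case True
    have "l2norm X (f i) \<le> low_bound"
      using low_dyadic[of 1 "dyadic i" i c] True c_le by (simp add: f_def)
    moreover have "H * min (z i) (1 / z i) \<ge> 0" using H z_pos[of i] by simp
    ultimately show ?thesis by linarith
  next
    case False
    define S where "S = {n. n \<in> dyadic i \<and> sieve_weight v 1 n \<noteq> 0}"
    have f_eq: "f i = (\<lambda>chi. \<Sum>n\<in>S. c n * beta (1 * n) * chi (int n))"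
      unfolding f_def by (intro ext sum.mono_neutral_cong_right) (auto simp: S_def c_def finite_dyadic)
    have bnd: "l2norm X (f i) \<le> sqrt (3 * sift_bound) * W * (Y / (real 1 * 2 ^ i)) powr a * sqrt (2 ^ i / real 1)"
      if "a \<in> {1/16, 1/4, 1/2, 3/4, 3}" for a
      unfolding f_eq
      by (rule high_dyadic) (use False c_le lamF_square_unsieved sift_bound_nonneg that in \<open>auto simp: S_def\<close>)
    have zi: "z i = ((2 ^ i) / Y) powr (1/4)"
      using Y by (simp add: z_def powr_divide powr_realpow[symmetric] powr_powr mult.commute powr_minus_divide)
    have sq: "sqrt (2 ^ i) = (2 ^ i) powr (1/2)" "sqrt Y = Y powr (1/2)" using Y by (simp_all add: powr_half_sqrt)
    have e1: "(Y / 2 ^ i) powr (1/4) * sqrt (2 ^ i) = sqrt Y * z i"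
      unfolding zi sq using Y by (simp add: powr_divide powr_diff[symmetric] field_simps powr_add[symmetric])
    have e2: "(Y / 2 ^ i) powr (3/4) * sqrt (2 ^ i) = sqrt Y * (1 / z i)"
      unfolding zi sq using Y by (simp add: powr_divide powr_diff[symmetric] field_simps powr_add[symmetric])
    have "l2norm X (f i) \<le> H * z i" "l2norm X (f i) \<le> H * (1 / z i)"
      using bnd[of "1/4"] bnd[of "3/4"] e1 e2 by (simp_all add: H_def mult.assoc)
    then have "l2norm X (f i) \<le> H * min (z i) (1 / z i)" by (simp add: min_def)
    then show ?thesis using low_bound_nonneg by linarith
  qed
  then have sum_le: "(\<Sum>i<I. l2norm X (f i)) \<le> (\<Sum>i<I. low_bound + H * min (z i) (1 / z i))" by (rule sum_mono)
  have "l2norm X (smoothed 1) = l2norm X (\<lambda>chi. \<Sum>i<I. f i chi)"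
    unfolding smoothed_def sum_dyadic f_def c_def by simp
  also have "\<dots> \<le> (\<Sum>i<I. l2norm X (f i))" by (rule l2norm_sum)
  also have "\<dots> \<le> (\<Sum>i<I. low_bound + H * min (z i) (1 / z i))" by (rule sum_le)
  also have "\<dots> = real I * low_bound + H * (\<Sum>i<I. min (z i) (1 / z i))"
    by (simp add: sum.distrib sum_distrib_left)
  also have "(\<Sum>i<I. min (z i) (1 / z i)) \<le> geometric_constant"
    unfolding z_def geometric_constant_def by (rule sum_min_geometric_le) (use Y in auto)
  finally show ?thesis using H by (simp add: H_def mult_left_mono)
qed


section \<open>Bilinear sums from the derivative in the interpolation parameter\<close>

definition bilinear_term :: "real \<Rightarrow> (int \<Rightarrow> complex) \<Rightarrow> nat \<Rightarrow> nat \<Rightarrow> complex" where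
  "bilinear_term x chi p m =
     of_real (v p) * lamF p * chi (int p) * (lamF m * of_real (sieve_weight v x m) * beta (p * m) * chi (int m))"

text \<open>A term of the derivative belongs to a factorisation \<open>n = p * m\<close> into
  coprime parts, on which \<open>lamF\<close> and \<open>chi\<close> split; after that only
  \<open>beta (p * m)\<close> and the summation conditions join the variables.\<close>

lemma smoothed_has_derivative:
  assumes chi: "chi \<in> X"
  shows "((\<lambda>x. smoothed x chi) has_vector_derivative
    - (\<Sum>p\<in>Q. \<Sum>m | m \<in> {1..<2 ^ I} \<and> \<not> p dvd m \<and> p * m < 2 ^ I. bilinear_term x chi p m)) (at x)"
proof -
  define g where "g n = (\<Sum>p\<in>sharp_primes n. bilinear_term x chi p (n div p))" for n
  have der: "((\<lambda>x. lamF n * of_real (sieve_weight v x n) * beta n * chi (int n)) has_vector_derivative - g n) (at x)"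
    if n: "n \<in> {1..<2 ^ I}" for n
  proof -
    define D where "D = (\<Sum>p\<in>sharp_primes n. v p * sieve_weight v x (n div p))"
    have "((\<lambda>x. complex_of_real (sieve_weight v x n)) has_vector_derivative of_real (- D)) (at x)"
      unfolding D_def by (rule has_vector_derivative_of_real, rule sieve_weight_has_derivative) (use n in simp)
    then have "((\<lambda>x. (lamF n * beta n * chi (int n)) * complex_of_real (sieve_weight v x n)) has_vector_derivative
       (lamF n * beta n * chi (int n)) * of_real (- D)) (at x)"
      by (rule has_vector_derivative_mult_right)
    moreover have "(lamF n * beta n * chi (int n)) * of_real D = g n"
    proof -
      have "(lamF n * beta n * chi (int n)) * of_real (v p * sieve_weight v x (n div p)) = bilinear_term x chi p (n div p)"
        if "p \<in> sharp_primes n" for p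
      proof -
        note s = sharp_primes_dvd[OF that]
        define m where "m = n div p"
        have n: "n = p * m" and pm: "\<not> p dvd m" using s by (simp_all add: m_def)
        have "coprime p m" using s(1) pm by (rule prime_imp_coprime_nat)
        then have "lamF n = lamF p * lamF m" unfolding n by (rule multiplicative)
        moreover have "chi (int n) = chi (int p) * chi (int m)"
          unfolding n of_nat_mult by (rule character_mult[OF character_X[OF chi]])
        ultimately show ?thesis
          unfolding m_def[symmetric] bilinear_term_def n[symmetric] by simp
      qed
      then show ?thesis unfolding D_def g_def of_real_sum sum_distrib_left by (rule sum.cong[OF refl])
    qed
    ultimately show ?thesis by (simp add: mult_ac)
  qed
  have "((\<lambda>x. smoothed x chi) has_vector_derivative (\<Sum>n\<in>{1..<2 ^ I}. - g n)) (at x)"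
    unfolding smoothed_def by (rule has_vector_derivative_sum) (rule der)
  also have "(\<Sum>n\<in>{1..<2 ^ I}. - g n) = - (\<Sum>n\<in>{1..<2 ^ I}. g n)" by (rule sum_negf)
  also have "(\<Sum>n\<in>{1..<2 ^ I}. g n) =
    (\<Sum>p\<in>Q. \<Sum>m | m \<in> {1..<2 ^ I} \<and> \<not> p dvd m \<and> p * m < 2 ^ I. bilinear_term x chi p m)"
    unfolding g_def
    by (rule sum_sharp_primes_eq) (auto simp: bilinear_term_def hat_weight_eq_0 finite_hat_support hat_support_bounds(1))
  finally show ?thesis .
qed

lemma norm_prime_coefficient_le:
  assumes "chi \<in> X" "p \<in> Q"
  shows "norm (of_real (v p) * lamF p * chi (int p)) \<le> real d"
proof -
  have "norm (of_real (v p) * lamF p * chi (int p)) \<le> 1 * real d * 1"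
    unfolding norm_mult
    using hat_weight_bounds[of J1 J2 p] norm_lamF_prime_le[OF hat_support_bounds(1)[OF assms(2)]] norm_chi[OF assms(1), of "int p"]
    by (intro mult_mono) auto
  then show ?thesis by simp
qed

lemma l2norm_bilinear_le:
  assumes p: "p \<in> Q"
  shows "l2norm X (\<lambda>chi. \<Sum>m\<in>S. bilinear_term x chi p m) \<le>
    real d * l2norm X (\<lambda>chi. \<Sum>m\<in>S. (lamF m * of_real (sieve_weight v x m)) * beta (p * m) * chi (int m))"
proof -
  have "l2norm X (\<lambda>chi. \<Sum>m\<in>S. bilinear_term x chi p m) \<le>
    l2norm X (\<lambda>chi. of_real (real d) * (\<Sum>m\<in>S. (lamF m * of_real (sieve_weight v x m)) * beta (p * m) * chi (int m)))"
  proof (rule l2norm_mono)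
    fix chi assume chi: "chi \<in> X"
    show "norm (\<Sum>m\<in>S. bilinear_term x chi p m) \<le> norm (of_real (real d) * (\<Sum>m\<in>S. (lamF m * of_real (sieve_weight v x m)) * beta (p * m) * chi (int m)))"
      unfolding bilinear_term_def sum_distrib_left[symmetric] norm_mult[of "of_real (v p) * lamF p * chi (int p)"] norm_mult[of "of_real (real d)"]
      using norm_prime_coefficient_le[OF chi p] by (intro mult_right_mono) auto
  qed
  then show ?thesis by (simp add: l2norm_const_mult)
qed

lemma card_Q_le: "real (card Q) \<le> exp (real J2 + 1)"
  by (rule card_hat_support_le)

lemma prime_Q: "p \<in> Q \<Longrightarrow> p \<ge> 1"
  using hat_support_bounds(1) prime_ge_1_nat by blast

text \<open>The primes are summed trivially. For the later choice of \<open>J2\<close> their number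
  is \<open>q^o(1)\<close>, which the power of \<open>q\<close> to spare in \<open>low_bound\<close>
  absorbs.\<close>

lemma l2norm_low_bilinear:
  assumes x: "0 \<le> x" "x \<le> 1" and low: "2 ^ i < q" and S: "\<And>p. S p \<subseteq> dyadic i"
  shows "l2norm X (\<lambda>chi. \<Sum>p\<in>Q. \<Sum>m\<in>S p. bilinear_term x chi p m) \<le> exp (real J2 + 1) * real d * low_bound"
proof -
  have "l2norm X (\<lambda>chi. \<Sum>p\<in>Q. \<Sum>m\<in>S p. bilinear_term x chi p m) \<le> (\<Sum>p\<in>Q. l2norm X (\<lambda>chi. \<Sum>m\<in>S p. bilinear_term x chi p m))"
    by (rule l2norm_sum)
  also have "\<dots> \<le> (\<Sum>p\<in>Q. real d * low_bound)"
  proof (rule sum_mono)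
    fix p assume p: "p \<in> Q"
    have "real d * l2norm X (\<lambda>chi. \<Sum>m\<in>S p. (lamF m * of_real (sieve_weight v x m)) * beta (p * m) * chi (int m)) \<le> real d * low_bound"
      by (intro mult_left_mono low_dyadic[OF prime_Q[OF p] S norm_lamF_sieve_le[OF x] low]) simp
    then show "l2norm X (\<lambda>chi. \<Sum>m\<in>S p. bilinear_term x chi p m) \<le> real d * low_bound"
      using l2norm_bilinear_le[OF p, of x "S p"] by linarith
  qed
  also have "\<dots> = real (card Q) * (real d * low_bound)" by simp
  also have "\<dots> \<le> exp (real J2 + 1) * (real d * low_bound)"
    using low_bound_nonneg by (intro mult_right_mono card_Q_le) simp
  finally show ?thesis by (simp add: mult.assoc)
qed

text \<open>These pairs are added to free \<open>m\<close> from \<open>p\<close>. Divisibility by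
  \<open>p\<close> saves \<open>1 / sqrt p\<close> in the norm, and the weight at
  \<open>p * m\<close> saves another \<open>1 / p\<close>, so the sum over the large primes in
  \<open>Q\<close> is small.\<close>

lemma l2norm_dvd_bilinear:
  assumes x: "0 \<le> x" "x \<le> 1" and high: "q \<le> 2 ^ i"
  shows "l2norm X (\<lambda>chi. \<Sum>p\<in>Q. \<Sum>m | m \<in> dyadic i \<and> p dvd m. bilinear_term x chi p m)
    \<le> real d * (sqrt (6 * K) * W * sqrt Y) * (15 * exp (- real J1 / 4))"
proof -
  have "l2norm X (\<lambda>chi. \<Sum>p\<in>Q. \<Sum>m | m \<in> dyadic i \<and> p dvd m. bilinear_term x chi p m) \<le>
      (\<Sum>p\<in>Q. l2norm X (\<lambda>chi. \<Sum>m | m \<in> dyadic i \<and> p dvd m. bilinear_term x chi p m))"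
    by (rule l2norm_sum)
  also have "\<dots> \<le> (\<Sum>p\<in>Q. real d * (sqrt (6 * K) * W * sqrt Y) * real p powr (- 3 / 2))"
  proof (rule sum_mono)
    fix p assume p: "p \<in> Q"
    note pr = hat_support_bounds(1)[OF p]
    have p0: "real p > 0" using prime_gt_0_nat[OF pr] by simp
    define S where "S = {m \<in> dyadic i. p dvd m}"
    have "(\<Sum>n\<in>S. (norm (lamF n))\<^sup>2) \<le> (\<Sum>n | n \<in> {1..<2 ^ Suc i} \<and> p ^ 1 dvd n. (norm (lamF n))\<^sup>2)"
      using dyadic_subset(1)[of i] by (intro sum_mono2) (auto simp: S_def)
    also have "\<dots> \<le> K * real (2 ^ Suc i) / real p ^ 1" by (rule lamF_square_dvd[OF pr]) simp
    finally have S2: "(\<Sum>n\<in>S. (norm (lamF n))\<^sup>2) \<le> 2 * K / real p * 2 ^ i" by (simp add: mult_ac)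
    have "l2norm X (\<lambda>chi. \<Sum>m\<in>S. (lamF m * of_real (sieve_weight v x m)) * beta (p * m) * chi (int m))
      \<le> sqrt (3 * (2 * K / real p)) * W * (Y / (real p * 2 ^ i)) powr (1/2) * sqrt (2 ^ i / real p)"
      by (intro high_dyadic prime_Q p norm_lamF_sieve_le x high S2) (use K in \<open>auto simp: S_def\<close>)
    also have "\<dots> = sqrt (6 * K) * W * sqrt Y * real p powr (- 3 / 2)"
    proof -
      have "(Y / (real p * 2 ^ i)) powr (1/2) * sqrt (2 ^ i / real p) = sqrt (Y / (real p * 2 ^ i) * (2 ^ i / real p))"
        unfolding real_sqrt_mult using Y p0 by (simp add: powr_half_sqrt)
      also have "Y / (real p * 2 ^ i) * (2 ^ i / real p) = Y / real p ^ 2" by (simp add: power2_eq_square)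
      also have "sqrt (Y / real p ^ 2) = sqrt Y / real p" using p0 by (simp add: real_sqrt_divide)
      finally have 1: "(Y / (real p * 2 ^ i)) powr (1/2) * sqrt (2 ^ i / real p) = sqrt Y / real p" .
      have "real p powr (- 3 / 2) = real p powr (- (1/2)) * real p powr (- 1)"
        by (simp only: powr_add[symmetric]) simp
      also have "\<dots> = 1 / sqrt (real p) / real p" using p0 by (simp add: powr_minus_divide powr_half_sqrt)
      finally have 2: "real p powr (- 3 / 2) = 1 / sqrt (real p) / real p" .
      have 3: "sqrt (3 * (2 * K / real p)) = sqrt (6 * K) / sqrt (real p)" by (simp add: real_sqrt_divide)
      have "sqrt (3 * (2 * K / real p)) * W * (Y / (real p * 2 ^ i)) powr (1/2) * sqrt (2 ^ i / real p)
        = sqrt (3 * (2 * K / real p)) * W * ((Y / (real p * 2 ^ i)) powr (1/2) * sqrt (2 ^ i / real p))" by simp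
      then show ?thesis unfolding 1 2 3 by simp
    qed
    finally have "real d * l2norm X (\<lambda>chi. \<Sum>m\<in>S. (lamF m * of_real (sieve_weight v x m)) * beta (p * m) * chi (int m))
      \<le> real d * (sqrt (6 * K) * W * sqrt Y * real p powr (- 3 / 2))" by (rule mult_left_mono) simp
    then show "l2norm X (\<lambda>chi. \<Sum>m | m \<in> dyadic i \<and> p dvd m. bilinear_term x chi p m)
      \<le> real d * (sqrt (6 * K) * W * sqrt Y) * real p powr (- 3 / 2)"
      using order_trans[OF l2norm_bilinear_le[OF p, of x S]] unfolding S_def by (simp only: mult.assoc)
  qed
  also have "\<dots> = real d * (sqrt (6 * K) * W * sqrt Y) * (\<Sum>p\<in>Q. real p powr (- 3 / 2))"
    by (simp add: sum_distrib_left)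
  also have "\<dots> \<le> real d * (sqrt (6 * K) * W * sqrt Y) * (15 * exp (- real J1 / 4))"
    using W Y K by (intro mult_left_mono sum_hat_support_le) auto
  finally show ?thesis .
qed

lemma sum_hat_weight: "(\<Sum>p\<in>Q. of_real (v p) * g p) = (\<Sum>j\<in>{J1..J2}. \<Sum>p\<in>hat_primes (real j). of_real (hat (ln (real p) - real j)) * (g p :: complex))"
proof -
  have "(\<Sum>p\<in>Q. of_real (v p) * g p) = (\<Sum>p\<in>Q. \<Sum>j\<in>{J1..J2}. of_real (hat (ln (real p) - real j)) * g p)"
    by (intro sum.cong refl) (simp add: hat_weight_def hat_support_bounds(1) sum_distrib_right)
  also have "\<dots> = (\<Sum>j\<in>{J1..J2}. \<Sum>p\<in>Q. of_real (hat (ln (real p) - real j)) * g p)"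
    by (rule sum.swap)
  also have "\<dots> = (\<Sum>j\<in>{J1..J2}. \<Sum>p\<in>hat_primes (real j). of_real (hat (ln (real p) - real j)) * g p)"
  proof (rule sum.cong[OF refl])
    fix j assume "j \<in> {J1..J2}"
    then have sub: "hat_primes (real j) \<subseteq> Q" by (auto simp: hat_support_def)
    show "(\<Sum>p\<in>Q. of_real (hat (ln (real p) - real j)) * g p) = (\<Sum>p\<in>hat_primes (real j). of_real (hat (ln (real p) - real j)) * g p)"
    proof (rule sum.mono_neutral_right[OF finite_hat_support sub], rule ballI)
      fix p assume "p \<in> Q - hat_primes (real j)"
      then show "of_real (hat (ln (real p) - real j)) * g p = 0"
        using hat_support_bounds(1) by (auto simp: hat_primes_def hat_def)
    qed
  qed
  finally show ?thesis .
qed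

text \<open>On the line \<open>Re w = 1/2\<close> the variables \<open>p\<close> and \<open>m\<close> separate, which exposes the sum over primes.\<close>

lemma l2norm_high_bilinear:
  assumes x: "0 \<le> x" "x \<le> 1" and high: "q \<le> 2 ^ i"
  shows "l2norm X (\<lambda>chi. \<Sum>p\<in>Q. \<Sum>m\<in>dyadic i. bilinear_term x chi p m)
    \<le> (real J2 + 1) * (sqrt (6 * K) * W * sqrt Y * \<epsilon>)"
proof -
  define b where "b m = lamF m * of_real (sieve_weight v x m)" for m
  define R where "R chi y = (\<Sum>m\<in>dyadic i. b m / of_nat m powr Complex 1 y * chi (int m))" for chi :: "int \<Rightarrow> complex" and y
  define k where "k y = of_nat (N q) powr (Complex (1/2) y / 2) * h (Complex (1/2) y)" for y
  define A where "A p chi = of_real (v p) * lamF p * chi (int p)" for p and chi :: "int \<Rightarrow> complex"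
  \<comment> \<open>The line \<open>Re w = 1/2\<close> and the factor \<open>1 / sqrt n\<close> in
    \<open>beta\<close> together put both variables on \<open>Re s = 1\<close>, where
    \<open>hat_sum\<close> is controlled.\<close>
  have beta_eq: "beta (p * m) = (LBINT y. k y / of_nat p powr Complex 1 y / of_nat m powr Complex 1 y)"
    if "p \<ge> 1" "m \<ge> 1" for p m
  proof -
    have "beta (p * m) = (LBINT y. of_nat (N q) powr (Complex (1/2) y / 2) / of_nat (p * m) powr Complex (1/2) y * h (Complex (1/2) y)) / of_nat (p * m) powr (1/2)"
      unfolding beta_def using weight_half[of "p * m"] that by (simp add: mellin_weight_def)
    also have "\<dots> = (LBINT y. of_nat (N q) powr (Complex (1/2) y / 2) / of_nat (p * m) powr Complex (1/2) y * h (Complex (1/2) y) / of_nat (p * m) powr (1/2))"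
      by (rule integral_divide_zero[symmetric])
    also have "\<dots> = (LBINT y. k y / of_nat p powr Complex 1 y / of_nat m powr Complex 1 y)"
    proof (rule Bochner_Integration.integral_cong[OF refl])
      fix y
      have c: "Complex 1 y = Complex (1/2) y + 1/2" by (simp add: complex_eq_iff)
      have pm: "(of_nat (p * m) :: complex) powr z = of_nat p powr z * of_nat m powr z" for z
        by (simp add: powr_times_real)
      show "of_nat (N q) powr (Complex (1/2) y / 2) / of_nat (p * m) powr Complex (1/2) y * h (Complex (1/2) y) / of_nat (p * m) powr (1/2)
        = k y / of_nat p powr Complex 1 y / of_nat m powr Complex 1 y"
        unfolding pm c powr_add k_def by simp
    qed
    finally show ?thesis .
  qed
  have k_cont: "continuous_on UNIV k"
    unfolding k_def using N1 by (intro continuous_intros h_continuous) (auto simp: Complex_eq intro!: continuous_intros)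
  have norm_k: "norm (k y) \<le> sqrt Y * norm (h (Complex (1/2) y))" for y
  proof -
    have "norm (k y) = real (N q) powr (1/4) * norm (h (Complex (1/2) y))"
      by (simp add: k_def norm_mult norm_of_nat_powr)
    also have "real (N q) powr (1/4) = sqrt (sqrt (real (N q)))"
      by (simp add: powr_half_sqrt[symmetric] powr_powr)
    also have "\<dots> \<le> sqrt Y" using Y by simp
    finally show ?thesis by (simp add: mult_right_mono)
  qed
  have powr_cont: "continuous_on UNIV (\<lambda>y. (of_nat n :: complex) powr Complex 1 y)" if "n \<ge> 1" for n
    using that by (intro continuous_intros) (auto simp: Complex_eq intro!: continuous_intros)
  have h_int: "integrable lborel (\<lambda>y. norm (h (Complex (1/2) y)))"
  proof (rule Bochner_Integration.integrable_bound[OF h_integrable])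
    have "continuous_on UNIV (\<lambda>y. norm (h (Complex (1/2) y)))" by (intro continuous_intros h_continuous)
    then show "(\<lambda>y. norm (h (Complex (1/2) y))) \<in> borel_measurable lborel"
      using borel_measurable_continuous_onI by auto
    have "norm (h (Complex (1/2) y)) \<le> (1 + \<bar>y\<bar>) * norm (h (Complex (1/2) y))" for y
      by (simp add: algebra_simps)
    then show "AE y in lborel. norm (norm (h (Complex (1/2) y))) \<le> norm ((1 + \<bar>y\<bar>) * norm (h (Complex (1/2) y)))"
      by simp
  qed
  have k_int: "integrable lborel (\<lambda>y. k y / of_nat p powr Complex 1 y / of_nat m powr Complex 1 y)" if pm: "p \<ge> 1" "m \<ge> 1" for p m
  proof (rule Bochner_Integration.integrable_bound)
    show "integrable lborel (\<lambda>y. sqrt Y * norm (h (Complex (1/2) y)))" using h_int by simp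
    have "continuous_on UNIV (\<lambda>y. k y / of_nat p powr Complex 1 y / of_nat m powr Complex 1 y)"
      using pm by (intro continuous_intros k_cont powr_cont) auto
    then show "(\<lambda>y. k y / of_nat p powr Complex 1 y / of_nat m powr Complex 1 y) \<in> borel_measurable lborel"
      using borel_measurable_continuous_onI by auto
    have "norm (k y / of_nat p powr Complex 1 y / of_nat m powr Complex 1 y) \<le> sqrt Y * norm (h (Complex (1/2) y))" for y
    proof -
      have "norm (k y / of_nat p powr Complex 1 y / of_nat m powr Complex 1 y) = norm (k y) / (real p * real m)"
        by (simp add: norm_divide norm_mult norm_of_nat_powr)
      also have "\<dots> \<le> norm (k y) / 1"
      proof (rule divide_left_mono)
        show "1 \<le> real p * real m" using pm by (metis mult_mono' of_nat_1 of_nat_le_iff mult_1 zero_le_one)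
      qed (use pm in auto)
      finally show ?thesis using norm_k[of y] by simp
    qed
    then show "AE y in lborel. norm (k y / of_nat p powr Complex 1 y / of_nat m powr Complex 1 y) \<le> norm (sqrt Y * norm (h (Complex (1/2) y)))"
      using Y by simp
  qed
  have integrand: "(\<Sum>p\<in>Q. \<Sum>m\<in>dyadic i. A p chi * b m * chi (int m) * (k y / of_nat p powr Complex 1 y / of_nat m powr Complex 1 y))
      = (\<Sum>j\<in>{J1..J2}. k y * hat_sum chi (real j) (Complex 1 y) * R chi y)" for chi y
  proof -
    have "(\<Sum>p\<in>Q. \<Sum>m\<in>dyadic i. A p chi * b m * chi (int m) * (k y / of_nat p powr Complex 1 y / of_nat m powr Complex 1 y))
      = (\<Sum>p\<in>Q. of_real (v p) * (lamF p * chi (int p) / of_nat p powr Complex 1 y * k y * R chi y))"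
      unfolding A_def R_def sum_distrib_left by (intro sum.cong refl) (simp add: field_simps)
    also have "\<dots> = (\<Sum>j\<in>{J1..J2}. k y * hat_sum chi (real j) (Complex 1 y) * R chi y)"
      unfolding sum_hat_weight hat_sum_def twist_def sum_distrib_left sum_distrib_right
      by (intro sum.cong refl) (simp add: field_simps)
    finally show ?thesis .
  qed
  have int1: "integrable lborel (\<lambda>y. \<Sum>p\<in>Q. \<Sum>m\<in>dyadic i. A p chi * b m * chi (int m) * (k y / of_nat p powr Complex 1 y / of_nat m powr Complex 1 y))" for chi
    by (intro Bochner_Integration.integrable_sum Bochner_Integration.integrable_mult_right k_int prime_Q dyadic_bounds(1)) auto
  have eq: "(\<Sum>p\<in>Q. \<Sum>m\<in>dyadic i. bilinear_term x chi p m) =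
    (LBINT y. \<Sum>j\<in>{J1..J2}. k y * hat_sum chi (real j) (Complex 1 y) * R chi y)" for chi
  proof -
    have "(\<Sum>p\<in>Q. \<Sum>m\<in>dyadic i. bilinear_term x chi p m) = (\<Sum>p\<in>Q. \<Sum>m\<in>dyadic i. A p chi * b m * chi (int m) * (LBINT y. k y / of_nat p powr Complex 1 y / of_nat m powr Complex 1 y))"
    proof (intro sum.cong refl)
      fix p m assume "p \<in> Q" "m \<in> dyadic i"
      then have "p \<ge> 1" "m \<ge> 1" using prime_Q dyadic_bounds(1) by auto
      note e = beta_eq[OF this]
      show "bilinear_term x chi p m = A p chi * b m * chi (int m) * (LBINT y. k y / of_nat p powr Complex 1 y / of_nat m powr Complex 1 y)"
        unfolding bilinear_term_def e A_def b_def by (simp only: mult_ac)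
    qed
    also have "\<dots> = (\<Sum>p\<in>Q. \<Sum>m\<in>dyadic i. LBINT y. A p chi * b m * chi (int m) * (k y / of_nat p powr Complex 1 y / of_nat m powr Complex 1 y))"
      by (simp only: integral_mult_right_zero)
    also have "\<dots> = (\<Sum>p\<in>Q. LBINT y. \<Sum>m\<in>dyadic i. A p chi * b m * chi (int m) * (k y / of_nat p powr Complex 1 y / of_nat m powr Complex 1 y))"
      by (intro sum.cong refl Bochner_Integration.integral_sum[symmetric] Bochner_Integration.integrable_mult_right k_int prime_Q dyadic_bounds(1)) auto
    also have "\<dots> = (LBINT y. \<Sum>p\<in>Q. \<Sum>m\<in>dyadic i. A p chi * b m * chi (int m) * (k y / of_nat p powr Complex 1 y / of_nat m powr Complex 1 y))"
      by (intro Bochner_Integration.integral_sum[symmetric] Bochner_Integration.integrable_sum Bochner_Integration.integrable_mult_right k_int prime_Q dyadic_bounds(1)) auto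
    finally show ?thesis unfolding integrand .
  qed
  define H where "H = (real J2 + 1) * (sqrt (6 * K) * sqrt Y * \<epsilon>)"
  have H: "H \<ge> 0" using K Y eps by (simp add: H_def)
  \<comment> \<open>On \<open>Re s = 1\<close> a long block is bounded in mean square: the large
    sieve gives \<open>2 ^ i\<close> and the coefficients contribute
    \<open>1 / 2 ^ i\<close>.\<close>
  have R_le: "l2norm X (\<lambda>chi. R chi y) \<le> sqrt (6 * K)" for y
  proof -
    have "l2norm X (\<lambda>chi. R chi y) \<le> sqrt (3 * (2 * K)) * 2 ^ i * (1 / 2 ^ i)"
      unfolding R_def
    proof (rule l2norm_dyadic_high[OF _ _ _ lamF_square_dyadic _ high])
      fix m assume m: "m \<in> dyadic i"
      have "norm (b m / of_nat m powr Complex 1 y) = norm (b m) / real m"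
        by (simp add: norm_divide norm_of_nat_powr)
      also have "\<dots> \<le> norm (lamF m) / 2 ^ i"
        using dyadic_bounds[OF m] norm_lamF_sieve_le[OF x, of m] by (intro frac_le) (auto simp: b_def)
      finally show "norm (b m / of_nat m powr Complex 1 y) \<le> norm (lamF m) * (1 / 2 ^ i)" by simp
    qed (use K in auto)
    then show ?thesis by simp
  qed
  have "l2norm X (\<lambda>chi. LBINT y. \<Sum>j\<in>{J1..J2}. k y * hat_sum chi (real j) (Complex 1 y) * R chi y)
      \<le> (LBINT y. H * ((1 + \<bar>y\<bar>) * norm (h (Complex (1/2) y))))"
  proof (rule l2norm_integral_le[OF X(1)])
    show "integrable lborel (\<lambda>y. \<Sum>j\<in>{J1..J2}. k y * hat_sum chi (real j) (Complex 1 y) * R chi y)" for chi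
      using int1[of chi] unfolding integrand .
    show "integrable lborel (\<lambda>y. H * ((1 + \<bar>y\<bar>) * norm (h (Complex (1/2) y))))" using h_integrable by simp
    fix y
    have "l2norm X (\<lambda>chi. \<Sum>j\<in>{J1..J2}. k y * hat_sum chi (real j) (Complex 1 y) * R chi y)
       \<le> (\<Sum>j\<in>{J1..J2}. l2norm X (\<lambda>chi. k y * hat_sum chi (real j) (Complex 1 y) * R chi y))"
      by (rule l2norm_sum)
    also have "\<dots> \<le> (\<Sum>j\<in>{J1..J2}. (sqrt Y * norm (h (Complex (1/2) y)) * (\<epsilon> * (1 + \<bar>y\<bar>))) * sqrt (6 * K))"
    proof (rule sum_mono)
      fix j assume j: "j \<in> {J1..J2}"
      let ?c = "sqrt Y * norm (h (Complex (1/2) y)) * (\<epsilon> * (1 + \<bar>y\<bar>))"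
      have c0: "?c \<ge> 0" using Y eps by simp
      have "l2norm X (\<lambda>chi. k y * hat_sum chi (real j) (Complex 1 y) * R chi y) \<le> l2norm X (\<lambda>chi. of_real ?c * R chi y)"
      proof (rule l2norm_mono)
        fix chi assume chi: "chi \<in> X"
        have "norm (k y * hat_sum chi (real j) (Complex 1 y)) \<le> ?c"
          unfolding norm_mult using norm_k[of y] hat_sum_le[OF chi j, of y] Y by (intro mult_mono) auto
        then show "norm (k y * hat_sum chi (real j) (Complex 1 y) * R chi y) \<le> norm (of_real ?c * R chi y)"
          unfolding norm_mult[of _ "R chi y"] using c0 by (intro mult_right_mono) (simp_all only: norm_of_real abs_of_nonneg norm_ge_zero)
      qed
      also have "\<dots> = ?c * l2norm X (\<lambda>chi. R chi y)" unfolding l2norm_const_mult norm_of_real using c0 by simp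
      also have "\<dots> \<le> ?c * sqrt (6 * K)" using c0 R_le by (rule mult_left_mono[rotated])
      finally show "l2norm X (\<lambda>chi. k y * hat_sum chi (real j) (Complex 1 y) * R chi y) \<le> ?c * sqrt (6 * K)" .
    qed
    also have "\<dots> = real (Suc J2 - J1) * ((sqrt Y * norm (h (Complex (1/2) y)) * (\<epsilon> * (1 + \<bar>y\<bar>))) * sqrt (6 * K))"
      by simp
    also have "\<dots> \<le> (real J2 + 1) * ((sqrt Y * norm (h (Complex (1/2) y)) * (\<epsilon> * (1 + \<bar>y\<bar>))) * sqrt (6 * K))"
      using Y eps K by (intro mult_right_mono) auto
    also have "\<dots> = H * ((1 + \<bar>y\<bar>) * norm (h (Complex (1/2) y)))" by (simp add: H_def)
    finally show "l2norm X (\<lambda>chi. \<Sum>j\<in>{J1..J2}. k y * hat_sum chi (real j) (Complex 1 y) * R chi y)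
       \<le> H * ((1 + \<bar>y\<bar>) * norm (h (Complex (1/2) y)))" .
  qed
  also have "\<dots> = H * (LBINT y. (1 + \<bar>y\<bar>) * norm (h (Complex (1/2) y)))" by (rule integral_mult_right_zero)
  also have "\<dots> \<le> H * W" using H h_integral by (rule mult_left_mono[rotated])
  finally show ?thesis unfolding eq H_def by (simp add: mult_ac)
qed

text \<open>The truncation point satisfies \<open>2 ^ I \<ge> Y ^ 3\<close> for this purpose: beyond
  it the cubic decay of the weight swallows \<open>Y\<close> and leaves a summable
  \<open>1 / n^2\<close>.\<close>

lemma cube_le: "n \<ge> 2 ^ I \<Longrightarrow> (Y / real n) powr 3 \<le> 1 / (real n)\<^sup>2"
proof -
  assume "n \<ge> 2 ^ I"
  then have n: "2 ^ I \<le> real n" by (metis of_nat_le_iff of_nat_numeral of_nat_power)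
  have n0: "real n > 0" using n by (rule less_le_trans[rotated]) simp
  have "(Y / real n) powr 3 = Y ^ 3 / real n ^ 3" using Y n0 by (simp add: powr_numeral power_divide)
  also have "\<dots> \<le> real n / real n ^ 3" using n0 by (intro divide_right_mono order_trans[OF I n]) auto
  also have "\<dots> = 1 / (real n)\<^sup>2" using n0 by (simp add: power2_eq_square power3_eq_cube)
  finally show ?thesis .
qed

lemma sqrt_card_X_le: "sqrt (real (card X)) \<le> sqrt (2 * real q)"
  using card_characters_le[OF X(1) character_X] q by (intro real_sqrt_le_mono) auto

text \<open>The pairs with \<open>p * m \<ge> 2 ^ I\<close> are added so that \<open>m\<close> runs
  over whole dyadic blocks. The weight is so small there that terms are bounded absolutely, and
  passing to the mean square costs only \<open>sqrt q\<close>.\<close>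

lemma l2norm_overflow:
  assumes x: "0 \<le> x" "x \<le> 1"
  shows "l2norm X (\<lambda>chi. \<Sum>p\<in>Q. \<Sum>m | m \<in> {1..<2 ^ I} \<and> \<not> p dvd m \<and> \<not> p * m < 2 ^ I. bilinear_term x chi p m)
    \<le> 4 * real d * K * W * sqrt (2 * real q)"
proof -
  define S where "S p = {m. m \<in> {1..<2 ^ I} \<and> \<not> p dvd m \<and> \<not> p * m < (2::nat) ^ I}" for p
  define D where "D = real d * K * W"
  have D: "D \<ge> 0" using K W by (simp add: D_def)
  have finS: "finite (S p)" for p by (rule finite_subset[of _ "{1..<2 ^ I}"]) (auto simp: S_def)
  have "norm (\<Sum>p\<in>Q. \<Sum>m\<in>S p. bilinear_term x chi p m) \<le> 4 * D" if chi: "chi \<in> X" for chi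
  proof -
    have term_le: "norm (bilinear_term x chi p m) \<le> D * (1 / (real p)\<^sup>2 * (1 / (real m)\<^sup>2))" if p: "p \<in> Q" and m: "m \<in> S p" for p m
    proof -
      have p1: "p \<ge> 1" by (rule prime_Q[OF p])
      have m1: "m \<ge> 1" and pm: "p * m \<ge> 2 ^ I" using m by (auto simp: S_def)
      have pm1: "p * m \<ge> 1" using p1 m1 by simp
      have "norm (lamF m * of_real (sieve_weight v x m)) \<le> K * sqrt (real m)"
        using norm_lamF_sieve_le[OF x, of m] lamF_sqrt[OF m1] by linarith
      moreover have "norm (beta (p * m)) \<le> W * (1 / (real (p * m))\<^sup>2) / sqrt (real m)"
      proof -
        have "norm (beta (p * m)) \<le> W * (Y / real (p * m)) powr 3 / sqrt (real (p * m))" by (rule norm_beta_le[OF _ pm1]) simp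
        also have "\<dots> \<le> W * (1 / (real (p * m))\<^sup>2) / sqrt (real m)"
        proof (rule frac_le)
          show "W * (Y / real (p * m)) powr 3 \<le> W * (1 / (real (p * m))\<^sup>2)"
            using W by (intro mult_left_mono cube_le pm) simp
          have "m \<le> p * m" using p1 by simp
          then show "sqrt (real m) \<le> sqrt (real (p * m))" by (simp only: real_sqrt_le_iff of_nat_le_iff)
        qed (use W m1 in auto)
        finally show ?thesis .
      qed
      ultimately have "norm (bilinear_term x chi p m) \<le> real d * ((K * sqrt (real m)) * (W * (1 / (real (p * m))\<^sup>2) / sqrt (real m)) * 1)"
        unfolding bilinear_term_def norm_mult[of "of_real (v p) * lamF p * chi (int p)"] norm_mult[of "lamF m * of_real (sieve_weight v x m) * beta (p * m)"]
          norm_mult[of "lamF m * of_real (sieve_weight v x m)"]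
        using norm_prime_coefficient_le[OF chi p] norm_chi[OF chi] K W
        by (intro mult_mono) auto
      also have "\<dots> = D * (1 / (real p)\<^sup>2 * (1 / (real m)\<^sup>2))" using m1 by (simp add: D_def power_mult_distrib)
      finally show ?thesis .
    qed
    have "norm (\<Sum>p\<in>Q. \<Sum>m\<in>S p. bilinear_term x chi p m) \<le> (\<Sum>p\<in>Q. \<Sum>m\<in>S p. D * (1 / (real p)\<^sup>2 * (1 / (real m)\<^sup>2)))"
      by (intro sum_norm_le term_le)
    also have "\<dots> = D * (\<Sum>p\<in>Q. 1 / (real p)\<^sup>2 * (\<Sum>m\<in>S p. 1 / (real m)\<^sup>2))"
      by (simp only: sum_distrib_left)
    also have "\<dots> \<le> D * (\<Sum>p\<in>Q. 1 / (real p)\<^sup>2 * 2)"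
      by (intro mult_left_mono sum_mono inverse_square_sums(1) finS D) simp
    also have "\<dots> = D * ((\<Sum>p\<in>Q. 1 / (real p)\<^sup>2) * 2)" by (simp only: sum_distrib_right)
    also have "\<dots> \<le> D * (2 * 2)"
      by (intro mult_left_mono mult_right_mono inverse_square_sums(1) finite_hat_support D) simp
    finally show ?thesis by simp
  qed
  then have "l2norm X (\<lambda>chi. \<Sum>p\<in>Q. \<Sum>m\<in>S p. bilinear_term x chi p m) \<le> 4 * D * sqrt (real (card X))"
    using D by (intro l2norm_le_const) auto
  also have "\<dots> \<le> 4 * D * sqrt (2 * real q)" using D sqrt_card_X_le by (intro mult_left_mono) auto
  finally show ?thesis unfolding S_def D_def by simp
qed

definition derivative_bound :: real where
  "derivative_bound = real I * (2 * exp (real J2 + 1) * real d * low_bound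
      + (real J2 + 1) * (sqrt (6 * K) * W * sqrt Y * \<epsilon>)
      + real d * (sqrt (6 * K) * W * sqrt Y) * (15 * exp (- real J1 / 4)))
    + 4 * real d * K * W * sqrt (2 * real q)"

text \<open>The pairs that occur are all pairs less those with \<open>p dvd m\<close> and less the
  overflow; this frees the variables. \<open>2 * E + A + B\<close> covers both kinds of blocks:
  below \<open>q\<close> the two sums cost \<open>E\<close> each, from \<open>q\<close> on they cost
  \<open>A\<close> and \<open>B\<close>.\<close>

lemma l2norm_derivative:
  assumes x: "0 \<le> x" "x \<le> 1"
  shows "l2norm X (\<lambda>chi. - (\<Sum>p\<in>Q. \<Sum>m | m \<in> {1..<2 ^ I} \<and> \<not> p dvd m \<and> p * m < 2 ^ I. bilinear_term x chi p m)) \<le> derivative_bound"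
proof -
  define g where "g chi p m = bilinear_term x chi p m" for chi p m
  define T1 where "T1 i chi = (\<Sum>p\<in>Q. \<Sum>m\<in>dyadic i. g chi p m)" for i chi
  define T2 where "T2 i chi = (\<Sum>p\<in>Q. \<Sum>m | m \<in> dyadic i \<and> p dvd m. g chi p m)" for i chi
  define T3 where "T3 chi = (\<Sum>p\<in>Q. \<Sum>m | m \<in> {1..<2 ^ I} \<and> \<not> p dvd m \<and> \<not> p * m < 2 ^ I. g chi p m)" for chi
  define E where "E = exp (real J2 + 1) * real d * low_bound"
  define A where "A = (real J2 + 1) * (sqrt (6 * K) * W * sqrt Y * \<epsilon>)"
  define B where "B = real d * (sqrt (6 * K) * W * sqrt Y) * (15 * exp (- real J1 / 4))"
  have nn: "E \<ge> 0" "A \<ge> 0" "B \<ge> 0"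
    using low_bound_nonneg K W Y eps by (simp_all add: E_def A_def B_def)
  have split: "- (\<Sum>p\<in>Q. \<Sum>m | m \<in> {1..<2 ^ I} \<and> \<not> p dvd m \<and> p * m < 2 ^ I. bilinear_term x chi p m)
     = (\<Sum>i<I. T2 i chi - T1 i chi) + T3 chi" for chi
  proof -
    have "(\<Sum>m\<in>{1..<2 ^ I}. g chi p m) = (\<Sum>m | m \<in> {1..<2 ^ I} \<and> p dvd m. g chi p m)
      + ((\<Sum>m | m \<in> {1..<2 ^ I} \<and> \<not> p dvd m \<and> p * m < 2 ^ I. g chi p m)
        + (\<Sum>m | m \<in> {1..<2 ^ I} \<and> \<not> p dvd m \<and> \<not> p * m < 2 ^ I. g chi p m))" for p
    proof -
      have i: "(\<Sum>m | m \<in> {1..<2 ^ I} \<and> P m. g chi p m) = (\<Sum>m\<in>{1..<2 ^ I}. if P m then g chi p m else 0)" for P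
        by (rule sum.inter_filter) simp
      show ?thesis unfolding i sum.distrib[symmetric] by (rule sum.cong) auto
    qed
    then have "(\<Sum>p\<in>Q. \<Sum>m\<in>{1..<2 ^ I}. g chi p m) = (\<Sum>p\<in>Q. \<Sum>m | m \<in> {1..<2 ^ I} \<and> p dvd m. g chi p m)
      + ((\<Sum>p\<in>Q. \<Sum>m | m \<in> {1..<2 ^ I} \<and> \<not> p dvd m \<and> p * m < 2 ^ I. g chi p m) + T3 chi)"
      by (simp only: sum.distrib T3_def)
    moreover have "(\<Sum>p\<in>Q. \<Sum>m\<in>{1..<2 ^ I}. g chi p m) = (\<Sum>i<I. T1 i chi)"
      unfolding sum_dyadic T1_def by (rule sum.swap)
    moreover have "(\<Sum>p\<in>Q. \<Sum>m | m \<in> {1..<2 ^ I} \<and> p dvd m. g chi p m) = (\<Sum>i<I. T2 i chi)"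
      unfolding sum_dyadic_filter T2_def by (rule sum.swap)
    ultimately have e: "(\<Sum>i<I. T1 i chi) = (\<Sum>i<I. T2 i chi)
      + ((\<Sum>p\<in>Q. \<Sum>m | m \<in> {1..<2 ^ I} \<and> \<not> p dvd m \<and> p * m < 2 ^ I. g chi p m) + T3 chi)"
      by (simp only:)
    show ?thesis unfolding sum_subtractf e g_def by simp
  qed
  have i_le: "l2norm X (\<lambda>chi. T2 i chi - T1 i chi) \<le> 2 * E + A + B" for i
  proof (cases "2 ^ i < q")
    case True
    have "l2norm X (T1 i) \<le> E" "l2norm X (T2 i) \<le> E"
      unfolding T1_def T2_def g_def E_def using True x by (auto intro!: l2norm_low_bilinear)
    then show ?thesis using l2norm_diff[of X "T2 i" "T1 i"] nn by linarith
  next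
    case False
    have "l2norm X (T1 i) \<le> A" unfolding T1_def g_def A_def
      by (rule l2norm_high_bilinear) (use False x in auto)
    moreover have "l2norm X (T2 i) \<le> B" unfolding T2_def g_def B_def
      by (rule l2norm_dvd_bilinear) (use False x in auto)
    ultimately show ?thesis using l2norm_diff[of X "T2 i" "T1 i"] nn by linarith
  qed
  have "l2norm X (\<lambda>chi. (\<Sum>i<I. T2 i chi - T1 i chi) + T3 chi) \<le> l2norm X (\<lambda>chi. \<Sum>i<I. T2 i chi - T1 i chi) + l2norm X T3"
    by (rule l2norm_triangle)
  also have "l2norm X (\<lambda>chi. \<Sum>i<I. T2 i chi - T1 i chi) \<le> (\<Sum>i<I. l2norm X (\<lambda>chi. T2 i chi - T1 i chi))"
    by (rule l2norm_sum)
  also have "\<dots> \<le> (\<Sum>i<I. 2 * E + A + B)" by (rule sum_mono) (rule i_le)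
  also have "l2norm X T3 \<le> 4 * real d * K * W * sqrt (2 * real q)"
    unfolding T3_def g_def by (rule l2norm_overflow[OF x])
  finally show ?thesis unfolding split derivative_bound_def E_def A_def B_def by (simp add: mult.assoc)
qed

lemma l2norm_tail:
  "l2norm X (\<lambda>chi. (\<Sum>n. twist lamF chi n / of_nat n powr (1/2) * mellin_weight h 1 (N q) n) - smoothed 0 chi)
    \<le> 2 * K * W * sqrt (2 * real q)"
proof -
  have "norm ((\<Sum>n. twist lamF chi n / of_nat n powr (1/2) * mellin_weight h 1 (N q) n) - smoothed 0 chi) \<le> 2 * K * W"
    if chi: "chi \<in> X" for chi
  proof -
    define f where "f n = twist lamF chi n / of_nat n powr (1/2) * mellin_weight h 1 (N q) n" for n
    have f_eq: "f n = lamF n * beta n * chi (int n)" for n by (simp add: f_def twist_def beta_def)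
    have f_le: "norm (f n) \<le> K * W * (1 / (real n)\<^sup>2)" if n: "n \<ge> 2 ^ I" for n
    proof -
      have n1: "n \<ge> 1" using n one_le_power[of "2::nat" I] by linarith
      have "norm (beta n) \<le> W * (Y / real n) powr 3 / sqrt (real n)" by (rule norm_beta_le[OF _ n1]) simp
      also have "\<dots> \<le> W * (1 / (real n)\<^sup>2) / sqrt (real n)"
        using W by (intro divide_right_mono mult_left_mono cube_le n) auto
      finally have "norm (lamF n) * norm (beta n) * norm (chi (int n)) \<le> (K * sqrt (real n)) * (W * (1 / (real n)\<^sup>2) / sqrt (real n)) * 1"
        using lamF_sqrt[OF n1] norm_chi[OF chi, of "int n"] K W by (intro mult_mono) auto
      also have "\<dots> = K * W * (1 / (real n)\<^sup>2)" using n1 by simp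
      finally show ?thesis by (simp add: f_eq norm_mult)
    qed
    have f0: "f 0 = 0" by (simp add: f_def)
    have sum2: "summable (\<lambda>n. K * W * (1 / (real n)\<^sup>2))" by (intro summable_mult inverse_square_sums(2))
    have "summable f"
      by (rule summable_comparison_test'[OF sum2, of "2 ^ I"]) (rule f_le)
    then have "(\<Sum>n. f n) = (\<Sum>n. f (n + 2 ^ I)) + (\<Sum>n<2 ^ I. f n)"
      by (rule suminf_split_initial_segment)
    moreover have "(\<Sum>n<2 ^ I. f n) = smoothed 0 chi"
    proof -
      have "(\<Sum>n<2 ^ I. f n) = (\<Sum>n\<in>{1..<2 ^ I}. f n)"
        using f0 by (intro sum.mono_neutral_right) (auto simp: Suc_le_eq)
      then show ?thesis by (simp add: smoothed_def sieve_weight_0 f_eq)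
    qed
    moreover have "norm (\<Sum>n. f (n + 2 ^ I)) \<le> 2 * K * W"
    proof -
      have s: "summable (\<lambda>n. K * W * (1 / (real (n + 2 ^ I))\<^sup>2))"
        by (rule summable_ignore_initial_segment[OF sum2])
      have "norm (\<Sum>n. f (n + 2 ^ I)) \<le> (\<Sum>n. K * W * (1 / (real (n + 2 ^ I))\<^sup>2))"
        by (rule norm_suminf_le[OF _ s]) (rule f_le, simp)
      also have "\<dots> \<le> (\<Sum>n. K * W * (1 / (real n)\<^sup>2))"
        using suminf_split_initial_segment[OF sum2, of "2 ^ I"] K W by (simp add: sum_nonneg)
      also have "\<dots> = K * W * (\<Sum>n. 1 / (real n)\<^sup>2)" by (rule suminf_mult[OF inverse_square_sums(2)])
      also have "\<dots> \<le> K * W * 2" using K W by (intro mult_left_mono inverse_square_sums(3)) auto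
      finally show ?thesis by simp
    qed
    ultimately show ?thesis unfolding f_def[symmetric] by simp
  qed
  then have "l2norm X (\<lambda>chi. (\<Sum>n. twist lamF chi n / of_nat n powr (1/2) * mellin_weight h 1 (N q) n) - smoothed 0 chi)
    \<le> 2 * K * W * sqrt (real (card X))"
    using K W by (intro l2norm_le_const) auto
  also have "\<dots> \<le> 2 * K * W * sqrt (2 * real q)" using K W sqrt_card_X_le by (intro mult_left_mono) auto
  finally show ?thesis .
qed

text \<open>Since the weight at \<open>x = 0\<close> is 1, the central sum differs from
  \<open>smoothed 0\<close> by a tail only; the passage from \<open>smoothed 0\<close> to
  \<open>smoothed 1\<close> costs the bound for the derivative.\<close>

lemma l2norm_central_sum:
  "l2norm X (\<lambda>chi. \<Sum>n. twist lamF chi n / of_nat n powr (1/2) * mellin_weight h 1 (N q) n)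
   \<le> 2 * K * W * sqrt (2 * real q) + derivative_bound
      + (real I * low_bound + sqrt (3 * sift_bound) * W * sqrt Y * geometric_constant)"
proof -
  define S where "S chi = (\<Sum>n. twist lamF chi n / of_nat n powr (1/2) * mellin_weight h 1 (N q) n)" for chi
  have 1: "l2norm X (\<lambda>chi. smoothed 1 chi - smoothed 0 chi) \<le> derivative_bound"
    using X(1) smoothed_has_derivative l2norm_derivative by (rule l2norm_mean_value)
  have "l2norm X S = l2norm X (\<lambda>chi. (S chi - smoothed 0 chi) + (smoothed 1 chi - (smoothed 1 chi - smoothed 0 chi)))"
    by (rule l2norm_cong) simp
  also have "\<dots> \<le> l2norm X (\<lambda>chi. S chi - smoothed 0 chi) + l2norm X (\<lambda>chi. smoothed 1 chi - (smoothed 1 chi - smoothed 0 chi))"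
    by (rule l2norm_triangle)
  also have "l2norm X (\<lambda>chi. smoothed 1 chi - (smoothed 1 chi - smoothed 0 chi)) \<le> l2norm X (smoothed 1) + l2norm X (\<lambda>chi. smoothed 1 chi - smoothed 0 chi)"
    by (rule l2norm_diff)
  finally show ?thesis using 1 l2norm_smoothed_1 l2norm_tail unfolding S_def by linarith
qed

end

section \<open>Choice of parameters\<close>

text \<open>Here \<open>x\<close> stands for \<open>ln q\<close>, \<open>x ^ 100\<close> for the
  height \<open>T\<close>, and \<open>x powr a\<close>, \<open>x powr b\<close> for the logarithms
  of the ends of the range of primes. In the last inequality the power saving
  \<open>exp (- 5 * x / 32)\<close> beats \<open>exp (x powr b)\<close> because
  \<open>b < 1\<close>.\<close>

lemma eventually_parameters:
  fixes a b \<epsilon> c C D1 D2 \<eta> :: real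
  assumes "0 < a" "a < b" "b < 1" "0 < \<epsilon>" "c > 0" "C > 0"
  shows "eventually (\<lambda>x::real. 1 \<le> x \<and> 100 * ln x \<le> x \<and> 4 \<le> x ^ 100 \<and> 1 + D1 + D2 * x \<le> 2 * x ^ 100 \<and>
      x ^ 100 * exp (- (c / 4) * x powr \<epsilon>) \<le> 1 / (x ^ 100)\<^sup>2 \<and>
      C * (x / x ^ 100 + 3 * x ^ 100 * (2 * x / c) * (2 / (x ^ 100)\<^sup>2)) \<le> 1 / x ^ 5 \<and>
      4 * (D2 * exp 2) / x ^ 100 \<le> 1 / x ^ 5 \<and>
      x powr a + 1 \<le> x powr b - 1 \<and> 2 \<le> x powr b \<and> 1 \<le> x powr a \<and>
      exp (- (x powr a) / 4) \<le> 1 / x ^ 5 \<and>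
      3 * (D1 + D2 * x) / ln 2 + 2 \<le> x\<^sup>2 \<and>
      x\<^sup>2 * (x + 1) * exp (x powr b + 1) * exp (- 5 * x / 32) \<le> x powr (- \<eta> / 2)) at_top"
  (is "eventually (\<lambda>x. _ x \<and> _ x \<and> _ x \<and> _ x \<and> ?P5 x \<and> ?P6 x \<and> ?P7 x \<and> ?P8 x \<and> _ x \<and> _ x \<and> ?P11 x \<and> ?P12 x \<and> ?P13 x) _")
proof (intro eventually_conj)
  show "eventually ?P5 at_top" using assms by real_asymp
  show "eventually ?P6 at_top" using assms by real_asymp
  show "eventually ?P7 at_top" using assms by real_asymp
  show "eventually ?P8 at_top" using assms by real_asymp
  show "eventually ?P11 at_top" using assms by real_asymp
  show "eventually ?P12 at_top" using assms by real_asymp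
  show "eventually ?P13 at_top" using assms by real_asymp
  show "eventually (\<lambda>x::real. 1 \<le> x) at_top" "eventually (\<lambda>x::real. 100 * ln x \<le> x) at_top"
    "eventually (\<lambda>x::real. 4 \<le> x ^ 100) at_top" by real_asymp+
  show "eventually (\<lambda>x::real. 1 + D1 + D2 * x \<le> 2 * x ^ 100) at_top" by real_asymp
  show "eventually (\<lambda>x::real. 2 \<le> x powr b) at_top" "eventually (\<lambda>x::real. 1 \<le> x powr a) at_top"
    using assms by real_asymp+
qed

text \<open>Only finitely many lines are used, so one \<open>W\<close> can dominate all their
  constants.\<close>

lemma (in decaying_weight) weight_constants:
  "\<exists>W\<ge>1. (\<forall>c\<in>{1/16, 1/4, 1/2, 3/4, 3}. \<forall>M\<ge>1. \<forall>n\<ge>1. norm (mellin_weight h 1 M n) \<le> W * (sqrt (real M) / real n) powr c) \<and>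
     integrable lborel (\<lambda>y. (1 + \<bar>y\<bar>) * norm (h (Complex (1/2) y))) \<and>
     (LBINT y. (1 + \<bar>y\<bar>) * norm (h (Complex (1/2) y))) \<le> W"
proof -
  have "\<forall>c\<in>{1/16, 1/4, 1/2, 3/4, 3::real}. \<exists>C\<ge>0. \<forall>M\<ge>1. \<forall>n\<ge>1. norm (mellin_weight h 1 M n) \<le> C * (sqrt (real M) / real n) powr c"
  proof
    fix c :: real assume "c \<in> {1/16, 1/4, 1/2, 3/4, 3}"
    then have c: "c > 0" by auto
    show "\<exists>C\<ge>0. \<forall>M\<ge>1. \<forall>n\<ge>1. norm (mellin_weight h 1 M n) \<le> C * (sqrt (real M) / real n) powr c"
      using norm_mellin_weight_le[OF c] mellin_weight_shift[OF zero_less_one c] by auto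
  qed
  then obtain D where D: "\<And>c. c \<in> {1/16, 1/4, 1/2, 3/4, 3::real} \<Longrightarrow> D c \<ge> 0"
    "\<And>c M n. c \<in> {1/16, 1/4, 1/2, 3/4, 3::real} \<Longrightarrow> M \<ge> 1 \<Longrightarrow> n \<ge> 1 \<Longrightarrow> norm (mellin_weight h 1 M n) \<le> D c * (sqrt (real M) / real n) powr c"
    by metis
  obtain C where C: "C \<ge> 0" "\<And>w. 1/2 \<le> Re w \<Longrightarrow> Re w \<le> 1/2 \<Longrightarrow> norm (h w) \<le> C / (1 + (Im w)\<^sup>2)\<^sup>2"
    using decay[of "1/2" "1/2"] by auto
  have bound: "(1 + \<bar>y\<bar>) * norm (h (Complex (1/2) y)) \<le> 2 * C * inverse (1 + y\<^sup>2)" for y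
  proof -
    have pos: "1 + y\<^sup>2 > 0" by (simp add: add_pos_nonneg)
    have "\<bar>y\<bar> \<le> 1 + y\<^sup>2" using zero_le_power2[of "\<bar>y\<bar> - 1"] by (simp add: power2_diff)
    then have "1 + \<bar>y\<bar> \<le> 1 + (1 + y\<^sup>2)" by simp
    also have "\<dots> \<le> 2 * (1 + y\<^sup>2)" by simp
    finally have "1 + \<bar>y\<bar> \<le> 2 * (1 + y\<^sup>2)" .
    then have "(1 + \<bar>y\<bar>) * norm (h (Complex (1/2) y)) \<le> (2 * (1 + y\<^sup>2)) * (C / (1 + y\<^sup>2)\<^sup>2)"
      using C(2)[of "Complex (1/2) y"] by (intro mult_mono) auto
    also have "\<dots> = 2 * C * inverse (1 + y\<^sup>2)" 
    proof -
      have "2 * P * (C / P\<^sup>2) = 2 * C * inverse P" if "P > 0" for P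
        using that by (simp add: power2_eq_square divide_inverse)
      then show ?thesis using pos .
    qed
    finally show ?thesis .
  qed
  have int: "integrable lborel (\<lambda>y. (1 + \<bar>y\<bar>) * norm (h (Complex (1/2) y)))"
  proof (rule Bochner_Integration.integrable_bound)
    show "integrable lborel (\<lambda>y. 2 * C * inverse (1 + y\<^sup>2))"
      using integrable_inverse_1_plus_square_lborel by simp
    have "continuous_on UNIV (\<lambda>y. (1 + \<bar>y\<bar>) * norm (h (Complex (1/2) y)))"
      by (intro continuous_intros continuous_on_line) simp
    then show "(\<lambda>y. (1 + \<bar>y\<bar>) * norm (h (Complex (1/2) y))) \<in> borel_measurable lborel"
      using borel_measurable_continuous_onI by auto
    have "norm ((1 + \<bar>y\<bar>) * norm (h (Complex (1/2) y))) \<le> norm (2 * C * inverse (1 + y\<^sup>2))" for y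
      using bound[of y] C(1) by (simp add: abs_mult)
    then show "AE y in lborel. norm ((1 + \<bar>y\<bar>) * norm (h (Complex (1/2) y))) \<le> norm (2 * C * inverse (1 + y\<^sup>2))"
      by simp
  qed
  define J where "J = (LBINT y. (1 + \<bar>y\<bar>) * norm (h (Complex (1/2) y)))"
  define W where "W = 1 + \<bar>J\<bar> + (\<Sum>c\<in>{1/16, 1/4, 1/2, 3/4, 3}. D c)"
  have sum0: "(\<Sum>c\<in>{1/16, 1/4, 1/2, 3/4, 3}. D c) \<ge> 0" by (rule sum_nonneg) (rule D(1))
  show ?thesis
  proof (intro exI[of _ W] conjI ballI allI impI int)
    show "1 \<le> W" using sum0 by (simp add: W_def)
    show "(LBINT y. (1 + \<bar>y\<bar>) * norm (h (Complex (1/2) y))) \<le> W" using sum0 by (simp add: W_def J_def[symmetric])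
    fix c :: real and M n :: nat assume c: "c \<in> {1/16, 1/4, 1/2, 3/4, 3}" and *: "M \<ge> 1" "n \<ge> 1"
    have "D c \<le> (\<Sum>c\<in>{1/16, 1/4, 1/2, 3/4, 3}. D c)" using c D(1) by (intro member_le_sum) auto
    then have "D c \<le> W" by (simp add: W_def)
    then have "D c * (sqrt (real M) / real n) powr c \<le> W * (sqrt (real M) / real n) powr c" by (rule mult_right_mono) simp
    then show "norm (mellin_weight h 1 M n) \<le> W * (sqrt (real M) / real n) powr c" using D(2)[OF c *] by linarith
  qed
qed

context dyadic_moment
begin

definition moment_constant :: real where
  "moment_constant = 4 * K * W + 8 * real d * K * W + 2 * real d * sqrt (6 * K) * W + 2 * (sqrt (6 * K) * W)
     + 15 * real d * sqrt (6 * K) * W + sqrt (90 * K) * W * geometric_constant"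

text \<open>The bound is sorted into three kinds of terms that the parameters treat differently: the
  sieve saving, the terms small because of the primes, and those with a power of \<open>q\<close> to
  spare.\<close>

lemma l2norm_central_sum_le:
  "l2norm X (\<lambda>chi. \<Sum>n. twist lamF chi n / of_nat n powr (1/2) * mellin_weight h 1 (N q) n)
   \<le> moment_constant * (sqrt Y * sqrt (real J1 / real J2 + exp (- real J1 / 4))
      + (real I + 1) * (real J2 + 1) * sqrt Y * (\<epsilon> + exp (- real J1 / 4))
      + (real I + 1) * (real J2 + 1) * exp (real J2 + 1) * sqrt (real q) * Y powr (1/16))"
proof -
  define e where "e = exp (- real J1 / 4)"
  define s where "s = sqrt (6 * K)"
  define A where "A = sqrt Y * sqrt (real J1 / real J2 + e)"
  define B where "B = (real I + 1) * (real J2 + 1) * sqrt Y * (\<epsilon> + e)"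
  define D where "D = (real I + 1) * (real J2 + 1) * exp (real J2 + 1) * sqrt (real q) * Y powr (1/16)"
  have e0: "e > 0" by (simp add: e_def)
  have pos: "s \<ge> 0" "W \<ge> 0" "K \<ge> 0" "A \<ge> 0" "B \<ge> 0" "D \<ge> 0" "sqrt Y \<ge> 0"
    using K W Y eps e0 by (simp_all add: s_def A_def B_def D_def)
  have G: "geometric_constant \<ge> 0" using ge_one_powr_ge_zero[of 2 "1/4"] by (simp add: geometric_constant_def)
  have one_le: "1 \<le> (real I + 1) * (real J2 + 1)" "real I \<le> (real I + 1) * (real J2 + 1)"
    "real I * (real J2 + 1) \<le> (real I + 1) * (real J2 + 1)"
    by (simp_all add: algebra_simps)
  have Y1: "Y powr (1/16) \<ge> 1" using Y by (simp add: ge_one_powr_ge_zero)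
  have D1: "sqrt (real q) \<le> D"
  proof -
    have "1 * 1 * sqrt (real q) * 1 \<le> D"
      unfolding D_def by (intro mult_mono one_le Y1) auto
    then show ?thesis by simp
  qed
  have D2: "real I * exp (real J2 + 1) * (sqrt (real q) * Y powr (1/16)) \<le> D"

  proof -
    have "real I * (exp (real J2 + 1) * (sqrt (real q) * Y powr (1/16))) \<le> ((real I + 1) * (real J2 + 1)) * (exp (real J2 + 1) * (sqrt (real q) * Y powr (1/16)))"
      by (rule mult_right_mono[OF one_le(2)]) simp
    then show ?thesis by (simp add: D_def mult.assoc)
  qed
  have D3: "real I * (sqrt (real q) * Y powr (1/16)) \<le> D"
  proof -
    have "real I * (sqrt (real q) * Y powr (1/16)) * 1 \<le> real I * (sqrt (real q) * Y powr (1/16)) * exp (real J2 + 1)"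
      by (intro mult_left_mono) auto
    then show ?thesis using D2 by (simp add: mult_ac)
  qed
  have B1: "real I * (real J2 + 1) * (sqrt Y * \<epsilon>) \<le> B"
  proof -
    have "real I * (real J2 + 1) * (sqrt Y * \<epsilon>) \<le> (real I + 1) * (real J2 + 1) * (sqrt Y * (\<epsilon> + e))"
      by (rule mult_mono[OF one_le(3)]) (use pos eps e0 in \<open>auto intro: mult_left_mono\<close>)
    then show ?thesis by (simp add: B_def mult.assoc)
  qed
  have B2: "real I * (sqrt Y * e) \<le> B"
  proof -
    have "real I * (sqrt Y * e) \<le> (real I + 1) * (real J2 + 1) * (sqrt Y * (\<epsilon> + e))"
      by (rule mult_mono[OF one_le(2)]) (use pos eps e0 in \<open>auto intro: mult_left_mono\<close>)
    then show ?thesis by (simp add: B_def mult.assoc)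
  qed
  have low: "low_bound = s * W * (sqrt (real q) * Y powr (1/16))"
    by (simp add: low_bound_def s_def real_sqrt_mult)
  have q2: "sqrt (2 * real q) \<le> 2 * sqrt (real q)" 
    unfolding real_sqrt_mult by (rule mult_right_mono[OF less_imp_le[OF sqrt2_less_2]]) simp
  have t1: "2 * K * W * sqrt (2 * real q) \<le> 4 * K * W * D"
  proof -
    have "2 * K * W * sqrt (2 * real q) \<le> 2 * K * W * (2 * D)" using q2 D1 pos by (intro mult_left_mono) auto
    then show ?thesis by simp
  qed
  have t2: "4 * real d * K * W * sqrt (2 * real q) \<le> 8 * real d * K * W * D"
  proof -
    have "4 * real d * K * W * sqrt (2 * real q) \<le> 4 * real d * K * W * (2 * D)" using q2 D1 pos by (intro mult_left_mono) auto
    then show ?thesis by simp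
  qed
  have t3: "real I * (2 * exp (real J2 + 1) * real d * low_bound) \<le> 2 * real d * s * W * D"
    using mult_left_mono[OF D2, of "2 * real d * s * W"] pos unfolding low by (simp add: mult_ac)
  have t4: "real I * ((real J2 + 1) * (s * W * sqrt Y * \<epsilon>)) \<le> s * W * B"
    using mult_left_mono[OF B1, of "s * W"] pos by (simp add: mult_ac)
  have t5: "real I * (real d * (s * W * sqrt Y) * (15 * e)) \<le> 15 * real d * s * W * B"
    using mult_left_mono[OF B2, of "15 * real d * s * W"] pos by (simp add: mult_ac)
  have t6: "real I * low_bound \<le> s * W * D"
    using mult_left_mono[OF D3, of "s * W"] pos unfolding low by (simp add: mult_ac)
  have t7: "sqrt (3 * sift_bound) * W * sqrt Y * geometric_constant \<le> sqrt (90 * K) * W * geometric_constant * A"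
  proof -
    have "3 * sift_bound \<le> 90 * K * (real J1 / real J2 + e)"
    proof -
      have "K * (real J1 / real J2) \<ge> 0" using pos by simp
      then show ?thesis by (simp add: sift_bound_def e_def distrib_left mult.assoc)
    qed
    then have "sqrt (3 * sift_bound) \<le> sqrt (90 * K) * sqrt (real J1 / real J2 + e)"
      by (simp only: real_sqrt_mult[symmetric] real_sqrt_le_iff)
    then have "sqrt (3 * sift_bound) * (W * sqrt Y * geometric_constant) \<le> sqrt (90 * K) * sqrt (real J1 / real J2 + e) * (W * sqrt Y * geometric_constant)"
      using pos G by (intro mult_right_mono) auto
    then show ?thesis by (simp add: A_def mult_ac)
  qed
  have "derivative_bound = real I * (2 * exp (real J2 + 1) * real d * low_bound) + real I * ((real J2 + 1) * (s * W * sqrt Y * \<epsilon>))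
      + real I * (real d * (s * W * sqrt Y) * (15 * e)) + 4 * real d * K * W * sqrt (2 * real q)"
    by (simp add: derivative_bound_def s_def e_def distrib_left)
  then have "l2norm X (\<lambda>chi. \<Sum>n. twist lamF chi n / of_nat n powr (1/2) * mellin_weight h 1 (N q) n)
    \<le> 4 * K * W * D + (2 * real d * s * W * D + s * W * B + 15 * real d * s * W * B + 8 * real d * K * W * D)
      + (s * W * D + sqrt (90 * K) * W * geometric_constant * A)"
    using l2norm_central_sum t1 t2 t3 t4 t5 t6 t7 by linarith
  also have "\<dots> = (4 * K * W + 8 * real d * K * W + 2 * real d * s * W + s * W) * D
      + (s * W + 15 * real d * s * W) * B + sqrt (90 * K) * W * geometric_constant * A"
    by (simp only: distrib_right)
  also have "\<dots> \<le> moment_constant * D + moment_constant * B + moment_constant * A"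
  proof -
    have "4 * K * W \<ge> 0" "8 * real d * K * W \<ge> 0" "2 * real d * s * W \<ge> 0" "s * W \<ge> 0" "15 * real d * s * W \<ge> 0" "sqrt (90 * K) * W * geometric_constant \<ge> 0"
      using pos G by simp_all
    then have "4 * K * W + 8 * real d * K * W + 2 * real d * s * W + s * W \<le> moment_constant"
      "s * W + 15 * real d * s * W \<le> moment_constant" "sqrt (90 * K) * W * geometric_constant \<le> moment_constant"
      unfolding moment_constant_def s_def[symmetric] by linarith+
    then show ?thesis using pos by (intro add_mono mult_right_mono) auto
  qed
  finally show ?thesis by (simp add: A_def B_def D_def e_def distrib_left)
qed

end

context L_function_bounds
begin

text \<open>All constants are obtained before \<open>q\<close> and \<open>X\<close> are fixed, and
  \<open>dyadic_moment\<close> is entered only afterwards; this makes \<open>C\<close>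
  uniform.\<close>

lemma second_moment_bound:
  "\<exists>C>0. \<forall>q X Y J1 J2 I \<epsilon>. q \<ge> 2 \<longrightarrow> X \<subseteq> primitive_characters q \<longrightarrow> (\<forall>chi\<in>X. chi (-1) = e) \<longrightarrow> N q \<ge> 1 \<longrightarrow>
     Y \<ge> 1 \<longrightarrow> sqrt (real (N q)) \<le> Y \<longrightarrow> 1 \<le> J1 \<longrightarrow> J1 \<le> J2 \<longrightarrow> exp (real J2) \<le> real q \<longrightarrow> Y ^ 3 \<le> 2 ^ I \<longrightarrow> \<epsilon> \<ge> 0 \<longrightarrow>
     (\<forall>chi\<in>X. \<forall>j\<in>{J1..J2}. \<forall>y. norm (hat_sum chi (real j) (Complex 1 y)) \<le> \<epsilon> * (1 + \<bar>y\<bar>)) \<longrightarrow>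
     l2norm X (\<lambda>chi. L_twist lamF chi (1/2)) \<le> C * (sqrt Y * sqrt (real J1 / real J2 + exp (- real J1 / 4))
      + (real I + 1) * (real J2 + 1) * sqrt Y * (\<epsilon> + exp (- real J1 / 4))
      + (real I + 1) * (real J2 + 1) * exp (real J2 + 1) * sqrt (real q) * Y powr (1/16))"
proof -
  obtain h where h: "decaying_weight h" and afe: "\<And>q chi. q \<ge> 2 \<Longrightarrow> chi \<in> primitive_characters q \<Longrightarrow> chi (-1) = e \<Longrightarrow>
     norm (L_twist lamF chi (1 / 2)) \<le> norm (\<Sum>n. twist lamF chi n / of_nat n powr (1 / 2) * mellin_weight h 1 (N q) n)"
    using approximate_functional_equation[of e] by blast
  interpret decaying_weight h by (rule h)
  obtain W where W: "W \<ge> 1" "\<And>c M n. c \<in> {1/16, 1/4, 1/2, 3/4, 3} \<Longrightarrow> M \<ge> 1 \<Longrightarrow> n \<ge> 1 \<Longrightarrow>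
      norm (mellin_weight h 1 M n) \<le> W * (sqrt (real M) / real n) powr c"
    "integrable lborel (\<lambda>y. (1 + \<bar>y\<bar>) * norm (h (Complex (1/2) y)))"
    "(LBINT y. (1 + \<bar>y\<bar>) * norm (h (Complex (1/2) y))) \<le> W"
    using weight_constants by blast
  obtain K1 where K1: "K1 \<ge> 1" "\<And>n. n \<ge> 1 \<Longrightarrow> norm (lamF n) \<le> K1 * sqrt (real n)" using norm_lamF_le_sqrt by blast
  obtain K2 where K2: "K2 \<ge> 1" "\<And>M::nat. (\<Sum>n\<in>{1..<M}. (norm (lamF n))\<^sup>2) \<le> K2 * real M" using mean_square_lamF by blast
  obtain K3 where K3: "K3 \<ge> 1" "\<And>p a. \<And>M::nat. prime p \<Longrightarrow> a \<le> 2 \<Longrightarrow>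
      (\<Sum>n | n \<in> {1..<M} \<and> p ^ a dvd n. (norm (lamF n))\<^sup>2) \<le> K3 * real M / real p ^ a"
    using mean_square_lamF_dvd by blast
  obtain K4 where K4: "\<And>P1 P2 X :: real. 2 \<le> P1 \<Longrightarrow> P1 \<le> P2 \<Longrightarrow> P2 \<le> X \<Longrightarrow>
      (\<Sum>n | 1 \<le> n \<and> real n \<le> X \<and> coprime n (\<Prod>p | prime p \<and> P1 \<le> real p \<and> real p \<le> P2. p). (norm (lamF n))\<^sup>2)
      \<le> K4 * (X * (ln P1 / ln P2))"
    using sifted by blast
  define K where "K = max (max K1 K2) (max K3 K4)"
  have K: "K1 \<le> K" "K2 \<le> K" "K3 \<le> K" "K4 \<le> K" by (auto simp: K_def)
  define s where "s = sqrt (6 * K)"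
  define G :: real where "G = 2 / (2 powr (1/4) - 1) + 2"
  define C where "C = 4 * K * W + 8 * real d * K * W + 2 * real d * s * W + 2 * (s * W) + 15 * real d * s * W + sqrt (90 * K) * W * G"
  have G0: "G \<ge> 0" using ge_one_powr_ge_zero[of 2 "1/4"] by (simp add: G_def)
  have C0: "C > 0"
  proof -
    have "K \<ge> 1" using K K1 by linarith
    then have "4 * K * W > 0" "8 * real d * K * W \<ge> 0" "2 * real d * s * W \<ge> 0" "2 * (s * W) \<ge> 0" "15 * real d * s * W \<ge> 0" "sqrt (90 * K) * W * G \<ge> 0"
      using W(1) G0 by (simp_all add: s_def)
    then show ?thesis unfolding C_def by linarith
  qed
  show ?thesis
  proof (intro exI[of _ C] conjI allI impI C0)
    fix q X Y J1 J2 I \<epsilon>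
    assume *: "q \<ge> 2" "X \<subseteq> primitive_characters q" "\<forall>chi\<in>X. chi (-1) = e" "N q \<ge> 1" "Y \<ge> (1::real)" "sqrt (real (N q)) \<le> Y"
      "1 \<le> J1" "J1 \<le> J2" "exp (real J2) \<le> real q" "Y ^ 3 \<le> 2 ^ I" "\<epsilon> \<ge> 0"
      "\<forall>chi\<in>X. \<forall>j\<in>{J1..J2}. \<forall>y. norm (hat_sum chi (real j) (Complex 1 y)) \<le> \<epsilon> * (1 + \<bar>y\<bar>)"
    interpret D: dyadic_moment d lamF \<alpha> N \<mu> \<theta> h K W Y \<epsilon> q J1 J2 I X
    proof
      show "1 \<le> K" using K K1 by linarith
      show "norm (lamF n) \<le> K * sqrt (real n)" if "n \<ge> 1" for n
        using K1(2)[OF that] mult_right_mono[OF K(1), of "sqrt (real n)"] by simp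
      show "(\<Sum>n\<in>{1..<M}. (norm (lamF n))\<^sup>2) \<le> K * real M" for M
        using K2(2)[of M] mult_right_mono[OF K(2), of "real M"] by simp
      show "(\<Sum>n | n \<in> {1..<M} \<and> p ^ a dvd n. (norm (lamF n))\<^sup>2) \<le> K * real M / real p ^ a" if "prime p" "a \<le> 2" for p a M
        using K3(2)[OF that, of M] mult_right_mono[OF K(3), of "real M / real p ^ a"] by simp
      show "(\<Sum>n | 1 \<le> n \<and> real n \<le> x \<and> coprime n (\<Prod>p | prime p \<and> P1 \<le> real p \<and> real p \<le> P2. p). (norm (lamF n))\<^sup>2)
        \<le> K * (x * (ln P1 / ln P2))" if P: "2 \<le> P1" "P1 \<le> P2" "P2 \<le> x" for P1 P2 x :: real
        using K4[OF P] mult_right_mono[OF K(4), of "x * (ln P1 / ln P2)"] P by simp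
      show "mellin_weight h 1 (N q) n = mellin_weight h (1/2) (N q) n" if "n \<ge> 1" for n
        using mellin_weight_shift[of 1 "1/2" "N q" n] *(4) that by simp
      show "continuous_on UNIV (\<lambda>y. h (Complex (1/2) y))" by (rule continuous_on_line) simp
      show "finite X" using *(1,2) finite_primitive_characters[of q] finite_subset by auto
      show "norm (mellin_weight h 1 (N q) n) \<le> W * (sqrt (real (N q)) / real n) powr c"
        if "c \<in> {1/16, 1/4, 1/2, 3/4, 3}" "n \<ge> 1" for c n using W(2)[OF that(1) *(4) that(2)] .
    qed (use * W in auto)
    have "l2norm X (\<lambda>chi. L_twist lamF chi (1/2)) \<le> l2norm X (\<lambda>chi. \<Sum>n. twist lamF chi n / of_nat n powr (1/2) * mellin_weight h 1 (N q) n)"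
      using afe *(1,2,3) by (intro l2norm_mono) auto
    also note D.l2norm_central_sum_le
    also have "D.moment_constant = C" by (simp add: D.moment_constant_def D.geometric_constant_def C_def s_def G_def)
    finally show "l2norm X (\<lambda>chi. L_twist lamF chi (1/2)) \<le> C * (sqrt Y * sqrt (real J1 / real J2 + exp (- real J1 / 4))
      + (real I + 1) * (real J2 + 1) * sqrt Y * (\<epsilon> + exp (- real J1 / 4))
      + (real I + 1) * (real J2 + 1) * exp (real J2 + 1) * sqrt (real q) * Y powr (1/16))" .
  qed
qed


lemma parity_second_moment:
  assumes d: "d \<ge> 3" and beta: "0 \<le> \<beta>" "\<beta> < 1" and eta: "0 < \<eta>" "\<eta> < 1 - \<beta>" and cF: "cF > 0"
  shows "\<exists>C. \<exists>q1\<ge>2. \<forall>q\<ge>q1. \<forall>X. X \<subseteq> primitive_characters q \<longrightarrow> (\<forall>chi\<in>X. chi (-1) = e) \<longrightarrow>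
     (\<forall>chi\<in>X. \<forall>\<sigma> t. \<sigma> > 1 - cF / ln (real q * ln (real q) ^ 100) powr \<beta> \<and> \<bar>t\<bar> \<le> ln (real q) ^ 100 \<longrightarrow>
        L_twist lamF chi (Complex \<sigma> t) \<noteq> 0) \<longrightarrow>
     (\<Sum>chi\<in>X. (norm (L_twist lamF chi (1/2)))\<^sup>2) \<le> C * (real q powr (real d / 2) / ln (real q) powr \<eta>)"
proof -
  \<comment> \<open>Half of the room left by \<open>\<eta> < 1 - \<beta>\<close>: then
    \<open>b - a = \<eta>\<close> is exactly the saving claimed, while \<open>a > \<beta>\<close>
    and \<open>b < 1\<close>.\<close>
  define \<epsilon>0 where "\<epsilon>0 = (1 - \<beta> - \<eta>) / 2"
  define a where "a = \<beta> + \<epsilon>0"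
  define b where "b = 1 - \<epsilon>0"
  \<comment> \<open>The continuation of the prime series is available for widths up to
    \<open>1 / 4\<close>, hence the minimum.\<close>
  define c where "c = min cF (1/4)"
  have params: "0 < a" "a < b" "b < 1" "0 < \<epsilon>0" "c > 0" "\<eta> < 1"
    using beta eta cF by (simp_all add: a_def b_def \<epsilon>0_def c_def field_simps)
  have c_le: "c \<le> cF" "c \<le> 1/4" by (simp_all add: c_def)
  have ab: "a - b = - \<eta>" "a - \<beta> = \<epsilon>0" by (simp_all add: a_def b_def \<epsilon>0_def field_simps)
  obtain C1 where C1: "C1 > 0" and moment: "\<And>q X Y J1 J2 I \<epsilon>. q \<ge> 2 \<Longrightarrow> X \<subseteq> primitive_characters q \<Longrightarrow> (\<forall>chi\<in>X. chi (-1) = e) \<Longrightarrow> N q \<ge> 1 \<Longrightarrow>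
     Y \<ge> 1 \<Longrightarrow> sqrt (real (N q)) \<le> Y \<Longrightarrow> 1 \<le> J1 \<Longrightarrow> J1 \<le> J2 \<Longrightarrow> exp (real J2) \<le> real q \<Longrightarrow> Y ^ 3 \<le> 2 ^ I \<Longrightarrow> \<epsilon> \<ge> 0 \<Longrightarrow>
     (\<forall>chi\<in>X. \<forall>j\<in>{J1..J2}. \<forall>y. norm (hat_sum chi (real j) (Complex 1 y)) \<le> \<epsilon> * (1 + \<bar>y\<bar>)) \<Longrightarrow>
     l2norm X (\<lambda>chi. L_twist lamF chi (1/2)) \<le> C1 * (sqrt Y * sqrt (real J1 / real J2 + exp (- real J1 / 4))
      + (real I + 1) * (real J2 + 1) * sqrt Y * (\<epsilon> + exp (- real J1 / 4))
      + (real I + 1) * (real J2 + 1) * exp (real J2 + 1) * sqrt (real q) * Y powr (1/16))"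
    using second_moment_bound[of e] by metis
  obtain C2 where C2: "C2 > 0" and hat: "\<And>q chi \<delta> T j s. q \<ge> 2 \<Longrightarrow> chi \<in> primitive_characters q \<Longrightarrow> chi (-1) = e \<Longrightarrow> 0 < \<delta> \<Longrightarrow> \<delta> \<le> 1 / 4 \<Longrightarrow> 4 \<le> T \<Longrightarrow>
     (\<forall>s. Re s > 1 - \<delta> \<and> \<bar>Im s\<bar> \<le> T \<longrightarrow> L_twist lamF chi s \<noteq> 0) \<Longrightarrow> 1 \<le> j \<Longrightarrow> Re s = 1 \<Longrightarrow> \<bar>Im s\<bar> \<le> T / 4 \<Longrightarrow>
     norm (hat_sum chi j s) \<le> C2 * (j / T + (1 + ln (real (N q)) + T) / \<delta> * (T * exp (- (j * \<delta> / 2)) + 1 / T\<^sup>2))"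
    using hat_sum_bound[of e] by metis
  obtain K0 qc where K0: "\<And>q chi. q \<ge> max 2 qc \<Longrightarrow> chi \<in> primitive_characters q \<Longrightarrow> real (N q) \<le> K0 * real q ^ d"
    using conductor_bound by blast
  define K where "K = max K0 1"
  define D1 where "D1 = ln K"
  have K: "K \<ge> 1" "K0 \<le> K" by (simp_all add: K_def)
  have D1: "D1 \<ge> 0" using K by (simp add: D1_def)
  obtain x0 where x0: "\<And>x. x \<ge> x0 \<Longrightarrow> 1 \<le> x \<and> 100 * ln x \<le> x \<and> 4 \<le> x ^ 100 \<and> 1 + D1 + real d * x \<le> 2 * x ^ 100 \<and>
      x ^ 100 * exp (- (c / 4) * x powr \<epsilon>0) \<le> 1 / (x ^ 100)\<^sup>2 \<and>
      C2 * (x / x ^ 100 + 3 * x ^ 100 * (2 * x / c) * (2 / (x ^ 100)\<^sup>2)) \<le> 1 / x ^ 5 \<and>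
      4 * (real d * exp 2) / x ^ 100 \<le> 1 / x ^ 5 \<and>
      x powr a + 1 \<le> x powr b - 1 \<and> 2 \<le> x powr b \<and> 1 \<le> x powr a \<and>
      exp (- (x powr a) / 4) \<le> 1 / x ^ 5 \<and>
      3 * (D1 + real d * x) / ln 2 + 2 \<le> x\<^sup>2 \<and>
      x\<^sup>2 * (x + 1) * exp (x powr b + 1) * exp (- 5 * x / 32) \<le> x powr (- \<eta> / 2)"
    using eventually_parameters[OF params(1-5) C2, of D1 "real d" \<eta>] unfolding eventually_at_top_linorder by blast
  define q1 where "q1 = max (max 2 qc) (nat \<lceil>exp x0\<rceil>)"
  \<comment> \<open>The summands 3, 4 and 1 come from \<open>t1\<close>, \<open>t2\<close> and
    \<open>t3\<close> below, and \<open>K\<close> from the conductor.\<close>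
  define C where "C = (C1 * (3 + 4 + 1))\<^sup>2 * K"
  show ?thesis
  proof (intro exI[of _ C] exI[of _ q1] conjI allI impI)
    show "2 \<le> q1" by (simp add: q1_def)
    fix q X
    assume q: "q1 \<le> q" and X: "X \<subseteq> primitive_characters q" "\<forall>chi\<in>X. chi (-1) = e"
      and nz: "\<forall>chi\<in>X. \<forall>\<sigma> t. \<sigma> > 1 - cF / ln (real q * ln (real q) ^ 100) powr \<beta> \<and> \<bar>t\<bar> \<le> ln (real q) ^ 100 \<longrightarrow>
        L_twist lamF chi (Complex \<sigma> t) \<noteq> 0"
    have q2: "q \<ge> 2" "q \<ge> max 2 qc" using q by (auto simp: q1_def)
    define x where "x = ln (real q)"
    have qx: "real q = exp x" using q2 by (simp add: x_def)
    have "exp x0 \<le> real q" using q unfolding q1_def by linarith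
    then have "x \<ge> x0" using q2 by (simp add: qx)
    note x = x0[OF this]
    define T where "T = x ^ 100"
    have x1: "x \<ge> 1" and T4: "4 \<le> T" using x by (simp_all add: T_def)
    show "(\<Sum>chi\<in>X. (norm (L_twist lamF chi (1/2)))\<^sup>2) \<le> C * (real q powr (real d / 2) / ln (real q) powr \<eta>)"
    \<comment> \<open>The conductor is known to be positive and bounded only when a primitive
      character exists.\<close>
    proof (cases "X = {}")
      case True
      then show ?thesis using K by (simp add: C_def)
    next
      case False
      then obtain chi0 where chi0: "chi0 \<in> primitive_characters q" using X by blast
      define Y where "Y = sqrt K * real q powr (real d / 2)"
      have N: "N q \<ge> 1" using N_pos[OF q2(1) chi0] by simp
      have N_le: "real (N q) \<le> K * real q ^ d"
        using K0[OF q2(2) chi0] mult_right_mono[OF K(2), of "real q ^ d"] by simp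
      have Y_ge: "real q powr (real d / 2) \<le> Y"
        using K mult_right_mono[of 1 "sqrt K" "real q powr (real d / 2)"] by (simp add: Y_def)
      \<comment> \<open>The degree enters here: \<open>d \<ge> 3\<close> gives
        \<open>Y \<ge> q powr (3/2)\<close>, the source of the power saving in
        \<open>t3\<close>.\<close>
      have qd: "real q powr (3/2) \<le> real q powr (real d / 2)" using q2 d by (intro powr_mono) auto
      have Y1: "Y \<ge> 1" using Y_ge q2 ge_one_powr_ge_zero[of "real q" "real d / 2"] by simp
      have Ysq: "Y = sqrt (K * real q ^ d)"
        using q2 by (simp add: Y_def real_sqrt_mult powr_half_sqrt[symmetric] powr_realpow[symmetric] powr_powr)
      have NY: "sqrt (real (N q)) \<le> Y" unfolding Ysq using N_le by simp
      \<comment> \<open>\<open>L\<close> lies between 1 and \<open>2 * x\<close>, so replacing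
        \<open>log (q * T)\<close> by \<open>log q\<close> changes the width of the region by a
        factor of at most 2.\<close>
      define L where "L = ln (real q * T)"
      have L_eq: "L = x + 100 * ln x" using q2 x1 by (simp add: L_def T_def x_def ln_mult ln_realpow)
      have L: "1 \<le> L" "L \<le> 2 * x"
      proof -
        show "1 \<le> L" unfolding L_eq using x1 ln_ge_zero[OF x1] by linarith
        show "L \<le> 2 * x" unfolding L_eq using x by linarith
      qed
      define \<delta> where "\<delta> = c / L powr \<beta>"
      have Lb: "1 \<le> L powr \<beta>" using L beta by (simp add: ge_one_powr_ge_zero)
      have Lb2: "L powr \<beta> \<le> 2 * x powr \<beta>"
      proof -
        have "L powr \<beta> \<le> (2 * x) powr \<beta>" using L beta by (intro powr_mono2) auto
        also have "\<dots> = 2 powr \<beta> * x powr \<beta>" using x1 by (simp add: powr_mult)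
        also have "\<dots> \<le> 2 powr 1 * x powr \<beta>" using beta by (intro mult_right_mono powr_mono) auto
        finally show ?thesis by simp
      qed
      have \<delta>: "0 < \<delta>" "\<delta> \<le> 1 / 4" "\<delta> \<le> cF / L powr \<beta>"
      proof -
        show "0 < \<delta>" unfolding \<delta>_def by (rule divide_pos_pos) (use params Lb in linarith)+
        have "c / L powr \<beta> \<le> c / 1" using params Lb by (intro divide_left_mono) auto
        then show "\<delta> \<le> 1 / 4" using c_le unfolding \<delta>_def by linarith
        show "\<delta> \<le> cF / L powr \<beta>" unfolding \<delta>_def using c_le by (intro divide_right_mono) auto
      qed
      have \<delta>_ge: "c / (2 * x powr \<beta>) \<le> \<delta>" 
        unfolding \<delta>_def using params Lb2 Lb x1 by (intro divide_left_mono mult_pos_pos) linarith+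
      have inv_\<delta>: "1 / \<delta> \<le> 2 * x / c"
      proof -
        have "1 / \<delta> = L powr \<beta> / c" by (simp add: \<delta>_def)
        also have "\<dots> \<le> 2 * x powr \<beta> / c" using Lb2 params by (intro divide_right_mono) auto
        also have "\<dots> \<le> 2 * x powr 1 / c" using x1 params beta by (intro divide_right_mono mult_left_mono powr_mono) auto
        finally show ?thesis using x1 by simp
      qed
      \<comment> \<open>Rounding inwards costs at most 1 at either end, which
        \<open>x powr a + 1 \<le> x powr b - 1\<close> allows for.\<close>
      define J1 where "J1 = nat \<lceil>x powr a\<rceil>"
      define J2 where "J2 = nat \<lfloor>x powr b\<rfloor>"
      have J1: "x powr a \<le> real J1" "real J1 \<le> x powr a + 1" 
      proof -
        have "real J1 = of_int \<lceil>x powr a\<rceil>" by (simp add: J1_def)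
        then show "x powr a \<le> real J1" "real J1 \<le> x powr a + 1" by linarith+
      qed
      have J2: "real J2 \<le> x powr b" "x powr b - 1 \<le> real J2" 
      proof -
        have "real J2 = of_int \<lfloor>x powr b\<rfloor>" by (simp add: J2_def)
        then show "real J2 \<le> x powr b" "x powr b - 1 \<le> real J2" by linarith+
      qed
      have xb: "x powr b \<le> x" using x1 params powr_mono[of b 1 x] by simp
      have J1_1: "1 \<le> J1" using J1 x by linarith
      have J12: "J1 \<le> J2" using J1 J2 x by linarith
      have J2_x: "real J2 \<le> x" using J2 xb by linarith
      have J2_q: "exp (real J2) \<le> real q" using J2_x by (simp add: qx)
      define I where "I = nat \<lceil>log 2 (Y ^ 3)\<rceil>"
      have I: "Y ^ 3 \<le> 2 ^ I"
      proof -
        have "log 2 (Y ^ 3) \<le> real I" by (simp add: I_def) linarith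
        then have "2 powr log 2 (Y ^ 3) \<le> 2 powr real I" by simp
        then show ?thesis using Y1 by (simp add: powr_realpow)
      qed
      have lnY: "ln Y \<le> D1 + real d * x"
      proof -
        have "ln Y = ln K / 2 + real d * x / 2" using K q2
          by (simp add: Ysq ln_sqrt ln_mult ln_realpow x_def add_divide_distrib)
        moreover have "real d * x \<ge> 0" using x1 by simp
        ultimately show ?thesis using D1 by (simp add: D1_def)
      qed
      have I_le: "real I + 1 \<le> x\<^sup>2"
      proof -
        have "log 2 (Y ^ 3) \<ge> 0" using Y1 by simp
        then have "real I \<le> log 2 (Y ^ 3) + 1" by (simp add: I_def)
        also have "log 2 (Y ^ 3) = 3 * ln Y / ln 2" using Y1 by (simp add: log_def ln_realpow)
        also have "\<dots> \<le> 3 * (D1 + real d * x) / ln 2" using lnY by (intro divide_right_mono) auto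
        finally show ?thesis using x by linarith
      qed
      \<comment> \<open>The fifth power pays for \<open>x^2\<close> dyadic blocks and
        \<open>x + 1\<close> windows and still leaves \<open>x powr (- 2)\<close>.\<close>
      define \<epsilon> where "\<epsilon> = 1 / x ^ 5"
      have \<epsilon>: "\<epsilon> \<ge> 0" using x1 by (simp add: \<epsilon>_def)
      have hats: "norm (hat_sum chi (real j) (Complex 1 y)) \<le> \<epsilon> * (1 + \<bar>y\<bar>)" if chi: "chi \<in> X" and j: "j \<in> {J1..J2}" for chi j y
      \<comment> \<open>Beyond \<open>T / 4\<close> the trivial bound suffices, since the permitted
        factor \<open>1 + \<bar>y\<bar>\<close> is then larger than \<open>T / 4\<close>.\<close>
      proof (cases "\<bar>y\<bar> \<le> T / 4")
        case True
        have chip: "chi \<in> primitive_characters q" "chi (-1) = e" using chi X by auto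
        have nzs: "\<forall>s. Re s > 1 - \<delta> \<and> \<bar>Im s\<bar> \<le> T \<longrightarrow> L_twist lamF chi s \<noteq> 0"
        proof (intro allI impI)
          fix s assume s: "Re s > 1 - \<delta> \<and> \<bar>Im s\<bar> \<le> T"
          then have "Re s > 1 - cF / L powr \<beta>" using \<delta> by linarith
          then have "L_twist lamF chi (Complex (Re s) (Im s)) \<noteq> 0"
            using nz chi s unfolding L_def T_def x_def by blast
          then show "L_twist lamF chi s \<noteq> 0" by simp
        qed
        have j1: "1 \<le> real j" "x powr a \<le> real j" "real j \<le> x" using j J1_1 J1 J2_x by auto
        have "norm (hat_sum chi (real j) (Complex 1 y)) \<le> C2 * (real j / T + (1 + ln (real (N q)) + T) / \<delta> * (T * exp (- (real j * \<delta> / 2)) + 1 / T\<^sup>2))"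
          by (rule hat[OF q2(1) chip \<delta>(1,2) T4 nzs]) (use True j1 in auto)
        also have "\<dots> \<le> C2 * (x / T + 3 * T * (2 * x / c) * (2 / T\<^sup>2))"
        proof (intro mult_left_mono add_mono)
          show "real j / T \<le> x / T" using j1 T4 by (intro divide_right_mono) auto
          have lnN: "1 + ln (real (N q)) + T \<le> 3 * T"
          proof -
            have "ln (real (N q)) \<le> ln (K * real q ^ d)" using N_le N K q2 by (subst ln_le_cancel_iff) auto
            also have "\<dots> = D1 + real d * x" using K q2 by (simp add: ln_mult ln_realpow D1_def x_def)
            finally show ?thesis using x unfolding T_def by linarith
          qed
          have m1: "(1 + ln (real (N q)) + T) * (1 / \<delta>) \<le> 3 * T * (2 * x / c)"
            using lnN inv_\<delta> T4 \<delta>(1) by (intro mult_mono) auto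
          have m2: "T * exp (- (real j * \<delta> / 2)) + 1 / T\<^sup>2 \<le> 2 / T\<^sup>2"
          proof -
            \<comment> \<open>\<open>j\<close> is at least \<open>x powr a\<close> and
              \<open>\<delta>\<close> at least a constant times \<open>x powr (- \<beta>)\<close>,
              so the exponent grows at least like \<open>x powr (a - \<beta>)\<close> and outruns
              \<open>ln T = 100 * ln x\<close>.\<close>
            have "c / 4 * x powr \<epsilon>0 = x powr a * (c / (2 * x powr \<beta>)) / 2"
              using x1 by (simp add: ab(2)[symmetric] powr_diff)
            also have "\<dots> \<le> real j * \<delta> / 2"
              using j1 \<delta>_ge params by (intro divide_right_mono mult_mono) auto
            finally have "T * exp (- (real j * \<delta> / 2)) \<le> T * exp (- (c / 4) * x powr \<epsilon>0)"
              using T4 by (intro mult_left_mono) auto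
            also have "\<dots> \<le> 1 / T\<^sup>2" using x unfolding T_def by blast
            finally show ?thesis by simp
          qed
          have "(1 + ln (real (N q)) + T) * (1 / \<delta>) * (T * exp (- (real j * \<delta> / 2)) + 1 / T\<^sup>2) \<le> 3 * T * (2 * x / c) * (2 / T\<^sup>2)"
            by (rule mult_mono[OF m1 m2]) (use T4 x1 params in auto)
          then show "(1 + ln (real (N q)) + T) / \<delta> * (T * exp (- (real j * \<delta> / 2)) + 1 / T\<^sup>2) \<le> 3 * T * (2 * x / c) * (2 / T\<^sup>2)"
            by simp
        qed (use C2 in auto)
        also have "\<dots> \<le> \<epsilon>" using x unfolding T_def \<epsilon>_def by blast
        also have "\<dots> \<le> \<epsilon> * (1 + \<bar>y\<bar>)" using \<epsilon> by (simp add: mult_left_mono distrib_left)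
        finally show ?thesis .
      next
        case False
        have chip: "chi \<in> primitive_characters q" using chi X by auto
        have "norm (hat_sum chi (real j) (Complex 1 y)) \<le> real d * exp 2"
          by (rule norm_hat_sum_trivial[OF q2(1) chip]) simp
        also have "\<dots> = (4 * (real d * exp 2) / T) * (T / 4)" using T4 by simp
        also have "\<dots> \<le> \<epsilon> * \<bar>y\<bar>"
          using x False T4 \<epsilon> unfolding T_def \<epsilon>_def by (intro mult_mono) auto
        also have "\<dots> \<le> \<epsilon> * (1 + \<bar>y\<bar>)" using \<epsilon> by (intro mult_left_mono) auto
        finally show ?thesis .
      qed
      \<comment> \<open>The target: \<open>E^2 = Y / x powr \<eta>\<close>, where \<open>Y\<close>
        is a constant times \<open>q powr (d / 2)\<close>.\<close>
      define E where "E = sqrt Y * x powr (- \<eta> / 2)"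
      have E0: "E \<ge> 0" using Y1 by (simp add: E_def)
      have x5: "1 / x ^ 5 \<le> x powr (- \<eta>)" "x\<^sup>2 * (x + 1) * (2 * (1 / x ^ 5)) \<le> 4 * x powr (- \<eta> / 2)"
      proof -
        have "1 / x ^ 5 = x powr (- 5)" using x1 by (simp add: powr_minus powr_numeral divide_inverse)
        also have "\<dots> \<le> x powr (- \<eta>)" using x1 params by (intro powr_mono) auto
        finally show "1 / x ^ 5 \<le> x powr (- \<eta>)" .
        have "x\<^sup>2 * (x + 1) * (2 * (1 / x ^ 5)) \<le> x\<^sup>2 * (2 * x) * (2 * (1 / x ^ 5))"
          using x1 by (intro mult_right_mono mult_left_mono) auto
        also have "\<dots> = 4 * x powr (- 2)" 
          using x1 by (simp add: powr_minus powr_numeral field_simps eval_nat_numeral)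
        also have "\<dots> \<le> 4 * x powr (- \<eta> / 2)" using x1 params by (intro mult_left_mono powr_mono) auto
        finally show "x\<^sup>2 * (x + 1) * (2 * (1 / x ^ 5)) \<le> 4 * x powr (- \<eta> / 2)" .
      qed
      have expJ: "exp (- real J1 / 4) \<le> 1 / x ^ 5"
      proof -
        have "exp (- real J1 / 4) \<le> exp (- (x powr a) / 4)" using J1 by simp
        then show ?thesis using x by linarith
      qed
      have t1: "sqrt Y * sqrt (real J1 / real J2 + exp (- real J1 / 4)) \<le> 3 * E"
      proof -
        \<comment> \<open>Rounding costs a factor 2 in each of \<open>J1\<close> and
          \<open>J2\<close>; adding the exponential gives \<open>4 + 1 \<le> 3^2\<close>, hence the
          3 in the claim.\<close>
        have "real J1 / real J2 \<le> (2 * x powr a) / (x powr b / 2)"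
          using J1 J2 x by (intro frac_le) auto
        also have "\<dots> = 4 * x powr (- \<eta>)" by (simp add: ab(1)[symmetric] powr_diff)
        finally have "real J1 / real J2 + exp (- real J1 / 4) \<le> 4 * x powr (- \<eta>) + x powr (- \<eta>)"
          using expJ x5(1) by linarith
        also have "\<dots> \<le> (3 * x powr (- \<eta> / 2))\<^sup>2"
        proof -
          have "(x powr (- \<eta> / 2))\<^sup>2 = x powr (- \<eta>)" by (simp add: power2_eq_square powr_add[symmetric])
          then show ?thesis by (simp add: power_mult_distrib)
        qed
        finally have "sqrt (real J1 / real J2 + exp (- real J1 / 4)) \<le> 3 * x powr (- \<eta> / 2)"
          by (intro real_le_lsqrt) auto
        then have "sqrt Y * sqrt (real J1 / real J2 + exp (- real J1 / 4)) \<le> sqrt Y * (3 * x powr (- \<eta> / 2))"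
          using Y1 by (intro mult_left_mono) auto
        then show ?thesis by (simp add: E_def)
      qed
      have IJ: "(real I + 1) * (real J2 + 1) \<le> x\<^sup>2 * (x + 1)" using I_le J2_x by (intro mult_mono) auto
      have t2: "(real I + 1) * (real J2 + 1) * sqrt Y * (\<epsilon> + exp (- real J1 / 4)) \<le> 4 * E"
      proof -
        have "(real I + 1) * (real J2 + 1) * sqrt Y * (\<epsilon> + exp (- real J1 / 4)) \<le> x\<^sup>2 * (x + 1) * sqrt Y * (2 * (1 / x ^ 5))"
          using expJ Y1 \<epsilon> x1 by (intro mult_mono IJ) (auto simp: \<epsilon>_def)
        also have "\<dots> = sqrt Y * (x\<^sup>2 * (x + 1) * (2 * (1 / x ^ 5)))" by (simp only: mult_ac)
        also have "\<dots> \<le> sqrt Y * (4 * x powr (- \<eta> / 2))" using Y1 by (intro mult_left_mono x5(2)) auto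
        finally show ?thesis by (simp add: E_def)
      qed
      have t3: "(real I + 1) * (real J2 + 1) * exp (real J2 + 1) * sqrt (real q) * Y powr (1/16) \<le> 1 * E"
      proof -
        \<comment> \<open>\<open>sqrt Y\<close> exceeds \<open>Y powr (1/16)\<close> by
          \<open>Y powr (7/16)\<close>, which is at least \<open>q powr (21/32)\<close>; after
          paying for \<open>sqrt q\<close> there remains \<open>21/32 - 1/2 = 5/32\<close>.\<close>
        have "sqrt (real q) * Y powr (1/16) \<le> sqrt Y * exp (- 5 * x / 32)"
        proof -
          have "sqrt (real q) * exp (5 * x / 32) = real q powr (1/2 + 5/32)"

          proof -
            have "sqrt (real q) = real q powr (1/2)" by (simp add: powr_half_sqrt)
            moreover have "exp (5 * x / 32) = real q powr (5/32)" using q2 by (simp add: powr_def x_def)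
            ultimately show ?thesis by (simp only: powr_add)
          qed
          also have "\<dots> = (real q powr (3/2)) powr (7/16)" by (simp add: powr_powr)
          also have "\<dots> \<le> Y powr (7/16)" using Y_ge qd by (intro powr_mono2) auto
          finally have "sqrt (real q) * exp (5 * x / 32) * Y powr (1/16) \<le> Y powr (7/16) * Y powr (1/16)"
            by (rule mult_right_mono) simp
          also have "\<dots> = sqrt Y" using Y1 by (simp add: powr_add[symmetric] powr_half_sqrt)
          finally have "(sqrt (real q) * exp (5 * x / 32) * Y powr (1/16)) * exp (- 5 * x / 32) \<le> sqrt Y * exp (- 5 * x / 32)"
            by (rule mult_right_mono) simp
          moreover have "exp (5 * x / 32) * exp (- 5 * x / 32) = 1" by (simp add: exp_add[symmetric])
          then have "(sqrt (real q) * exp (5 * x / 32) * Y powr (1/16)) * exp (- 5 * x / 32) = sqrt (real q) * Y powr (1/16)"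
            by (simp only: mult_ac mult_1_right)
          ultimately show ?thesis by linarith
        qed
        moreover have "exp (real J2 + 1) \<le> exp (x powr b + 1)" using J2 by simp
        ultimately have "(real I + 1) * (real J2 + 1) * exp (real J2 + 1) * (sqrt (real q) * Y powr (1/16)) \<le>
            x\<^sup>2 * (x + 1) * exp (x powr b + 1) * (sqrt Y * exp (- 5 * x / 32))"
          using x1 by (intro mult_mono[OF mult_mono[OF IJ]]) auto
        also have "\<dots> = sqrt Y * (x\<^sup>2 * (x + 1) * exp (x powr b + 1) * exp (- 5 * x / 32))" by (simp only: mult_ac)
        also have "\<dots> \<le> E" unfolding E_def using x Y1 by (intro mult_left_mono) auto
        finally show ?thesis by (simp add: mult.assoc)
      qed
      have "l2norm X (\<lambda>chi. L_twist lamF chi (1/2)) \<le> C1 * (sqrt Y * sqrt (real J1 / real J2 + exp (- real J1 / 4))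
        + (real I + 1) * (real J2 + 1) * sqrt Y * (\<epsilon> + exp (- real J1 / 4))
        + (real I + 1) * (real J2 + 1) * exp (real J2 + 1) * sqrt (real q) * Y powr (1/16))"
        by (rule moment[OF q2(1) X N Y1 NY J1_1 J12 J2_q I \<epsilon>]) (use hats in blast)
      also have "\<dots> \<le> C1 * (3 * E + 4 * E + 1 * E)" using C1 by (intro mult_left_mono add_mono t1 t2 t3) auto
      also have "\<dots> = C1 * (3 + 4 + 1) * E" by (simp add: algebra_simps)
      finally have "(l2norm X (\<lambda>chi. L_twist lamF chi (1/2)))\<^sup>2 \<le> (C1 * (3 + 4 + 1) * E)\<^sup>2"
        by (intro power_mono l2norm_nonneg)
      also have "\<dots> = (C1 * (3 + 4 + 1))\<^sup>2 * E\<^sup>2" by (rule power_mult_distrib)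
      also have "E\<^sup>2 = Y * (1 / x powr \<eta>)"
      proof -
        have e: "(x powr (- \<eta> / 2))\<^sup>2 = x powr (- \<eta>)" by (simp add: power2_eq_square powr_add[symmetric])
        show ?thesis unfolding E_def power_mult_distrib e using Y1 by (simp add: powr_minus_divide)
      qed
      also have "Y * (1 / x powr \<eta>) \<le> K * real q powr (real d / 2) * (1 / x powr \<eta>)"
      proof (rule mult_right_mono)
        have "sqrt K \<le> K" using K real_sqrt_le_mono[of 1 K] mult_left_mono[of 1 "sqrt K" "sqrt K"] by simp
        then show "Y \<le> K * real q powr (real d / 2)" unfolding Y_def by (rule mult_right_mono) simp
      qed simp
      finally show ?thesis unfolding l2norm_power2 C_def x_def by (simp add: mult_left_mono mult.assoc)
    qed
  qed
qed

end

section \<open>Combination of the two parities\<close>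

lemma primitive_character_minus_one:
  assumes "chi \<in> primitive_characters q"
  shows "chi (-1) = 1 \<or> chi (-1) = -1"
proof -
  have c: "dirichlet_character q chi" using assms by (rule primitive_imp_character)
  have "chi (-1) * chi (-1) = chi ((-1) * (-1))" by (rule character_mult[OF c, symmetric])
  also have "\<dots> = 1" using character_1[OF c] by simp
  finally show ?thesis by (simp add: square_eq_1_iff)
qed

text \<open>The zero-free region is applied at this height only, the lowest that the condition on
  \<open>T\<close> allows up to constants.\<close>

lemma admissible_height_log: "admissible_height (\<lambda>q. ln (real q) ^ 100)"
  unfolding admissible_height_def
proof
  show "\<exists>c>0. \<forall>\<^sub>F q in sequentially. c * ln (real q) ^ 100 \<le> ln (real q) ^ 100"
    by (intro exI[of _ 1]) simp
  show "(\<lambda>q. ln (ln (real q) ^ 100)) \<in> o(\<lambda>q. ln (real q))" by real_asymp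
qed

theorem theorem1p1:
  fixes d :: nat
    and lamF :: "nat \<Rightarrow> complex"
    and \<alpha> :: "nat \<Rightarrow> nat \<Rightarrow> complex"
    and N :: "nat \<Rightarrow> nat"
    and \<mu> :: "complex \<Rightarrow> nat \<Rightarrow> complex"
    and \<theta> \<beta> \<eta> cF :: real
    and q0 :: "(nat \<Rightarrow> real) \<Rightarrow> nat"
  assumes degree: "d \<ge> 3"
    and framework: "L_function_framework d lamF \<alpha> N \<mu> \<theta>"
    and beta: "0 \<le> \<beta>" "\<beta> < 1"
    and A1: "\<forall>n\<ge>1. norm (lamF n) \<le> real (tau d n)"
    and A2: "\<exists>\<epsilon>>0. \<exists>K X0. \<forall>X Y :: real.
               X \<ge> max 2 X0 \<and> X powr (1 - \<epsilon>) \<le> Y \<and> Y \<le> X \<longrightarrow>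
               (\<Sum>n | X \<le> real n \<and> real n \<le> X + Y. (norm (lamF n))\<^sup>2) \<le> K * Y"
    and A3: "\<exists>K. \<forall>P1 P2 X :: real.
               2 \<le> P1 \<and> P1 \<le> P2 \<and> P2 \<le> X \<longrightarrow>
               (\<Sum>n | 1 \<le> n \<and> real n \<le> X \<and>
                      coprime n (\<Prod>p | prime p \<and> P1 \<le> real p \<and> real p \<le> P2. p).
                  (norm (lamF n))\<^sup>2)
               \<le> K * (X * (ln P1 / ln P2))"
    and cF: "cF > 0"
    and eta: "\<eta> < 1 - \<beta>"
  shows "\<exists>C. \<forall>Fam :: nat \<Rightarrow> (int \<Rightarrow> complex) set.
           (\<forall>q\<ge>2. Fam q \<subseteq> primitive_characters q) \<and>
           zero_free_region lamF cF \<beta> q0 Fam \<longrightarrow>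
           (\<forall>q\<ge>2. (\<Sum>chi\<in>Fam q. (norm (L_twist lamF chi (1 / 2)))\<^sup>2)
                    \<le> C * (real q powr (real d / 2) / ln (real q) powr \<eta>))"
proof -
  interpret L_function_bounds d lamF \<alpha> N \<mu> \<theta>
    by (intro L_function_bounds.intro L_function_bounds_axioms.intro framework A3) (use A1 in blast)
  \<comment> \<open>\<open>\<eta>\<close> may be zero or negative; a positive exponent at least as
    large is used instead, which gives a stronger bound once \<open>ln q \<ge> 1\<close>.\<close>
  define \<eta>' where "\<eta>' = max \<eta> ((1 - \<beta>) / 2)"
  have eta': "0 < \<eta>'" "\<eta>' < 1 - \<beta>" "\<eta> \<le> \<eta>'" using beta eta by (auto simp: \<eta>'_def less_max_iff_disj)
  define T where "T = (\<lambda>q::nat. ln (real q) ^ 100)"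
  define Lh where "Lh chi = (norm (L_twist lamF chi (1 / 2)))\<^sup>2" for chi
  define B where "B q = real q powr (real d / 2) / ln (real q) powr \<eta>" for q :: nat
  define Z where "Z q X \<longleftrightarrow> (\<forall>chi\<in>X. \<forall>\<sigma> t. \<sigma> > 1 - cF / ln (real q * T q) powr \<beta> \<and> \<bar>t\<bar> \<le> T q \<longrightarrow>
     L_twist lamF chi (Complex \<sigma> t) \<noteq> 0)" for q X
  define B' where "B' q = real q powr (real d / 2) / ln (real q) powr \<eta>'" for q :: nat
  have parity: "\<exists>C. \<exists>q1\<ge>2. \<forall>q\<ge>q1. \<forall>X. X \<subseteq> primitive_characters q \<longrightarrow> (\<forall>chi\<in>X. chi (-1) = e) \<longrightarrow> Z q X \<longrightarrow>
     (\<Sum>chi\<in>X. Lh chi) \<le> C * B' q" for e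
    unfolding T_def Lh_def Z_def B'_def by (rule parity_second_moment[OF degree beta eta'(1,2) cF])
  obtain C1 q1 where P1: "\<And>q X. q \<ge> q1 \<Longrightarrow> X \<subseteq> primitive_characters q \<Longrightarrow> (\<forall>chi\<in>X. chi (-1) = 1) \<Longrightarrow> Z q X \<Longrightarrow>
     (\<Sum>chi\<in>X. Lh chi) \<le> C1 * B' q"
    using parity[of 1] by metis
  obtain C2 q2 where P2: "\<And>q X. q \<ge> q2 \<Longrightarrow> X \<subseteq> primitive_characters q \<Longrightarrow> (\<forall>chi\<in>X. chi (-1) = -1) \<Longrightarrow> Z q X \<Longrightarrow>
     (\<Sum>chi\<in>X. Lh chi) \<le> C2 * B' q"
    using parity[of "-1"] by metis
  \<comment> \<open>The bound 3 ensures \<open>ln q \<ge> 1\<close>, and \<open>q0 T\<close> is the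
    threshold of the zero-free region for the chosen height.\<close>
  define M where "M = max (max q1 q2) (max 3 (q0 T))"
  \<comment> \<open>For the finitely many \<open>q < M\<close> any family is dominated by the set of
    all primitive characters, so the constant does not depend on \<open>Fam\<close>.\<close>
  define R where "R q = (\<Sum>chi\<in>primitive_characters q. Lh chi) / B q" for q
  have Lh0: "Lh chi \<ge> 0" for chi by (simp add: Lh_def)
  have B0: "B q > 0" if "q \<ge> 2" for q using that by (simp add: B_def)
  have R0: "R q \<ge> 0" for q unfolding R_def by (intro divide_nonneg_nonneg sum_nonneg Lh0) (simp add: B_def)
  define C where "C = \<bar>C1\<bar> + \<bar>C2\<bar> + (\<Sum>q<M. R q)"
  have sumR: "(\<Sum>q<M. R q) \<ge> 0" by (intro sum_nonneg R0)
  have "(\<Sum>chi\<in>Fam q. Lh chi) \<le> C * B q"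
    if sub: "\<forall>q\<ge>2. Fam q \<subseteq> primitive_characters q" and zf: "zero_free_region lamF cF \<beta> q0 Fam" and q: "q \<ge> 2" for Fam q
  proof -
    have fin: "finite (primitive_characters q)" using q by (intro finite_primitive_characters) simp
    have subq: "Fam q \<subseteq> primitive_characters q" using sub q by simp
    have finF: "finite (Fam q)" using subq fin by (rule finite_subset)
    show ?thesis
    proof (cases "q < M")
      case True
      have "(\<Sum>chi\<in>Fam q. Lh chi) \<le> (\<Sum>chi\<in>primitive_characters q. Lh chi)"
        using sub q by (intro sum_mono2 fin Lh0) auto
      also have "\<dots> = R q * B q" using B0[OF q] by (simp add: R_def)
      also have "R q \<le> (\<Sum>q<M. R q)" using True by (intro member_le_sum R0) auto
      also have "(\<Sum>q<M. R q) \<le> C" by (simp add: C_def)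
      finally show ?thesis using B0[OF q] by (simp add: mult_right_mono)
    next
      case False
      have nz: "L_twist lamF chi (Complex \<sigma> t) \<noteq> 0"
        if "chi \<in> Fam q" "\<sigma> > 1 - cF / ln (real q * T q) powr \<beta> \<and> \<bar>t\<bar> \<le> T q" for chi \<sigma> t
      proof -
        have "admissible_height T" unfolding T_def by (rule admissible_height_log)
        moreover have "q \<ge> max 2 (q0 T)" using False by (auto simp: M_def)
        ultimately have "(\<Prod>chi\<in>Fam q. L_twist lamF chi (Complex \<sigma> t)) \<noteq> 0"
          using zf that(2) unfolding zero_free_region_def by blast
        \<comment> \<open>A non-zero product over a finite set has no zero factor, so the hypothesis
          on the family becomes one on single characters and passes to the two parity
          classes.\<close>
        then show ?thesis using that(1) finF by auto
      qed
      have qM: "q \<ge> q1" "q \<ge> q2" "q \<ge> 3" using False by (auto simp: M_def)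
      define X1 where "X1 = {chi \<in> Fam q. chi (-1) = 1}"
      define X2 where "X2 = {chi \<in> Fam q. chi (-1) = -1}"
      have "Fam q = X1 \<union> X2" "X1 \<inter> X2 = {}"
        using sub q primitive_character_minus_one by (fastforce simp: X1_def X2_def)+
      moreover have "finite X1" "finite X2" using finF by (auto simp: X1_def X2_def)
      ultimately have "(\<Sum>chi\<in>Fam q. Lh chi) = (\<Sum>chi\<in>X1. Lh chi) + (\<Sum>chi\<in>X2. Lh chi)"
        by (simp add: sum.union_disjoint)
      also have "(\<Sum>chi\<in>X1. Lh chi) \<le> C1 * B' q"
        by (rule P1) (use qM subq nz in \<open>auto simp: X1_def Z_def\<close>)
      also have "(\<Sum>chi\<in>X2. Lh chi) \<le> C2 * B' q"
        by (rule P2) (use qM subq nz in \<open>auto simp: X2_def Z_def\<close>)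
      also have "C1 * B' q + C2 * B' q = (C1 + C2) * B' q" by (simp add: distrib_right)
      also have "\<dots> \<le> C * B' q"
      proof (rule mult_right_mono)
        show "C1 + C2 \<le> C" using sumR unfolding C_def by linarith
      qed (simp add: B'_def)
      also have "\<dots> \<le> C * B q"
      proof (rule mult_left_mono)
        have "ln (real q) \<ge> 1"
        proof -
          have "exp 1 \<le> real q" using qM(3) exp_le by linarith
          then show ?thesis using q by (simp add: ln_ge_iff)
        qed
        then show "B' q \<le> B q"
          unfolding B'_def B_def using eta'(3) by (intro divide_left_mono powr_mono) auto
        show "0 \<le> C" using sumR by (simp add: C_def)
      qed
      finally show ?thesis by simp
    qed
  qed
  then show ?thesis unfolding Lh_def B_def by blast
qed

end
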